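(* Let $N\geq 1$ and let $\mathcal{I}_N$ be an $N$-Ising fusion category. Assume that $\mathcal{I}_N$ admits a braiding. Then $\mathcal{I}_N$ (with respect to such a braiding) is prime.
   Context: Throughout, $k$ is an algebraically closed field of characteristic zero and all fusion categories are over $k$. A braided fusion category is non-degenerate if its Müger center (the full subcategory of objects $X$ with $c_{Y,X}c_{X,Y}=\mathrm{id}_{X\otimes Y}$ for all $Y$) is equivalent to $\mathrm{Vec}$. A braided fusion category $\mathcal{C}$ is prime if it contains no non-trivial non-degenerate fusion subcategories, where trivial subcategories are $\mathrm{Vec}$ and $\mathcal{C}$ itself. $N$-Ising categories. Let $\mathfrak{I}$ be the semisimplification of the representation category of $U_{-q}(\mathfrak{sl}_2)$, $q=\exp(i\pi/4)$. It is an Ising fusion category, i.e. a non-pointed fusion category of Frobenius-Perron dimension $4$; its simple objects are $\mathbf{1}$, an invertible object $\delta$ and a non-invertible object $Z$ with $Z\otimes Z\cong \mathbf{1}\oplus\delta$. For $N\geq 1$, $\mathfrak{I}_N$ denotes the fusion subcategory of $\mathfrak{I}\boxtimes \mathrm{Vec}_{\mathbb{Z}_{2^N}}$ generated by $Z\boxtimes 1$, where $1\in\mathbb{Z}_{2^N}$ is the canonical generator; it is graded by $\mathbb{Z}_{2^N}$, with $Y\boxtimes j$ of degree $j$. For a $2^N$th root of unity $\zeta\in k^\times$, let $\omega_\zeta$ be the 3-cocycle on $\mathbb{Z}_{2^N}$ given, for $0\le i,j,\ell<2^N$, by $\omega_\zeta(i,j,\ell)=1$ if $j+\ell<2^N$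 and $\omega_\zeta(i,j,\ell)=\zeta^i$ if $j+\ell\geq 2^N$. The category $\mathfrak{I}_{N,\zeta}$ is obtained from $\mathfrak{I}_N$ by multiplying the associativity constraint on homogeneous objects of degrees $i,j,\ell$ by $\omega_\zeta(i,j,\ell)$. An $N$-Ising fusion category is any of the categories $\mathfrak{I}_{N,\zeta}$. *)

theory Defs
  imports "Jordan_Normal_Form.Matrix" "HOL-Computational_Algebra.Polynomial"
begin

section \<open>Linear monoidal categories\<close>

text \<open>
  All categories below are given by concrete data in the following record. Morphisms know their
  source and target, so distinct hom sets are disjoint and composition, sums, scalar multiples and
  tensor products of morphisms need no object arguments. Only objects in \<open>Ob\<close> matter; a full
  subcategory is obtained by shrinking \<open>Ob\<close>. The associativity constraint goes
  \<open>Assoc X Y Z : (X \<odot> Y) \<odot> Z \<rightarrow> X \<odot> (Y \<odot> Z)\<close>, and the unit constraints go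
  \<open>LUnit X : \<one> \<odot> X \<rightarrow> X\<close> and \<open>RUnit X : X \<odot> \<one> \<rightarrow> X\<close>.
\<close>

datatype ('o, 'm) arrow = Arr (src: 'o) (tgt: 'o) (body: 'm)

record ('o, 'm, 'k) lincat =
  Ob :: "'o set"
  Hom :: "'o \<Rightarrow> 'o \<Rightarrow> 'm set"
  Ident :: "'o \<Rightarrow> 'm"
  Comp :: "'m \<Rightarrow> 'm \<Rightarrow> 'm"  (infixl "\<cdot>\<index>" 60)
  Zero :: "'o \<Rightarrow> 'o \<Rightarrow> 'm"
  Add :: "'m \<Rightarrow> 'm \<Rightarrow> 'm"
  Scale :: "'k \<Rightarrow> 'm \<Rightarrow> 'm"
  TensO :: "'o \<Rightarrow> 'o \<Rightarrow> 'o"  (infixl "\<odot>\<index>" 75)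
  TensM :: "'m \<Rightarrow> 'm \<Rightarrow> 'm"  (infixl "\<boxtimes>\<index>" 75)
  Unit :: "'o"
  Assoc :: "'o \<Rightarrow> 'o \<Rightarrow> 'o \<Rightarrow> 'm"
  LUnit :: "'o \<Rightarrow> 'm"
  RUnit :: "'o \<Rightarrow> 'm"

definition full_subcat :: "('o, 'm, 'k) lincat \<Rightarrow> 'o set \<Rightarrow> ('o, 'm, 'k) lincat" where
  "full_subcat C S = C\<lparr>Ob := S\<rparr>"

definition mutually_inverse :: "('o, 'm, 'k) lincat \<Rightarrow> 'o \<Rightarrow> 'o \<Rightarrow> 'm \<Rightarrow> 'm \<Rightarrow> bool" where
  "mutually_inverse C X Y f g \<longleftrightarrow> f \<in> Hom C X Y \<and> g \<in> Hom C Y X \<and>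
     g \<cdot>\<^bsub>C\<^esub> f = Ident C X \<and> f \<cdot>\<^bsub>C\<^esub> g = Ident C Y"

definition iso_arrow :: "('o, 'm, 'k) lincat \<Rightarrow> 'o \<Rightarrow> 'o \<Rightarrow> 'm \<Rightarrow> bool" where
  "iso_arrow C X Y f \<longleftrightarrow> (\<exists>g. mutually_inverse C X Y f g)"

definition inverse_arrow :: "('o, 'm, 'k) lincat \<Rightarrow> 'o \<Rightarrow> 'o \<Rightarrow> 'm \<Rightarrow> 'm" where
  "inverse_arrow C X Y f = (THE g. mutually_inverse C X Y f g)"

abbreviation Assoc_inv :: "('o, 'm, 'k) lincat \<Rightarrow> 'o \<Rightarrow> 'o \<Rightarrow> 'o \<Rightarrow> 'm" where
  "Assoc_inv C X Y Z \<equiv>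
     inverse_arrow C ((X \<odot>\<^bsub>C\<^esub> Y) \<odot>\<^bsub>C\<^esub> Z) (X \<odot>\<^bsub>C\<^esub> (Y \<odot>\<^bsub>C\<^esub> Z)) (Assoc C X Y Z)"

definition direct_summand :: "('o, 'm, 'k) lincat \<Rightarrow> 'o \<Rightarrow> 'o \<Rightarrow> bool" where
  "direct_summand C X Y \<longleftrightarrow>
     (\<exists>i\<in>Hom C X Y. \<exists>p\<in>Hom C Y X. p \<cdot>\<^bsub>C\<^esub> i = Ident C X)"

definition direct_sum :: "('o, 'm, 'k) lincat \<Rightarrow> 'o \<Rightarrow> 'o \<Rightarrow> 'o \<Rightarrow> bool" where
  "direct_sum C X Y S \<longleftrightarrow>
     (\<exists>i\<in>Hom C X S. \<exists>j\<in>Hom C Y S. \<exists>p\<in>Hom C S X. \<exists>r\<in>Hom C S Y.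
        p \<cdot>\<^bsub>C\<^esub> i = Ident C X \<and> r \<cdot>\<^bsub>C\<^esub> j = Ident C Y \<and>
        r \<cdot>\<^bsub>C\<^esub> i = Zero C X Y \<and> p \<cdot>\<^bsub>C\<^esub> j = Zero C Y X \<and>
        Add C (i \<cdot>\<^bsub>C\<^esub> p) (j \<cdot>\<^bsub>C\<^esub> r) = Ident C S)"

text \<open>\<open>dual_objects C X Y\<close>: \<open>Y\<close> is a left dual of \<open>X\<close>, equivalently \<open>X\<close> is a right dual of \<open>Y\<close>.\<close>

definition dual_objects :: "('o, 'm, 'k) lincat \<Rightarrow> 'o \<Rightarrow> 'o \<Rightarrow> bool" where
  "dual_objects C X Y \<longleftrightarrow>
     (\<exists>ev\<in>Hom C (Y \<odot>\<^bsub>C\<^esub> X) (Unit C). \<exists>coev\<in>Hom C (Unit C) (X \<odot>\<^bsub>C\<^esub> Y).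
        RUnit C X \<cdot>\<^bsub>C\<^esub> (Ident C X \<boxtimes>\<^bsub>C\<^esub> ev) \<cdot>\<^bsub>C\<^esub> Assoc C X Y X \<cdot>\<^bsub>C\<^esub> (coev \<boxtimes>\<^bsub>C\<^esub> Ident C X)
          = LUnit C X \<and>
        LUnit C Y \<cdot>\<^bsub>C\<^esub> (ev \<boxtimes>\<^bsub>C\<^esub> Ident C Y) \<cdot>\<^bsub>C\<^esub> Assoc_inv C Y X Y \<cdot>\<^bsub>C\<^esub> (Ident C Y \<boxtimes>\<^bsub>C\<^esub> coev)
          = RUnit C Y)"

text \<open>
  Fusion subcategories are full subcategories, identified with their sets of objects. Closure under
  direct summands includes closure under isomorphism and the presence of zero objects. If the ambient
  category is a fusion category, then a full subcategory closed in this way is again one.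
\<close>

definition fusion_subcategory :: "('o, 'm, 'k) lincat \<Rightarrow> 'o set \<Rightarrow> bool" where
  "fusion_subcategory C S \<longleftrightarrow> S \<subseteq> Ob C \<and> Unit C \<in> S \<and>
     (\<forall>X\<in>S. \<forall>Y\<in>S. X \<odot>\<^bsub>C\<^esub> Y \<in> S) \<and>
     (\<forall>X\<in>S. \<forall>Y\<in>S. \<forall>Z\<in>Ob C. direct_sum C X Y Z \<longrightarrow> Z \<in> S) \<and>
     (\<forall>X\<in>Ob C. \<forall>Y\<in>S. direct_summand C X Y \<longrightarrow> X \<in> S) \<and>
     (\<forall>X\<in>S. \<forall>Y\<in>Ob C. dual_objects C X Y \<or> dual_objects C Y X \<longrightarrow> Y \<in> S)"

definition generated_subcat :: "('o, 'm, 'k) lincat \<Rightarrow> 'o \<Rightarrow> ('o, 'm, 'k) lincat" where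
  "generated_subcat C X = full_subcat C (\<Inter>{S. fusion_subcategory C S \<and> X \<in> S})"

section \<open>Equivalence of linear monoidal categories\<close>

text \<open>A linear functor (\<open>F\<close>, \<open>F'\<close> on objects and morphisms) with monoidal structure
  \<open>J X Y : F X \<odot> F Y \<rightarrow> F (X \<odot> Y)\<close> and \<open>u : \<one> \<rightarrow> F \<one>\<close>.\<close>

definition monoidal_functor ::
  "('o, 'm, 'k) lincat \<Rightarrow> ('p, 'n, 'k) lincat \<Rightarrow>
     ('o \<Rightarrow> 'p) \<Rightarrow> ('m \<Rightarrow> 'n) \<Rightarrow> ('o \<Rightarrow> 'o \<Rightarrow> 'n) \<Rightarrow> 'n \<Rightarrow> bool" where
  "monoidal_functor C D F F' J u \<longleftrightarrow>
     (\<forall>X\<in>Ob C. F X \<in> Ob D \<and> F' (Ident C X) = Ident D (F X)) \<and>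
     (\<forall>X\<in>Ob C. \<forall>Y\<in>Ob C. \<forall>f\<in>Hom C X Y. F' f \<in> Hom D (F X) (F Y) \<and>
        (\<forall>a. F' (Scale C a f) = Scale D a (F' f)) \<and>
        (\<forall>g\<in>Hom C X Y. F' (Add C f g) = Add D (F' f) (F' g)) \<and>
        (\<forall>Z\<in>Ob C. \<forall>g\<in>Hom C Y Z. F' (g \<cdot>\<^bsub>C\<^esub> f) = F' g \<cdot>\<^bsub>D\<^esub> F' f)) \<and>
     (\<forall>X\<in>Ob C. \<forall>Y\<in>Ob C. iso_arrow D (F X \<odot>\<^bsub>D\<^esub> F Y) (F (X \<odot>\<^bsub>C\<^esub> Y)) (J X Y)) \<and>
     (\<forall>X\<in>Ob C. \<forall>X'\<in>Ob C. \<forall>Y\<in>Ob C. \<forall>Y'\<in>Ob C. \<forall>f\<in>Hom C X X'. \<forall>g\<in>Hom C Y Y'.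
        J X' Y' \<cdot>\<^bsub>D\<^esub> (F' f \<boxtimes>\<^bsub>D\<^esub> F' g) = F' (f \<boxtimes>\<^bsub>C\<^esub> g) \<cdot>\<^bsub>D\<^esub> J X Y) \<and>
     (\<forall>X\<in>Ob C. \<forall>Y\<in>Ob C. \<forall>Z\<in>Ob C.
        F' (Assoc C X Y Z) \<cdot>\<^bsub>D\<^esub> J (X \<odot>\<^bsub>C\<^esub> Y) Z \<cdot>\<^bsub>D\<^esub> (J X Y \<boxtimes>\<^bsub>D\<^esub> Ident D (F Z)) =
        J X (Y \<odot>\<^bsub>C\<^esub> Z) \<cdot>\<^bsub>D\<^esub> (Ident D (F X) \<boxtimes>\<^bsub>D\<^esub> J Y Z) \<cdot>\<^bsub>D\<^esub> Assoc D (F X) (F Y) (F Z)) \<and>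
     iso_arrow D (Unit D) (F (Unit C)) u \<and>
     (\<forall>X\<in>Ob C.
        F' (LUnit C X) \<cdot>\<^bsub>D\<^esub> J (Unit C) X \<cdot>\<^bsub>D\<^esub> (u \<boxtimes>\<^bsub>D\<^esub> Ident D (F X)) = LUnit D (F X) \<and>
        F' (RUnit C X) \<cdot>\<^bsub>D\<^esub> J X (Unit C) \<cdot>\<^bsub>D\<^esub> (Ident D (F X) \<boxtimes>\<^bsub>D\<^esub> u) = RUnit D (F X))"

definition monoidally_equivalent ::
  "('o, 'm, 'k) lincat \<Rightarrow> ('p, 'n, 'k) lincat \<Rightarrow> bool" where
  "monoidally_equivalent C D \<longleftrightarrow>
     (\<exists>F F' J u. monoidal_functor C D F F' J u \<and>
        (\<forall>X\<in>Ob C. \<forall>Y\<in>Ob C. bij_betw F' (Hom C X Y) (Hom D (F X) (F Y))) \<and>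
        (\<forall>W\<in>Ob D. \<exists>X\<in>Ob C. \<exists>f. iso_arrow D (F X) W f))"

section \<open>Braidings, non-degeneracy, primeness\<close>

text \<open>\<open>c X Y : X \<odot> Y \<rightarrow> Y \<odot> X\<close>, natural and satisfying both hexagon identities.\<close>

definition braiding :: "('o, 'm, 'k) lincat \<Rightarrow> ('o \<Rightarrow> 'o \<Rightarrow> 'm) \<Rightarrow> bool" where
  "braiding C c \<longleftrightarrow>
     (\<forall>X\<in>Ob C. \<forall>Y\<in>Ob C. iso_arrow C (X \<odot>\<^bsub>C\<^esub> Y) (Y \<odot>\<^bsub>C\<^esub> X) (c X Y)) \<and>
     (\<forall>X\<in>Ob C. \<forall>X'\<in>Ob C. \<forall>Y\<in>Ob C. \<forall>Y'\<in>Ob C. \<forall>f\<in>Hom C X X'. \<forall>g\<in>Hom C Y Y'.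
        c X' Y' \<cdot>\<^bsub>C\<^esub> (f \<boxtimes>\<^bsub>C\<^esub> g) = (g \<boxtimes>\<^bsub>C\<^esub> f) \<cdot>\<^bsub>C\<^esub> c X Y) \<and>
     (\<forall>X\<in>Ob C. \<forall>Y\<in>Ob C. \<forall>Z\<in>Ob C.
        Assoc C Y Z X \<cdot>\<^bsub>C\<^esub> c X (Y \<odot>\<^bsub>C\<^esub> Z) \<cdot>\<^bsub>C\<^esub> Assoc C X Y Z =
        (Ident C Y \<boxtimes>\<^bsub>C\<^esub> c X Z) \<cdot>\<^bsub>C\<^esub> Assoc C Y X Z \<cdot>\<^bsub>C\<^esub> (c X Y \<boxtimes>\<^bsub>C\<^esub> Ident C Z) \<and>
        Assoc_inv C Z X Y \<cdot>\<^bsub>C\<^esub> c (X \<odot>\<^bsub>C\<^esub> Y) Z \<cdot>\<^bsub>C\<^esub> Assoc_inv C X Y Z =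
        (c X Z \<boxtimes>\<^bsub>C\<^esub> Ident C Y) \<cdot>\<^bsub>C\<^esub> Assoc_inv C X Z Y \<cdot>\<^bsub>C\<^esub> (Ident C X \<boxtimes>\<^bsub>C\<^esub> c Y Z))"

definition Mueger_center ::
  "('o, 'm, 'k) lincat \<Rightarrow> ('o \<Rightarrow> 'o \<Rightarrow> 'm) \<Rightarrow> ('o, 'm, 'k) lincat" where
  "Mueger_center C c =
     full_subcat C {X \<in> Ob C. \<forall>Y\<in>Ob C. c Y X \<cdot>\<^bsub>C\<^esub> c X Y = Ident C (X \<odot>\<^bsub>C\<^esub> Y)}"

text \<open>Kronecker product of matrices with respect to an arbitrary multiplication of entries; with
  lexicographically ordered bases it is strictly associative.\<close>

definition kronecker :: "('a \<Rightarrow> 'b \<Rightarrow> 'c) \<Rightarrow> 'a mat \<Rightarrow> 'b mat \<Rightarrow> 'c mat" where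
  "kronecker m A B = mat (dim_row A * dim_row B) (dim_col A * dim_col B)
     (\<lambda>(i, j). m (A $$ (i div dim_row B, j div dim_col B)) (B $$ (i mod dim_row B, j mod dim_col B)))"

text \<open>Finite-dimensional vector spaces: the object \<open>n\<close> stands for \<open>k\<^sup>n\<close>.\<close>

definition Vec :: "(nat, (nat, 'k::field mat) arrow, 'k) lincat" where
  "Vec = \<lparr>
     Ob = UNIV,
     Hom = (\<lambda>m n. Arr m n ` carrier_mat n m),
     Ident = (\<lambda>n. Arr n n (1\<^sub>m n)),
     Comp = (\<lambda>g f. Arr (src f) (tgt g) (body g * body f)),
     Zero = (\<lambda>m n. Arr m n (0\<^sub>m n m)),
     Add = (\<lambda>f g. Arr (src f) (tgt f) (body f + body g)),
     Scale = (\<lambda>a f. Arr (src f) (tgt f) (a \<cdot>\<^sub>m body f)),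
     TensO = (*),
     TensM = (\<lambda>f g. Arr (src f * src g) (tgt f * tgt g) (kronecker (*) (body f) (body g))),
     Unit = 1,
     Assoc = (\<lambda>l m n. Arr (l * m * n) (l * (m * n)) (1\<^sub>m (l * m * n))),
     LUnit = (\<lambda>n. Arr (1 * n) n (1\<^sub>m n)),
     RUnit = (\<lambda>n. Arr (n * 1) n (1\<^sub>m n))\<rparr>"

definition non_degenerate :: "('o, 'm, 'k::field) lincat \<Rightarrow> ('o \<Rightarrow> 'o \<Rightarrow> 'm) \<Rightarrow> bool" where
  "non_degenerate C c \<longleftrightarrow> monoidally_equivalent (Mueger_center C c) (Vec :: (_, _, 'k) lincat)"

definition prime_braided :: "('o, 'm, 'k::field) lincat \<Rightarrow> ('o \<Rightarrow> 'o \<Rightarrow> 'm) \<Rightarrow> bool" where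
  "prime_braided C c \<longleftrightarrow>
     (\<forall>S. fusion_subcategory C S \<and> non_degenerate (full_subcat C S) c \<longrightarrow>
        monoidally_equivalent (full_subcat C S) (Vec :: (_, _, 'k) lincat) \<or> S = Ob C)"

section \<open>Representations of the quantum group of \<open>\<ss>\<ll>\<^sub>2\<close>\<close>

text \<open>
  A finite-dimensional representation of \<open>U\<^sub>q(\<ss>\<ll>\<^sub>2)\<close> on \<open>k\<^sup>n\<close>, given by the matrices by which the
  generators \<open>E\<close>, \<open>F\<close>, \<open>K\<close>, \<open>K\<^sup>-\<^sup>1\<close> act. The comultiplication is
  \<open>\<Delta>E = E \<otimes> K + 1 \<otimes> E\<close>, \<open>\<Delta>F = F \<otimes> 1 + K\<^sup>-\<^sup>1 \<otimes> F\<close>, \<open>\<Delta>K = K \<otimes> K\<close>; the square of the antipode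
  is then conjugation by \<open>K\<close>.
\<close>

record 'k uq_module =
  dimen :: nat
  actE :: "'k mat"
  actF :: "'k mat"
  actK :: "'k mat"
  actKinv :: "'k mat"

definition uq_modules :: "'k::field \<Rightarrow> 'k uq_module set" where
  "uq_modules q = {V.
     {actE V, actF V, actK V, actKinv V} \<subseteq> carrier_mat (dimen V) (dimen V) \<and>
     actK V * actKinv V = 1\<^sub>m (dimen V) \<and> actKinv V * actK V = 1\<^sub>m (dimen V) \<and>
     actK V * actE V = q\<^sup>2 \<cdot>\<^sub>m (actE V * actK V) \<and>
     actK V * actF V = inverse (q\<^sup>2) \<cdot>\<^sub>m (actF V * actK V) \<and>
     actE V * actF V - actF V * actE V = inverse (q - inverse q) \<cdot>\<^sub>m (actK V - actKinv V)}"

definition uq_hom :: "'k::field uq_module \<Rightarrow> 'k uq_module \<Rightarrow> ('k uq_module, 'k mat) arrow set" where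
  "uq_hom V W = Arr V W ` {A \<in> carrier_mat (dimen W) (dimen V).
     A * actE V = actE W * A \<and> A * actF V = actF W * A \<and>
     A * actK V = actK W * A \<and> A * actKinv V = actKinv W * A}"

definition uq_tensor :: "'k::field uq_module \<Rightarrow> 'k uq_module \<Rightarrow> 'k uq_module" where
  "uq_tensor V W = \<lparr>
     dimen = dimen V * dimen W,
     actE = kronecker (*) (actE V) (actK W) + kronecker (*) (1\<^sub>m (dimen V)) (actE W),
     actF = kronecker (*) (actF V) (1\<^sub>m (dimen W)) + kronecker (*) (actKinv V) (actF W),
     actK = kronecker (*) (actK V) (actK W),
     actKinv = kronecker (*) (actKinv V) (actKinv W)\<rparr>"

definition uq_trivial :: "'k::field uq_module" where
  "uq_trivial = \<lparr>dimen = 1, actE = 0\<^sub>m 1 1, actF = 0\<^sub>m 1 1, actK = 1\<^sub>m 1, actKinv = 1\<^sub>m 1\<rparr>"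

definition uq_vector :: "'k::field \<Rightarrow> 'k uq_module" where
  "uq_vector q = \<lparr>
     dimen = 2,
     actE = mat_of_rows_list 2 [[0, 1], [0, 0]],
     actF = mat_of_rows_list 2 [[0, 0], [1, 0]],
     actK = mat_of_rows_list 2 [[q, 0], [0, inverse q]],
     actKinv = mat_of_rows_list 2 [[inverse q, 0], [0, q]]\<rparr>"

type_synonym 'k uq_arrow = "('k uq_module, 'k mat) arrow"

definition Rep_Uq :: "'k::field \<Rightarrow> ('k uq_module, 'k uq_arrow, 'k) lincat" where
  "Rep_Uq q = \<lparr>
     Ob = uq_modules q,
     Hom = uq_hom,
     Ident = (\<lambda>V. Arr V V (1\<^sub>m (dimen V))),
     Comp = (\<lambda>g f. Arr (src f) (tgt g) (body g * body f)),
     Zero = (\<lambda>V W. Arr V W (0\<^sub>m (dimen W) (dimen V))),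
     Add = (\<lambda>f g. Arr (src f) (tgt f) (body f + body g)),
     Scale = (\<lambda>a f. Arr (src f) (tgt f) (a \<cdot>\<^sub>m body f)),
     TensO = uq_tensor,
     TensM = (\<lambda>f g. Arr (uq_tensor (src f) (src g)) (uq_tensor (tgt f) (tgt g))
                        (kronecker (*) (body f) (body g))),
     Unit = uq_trivial,
     Assoc = (\<lambda>U V W. Arr (uq_tensor (uq_tensor U V) W) (uq_tensor U (uq_tensor V W))
                          (1\<^sub>m (dimen U * dimen V * dimen W))),
     LUnit = (\<lambda>V. Arr (uq_tensor uq_trivial V) V (1\<^sub>m (dimen V))),
     RUnit = (\<lambda>V. Arr (uq_tensor V uq_trivial) V (1\<^sub>m (dimen V)))\<rparr>"

section \<open>Semisimplification\<close>

text \<open>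
  As usual at roots of unity, the semisimplification is that of the category of tilting modules,
  the quotient by the ideal of negligible morphisms. Tilting modules are the direct summands of
  direct sums of tensor powers of the vector representation, i.e. they form the smallest full
  subcategory containing it which is closed as in \<open>fusion_subcategory\<close> (the vector representation
  is self-dual). The quotient of all of \<open>Rep_Uq q\<close> by its negligible morphisms has infinitely many
  simple objects and is not a fusion category.
\<close>

definition tilting_modules :: "'k::field \<Rightarrow> ('k uq_module, 'k uq_arrow, 'k) lincat" where
  "tilting_modules q = generated_subcat (Rep_Uq q) (uq_vector q)"

definition quantum_trace :: "'k::field uq_arrow \<Rightarrow> 'k" where
  "quantum_trace f = sum_list (diag_mat (actK (src f) * body f))"

definition negligible :: "('k::field uq_module, 'k uq_arrow, 'k) lincat \<Rightarrow> 'k uq_arrow \<Rightarrow> bool" where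
  "negligible C f \<longleftrightarrow> (\<forall>h \<in> Hom C (tgt f) (src f). quantum_trace (h \<cdot>\<^bsub>C\<^esub> f) = 0)"

definition negligible_rel :: "('k::field uq_module, 'k uq_arrow, 'k) lincat \<Rightarrow> 'k uq_arrow rel" where
  "negligible_rel C = {(f, g). \<exists>X\<in>Ob C. \<exists>Y\<in>Ob C. f \<in> Hom C X Y \<and> g \<in> Hom C X Y \<and>
     negligible C (Add C f (Scale C (-1) g))}"

text \<open>Quotient by an equivalence relation on morphisms; its morphisms are equivalence classes.\<close>

definition quotient_cat :: "('o, 'm, 'k) lincat \<Rightarrow> 'm rel \<Rightarrow> ('o, 'm set, 'k) lincat" where
  "quotient_cat C R = \<lparr>
     Ob = Ob C,
     Hom = (\<lambda>X Y. Hom C X Y // R),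
     Ident = (\<lambda>X. R `` {Ident C X}),
     Comp = (\<lambda>G F. R `` {g \<cdot>\<^bsub>C\<^esub> f | g f. g \<in> G \<and> f \<in> F}),
     Zero = (\<lambda>X Y. R `` {Zero C X Y}),
     Add = (\<lambda>F G. R `` {Add C f g | f g. f \<in> F \<and> g \<in> G}),
     Scale = (\<lambda>a F. R `` {Scale C a f | f. f \<in> F}),
     TensO = TensO C,
     TensM = (\<lambda>F G. R `` {f \<boxtimes>\<^bsub>C\<^esub> g | f g. f \<in> F \<and> g \<in> G}),
     Unit = Unit C,
     Assoc = (\<lambda>X Y Z. R `` {Assoc C X Y Z}),
     LUnit = (\<lambda>X. R `` {LUnit C X}),
     RUnit = (\<lambda>X. R `` {RUnit C X})\<rparr>"

definition semisimplified_Rep_Uq :: "'k::field \<Rightarrow> ('k uq_module, 'k uq_arrow set, 'k) lincat" where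
  "semisimplified_Rep_Uq q = quotient_cat (tilting_modules q) (negligible_rel (tilting_modules q))"

section \<open>The product with graded vector spaces\<close>

text \<open>
  Concrete model of \<open>C \<boxtimes> Vec\<^bsub>\<int>/n\<^esub>\<close>: the additive category spanned by the homogeneous objects
  \<open>X \<boxtimes> g\<close> with \<open>X\<close> in \<open>C\<close> and \<open>g \<in> {0..<n}\<close>, where \<open>Hom (X \<boxtimes> g) (Y \<boxtimes> h)\<close> is \<open>Hom X Y\<close> if \<open>g = h\<close>
  and \<open>0\<close> otherwise. A list of pairs \<open>(X, g)\<close> is the formal direct sum of its entries, and
  morphisms are matrices. Tensor products of lists are ordered lexicographically, so the
  constraints are diagonal matrices. For semisimple \<open>C\<close> this is the Deligne product.

  The argument \<open>\<omega>\<close> is a normalized 3-cocycle by which the associativity constraint on homogeneous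
  objects is multiplied; the untwisted product is the case \<open>\<omega> = 1\<close>.
\<close>

type_synonym 'o graded = "('o \<times> nat) list"

definition graded_hom ::
  "('o, 'm, 'k) lincat \<Rightarrow> 'o graded \<Rightarrow> 'o graded \<Rightarrow> ('o graded, 'm mat) arrow set" where
  "graded_hom C xs ys = Arr xs ys ` {M \<in> carrier_mat (length ys) (length xs).
     \<forall>i<length ys. \<forall>j<length xs.
       (if snd (xs ! j) = snd (ys ! i)
        then M $$ (i, j) \<in> Hom C (fst (xs ! j)) (fst (ys ! i))
        else M $$ (i, j) = Zero C (fst (xs ! j)) (fst (ys ! i)))}"

definition graded_diag ::
  "('o, 'm, 'k) lincat \<Rightarrow> 'o graded \<Rightarrow> 'o graded \<Rightarrow> 'm list \<Rightarrow> ('o graded, 'm mat) arrow" where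
  "graded_diag C xs ys fs = Arr xs ys (mat (length ys) (length xs)
     (\<lambda>(i, j). if i = j then fs ! i else Zero C (fst (xs ! j)) (fst (ys ! i))))"

definition graded_comp ::
  "('o, 'm, 'k) lincat \<Rightarrow> ('o graded, 'm mat) arrow \<Rightarrow> ('o graded, 'm mat) arrow
     \<Rightarrow> ('o graded, 'm mat) arrow" where
  "graded_comp C g f = Arr (src f) (tgt g) (mat (length (tgt g)) (length (src f))
     (\<lambda>(i, j). foldr (Add C)
        [(body g $$ (i, l)) \<cdot>\<^bsub>C\<^esub> (body f $$ (l, j)). l \<leftarrow> [0..<length (tgt f)]]
        (Zero C (fst (src f ! j)) (fst (tgt g ! i)))))"

definition graded_tensor ::
  "('o, 'm, 'k) lincat \<Rightarrow> nat \<Rightarrow> 'o graded \<Rightarrow> 'o graded \<Rightarrow> 'o graded" where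
  "graded_tensor C n xs ys = [(X \<odot>\<^bsub>C\<^esub> Y, (g + h) mod n). (X, g) \<leftarrow> xs, (Y, h) \<leftarrow> ys]"

definition graded_assoc ::
  "('o, 'm, 'k) lincat \<Rightarrow> nat \<Rightarrow> (nat \<Rightarrow> nat \<Rightarrow> nat \<Rightarrow> 'k) \<Rightarrow>
     'o graded \<Rightarrow> 'o graded \<Rightarrow> 'o graded \<Rightarrow> ('o graded, 'm mat) arrow" where
  "graded_assoc C n \<omega> xs ys zs =
     graded_diag C
       (graded_tensor C n (graded_tensor C n xs ys) zs)
       (graded_tensor C n xs (graded_tensor C n ys zs))
       [Scale C (\<omega> g h l) (Assoc C X Y Z). (X, g) \<leftarrow> xs, (Y, h) \<leftarrow> ys, (Z, l) \<leftarrow> zs]"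

definition graded_product ::
  "('o, 'm, 'k) lincat \<Rightarrow> nat \<Rightarrow> (nat \<Rightarrow> nat \<Rightarrow> nat \<Rightarrow> 'k)
     \<Rightarrow> ('o graded, ('o graded, 'm mat) arrow, 'k) lincat" where
  "graded_product C n \<omega> = \<lparr>
     Ob = {xs. set xs \<subseteq> Ob C \<times> {0..<n}},
     Hom = graded_hom C,
     Ident = (\<lambda>xs. graded_diag C xs xs [Ident C X. (X, g) \<leftarrow> xs]),
     Comp = graded_comp C,
     Zero = (\<lambda>xs ys. Arr xs ys (mat (length ys) (length xs)
               (\<lambda>(i, j). Zero C (fst (xs ! j)) (fst (ys ! i))))),
     Add = (\<lambda>f g. Arr (src f) (tgt f) (mat (length (tgt f)) (length (src f))
               (\<lambda>ij. Add C (body f $$ ij) (body g $$ ij)))),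
     Scale = (\<lambda>a f. Arr (src f) (tgt f) (map_mat (Scale C a) (body f))),
     TensO = graded_tensor C n,
     TensM = (\<lambda>f g. Arr (graded_tensor C n (src f) (src g)) (graded_tensor C n (tgt f) (tgt g))
               (kronecker (TensM C) (body f) (body g))),
     Unit = [(Unit C, 0)],
     Assoc = graded_assoc C n \<omega>,
     LUnit = (\<lambda>xs. graded_diag C (graded_tensor C n [(Unit C, 0)] xs) xs
               [LUnit C X. (X, g) \<leftarrow> xs]),
     RUnit = (\<lambda>xs. graded_diag C (graded_tensor C n xs [(Unit C, 0)]) xs
               [RUnit C X. (X, g) \<leftarrow> xs])\<rparr>"

section \<open>N-Ising categories\<close>

text \<open>Over \<open>k\<close>, the number \<open>exp(i\<pi>/4)\<close> is a primitive eighth root of unity \<open>q\<close>, i.e. \<open>q\<^sup>4 = -1\<close>.\<close>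

definition Ising :: "'k::field \<Rightarrow> ('k uq_module, 'k uq_arrow set, 'k) lincat" where
  "Ising q = semisimplified_Rep_Uq (- q)"

text \<open>The non-invertible simple object of \<open>Ising q\<close> is the vector representation.\<close>

definition Ising_Z :: "'k::field \<Rightarrow> 'k uq_module" where
  "Ising_Z q = uq_vector (- q)"

type_synonym 'k ising_ob = "'k uq_module graded"
type_synonym 'k ising_arrow = "('k ising_ob, 'k uq_arrow set mat) arrow"

definition Ising_N :: "'k::field \<Rightarrow> nat \<Rightarrow> ('k ising_ob, 'k ising_arrow, 'k) lincat" where
  "Ising_N q N =
     generated_subcat (graded_product (Ising q) (2 ^ N) (\<lambda>_ _ _. 1)) [(Ising_Z q, 1)]"

definition omega :: "nat \<Rightarrow> 'k::field \<Rightarrow> nat \<Rightarrow> nat \<Rightarrow> nat \<Rightarrow> 'k" where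
  "omega N \<zeta> i j l = (if j + l < 2 ^ N then 1 else \<zeta> ^ i)"

definition Ising_N_twisted ::
  "'k::field \<Rightarrow> nat \<Rightarrow> 'k \<Rightarrow> ('k ising_ob, 'k ising_arrow, 'k) lincat" where
  "Ising_N_twisted q N \<zeta> = (Ising_N q N)\<lparr>Assoc := graded_assoc (Ising q) (2 ^ N) (omega N \<zeta>)\<rparr>"

definition N_Ising_category ::
  "'k::field \<Rightarrow> nat \<Rightarrow> ('k ising_ob, 'k ising_arrow, 'k) lincat \<Rightarrow> bool" where
  "N_Ising_category q N I \<longleftrightarrow> (\<exists>\<zeta>. \<zeta> ^ (2 ^ N) = 1 \<and> I = Ising_N_twisted q N \<zeta>)"

end

theory Submission
  imports Defs "HOL-Number_Theory.Cong"
begin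

no_notation Module.module.smult (infixl "\<odot>\<index>" 70)

section \<open>Strict linear monoidal categories\<close>

locale strict_tensor_category =
  fixes C :: "('o, 'm, 'k::field) lincat" (structure)
  assumes unit_ob: "Unit C \<in> Ob C"
    and tens_ob: "X \<in> Ob C \<Longrightarrow> Y \<in> Ob C \<Longrightarrow> X \<odot> Y \<in> Ob C"
    and tens_assoc: "X \<in> Ob C \<Longrightarrow> Y \<in> Ob C \<Longrightarrow> Z \<in> Ob C \<Longrightarrow> (X \<odot> Y) \<odot> Z = X \<odot> (Y \<odot> Z)"
    and unit_tens: "X \<in> Ob C \<Longrightarrow> Unit C \<odot> X = X"
    and tens_unit: "X \<in> Ob C \<Longrightarrow> X \<odot> Unit C = X"
    and ident_hom: "X \<in> Ob C \<Longrightarrow> Ident C X \<in> Hom C X X"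
    and comp_hom: "X \<in> Ob C \<Longrightarrow> Y \<in> Ob C \<Longrightarrow> Z \<in> Ob C \<Longrightarrow>
        f \<in> Hom C X Y \<Longrightarrow> g \<in> Hom C Y Z \<Longrightarrow> g \<cdot> f \<in> Hom C X Z"
    and zero_hom: "X \<in> Ob C \<Longrightarrow> Y \<in> Ob C \<Longrightarrow> Zero C X Y \<in> Hom C X Y"
    and add_hom: "X \<in> Ob C \<Longrightarrow> Y \<in> Ob C \<Longrightarrow>
        f \<in> Hom C X Y \<Longrightarrow> g \<in> Hom C X Y \<Longrightarrow> Add C f g \<in> Hom C X Y"
    and scale_hom: "X \<in> Ob C \<Longrightarrow> Y \<in> Ob C \<Longrightarrow> f \<in> Hom C X Y \<Longrightarrow> Scale C a f \<in> Hom C X Y"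
    and tens_hom: "X \<in> Ob C \<Longrightarrow> Y \<in> Ob C \<Longrightarrow> X' \<in> Ob C \<Longrightarrow> Y' \<in> Ob C \<Longrightarrow>
        f \<in> Hom C X Y \<Longrightarrow> g \<in> Hom C X' Y' \<Longrightarrow> f \<boxtimes> g \<in> Hom C (X \<odot> X') (Y \<odot> Y')"
    and ident_comp: "X \<in> Ob C \<Longrightarrow> Y \<in> Ob C \<Longrightarrow> f \<in> Hom C X Y \<Longrightarrow> Ident C Y \<cdot> f = f"
    and comp_ident: "X \<in> Ob C \<Longrightarrow> Y \<in> Ob C \<Longrightarrow> f \<in> Hom C X Y \<Longrightarrow> f \<cdot> Ident C X = f"
    and comp_assoc: "X \<in> Ob C \<Longrightarrow> Y \<in> Ob C \<Longrightarrow> Z \<in> Ob C \<Longrightarrow> W \<in> Ob C \<Longrightarrow>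
        f \<in> Hom C X Y \<Longrightarrow> g \<in> Hom C Y Z \<Longrightarrow> h \<in> Hom C Z W \<Longrightarrow> (h \<cdot> g) \<cdot> f = h \<cdot> (g \<cdot> f)"
    and add_assoc: "X \<in> Ob C \<Longrightarrow> Y \<in> Ob C \<Longrightarrow> f \<in> Hom C X Y \<Longrightarrow> g \<in> Hom C X Y \<Longrightarrow>
        h \<in> Hom C X Y \<Longrightarrow> Add C (Add C f g) h = Add C f (Add C g h)"
    and add_comm: "X \<in> Ob C \<Longrightarrow> Y \<in> Ob C \<Longrightarrow> f \<in> Hom C X Y \<Longrightarrow> g \<in> Hom C X Y \<Longrightarrow>
        Add C f g = Add C g f"
    and add_zero: "X \<in> Ob C \<Longrightarrow> Y \<in> Ob C \<Longrightarrow> f \<in> Hom C X Y \<Longrightarrow> Add C f (Zero C X Y) = f"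
    and scale_one: "X \<in> Ob C \<Longrightarrow> Y \<in> Ob C \<Longrightarrow> f \<in> Hom C X Y \<Longrightarrow> Scale C 1 f = f"
    and scale_scale: "X \<in> Ob C \<Longrightarrow> Y \<in> Ob C \<Longrightarrow> f \<in> Hom C X Y \<Longrightarrow>
        Scale C a (Scale C b f) = Scale C (a * b) f"
    and scale_zero: "X \<in> Ob C \<Longrightarrow> Y \<in> Ob C \<Longrightarrow> f \<in> Hom C X Y \<Longrightarrow> Scale C 0 f = Zero C X Y"
    and scale_sum: "X \<in> Ob C \<Longrightarrow> Y \<in> Ob C \<Longrightarrow> f \<in> Hom C X Y \<Longrightarrow>
        Scale C (a + b) f = Add C (Scale C a f) (Scale C b f)"
    and scale_add: "X \<in> Ob C \<Longrightarrow> Y \<in> Ob C \<Longrightarrow> f \<in> Hom C X Y \<Longrightarrow> g \<in> Hom C X Y \<Longrightarrow>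
        Scale C a (Add C f g) = Add C (Scale C a f) (Scale C a g)"
    and comp_add: "X \<in> Ob C \<Longrightarrow> Y \<in> Ob C \<Longrightarrow> Z \<in> Ob C \<Longrightarrow> f \<in> Hom C X Y \<Longrightarrow> f' \<in> Hom C X Y \<Longrightarrow>
        g \<in> Hom C Y Z \<Longrightarrow> g \<cdot> Add C f f' = Add C (g \<cdot> f) (g \<cdot> f')"
    and add_comp: "X \<in> Ob C \<Longrightarrow> Y \<in> Ob C \<Longrightarrow> Z \<in> Ob C \<Longrightarrow> f \<in> Hom C X Y \<Longrightarrow> g \<in> Hom C Y Z \<Longrightarrow>
        g' \<in> Hom C Y Z \<Longrightarrow> Add C g g' \<cdot> f = Add C (g \<cdot> f) (g' \<cdot> f)"
    and comp_scale: "X \<in> Ob C \<Longrightarrow> Y \<in> Ob C \<Longrightarrow> Z \<in> Ob C \<Longrightarrow> f \<in> Hom C X Y \<Longrightarrow>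
        g \<in> Hom C Y Z \<Longrightarrow> g \<cdot> Scale C a f = Scale C a (g \<cdot> f)"
    and scale_comp: "X \<in> Ob C \<Longrightarrow> Y \<in> Ob C \<Longrightarrow> Z \<in> Ob C \<Longrightarrow> f \<in> Hom C X Y \<Longrightarrow>
        g \<in> Hom C Y Z \<Longrightarrow> Scale C a g \<cdot> f = Scale C a (g \<cdot> f)"
    and tens_add: "X \<in> Ob C \<Longrightarrow> Y \<in> Ob C \<Longrightarrow> X' \<in> Ob C \<Longrightarrow> Y' \<in> Ob C \<Longrightarrow> f \<in> Hom C X Y \<Longrightarrow>
        g \<in> Hom C X' Y' \<Longrightarrow> g' \<in> Hom C X' Y' \<Longrightarrow> f \<boxtimes> Add C g g' = Add C (f \<boxtimes> g) (f \<boxtimes> g')"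
    and add_tens: "X \<in> Ob C \<Longrightarrow> Y \<in> Ob C \<Longrightarrow> X' \<in> Ob C \<Longrightarrow> Y' \<in> Ob C \<Longrightarrow> f \<in> Hom C X Y \<Longrightarrow>
        f' \<in> Hom C X Y \<Longrightarrow> g \<in> Hom C X' Y' \<Longrightarrow> Add C f f' \<boxtimes> g = Add C (f \<boxtimes> g) (f' \<boxtimes> g)"
    and tens_scale: "X \<in> Ob C \<Longrightarrow> Y \<in> Ob C \<Longrightarrow> X' \<in> Ob C \<Longrightarrow> Y' \<in> Ob C \<Longrightarrow> f \<in> Hom C X Y \<Longrightarrow>
        g \<in> Hom C X' Y' \<Longrightarrow> f \<boxtimes> Scale C a g = Scale C a (f \<boxtimes> g)"
    and scale_tens: "X \<in> Ob C \<Longrightarrow> Y \<in> Ob C \<Longrightarrow> X' \<in> Ob C \<Longrightarrow> Y' \<in> Ob C \<Longrightarrow> f \<in> Hom C X Y \<Longrightarrow>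
        g \<in> Hom C X' Y' \<Longrightarrow> Scale C a f \<boxtimes> g = Scale C a (f \<boxtimes> g)"
    and interchange: "X \<in> Ob C \<Longrightarrow> Y \<in> Ob C \<Longrightarrow> Z \<in> Ob C \<Longrightarrow> X' \<in> Ob C \<Longrightarrow> Y' \<in> Ob C \<Longrightarrow>
        Z' \<in> Ob C \<Longrightarrow> f \<in> Hom C X Y \<Longrightarrow> g \<in> Hom C Y Z \<Longrightarrow> f' \<in> Hom C X' Y' \<Longrightarrow>
        g' \<in> Hom C Y' Z' \<Longrightarrow> (g \<boxtimes> g') \<cdot> (f \<boxtimes> f') = (g \<cdot> f) \<boxtimes> (g' \<cdot> f')"
    and tens_ident: "X \<in> Ob C \<Longrightarrow> Y \<in> Ob C \<Longrightarrow> Ident C X \<boxtimes> Ident C Y = Ident C (X \<odot> Y)"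
    and tens_mor_assoc: "X \<in> Ob C \<Longrightarrow> Y \<in> Ob C \<Longrightarrow> X' \<in> Ob C \<Longrightarrow> Y' \<in> Ob C \<Longrightarrow> X'' \<in> Ob C \<Longrightarrow>
        Y'' \<in> Ob C \<Longrightarrow> f \<in> Hom C X Y \<Longrightarrow> f' \<in> Hom C X' Y' \<Longrightarrow> f'' \<in> Hom C X'' Y'' \<Longrightarrow>
        (f \<boxtimes> f') \<boxtimes> f'' = f \<boxtimes> (f' \<boxtimes> f'')"
    and ident_unit_tens: "X \<in> Ob C \<Longrightarrow> Y \<in> Ob C \<Longrightarrow> f \<in> Hom C X Y \<Longrightarrow> Ident C (Unit C) \<boxtimes> f = f"
    and tens_ident_unit: "X \<in> Ob C \<Longrightarrow> Y \<in> Ob C \<Longrightarrow> f \<in> Hom C X Y \<Longrightarrow> f \<boxtimes> Ident C (Unit C) = f"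
    and assoc_strict: "X \<in> Ob C \<Longrightarrow> Y \<in> Ob C \<Longrightarrow> Z \<in> Ob C \<Longrightarrow>
        Assoc C X Y Z = Ident C (X \<odot> (Y \<odot> Z))"
    and lunit_strict: "X \<in> Ob C \<Longrightarrow> LUnit C X = Ident C X"
    and runit_strict: "X \<in> Ob C \<Longrightarrow> RUnit C X = Ident C X"
begin

definition mor :: "'m \<Rightarrow> 'o \<Rightarrow> 'o \<Rightarrow> bool" where
  "mor f X Y \<longleftrightarrow> X \<in> Ob C \<and> Y \<in> Ob C \<and> f \<in> Hom C X Y"

lemma morI: "X \<in> Ob C \<Longrightarrow> Y \<in> Ob C \<Longrightarrow> f \<in> Hom C X Y \<Longrightarrow> mor f X Y"
  by (simp add: mor_def)

lemma morD: "mor f X Y \<Longrightarrow> X \<in> Ob C" "mor f X Y \<Longrightarrow> Y \<in> Ob C" "mor f X Y \<Longrightarrow> f \<in> Hom C X Y"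
  by (simp_all add: mor_def)

lemmas obs = unit_ob tens_ob

lemma mor_ident: "X \<in> Ob C \<Longrightarrow> mor (Ident C X) X X"
  by (simp add: mor_def ident_hom)
lemma mor_zero: "X \<in> Ob C \<Longrightarrow> Y \<in> Ob C \<Longrightarrow> mor (Zero C X Y) X Y"
  by (simp add: mor_def zero_hom)
lemma mor_comp: "mor g Y Z \<Longrightarrow> mor f X Y \<Longrightarrow> mor (g \<cdot> f) X Z"
  by (auto simp: mor_def intro: comp_hom)
lemma mor_add: "mor f X Y \<Longrightarrow> mor g X Y \<Longrightarrow> mor (Add C f g) X Y"
  by (auto simp: mor_def intro: add_hom)
lemma mor_scale: "mor f X Y \<Longrightarrow> mor (Scale C a f) X Y"
  by (auto simp: mor_def intro: scale_hom)
lemma mor_tens: "mor f X Y \<Longrightarrow> mor g X' Y' \<Longrightarrow> mor (f \<boxtimes> g) (X \<odot> X') (Y \<odot> Y')"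
  by (auto simp: mor_def intro: tens_hom tens_ob)

lemmas mors = mor_ident mor_zero mor_comp mor_add mor_scale mor_tens

lemma comp_zero: "mor f Y Z \<Longrightarrow> X \<in> Ob C \<Longrightarrow> f \<cdot> Zero C X Y = Zero C X Z"
  using comp_scale[of X Y Z "Zero C X Y" f 0] scale_zero[OF _ _ zero_hom, of X Y]
    scale_zero[OF _ _ comp_hom[of X Y Z "Zero C X Y" f]] by (simp add: mor_def zero_hom)
lemma zero_comp: "mor f X Y \<Longrightarrow> Z \<in> Ob C \<Longrightarrow> Zero C Y Z \<cdot> f = Zero C X Z"
  using scale_comp[of X Y Z f "Zero C Y Z" 0] scale_zero[OF _ _ zero_hom, of Y Z]
    scale_zero[OF _ _ comp_hom[of X Y Z f "Zero C Y Z"]] by (simp add: mor_def zero_hom)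
lemma tens_zero: "mor f X Y \<Longrightarrow> X' \<in> Ob C \<Longrightarrow> Y' \<in> Ob C \<Longrightarrow>
    f \<boxtimes> Zero C X' Y' = Zero C (X \<odot> X') (Y \<odot> Y')"
  using tens_scale[of X Y X' Y' f "Zero C X' Y'" 0] scale_zero[OF _ _ zero_hom, of X' Y']
    scale_zero[OF _ _ tens_hom[of X Y X' Y' f "Zero C X' Y'"]] by (simp add: mor_def zero_hom tens_ob)
lemma zero_tens: "mor f X Y \<Longrightarrow> X' \<in> Ob C \<Longrightarrow> Y' \<in> Ob C \<Longrightarrow>
    Zero C X' Y' \<boxtimes> f = Zero C (X' \<odot> X) (Y' \<odot> Y)"
  using scale_tens[of X' Y' X Y "Zero C X' Y'" f 0] scale_zero[OF _ _ zero_hom, of X' Y']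
    scale_zero[OF _ _ tens_hom[of X' Y' X Y "Zero C X' Y'" f]] by (simp add: mor_def zero_hom tens_ob)
lemma zero_add: "mor f X Y \<Longrightarrow> Add C (Zero C X Y) f = f"
  using add_comm[of X Y "Zero C X Y" f] by (simp add: mor_def zero_hom add_zero)
lemma scale_Zero: "X \<in> Ob C \<Longrightarrow> Y \<in> Ob C \<Longrightarrow> Scale C a (Zero C X Y) = Zero C X Y"
  using scale_scale[of X Y "Zero C X Y" a 0] by (simp add: zero_hom scale_zero)
text \<open>Composition, tensor product and bilinearity with the typing premises in one place.\<close>

lemma cassoc: "mor h Z W \<Longrightarrow> mor g Y Z \<Longrightarrow> mor f X Y \<Longrightarrow> (h \<cdot> g) \<cdot> f = h \<cdot> (g \<cdot> f)"
  by (auto simp: mor_def comp_assoc)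
lemma inter: "mor g Y Z \<Longrightarrow> mor f X Y \<Longrightarrow> mor g' Y' Z' \<Longrightarrow> mor f' X' Y' \<Longrightarrow>
    (g \<boxtimes> g') \<cdot> (f \<boxtimes> f') = (g \<cdot> f) \<boxtimes> (g' \<cdot> f')"
  by (auto simp: mor_def interchange)
lemma tassoc: "mor f X Y \<Longrightarrow> mor f' X' Y' \<Longrightarrow> mor f'' X'' Y'' \<Longrightarrow>
    (f \<boxtimes> f') \<boxtimes> f'' = f \<boxtimes> (f' \<boxtimes> f'')"
  by (auto simp: mor_def tens_mor_assoc)
lemma lid: "mor f X Y \<Longrightarrow> Ident C Y \<cdot> f = f" and rid: "mor f X Y \<Longrightarrow> f \<cdot> Ident C X = f"
  by (auto simp: mor_def ident_comp comp_ident)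
lemma ltid: "mor f X Y \<Longrightarrow> Ident C (Unit C) \<boxtimes> f = f"
  and rtid: "mor f X Y \<Longrightarrow> f \<boxtimes> Ident C (Unit C) = f"
  by (auto simp: mor_def ident_unit_tens tens_ident_unit)
lemma cadd: "mor g Y Z \<Longrightarrow> mor f X Y \<Longrightarrow> mor f' X Y \<Longrightarrow> g \<cdot> Add C f f' = Add C (g \<cdot> f) (g \<cdot> f')"
  by (auto simp: mor_def comp_add)
lemma addc: "mor g Y Z \<Longrightarrow> mor g' Y Z \<Longrightarrow> mor f X Y \<Longrightarrow> Add C g g' \<cdot> f = Add C (g \<cdot> f) (g' \<cdot> f)"
  by (auto simp: mor_def add_comp)
lemma cscale: "mor g Y Z \<Longrightarrow> mor f X Y \<Longrightarrow> g \<cdot> Scale C a f = Scale C a (g \<cdot> f)"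
  by (auto simp: mor_def comp_scale)
lemma scalec: "mor g Y Z \<Longrightarrow> mor f X Y \<Longrightarrow> Scale C a g \<cdot> f = Scale C a (g \<cdot> f)"
  by (auto simp: mor_def scale_comp)
lemma tadd: "mor f X Y \<Longrightarrow> mor g X' Y' \<Longrightarrow> mor g' X' Y' \<Longrightarrow>
    f \<boxtimes> Add C g g' = Add C (f \<boxtimes> g) (f \<boxtimes> g')"
  by (auto simp: mor_def tens_add)
lemma addt: "mor f X Y \<Longrightarrow> mor f' X Y \<Longrightarrow> mor g X' Y' \<Longrightarrow>
    Add C f f' \<boxtimes> g = Add C (f \<boxtimes> g) (f' \<boxtimes> g)"
  by (auto simp: mor_def add_tens)
lemma tscale: "mor f X Y \<Longrightarrow> mor g X' Y' \<Longrightarrow> f \<boxtimes> Scale C a g = Scale C a (f \<boxtimes> g)"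
  by (auto simp: mor_def tens_scale)
lemma scalet: "mor f X Y \<Longrightarrow> mor g X' Y' \<Longrightarrow> Scale C a f \<boxtimes> g = Scale C a (f \<boxtimes> g)"
  by (auto simp: mor_def scale_tens)
lemma addz: "mor f X Y \<Longrightarrow> Add C f (Zero C X Y) = f"
  by (auto simp: mor_def add_zero)
lemma scale0: "mor f X Y \<Longrightarrow> Scale C 0 f = Zero C X Y"
  by (auto simp: mor_def scale_zero)
lemma scale1: "mor f X Y \<Longrightarrow> Scale C 1 f = f"
  by (auto simp: mor_def scale_one)
lemma scalescale: "mor f X Y \<Longrightarrow> Scale C a (Scale C b f) = Scale C (a * b) f"
  by (auto simp: mor_def scale_scale)

text \<open>Sliding one factor past the other.\<close>

lemma tens_left_right: "mor f X Y \<Longrightarrow> mor g X' Y' \<Longrightarrow> (f \<boxtimes> Ident C Y') \<cdot> (Ident C X \<boxtimes> g) = f \<boxtimes> g"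
  using inter[of f X Y "Ident C X" X "Ident C Y'" Y' Y' g X'] by (simp add: lid rid mor_ident morD)
lemma tens_right_left: "mor f X Y \<Longrightarrow> mor g X' Y' \<Longrightarrow> (Ident C Y \<boxtimes> g) \<cdot> (f \<boxtimes> Ident C X') = f \<boxtimes> g"
  using inter[of "Ident C Y" Y Y f X g X' Y' "Ident C X'" X'] by (simp add: lid rid mor_ident morD)

lemma inverse_arrow_eq:
  assumes "mor f X Y" "mor g Y X" "g \<cdot> f = Ident C X" "f \<cdot> g = Ident C Y"
  shows "inverse_arrow C X Y f = g"
  unfolding inverse_arrow_def mutually_inverse_def
proof (rule the_equality)
  show "f \<in> Hom C X Y \<and> g \<in> Hom C Y X \<and> g \<cdot> f = Ident C X \<and> f \<cdot> g = Ident C Y"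
    using assms by (simp add: mor_def)
next
  fix h assume h: "f \<in> Hom C X Y \<and> h \<in> Hom C Y X \<and> h \<cdot> f = Ident C X \<and> f \<cdot> h = Ident C Y"
  then have "mor h Y X" using assms by (auto simp: mor_def)
  then show "h = g"
    using cassoc[of h Y X f Y g] assms h lid[OF assms(2)] rid[of h Y X] cassoc[OF _ assms(1,2), of h X]
    by simp
qed

lemma inverse_arrow_ident: "X \<in> Ob C \<Longrightarrow> inverse_arrow C X X (Ident C X) = Ident C X"
  by (intro inverse_arrow_eq) (simp_all add: mor_ident lid[OF mor_ident])

end

section \<open>Sums of morphisms that factor through given objects\<close>

context strict_tensor_category
begin

inductive_set through :: "'o set \<Rightarrow> 'o \<Rightarrow> 'o \<Rightarrow> 'm set" for P V W where
  through_zero: "Zero C V W \<in> through P V W"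
| through_add: "f \<in> through P V W \<Longrightarrow> L \<in> P \<Longrightarrow> p \<in> Hom C V L \<Longrightarrow> i \<in> Hom C L W \<Longrightarrow>
    Add C (i \<cdot> p) f \<in> through P V W"

lemma mor_through:
  assumes "f \<in> through P V W" "P \<subseteq> Ob C" "V \<in> Ob C" "W \<in> Ob C"
  shows "mor f V W"
  using assms
proof (induction rule: through.induct)
  case (through_add f L p i)
  then have m: "mor p V L" "mor i L W" by (auto simp: mor_def)
  show ?case by (rule mor_add[OF mor_comp[OF m(2,1)]]) (use through_add in auto)
qed (rule mor_zero)

lemma through_single:
  assumes "mor p V L" "mor i L W" "L \<in> P"
  shows "i \<cdot> p \<in> through P V W"
proof -
  have "Add C (i \<cdot> p) (Zero C V W) \<in> through P V W"
    using assms by (auto intro!: through.intros simp: mor_def)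
  then show ?thesis using addz[OF mor_comp[OF assms(2,1)]] by simp
qed

lemma through_Add:
  assumes "f \<in> through P V W" "g \<in> through P V W" "P \<subseteq> Ob C" "V \<in> Ob C" "W \<in> Ob C"
  shows "Add C f g \<in> through P V W"
  using assms
proof (induction rule: through.induct)
  case through_zero
  then show ?case using zero_add[OF mor_through[of g P V W]] by simp
next
  case (through_add f L p i)
  then have "mor p V L" "mor i L W" "mor f V W" "mor g V W"
    using mor_through by (auto simp: mor_def)
  then have "Add C (Add C (i \<cdot> p) f) g = Add C (i \<cdot> p) (Add C f g)"
    using add_assoc[of V W "i \<cdot> p" f g] mor_comp[of i L W p V] by (simp add: mor_def)
  with through_add show ?case by (auto intro: through.intros)
qed

text \<open>Additive maps between hom sets that preserve factorisations preserve \<open>through\<close>; all closure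
  properties below are instances.\<close>

lemma through_map:
  assumes "f \<in> through P V W" "P \<subseteq> Ob C" "V \<in> Ob C" "W \<in> Ob C" "Q \<subseteq> Ob C" "V' \<in> Ob C" "W' \<in> Ob C"
    and zero: "F (Zero C V W) = Zero C V' W'"
    and add: "\<And>f g. mor f V W \<Longrightarrow> mor g V W \<Longrightarrow> F (Add C f g) = Add C (F f) (F g)"
    and fac: "\<And>L i p. L \<in> P \<Longrightarrow> mor p V L \<Longrightarrow> mor i L W \<Longrightarrow> F (i \<cdot> p) \<in> through Q V' W'"
  shows "F f \<in> through Q V' W'"
  using assms(1)
proof (induction rule: through.induct)
  case through_zero
  then show ?case by (simp add: zero through.through_zero)
next
  case (through_add f L p i)
  then have m: "mor p V L" "mor i L W" "mor f V W"
    using assms(2-4) mor_through by (auto simp: mor_def)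
  then show ?case
    using through_add fac[OF _ m(1,2)] assms(2-7)
    by (simp add: add mor_comp[OF m(2,1)] through_Add)
qed

lemma through_comp_left:
  assumes "f \<in> through P V W" "P \<subseteq> Ob C" "V \<in> Ob C" "mor g W U"
  shows "g \<cdot> f \<in> through P V U"
proof (rule through_map[where F = "\<lambda>f. g \<cdot> f", OF assms(1,2,3)])
  fix L i p assume "L \<in> P" "mor p V L" "mor i L W"
  then show "g \<cdot> (i \<cdot> p) \<in> through P V U"
    using through_single[of p V L "g \<cdot> i" U P] mor_comp[OF assms(4)] cassoc[OF assms(4), of i L p V] by simp
qed (use assms morD[OF assms(4)] in \<open>auto simp: comp_zero intro: cadd\<close>)

lemma through_comp_right:
  assumes "f \<in> through P V W" "P \<subseteq> Ob C" "W \<in> Ob C" "mor g U V"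
  shows "f \<cdot> g \<in> through P U W"
proof (rule through_map[where F = "\<lambda>f. f \<cdot> g" and V = V and W = W, OF assms(1,2)])
  fix L i p assume "L \<in> P" "mor p V L" "mor i L W"
  then show "(i \<cdot> p) \<cdot> g \<in> through P U W"
    using through_single[of "p \<cdot> g" U L i W P] mor_comp[OF _ assms(4)] cassoc[OF _ _ assms(4), of i L W p] by simp
qed (use assms morD[OF assms(4)] in \<open>auto simp: zero_comp intro: addc\<close>)

lemma through_trans:
  assumes "f \<in> through P V W" "P \<subseteq> Ob C" "Q \<subseteq> Ob C" "V \<in> Ob C" "W \<in> Ob C"
    and "\<And>L. L \<in> P \<Longrightarrow> Ident C L \<in> through Q L L"
  shows "f \<in> through Q V W"
proof (rule through_map[where F = "\<lambda>f. f" and V = V and W = W and P = P])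
  fix L i p assume h: "L \<in> P" "mor p V L" "mor i L W"
  then have "i \<cdot> (Ident C L \<cdot> p) \<in> through Q V W"
    using assms(3) assms(6)[OF h(1)] h morD[OF h(2)] morD[OF h(3)]
    by (intro through_comp_left[OF through_comp_right]) (simp_all)
  then show "i \<cdot> p \<in> through Q V W" using lid[OF h(2)] by simp
qed (use assms in auto)

lemma through_mono: "f \<in> through P V W \<Longrightarrow> P \<subseteq> Q \<Longrightarrow> f \<in> through Q V W"
  by (induction rule: through.induct) (auto intro: through.intros)

lemma through_tens:
  assumes f: "f \<in> through P V W" and g: "g \<in> through Q V' W'"
    and ob: "P \<subseteq> Ob C" "Q \<subseteq> Ob C" "V \<in> Ob C" "W \<in> Ob C" "V' \<in> Ob C" "W' \<in> Ob C"
    and R: "\<And>L M. L \<in> P \<Longrightarrow> M \<in> Q \<Longrightarrow> L \<odot> M \<in> R" "R \<subseteq> Ob C"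
  shows "f \<boxtimes> g \<in> through R (V \<odot> V') (W \<odot> W')"
proof -
  have mg: "mor g V' W'" using g ob mor_through by blast
  have "(i \<cdot> p) \<boxtimes> g \<in> through R (V \<odot> V') (W \<odot> W')"
    if L: "L \<in> P" and m: "mor p V L" "mor i L W" for L i p
  proof (rule through_map[where F = "\<lambda>g. (i \<cdot> p) \<boxtimes> g", OF g])
    fix M j r assume M: "M \<in> Q" "mor r V' M" "mor j M W'"
    have "(i \<cdot> p) \<boxtimes> (j \<cdot> r) = (i \<boxtimes> j) \<cdot> (p \<boxtimes> r)" using inter[OF m(2,1) M(3,2)] by simp
    then show "(i \<cdot> p) \<boxtimes> (j \<cdot> r) \<in> through R (V \<odot> V') (W \<odot> W')"
      using through_single[OF mor_tens[OF m(1) M(2)] mor_tens[OF m(2) M(3)]] R L M by simp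
  qed (use ob R mor_comp[OF m(2,1)] in \<open>auto simp: tens_zero tadd obs\<close>)
  then show ?thesis
    by (intro through_map[where F = "\<lambda>f. f \<boxtimes> g", OF f])
       (use ob R mg in \<open>auto simp: zero_tens addt obs\<close>)
qed

section \<open>Duality in a strict category\<close>

definition zigzag :: "'o \<Rightarrow> 'o \<Rightarrow> 'm \<Rightarrow> 'm \<Rightarrow> bool" where
  "zigzag X Y ev coev \<longleftrightarrow> mor ev (Y \<odot> X) (Unit C) \<and> mor coev (Unit C) (X \<odot> Y) \<and>
     (Ident C X \<boxtimes> ev) \<cdot> (coev \<boxtimes> Ident C X) = Ident C X \<and>
     (ev \<boxtimes> Ident C Y) \<cdot> (Ident C Y \<boxtimes> coev) = Ident C Y"

lemma dual_objects_zigzag: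
  assumes "X \<in> Ob C" "Y \<in> Ob C"
  shows "dual_objects C X Y \<longleftrightarrow> (\<exists>ev coev. zigzag X Y ev coev)"
proof -
  have "RUnit C X \<cdot> (Ident C X \<boxtimes> ev) \<cdot> Assoc C X Y X \<cdot> (coev \<boxtimes> Ident C X) =
        (Ident C X \<boxtimes> ev) \<cdot> (coev \<boxtimes> Ident C X) \<and>
      LUnit C Y \<cdot> (ev \<boxtimes> Ident C Y) \<cdot> Assoc_inv C Y X Y \<cdot> (Ident C Y \<boxtimes> coev) =
        (ev \<boxtimes> Ident C Y) \<cdot> (Ident C Y \<boxtimes> coev)"
    if "mor ev (Y \<odot> X) (Unit C)" "mor coev (Unit C) (X \<odot> Y)" for ev coev
  proof -
    have "mor (Ident C X \<boxtimes> ev) (X \<odot> (Y \<odot> X)) X" "mor (ev \<boxtimes> Ident C Y) (Y \<odot> (X \<odot> Y)) Y"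
      using mor_tens[OF mor_ident[OF assms(1)] that(1)] mor_tens[OF that(1) mor_ident[OF assms(2)]]
        assms by (simp_all add: tens_unit unit_tens tens_assoc)
    then show ?thesis
      using assms by (simp add: lunit_strict runit_strict assoc_strict tens_assoc inverse_arrow_ident tens_ob lid rid)
  qed
  then show ?thesis
    unfolding dual_objects_def zigzag_def using assms
    by (auto simp: mor_def obs lunit_strict runit_strict)
qed

text \<open>The transpose \<open>Y \<rightarrow> Q\<close> of \<open>f : P \<rightarrow> X\<close>, where \<open>Y\<close> is dual to \<open>X\<close> by \<open>ev\<close> and \<open>Q\<close> is dual to
  \<open>P\<close> by \<open>coev\<close>.\<close>

definition transp :: "'o \<Rightarrow> 'o \<Rightarrow> 'm \<Rightarrow> 'm \<Rightarrow> 'm \<Rightarrow> 'm" where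
  "transp Y Q ev coev f = (ev \<boxtimes> Ident C Q) \<cdot> (Ident C Y \<boxtimes> ((f \<boxtimes> Ident C Q) \<cdot> coev))"

lemma mor_transp:
  assumes "zigzag X Y ev coev" "zigzag P Q ev' coev'" "mor f P X" "Y \<in> Ob C" "Q \<in> Ob C"
  shows "mor (transp Y Q ev coev' f) Y Q"
proof -
  have m: "mor ev (Y \<odot> X) (Unit C)" "mor coev' (Unit C) (P \<odot> Q)"
    using assms by (auto simp: zigzag_def)
  note o = assms(4,5) morD(1,2)[OF assms(3)]
  have "mor (ev \<boxtimes> Ident C Q) (Y \<odot> (X \<odot> Q)) Q"
    using mor_tens[OF m(1) mor_ident[OF o(2)]] o by (simp add: unit_tens tens_assoc)
  moreover have "mor (Ident C Y \<boxtimes> ((f \<boxtimes> Ident C Q) \<cdot> coev')) Y (Y \<odot> (X \<odot> Q))"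
    using mor_tens[OF mor_ident[OF o(1)] mor_comp[OF mor_tens[OF assms(3) mor_ident[OF o(2)]] m(2)]] o
    by (simp add: tens_unit)
  ultimately show ?thesis by (simp add: transp_def mor_comp)
qed

lemma transp_comp:
  assumes XY: "zigzag X Y ev coev" and PQ: "zigzag P Q ev' coev'"
    and i: "mor i P X" and p: "mor p X P" and oY: "Y \<in> Ob C" and oQ: "Q \<in> Ob C"
  shows "transp Q Y ev' coev p \<cdot> transp Y Q ev coev' i = transp Y Y ev coev (i \<cdot> p)"
proof -
  have ev: "mor ev (Y \<odot> X) (Unit C)" and coev: "mor coev (Unit C) (X \<odot> Y)"
    and ev': "mor ev' (Q \<odot> P) (Unit C)" and coev': "mor coev' (Unit C) (P \<odot> Q)"
    and zz: "(Ident C P \<boxtimes> ev') \<cdot> (coev' \<boxtimes> Ident C P) = Ident C P"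
    using assms by (auto simp: zigzag_def)
  have oP: "P \<in> Ob C" and oX: "X \<in> Ob C" using i by (auto simp: mor_def)
  note o = oP oX oY oQ unit_ob tens_ob
  note idm = mor_ident[OF oP] mor_ident[OF oX] mor_ident[OF oY] mor_ident[OF oQ] mor_ident[OF unit_ob]
  define e where "e = ev \<cdot> (Ident C Y \<boxtimes> i)"
  define c where "c = (p \<boxtimes> Ident C Y) \<cdot> coev"
  have e: "mor e (Y \<odot> P) (Unit C)" unfolding e_def by (rule mor_comp[OF ev mor_tens[OF idm(3) i]])
  have c: "mor c (Unit C) (P \<odot> Y)" unfolding c_def by (rule mor_comp[OF mor_tens[OF p idm(3)] coev])
  have pull: "(ev \<boxtimes> Ident C D) \<cdot> (Ident C Y \<boxtimes> ((i \<boxtimes> Ident C D) \<cdot> g)) =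
      (e \<boxtimes> Ident C D) \<cdot> (Ident C Y \<boxtimes> g)" if D: "D \<in> Ob C" and g: "mor g (Unit C) (P \<odot> D)" for D g
  proof -
    note iD = mor_ident[OF D]
    have "Ident C Y \<boxtimes> ((i \<boxtimes> Ident C D) \<cdot> g) = (Ident C Y \<boxtimes> (i \<boxtimes> Ident C D)) \<cdot> (Ident C Y \<boxtimes> g)"
      using inter[OF idm(3) idm(3) mor_tens[OF i iD] g] lid[OF idm(3)] by simp
    also have "\<dots> = ((Ident C Y \<boxtimes> i) \<boxtimes> Ident C D) \<cdot> (Ident C Y \<boxtimes> g)"
      using tassoc[OF idm(3) i iD] by simp
    finally have "(ev \<boxtimes> Ident C D) \<cdot> (Ident C Y \<boxtimes> ((i \<boxtimes> Ident C D) \<cdot> g)) =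
        (ev \<boxtimes> Ident C D) \<cdot> (((Ident C Y \<boxtimes> i) \<boxtimes> Ident C D) \<cdot> (Ident C Y \<boxtimes> g))" by simp
    also have "\<dots> = ((ev \<boxtimes> Ident C D) \<cdot> ((Ident C Y \<boxtimes> i) \<boxtimes> Ident C D)) \<cdot> (Ident C Y \<boxtimes> g)"
      using mor_tens[OF idm(3) g] D
      by (intro cassoc[OF mor_tens[OF ev iD] mor_tens[OF mor_tens[OF idm(3) i] iD], symmetric])
         (simp add: tens_assoc o)
    also have "\<dots> = (e \<boxtimes> Ident C D) \<cdot> (Ident C Y \<boxtimes> g)"
      using inter[OF ev mor_tens[OF idm(3) i] iD iD] lid[OF iD] by (simp add: e_def)
    finally show ?thesis .
  qed
  have t1: "transp Y Q ev coev' i = (e \<boxtimes> Ident C Q) \<cdot> (Ident C Y \<boxtimes> coev')"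
    unfolding transp_def by (rule pull[OF oQ coev'])
  have t2: "transp Q Y ev' coev p = (ev' \<boxtimes> Ident C Y) \<cdot> (Ident C Q \<boxtimes> c)"
    by (simp add: transp_def c_def)
  have t3: "transp Y Y ev coev (i \<cdot> p) = (e \<boxtimes> Ident C Y) \<cdot> (Ident C Y \<boxtimes> c)"
  proof -
    have "((i \<cdot> p) \<boxtimes> Ident C Y) \<cdot> coev = (i \<boxtimes> Ident C Y) \<cdot> c"
      using cassoc[OF mor_tens[OF i idm(3)] mor_tens[OF p idm(3)] coev] inter[OF i p idm(3) idm(3)]
        lid[OF idm(3)] by (simp add: c_def)
    then show ?thesis unfolding transp_def using pull[OF oY c] by simp
  qed
  define w where "w = Ident C (P \<odot> Y)"
  have w: "mor w (P \<odot> Y) (P \<odot> Y)" unfolding w_def by (intro mor_ident o)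
  have Qc: "mor (Ident C Q \<boxtimes> c) Q (Q \<odot> (P \<odot> Y))"
    using mor_tens[OF idm(4) c] by (simp add: tens_unit o)
  have e'Y: "mor (ev' \<boxtimes> Ident C Y) (Q \<odot> (P \<odot> Y)) Y"
    using mor_tens[OF ev' idm(3)] by (simp add: unit_tens tens_assoc o)
  have eD: "mor (e \<boxtimes> Ident C D) (Y \<odot> (P \<odot> D)) D" if "D \<in> Ob C" for D
    using mor_tens[OF e mor_ident[OF that]] that by (simp add: unit_tens tens_assoc o)
  have slide: "g \<cdot> (e \<boxtimes> Ident C D) = (e \<boxtimes> Ident C D') \<cdot> (Ident C (Y \<odot> P) \<boxtimes> g)"
    if "mor g D D'" for g D D'
    using tens_left_right[OF e that] tens_right_left[OF e that] ltid[OF that] by simp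
  have Yc': "mor (Ident C Y \<boxtimes> coev') Y (Y \<odot> (P \<odot> Q))"
    using mor_tens[OF idm(3) coev'] by (simp add: tens_unit o)
  have sp: "Ident C (Y \<odot> P) \<boxtimes> g = Ident C Y \<boxtimes> (Ident C P \<boxtimes> g)" if "mor g D D'" for g D D'
    using tassoc[OF idm(3,1) that] by (simp add: tens_ident o)
  have mY: "mor (Ident C (Y \<odot> P) \<boxtimes> g) (Y \<odot> (P \<odot> D)) (Y \<odot> (P \<odot> D'))" if "mor g D D'" for g D D'
    using mor_tens[OF idm(3) mor_tens[OF idm(1) that]] by (simp add: sp[OF that])
  let ?K = "(ev' \<boxtimes> Ident C Y) \<cdot> (Ident C Q \<boxtimes> c)"
  have K: "mor ?K Q Y" by (rule mor_comp[OF e'Y Qc])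
  have "?K \<cdot> ((e \<boxtimes> Ident C Q) \<cdot> (Ident C Y \<boxtimes> coev')) =
      (e \<boxtimes> Ident C Y) \<cdot> ((Ident C Y \<boxtimes> (Ident C P \<boxtimes> ?K)) \<cdot> (Ident C Y \<boxtimes> coev'))"
    using slide[OF K] cassoc[OF K eD[OF oQ] Yc'] cassoc[OF eD[OF oY] mY[OF K] Yc'] sp[OF K] by simp
  also have "(Ident C Y \<boxtimes> (Ident C P \<boxtimes> ?K)) \<cdot> (Ident C Y \<boxtimes> coev') =
      Ident C Y \<boxtimes> ((Ident C P \<boxtimes> ?K) \<cdot> coev')"
    using inter[OF idm(3) idm(3) mor_tens[OF idm(1) K] coev'] lid[OF idm(3)] by simp
  also have "(Ident C P \<boxtimes> ?K) \<cdot> coev' = c"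
  proof -
    have a: "Ident C P \<boxtimes> ?K = (Ident C P \<boxtimes> (ev' \<boxtimes> Ident C Y)) \<cdot> (Ident C P \<boxtimes> (Ident C Q \<boxtimes> c))"
      using inter[OF idm(1) idm(1) e'Y Qc] lid[OF idm(1)] by simp
    have b: "(Ident C P \<boxtimes> (Ident C Q \<boxtimes> c)) \<cdot> coev' = (coev' \<boxtimes> Ident C (P \<odot> Y)) \<cdot> c"
      using tens_left_right[OF coev' c] tens_right_left[OF coev' c] tassoc[OF idm(1,4) c]
        ltid[OF c] rtid[OF coev'] by (simp add: tens_ident o)
    have d: "mor (Ident C P \<boxtimes> (ev' \<boxtimes> Ident C Y)) (P \<odot> (Q \<odot> (P \<odot> Y))) (P \<odot> Y)"
      using mor_tens[OF idm(1) e'Y] by simp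
    have f: "mor (Ident C P \<boxtimes> (Ident C Q \<boxtimes> c)) (P \<odot> Q) (P \<odot> (Q \<odot> (P \<odot> Y)))"
      using mor_tens[OF idm(1) Qc] by simp
    have g: "mor (coev' \<boxtimes> Ident C (P \<odot> Y)) (P \<odot> Y) (P \<odot> (Q \<odot> (P \<odot> Y)))"
      using mor_tens[OF coev' w] by (simp add: w_def unit_tens tens_assoc o)
    have "(Ident C P \<boxtimes> ?K) \<cdot> coev' =
        ((Ident C P \<boxtimes> (ev' \<boxtimes> Ident C Y)) \<cdot> (coev' \<boxtimes> Ident C (P \<odot> Y))) \<cdot> c"
      unfolding a using cassoc[OF d f coev'] b cassoc[OF d g c] by simp
    also have "(Ident C P \<boxtimes> (ev' \<boxtimes> Ident C Y)) \<cdot> (coev' \<boxtimes> Ident C (P \<odot> Y)) =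
        ((Ident C P \<boxtimes> ev') \<boxtimes> Ident C Y) \<cdot> ((coev' \<boxtimes> Ident C P) \<boxtimes> Ident C Y)"
      using tassoc[OF idm(1) ev' idm(3)] tassoc[OF coev' idm(1,3)] by (simp add: tens_ident o)
    also have "\<dots> = Ident C P \<boxtimes> Ident C Y"
    proof -
      have "mor (coev' \<boxtimes> Ident C P) (Unit C \<odot> P) (P \<odot> (Q \<odot> P))"
        using mor_tens[OF coev' idm(1)] by (simp add: tens_assoc o)
      from inter[OF mor_tens[OF idm(1) ev'] this idm(3) idm(3)] show ?thesis
        using zz lid[OF idm(3)] by simp
    qed
    finally show ?thesis using lid[OF c] by (simp add: tens_ident o)
  qed
  finally show ?thesis by (simp add: t1 t2 t3)
qed

lemma transp_ident:
  assumes "zigzag X Y ev coev" "X \<in> Ob C" "Y \<in> Ob C"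
  shows "transp Y Y ev coev (Ident C X) = Ident C Y"
proof -
  have "mor coev (Unit C) (X \<odot> Y)" using assms by (auto simp: zigzag_def)
  then show ?thesis using assms by (simp add: transp_def tens_ident lid zigzag_def)
qed

text \<open>The identity of the dual is the transpose of the identity, so it factors through the duals of
  the objects through which the identity factors.\<close>

lemma through_dual:
  assumes XY: "zigzag X Y ev coev" and o: "X \<in> Ob C" "Y \<in> Ob C"
    and X: "Ident C X \<in> through P X X" and P: "P \<subseteq> Ob C"
    and dual: "\<And>L. L \<in> P \<Longrightarrow> \<exists>M\<in>P. \<exists>e c. zigzag L M e c"
  shows "Ident C Y \<in> through P Y Y"
proof -
  have ev: "mor ev (Y \<odot> X) (Unit C)" and coev: "mor coev (Unit C) (X \<odot> Y)"
    using XY by (auto simp: zigzag_def)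
  have evY: "mor (ev \<boxtimes> Ident C Y) (Y \<odot> (X \<odot> Y)) Y"
    using mor_tens[OF ev mor_ident[OF o(2)]] o by (simp add: unit_tens tens_assoc obs)
  have iY: "mor (Ident C Y) Y Y" by (rule mor_ident[OF o(2)])
  have mh: "mor ((f \<boxtimes> Ident C Y) \<cdot> coev) (Unit C) (X \<odot> Y)" if "mor f X X" for f
    by (rule mor_comp[OF mor_tens[OF that iY] coev])
  have mY: "mor (Ident C Y \<boxtimes> g) Y (Y \<odot> (X \<odot> Y))" if "mor g (Unit C) (X \<odot> Y)" for g
    using mor_tens[OF iY that] o by (simp add: tens_unit)
  have "transp Y Y ev coev (Ident C X) \<in> through P Y Y"
  proof (rule through_map[where F = "transp Y Y ev coev", OF X P o(1,1) P o(2,2)])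
    show "transp Y Y ev coev (Zero C X X) = Zero C Y Y"
      using o zero_comp[OF coev, of "X \<odot> Y"] comp_zero[OF evY, of Y]
      by (simp add: transp_def zero_tens[OF iY] tens_zero[OF iY] obs tens_unit)
  next
    fix f g assume f: "mor f X X" and g: "mor g X X"
    show "transp Y Y ev coev (Add C f g) = Add C (transp Y Y ev coev f) (transp Y Y ev coev g)"
      using f g cadd[OF evY mY[OF mh[OF f]] mY[OF mh[OF g]]] tadd[OF iY mh[OF f] mh[OF g]]
        addc[OF mor_tens[OF f iY] mor_tens[OF g iY] coev]
      by (simp add: transp_def addt[OF f g iY])
  next
    fix L i p assume L: "L \<in> P" "mor p X L" "mor i L X"
    then obtain M e c where M: "M \<in> P" "zigzag L M e c" using dual by blast
    have "M \<in> Ob C" using M P by auto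
    note t = transp_comp[OF XY M(2) L(3,2) o(2) this] mor_transp[OF XY M(2) L(3) o(2) this]
      mor_transp[OF M(2) XY L(2) this o(2)]
    show "transp Y Y ev coev (i \<cdot> p) \<in> through P Y Y"
      using through_single[OF t(2,3) M(1)] t(1) by simp
  qed
  then show ?thesis using transp_ident[OF XY o] by simp
qed

end

 

section \<open>The reversed tensor product\<close>

definition rev_cat :: "('o, 'm, 'k) lincat \<Rightarrow> ('o, 'm, 'k) lincat" where
  "rev_cat C = C\<lparr>TensO := (\<lambda>X Y. Y \<odot>\<^bsub>C\<^esub> X), TensM := (\<lambda>f g. g \<boxtimes>\<^bsub>C\<^esub> f),
     Assoc := (\<lambda>X Y Z. Ident C (Z \<odot>\<^bsub>C\<^esub> (Y \<odot>\<^bsub>C\<^esub> X))), LUnit := RUnit C, RUnit := LUnit C\<rparr>"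

lemma rev_simps [simp]:
  "Ob (rev_cat C) = Ob C" "Hom (rev_cat C) = Hom C" "Ident (rev_cat C) = Ident C"
  "Comp (rev_cat C) = Comp C" "Zero (rev_cat C) = Zero C" "Add (rev_cat C) = Add C"
  "Scale (rev_cat C) = Scale C" "X \<odot>\<^bsub>rev_cat C\<^esub> Y = Y \<odot>\<^bsub>C\<^esub> X" "f \<boxtimes>\<^bsub>rev_cat C\<^esub> g = g \<boxtimes>\<^bsub>C\<^esub> f"
  "Unit (rev_cat C) = Unit C" "LUnit (rev_cat C) = RUnit C" "RUnit (rev_cat C) = LUnit C"
  "Assoc (rev_cat C) X Y Z = Ident C (Z \<odot>\<^bsub>C\<^esub> (Y \<odot>\<^bsub>C\<^esub> X))"
  by (simp_all add: rev_cat_def)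

context strict_tensor_category
begin

lemma rev_strict: "strict_tensor_category (rev_cat C)"
  by unfold_locales
     (simp_all add: unit_ob tens_ob tens_assoc unit_tens tens_unit ident_hom comp_hom zero_hom add_hom
       scale_hom tens_hom ident_comp comp_ident comp_assoc add_zero scale_one scale_scale
       scale_zero scale_sum scale_add comp_add add_comp comp_scale scale_comp tens_add add_tens
       tens_scale scale_tens interchange tens_ident tens_mor_assoc ident_unit_tens tens_ident_unit
       lunit_strict runit_strict add_assoc, (rule add_comm; assumption))

lemma rev_zigzag:
  "strict_tensor_category.zigzag (rev_cat C) X Y ev coev \<longleftrightarrow> zigzag Y X ev coev"
proof -
  interpret rev: strict_tensor_category "rev_cat C" by (rule rev_strict)
  have "rev.mor = mor" unfolding rev.mor_def[abs_def] mor_def[abs_def] by simp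
  then show ?thesis by (auto simp: rev.zigzag_def zigzag_def)
qed

lemma rev_through: "strict_tensor_category.through (rev_cat C) = through"
proof -
  interpret rev: strict_tensor_category "rev_cat C" by (rule rev_strict)
  have "f \<in> rev.through P X Y \<Longrightarrow> f \<in> through P X Y" for f P X Y
    by (induction rule: rev.through.induct) (auto intro: through.intros)
  moreover have "f \<in> through P X Y \<Longrightarrow> f \<in> rev.through P X Y" for f P X Y
  proof (induction rule: through.induct)
    case through_zero
    then show ?case using rev.through_zero[of X Y P] by simp
  next
    case (through_add f L p i)
    then show ?case using rev.through_add[of f P X Y L p i] by simp
  qed
  ultimately show ?thesis by (simp add: fun_eq_iff) blast
qed

section \<open>Objects built from tensor powers of a self-dual object\<close>

lemma zigzag_tens_half:
  assumes XY: "zigzag X Y ev coev" and XY': "zigzag X' Y' ev' coev'"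
    and o: "X \<in> Ob C" "Y \<in> Ob C" "X' \<in> Ob C" "Y' \<in> Ob C"
  defines "e \<equiv> ev' \<cdot> (Ident C Y' \<boxtimes> (ev \<boxtimes> Ident C X'))"
    and "c \<equiv> (Ident C X \<boxtimes> (coev' \<boxtimes> Ident C Y)) \<cdot> coev"
  shows "mor e ((Y' \<odot> Y) \<odot> (X \<odot> X')) (Unit C)" "mor c (Unit C) ((X \<odot> X') \<odot> (Y' \<odot> Y))"
    "(Ident C (X \<odot> X') \<boxtimes> e) \<cdot> (c \<boxtimes> Ident C (X \<odot> X')) = Ident C (X \<odot> X')"
proof -
  have ev: "mor ev (Y \<odot> X) (Unit C)" and coev: "mor coev (Unit C) (X \<odot> Y)"
    and ev': "mor ev' (Y' \<odot> X') (Unit C)" and coev': "mor coev' (Unit C) (X' \<odot> Y')"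
    and zz: "(Ident C X \<boxtimes> ev) \<cdot> (coev \<boxtimes> Ident C X) = Ident C X"
    and zz': "(Ident C X' \<boxtimes> ev') \<cdot> (coev' \<boxtimes> Ident C X') = Ident C X'"
    using assms by (auto simp: zigzag_def)
  note O = o unit_ob tens_ob
  note idm = mor_ident[OF o(1)] mor_ident[OF o(2)] mor_ident[OF o(3)] mor_ident[OF o(4)]
  define A where "A = Ident C X \<boxtimes> (coev' \<boxtimes> Ident C Y)"
  define B where "B = Ident C Y' \<boxtimes> (ev \<boxtimes> Ident C X')"
  have A: "mor A (X \<odot> Y) (X \<odot> (X' \<odot> (Y' \<odot> Y)))" unfolding A_def
    using mor_tens[OF idm(1) mor_tens[OF coev' idm(2)]] by (simp add: unit_tens tens_assoc O)
  have B: "mor B (Y' \<odot> (Y \<odot> (X \<odot> X'))) (Y' \<odot> X')" unfolding B_def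
    using mor_tens[OF idm(4) mor_tens[OF ev idm(3)]] by (simp add: unit_tens tens_assoc O)
  show "mor e ((Y' \<odot> Y) \<odot> (X \<odot> X')) (Unit C)" unfolding e_def
    using mor_comp[OF ev' B] by (simp add: B_def tens_assoc O)
  show "mor c (Unit C) ((X \<odot> X') \<odot> (Y' \<odot> Y))" unfolding c_def
    using mor_comp[OF A coev] by (simp add: A_def tens_assoc O)
  let ?I = "Ident C (X \<odot> X')"
  have I: "mor ?I (X \<odot> X') (X \<odot> X')" by (intro mor_ident O)
  have s1: "?I \<boxtimes> e = (?I \<boxtimes> ev') \<cdot> (?I \<boxtimes> B)"
    using inter[OF I I ev' B] lid[OF I] by (simp add: e_def B_def)
  have s2: "c \<boxtimes> ?I = (A \<boxtimes> ?I) \<cdot> (coev \<boxtimes> ?I)"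
    using inter[OF A coev I I] lid[OF I] by (simp add: c_def A_def)
  \<comment> \<open>the inner cup and cap sit at different places, so they commute\<close>
  have u: "mor (coev' \<boxtimes> Ident C X') X' (X' \<odot> (Y' \<odot> X'))"
    using mor_tens[OF coev' idm(3)] by (simp add: unit_tens tens_assoc O)
  have v: "mor (ev \<boxtimes> Ident C X') (Y \<odot> (X \<odot> X')) X'"
    using mor_tens[OF ev idm(3)] by (simp add: unit_tens tens_assoc O)
  have L1: "?I \<boxtimes> B = Ident C X \<boxtimes> (Ident C (X' \<odot> Y') \<boxtimes> (ev \<boxtimes> Ident C X'))"
    using tassoc[OF idm(1,3) B] tassoc[OF idm(3,4) v] by (simp add: B_def tens_ident O)
  have L2: "A \<boxtimes> ?I = Ident C X \<boxtimes> (coev' \<boxtimes> Ident C (Y \<odot> (X \<odot> X')))"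
    using tassoc[OF idm(1) mor_tens[OF coev' idm(2)] I] tassoc[OF coev' idm(2) I]
    by (simp add: A_def tens_ident O)
  have w: "mor (coev' \<boxtimes> Ident C (Y \<odot> (X \<odot> X'))) (Y \<odot> (X \<odot> X')) (X' \<odot> (Y' \<odot> (Y \<odot> (X \<odot> X'))))"
    using mor_tens[OF coev' mor_ident[of "Y \<odot> (X \<odot> X')"]] by (simp add: unit_tens tens_assoc O)
  have w': "mor (Ident C (X' \<odot> Y') \<boxtimes> (ev \<boxtimes> Ident C X')) (X' \<odot> (Y' \<odot> (Y \<odot> (X \<odot> X')))) (X' \<odot> (Y' \<odot> X'))"
    using mor_tens[OF mor_ident[of "X' \<odot> Y'"] v] by (simp add: unit_tens tens_assoc O)
  have sl: "(Ident C (X' \<odot> Y') \<boxtimes> (ev \<boxtimes> Ident C X')) \<cdot> (coev' \<boxtimes> Ident C (Y \<odot> (X \<odot> X'))) =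
      (coev' \<boxtimes> Ident C X') \<cdot> (ev \<boxtimes> Ident C X')"
    using tens_right_left[OF coev' v] tens_left_right[OF coev' v] ltid[OF v] by simp
  have M: "(?I \<boxtimes> B) \<cdot> (A \<boxtimes> ?I) =
      (Ident C X \<boxtimes> (coev' \<boxtimes> Ident C X')) \<cdot> (Ident C X \<boxtimes> (ev \<boxtimes> Ident C X'))"
    unfolding L1 L2 using inter[OF idm(1) idm(1) w' w] inter[OF idm(1) idm(1) u v] sl by simp
  have R: "(Ident C X \<boxtimes> (ev \<boxtimes> Ident C X')) \<cdot> (coev \<boxtimes> ?I) = ?I"
  proof -
    have m: "mor (coev \<boxtimes> Ident C X) X (X \<odot> (Y \<odot> X))" "mor (Ident C X \<boxtimes> ev) (X \<odot> (Y \<odot> X)) X"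
      using mor_tens[OF coev idm(1)] mor_tens[OF idm(1) ev]
      by (simp_all add: unit_tens tens_unit tens_assoc O)
    have "(Ident C X \<boxtimes> (ev \<boxtimes> Ident C X')) \<cdot> (coev \<boxtimes> ?I) =
        ((Ident C X \<boxtimes> ev) \<boxtimes> Ident C X') \<cdot> ((coev \<boxtimes> Ident C X) \<boxtimes> Ident C X')"
      using tassoc[OF idm(1) ev idm(3)] tassoc[OF coev idm(1,3)] by (simp add: tens_ident O)
    then show ?thesis using inter[OF m(2,1) idm(3) idm(3)] zz lid[OF idm(3)]
      by (simp add: tens_ident O)
  qed
  have Lft: "(?I \<boxtimes> ev') \<cdot> (Ident C X \<boxtimes> (coev' \<boxtimes> Ident C X')) = ?I"
  proof -
    have m: "mor (Ident C X' \<boxtimes> ev') (X' \<odot> (Y' \<odot> X')) X'"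
      using mor_tens[OF idm(3) ev'] by (simp add: tens_unit tens_assoc O)
    have "?I \<boxtimes> ev' = Ident C X \<boxtimes> (Ident C X' \<boxtimes> ev')"
      using tassoc[OF idm(1,3) ev'] by (simp add: tens_ident O)
    then show ?thesis using inter[OF idm(1) idm(1) m u] zz' lid[OF idm(1)]
      by (simp add: tens_ident O)
  qed
  have m: "mor (?I \<boxtimes> ev') (X \<odot> (X' \<odot> (Y' \<odot> X'))) (X \<odot> X')"
    "mor (?I \<boxtimes> B) (X \<odot> (X' \<odot> (Y' \<odot> (Y \<odot> (X \<odot> X'))))) (X \<odot> (X' \<odot> (Y' \<odot> X')))"
    "mor (A \<boxtimes> ?I) (X \<odot> (Y \<odot> (X \<odot> X'))) (X \<odot> (X' \<odot> (Y' \<odot> (Y \<odot> (X \<odot> X')))))"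
    "mor (coev \<boxtimes> ?I) (X \<odot> X') (X \<odot> (Y \<odot> (X \<odot> X')))"
    "mor (Ident C X \<boxtimes> (coev' \<boxtimes> Ident C X')) (X \<odot> X') (X \<odot> (X' \<odot> (Y' \<odot> X')))"
    "mor (Ident C X \<boxtimes> (ev \<boxtimes> Ident C X')) (X \<odot> (Y \<odot> (X \<odot> X'))) (X \<odot> X')"
    using mor_tens[OF I ev'] mor_tens[OF I B] mor_tens[OF A I] mor_tens[OF coev I]
      mor_tens[OF idm(1) u] mor_tens[OF idm(1) v]
    by (simp_all add: unit_tens tens_unit tens_assoc O)
  have "(?I \<boxtimes> e) \<cdot> (c \<boxtimes> ?I) = (?I \<boxtimes> ev') \<cdot> (((?I \<boxtimes> B) \<cdot> (A \<boxtimes> ?I)) \<cdot> (coev \<boxtimes> ?I))"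
    unfolding s1 s2 using cassoc[OF m(1,2) mor_comp[OF m(3,4)]] cassoc[OF m(2,3,4)] by simp
  also have "\<dots> = (?I \<boxtimes> ev') \<cdot> (Ident C X \<boxtimes> (coev' \<boxtimes> Ident C X'))"
    unfolding M using cassoc[OF m(5,6,4)] R rid[OF m(5)] by simp
  finally show "(?I \<boxtimes> e) \<cdot> (c \<boxtimes> ?I) = ?I" using Lft by simp
qed

lemma zigzag_tens:
  assumes XY: "zigzag X Y ev coev" and XY': "zigzag X' Y' ev' coev'"
    and o: "X \<in> Ob C" "Y \<in> Ob C" "X' \<in> Ob C" "Y' \<in> Ob C"
  shows "\<exists>e c. zigzag (X \<odot> X') (Y' \<odot> Y) e c"
proof -
  interpret rev: strict_tensor_category "rev_cat C" by (rule rev_strict)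
  have ev: "mor ev (Y \<odot> X) (Unit C)" and coev: "mor coev (Unit C) (X \<odot> Y)"
    and ev': "mor ev' (Y' \<odot> X') (Unit C)" and coev': "mor coev' (Unit C) (X' \<odot> Y')"
    using assms by (auto simp: zigzag_def)
  have t: "(Ident C Y' \<boxtimes> ev) \<boxtimes> Ident C X' = Ident C Y' \<boxtimes> (ev \<boxtimes> Ident C X')"
      "(Ident C X \<boxtimes> coev') \<boxtimes> Ident C Y = Ident C X \<boxtimes> (coev' \<boxtimes> Ident C Y)"
    using tassoc[OF mor_ident ev mor_ident] tassoc[OF mor_ident coev' mor_ident] o by auto
  note h = zigzag_tens_half[OF assms]
  have "rev.zigzag Y X ev coev" "rev.zigzag Y' X' ev' coev'" using XY XY' by (simp_all add: rev_zigzag)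
  from rev.zigzag_tens_half(3)[OF this] o
  have "((ev' \<cdot> (Ident C Y' \<boxtimes> (ev \<boxtimes> Ident C X'))) \<boxtimes> Ident C (Y' \<odot> Y)) \<cdot>
      (Ident C (Y' \<odot> Y) \<boxtimes> ((Ident C X \<boxtimes> (coev' \<boxtimes> Ident C Y)) \<cdot> coev)) = Ident C (Y' \<odot> Y)"
    by (simp add: t)
  then show ?thesis unfolding zigzag_def using h by blast
qed

fun pow_ob :: "'o \<Rightarrow> nat \<Rightarrow> 'o" where
  "pow_ob X 0 = Unit C"
| "pow_ob X (Suc n) = X \<odot> pow_ob X n"

lemma pow_ob_in: "X \<in> Ob C \<Longrightarrow> pow_ob X n \<in> Ob C"
  by (induction n) (auto simp: obs)

lemma pow_ob_add: "X \<in> Ob C \<Longrightarrow> pow_ob X m \<odot> pow_ob X n = pow_ob X (m + n)"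
  by (induction m) (auto simp: pow_ob_in tens_assoc unit_tens)

lemma pow_ob_Suc_right: "X \<in> Ob C \<Longrightarrow> pow_ob X n \<odot> X = pow_ob X (Suc n)"
  using pow_ob_add[of X n 1] by (simp add: tens_unit)

lemma zigzag_unit: "zigzag (Unit C) (Unit C) (Ident C (Unit C)) (Ident C (Unit C))"
  using mor_ident[OF unit_ob] by (simp add: zigzag_def unit_tens unit_ob tens_ident lid)

lemma zigzag_pow:
  assumes "zigzag X X ev coev" "X \<in> Ob C"
  shows "\<exists>e c. zigzag (pow_ob X n) (pow_ob X n) e c"
proof (induction n)
  case 0
  then show ?case using zigzag_unit by auto
next
  case (Suc n)
  then obtain e c where "zigzag (pow_ob X n) (pow_ob X n) e c" by blast
  from zigzag_tens[OF assms(1) this] assms(2) show ?case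
    by (simp add: pow_ob_in pow_ob_Suc_right)
qed

definition built_from_powers :: "'o \<Rightarrow> 'o set" where
  "built_from_powers X = {V \<in> Ob C. Ident C V \<in> through (range (pow_ob X)) V V}"

theorem fusion_subcategory_built_from_powers:
  assumes zz: "zigzag X X ev coev" and X: "X \<in> Ob C"
  shows "fusion_subcategory C (built_from_powers X)" "X \<in> built_from_powers X"
proof -
  let ?P = "range (pow_ob X)"
  have P: "?P \<subseteq> Ob C" using X by (auto simp: pow_ob_in)
  have pw: "pow_ob X n \<in> built_from_powers X" for n
    using through_single[OF mor_ident mor_ident, of "pow_ob X n" ?P] X lid[OF mor_ident]
    by (simp add: built_from_powers_def pow_ob_in)
  have cl: "L \<odot> M \<in> ?P" if "L \<in> ?P" "M \<in> ?P" for L M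
    using that by (auto simp: pow_ob_add[OF X])
  show "X \<in> built_from_powers X" using pw[of 1] X by (simp add: tens_unit)
  show "fusion_subcategory C (built_from_powers X)"
    unfolding fusion_subcategory_def
  proof (intro conjI ballI impI)
    show "built_from_powers X \<subseteq> Ob C" by (auto simp: built_from_powers_def)
    show "Unit C \<in> built_from_powers X" using pw[of 0] by simp
  next
    fix V W assume "V \<in> built_from_powers X" "W \<in> built_from_powers X"
    then show "V \<odot> W \<in> built_from_powers X"
      using through_tens[where R = ?P and P = ?P and Q = ?P, of "Ident C V" V V "Ident C W" W W,
          OF _ _ P P _ _ _ _ cl P]
      by (simp add: built_from_powers_def obs tens_ident)
  next
    fix V W U assume VW: "V \<in> built_from_powers X" "W \<in> built_from_powers X" and U: "U \<in> Ob C"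
      and "direct_sum C V W U"
    then obtain i j p r where m: "mor i V U" "mor j W U" "mor p U V" "mor r U W"
      and s: "Add C (i \<cdot> p) (j \<cdot> r) = Ident C U"
      by (auto simp: direct_sum_def mor_def built_from_powers_def)
    have "i \<cdot> (Ident C V \<cdot> p) \<in> through ?P U U"
      using VW by (intro through_comp_left[OF through_comp_right[OF _ P _ m(3)] P U m(1)])
        (simp_all add: built_from_powers_def)
    moreover have "j \<cdot> (Ident C W \<cdot> r) \<in> through ?P U U"
      using VW by (intro through_comp_left[OF through_comp_right[OF _ P _ m(4)] P U m(2)])
        (simp_all add: built_from_powers_def)
    ultimately have "Add C (i \<cdot> p) (j \<cdot> r) \<in> through ?P U U"
      using through_Add P U lid[OF m(3)] lid[OF m(4)] by simp
    then show "U \<in> built_from_powers X" using s U by (simp add: built_from_powers_def)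
  next
    fix U V assume U: "U \<in> Ob C" and V: "V \<in> built_from_powers X" and "direct_summand C U V"
    then obtain i p where m: "mor i U V" "mor p V U" and s: "p \<cdot> i = Ident C U"
      by (auto simp: direct_summand_def mor_def built_from_powers_def)
    have "p \<cdot> (Ident C V \<cdot> i) \<in> through ?P U U"
      using V by (intro through_comp_left[OF through_comp_right[OF _ P _ m(1)] P U m(2)])
        (simp_all add: built_from_powers_def)
    then show "U \<in> built_from_powers X" using s U lid[OF m(1)] by (simp add: built_from_powers_def)
  next
    fix V Y assume V: "V \<in> built_from_powers X" and Y: "Y \<in> Ob C"
      and d: "dual_objects C V Y \<or> dual_objects C Y V"
    from V have V': "V \<in> Ob C" and V'': "Ident C V \<in> through ?P V V"
      by (simp_all add: built_from_powers_def)
    have du: "\<exists>M\<in>?P. \<exists>e c. zigzag L M e c" if "L \<in> ?P" for L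
      using that zigzag_pow[OF zz X] by blast
    have du': "\<exists>M\<in>?P. \<exists>e c. zigzag M L e c" if "L \<in> ?P" for L
      using that zigzag_pow[OF zz X] by blast
    consider e c where "zigzag V Y e c" | e c where "zigzag Y V e c"
      using d dual_objects_zigzag[OF V' Y] dual_objects_zigzag[OF Y V'] by blast
    then have "Ident C Y \<in> through ?P Y Y"
    proof cases
      case 1
      show ?thesis by (rule through_dual[OF 1 V' Y V'' P du])
    next
      case 2
      interpret rev: strict_tensor_category "rev_cat C" by (rule rev_strict)
      have "rev.zigzag V Y e c" using 2 by (simp only: rev_zigzag)
      then have "Ident (rev_cat C) Y \<in> rev.through ?P Y Y"
        by (rule rev.through_dual) (simp_all only: rev_simps rev_through rev_zigzag V' Y V'' P du')
      then show ?thesis by (simp only: rev_through rev_simps)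
    qed
    then show "Y \<in> built_from_powers X" using Y by (simp add: built_from_powers_def)
  qed
qed

end

section \<open>Full subcategories and quotients\<close>

lemma full_subcat_simps [simp]:
  "Ob (full_subcat C S) = S" "Hom (full_subcat C S) = Hom C" "Ident (full_subcat C S) = Ident C"
  "Comp (full_subcat C S) = Comp C" "Zero (full_subcat C S) = Zero C" "Add (full_subcat C S) = Add C"
  "Scale (full_subcat C S) = Scale C" "TensO (full_subcat C S) = TensO C" "TensM (full_subcat C S) = TensM C"
  "Unit (full_subcat C S) = Unit C" "LUnit (full_subcat C S) = LUnit C" "RUnit (full_subcat C S) = RUnit C"
  "Assoc (full_subcat C S) = Assoc C"
  by (simp_all add: full_subcat_def)

lemma (in strict_tensor_category) full_subcat_strict:
  assumes "S \<subseteq> Ob C" "Unit C \<in> S" "\<And>X Y. X \<in> S \<Longrightarrow> Y \<in> S \<Longrightarrow> X \<odot> Y \<in> S"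
  shows "strict_tensor_category (full_subcat C S)"
proof -
  have S: "X \<in> S \<Longrightarrow> X \<in> Ob C" for X using assms by auto
  show ?thesis
    by (rule strict_tensor_category.intro; unfold full_subcat_simps)
     ((rule assms(2)),
      (rule assms(3); assumption),
      (rule tens_assoc; (assumption | rule S, assumption)),
      (rule unit_tens; (assumption | rule S, assumption)),
      (rule tens_unit; (assumption | rule S, assumption)),
      (rule ident_hom; (assumption | rule S, assumption)),
      (rule comp_hom; (assumption | rule S, assumption)),
      (rule zero_hom; (assumption | rule S, assumption)),
      (rule add_hom; (assumption | rule S, assumption)),
      (rule scale_hom; (assumption | rule S, assumption)),
      (rule tens_hom; (assumption | rule S, assumption)),
      (rule ident_comp; (assumption | rule S, assumption)),
      (rule comp_ident; (assumption | rule S, assumption)),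
      (rule comp_assoc; (assumption | rule S, assumption)),
      (rule add_assoc; (assumption | rule S, assumption)),
      (rule add_comm; (assumption | rule S, assumption)),
      (rule add_zero; (assumption | rule S, assumption)),
      (rule scale_one; (assumption | rule S, assumption)),
      (rule scale_scale; (assumption | rule S, assumption)),
      (rule scale_zero; (assumption | rule S, assumption)),
      (rule scale_sum; (assumption | rule S, assumption)),
      (rule scale_add; (assumption | rule S, assumption)),
      (rule comp_add; (assumption | rule S, assumption)),
      (rule add_comp; (assumption | rule S, assumption)),
      (rule comp_scale; (assumption | rule S, assumption)),
      (rule scale_comp; (assumption | rule S, assumption)),
      (rule tens_add; (assumption | rule S, assumption)),
      (rule add_tens; (assumption | rule S, assumption)),
      (rule tens_scale; (assumption | rule S, assumption)),
      (rule scale_tens; (assumption | rule S, assumption)),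
      (rule interchange; (assumption | rule S, assumption)),
      (rule tens_ident; (assumption | rule S, assumption)),
      (rule tens_mor_assoc; (assumption | rule S, assumption)),
      (rule ident_unit_tens; (assumption | rule S, assumption)),
      (rule tens_ident_unit; (assumption | rule S, assumption)),
      (rule assoc_strict; (assumption | rule S, assumption)),
      (rule lunit_strict; (assumption | rule S, assumption)),
      (rule runit_strict; (assumption | rule S, assumption)))
qed

text \<open>An equivalence relation on each hom set that is compatible with all operations.\<close>

locale tensor_congruence = strict_tensor_category C for C :: "('o, 'm, 'k::field) lincat" (structure) +
  fixes R :: "'m rel"
  assumes R_hom: "(f, g) \<in> R \<Longrightarrow> f \<in> Hom C X Y \<Longrightarrow> g \<in> Hom C X Y"
    and R_refl: "mor f X Y \<Longrightarrow> (f, f) \<in> R"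
    and R_sym: "sym R" and R_trans: "trans R"
    and R_comp: "mor f X Y \<Longrightarrow> mor g Y Z \<Longrightarrow> (f, f') \<in> R \<Longrightarrow> (g, g') \<in> R \<Longrightarrow> (g \<cdot> f, g' \<cdot> f') \<in> R"
    and R_add: "mor f X Y \<Longrightarrow> mor g X Y \<Longrightarrow> (f, f') \<in> R \<Longrightarrow> (g, g') \<in> R \<Longrightarrow> (Add C f g, Add C f' g') \<in> R"
    and R_scale: "mor f X Y \<Longrightarrow> (f, f') \<in> R \<Longrightarrow> (Scale C a f, Scale C a f') \<in> R"
    and R_tens: "mor f X Y \<Longrightarrow> mor g X' Y' \<Longrightarrow> (f, f') \<in> R \<Longrightarrow> (g, g') \<in> R \<Longrightarrow> (f \<boxtimes> g, f' \<boxtimes> g') \<in> R"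
begin

definition cls :: "'m \<Rightarrow> 'm set" where "cls f = R `` {f}"

abbreviation "Q \<equiv> quotient_cat C R"

lemma cls_eq_iff: "mor f X Y \<Longrightarrow> mor g X Y \<Longrightarrow> cls f = cls g \<longleftrightarrow> (f, g) \<in> R"
  unfolding cls_def using R_refl R_sym R_trans
  by (auto dest: symD transD)

lemma Q_simps [simp]: "Ob Q = Ob C" "Ident Q X = cls (Ident C X)" "Zero Q X Y = cls (Zero C X Y)"
  "TensO Q = TensO C" "Unit Q = Unit C" "Assoc Q X Y Z = cls (Assoc C X Y Z)"
  "LUnit Q X = cls (LUnit C X)" "RUnit Q X = cls (RUnit C X)"
  by (simp_all add: quotient_cat_def cls_def)

lemma Q_hom: "X \<in> Ob C \<Longrightarrow> Y \<in> Ob C \<Longrightarrow> F \<in> Hom Q X Y \<longleftrightarrow> (\<exists>f. mor f X Y \<and> F = cls f)"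
  by (auto simp: quotient_cat_def quotient_def cls_def mor_def)

lemma Q_homE: "F \<in> Hom Q X Y \<Longrightarrow> X \<in> Ob C \<Longrightarrow> Y \<in> Ob C \<Longrightarrow> (\<And>f. mor f X Y \<Longrightarrow> F = cls f \<Longrightarrow> P) \<Longrightarrow> P"
  using Q_hom by blast

lemma cls_hom: "mor f X Y \<Longrightarrow> cls f \<in> Hom Q X Y"
  using Q_hom[OF morD(1) morD(2)] by blast

lemma cls_op2:
  assumes "\<And>f' g'. (f, f') \<in> R \<Longrightarrow> (g, g') \<in> R \<Longrightarrow> (op f g, op f' g') \<in> R" "(f, f) \<in> R" "(g, g) \<in> R"
  shows "R `` {op f' g' | f' g'. f' \<in> cls f \<and> g' \<in> cls g} = cls (op f g)"
proof (rule equalityI; rule subsetI)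
  fix x assume "x \<in> R `` {op f' g' | f' g'. f' \<in> cls f \<and> g' \<in> cls g}"
  then obtain f' g' where "(f, f') \<in> R" "(g, g') \<in> R" "(op f' g', x) \<in> R" by (auto simp: cls_def)
  then show "x \<in> cls (op f g)" using assms(1)[of f' g'] transD[OF R_trans] by (auto simp: cls_def)
next
  fix x assume "x \<in> cls (op f g)"
  then show "x \<in> R `` {op f' g' | f' g'. f' \<in> cls f \<and> g' \<in> cls g}"
    using assms(2,3) by (auto simp: cls_def)
qed

lemma cls_comp: "mor g Y Z \<Longrightarrow> mor f X Y \<Longrightarrow> cls g \<cdot>\<^bsub>Q\<^esub> cls f = cls (g \<cdot> f)"
  using cls_op2[of g f "\<lambda>g f. g \<cdot> f"] by (simp add: quotient_cat_def R_comp R_refl)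

lemma cls_add: "mor f X Y \<Longrightarrow> mor g X Y \<Longrightarrow> Add Q (cls f) (cls g) = cls (Add C f g)"
  using cls_op2[of f g "Add C"] by (simp add: quotient_cat_def R_add R_refl)

lemma cls_tens: "mor f X Y \<Longrightarrow> mor g X' Y' \<Longrightarrow> cls f \<boxtimes>\<^bsub>Q\<^esub> cls g = cls (f \<boxtimes> g)"
  using cls_op2[of f g "\<lambda>f g. f \<boxtimes> g"] by (simp add: quotient_cat_def R_tens R_refl)

lemma cls_scale: "mor f X Y \<Longrightarrow> Scale Q a (cls f) = cls (Scale C a f)"
  using cls_op2[of f f "\<lambda>f _. Scale C a f"] R_refl[of f X Y]
  by (auto simp: quotient_cat_def R_scale cls_def)

lemma quotient_strict: "strict_tensor_category Q"
proof -
  note hom = cls_hom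
  have 1: "(cls h \<cdot>\<^bsub>Q\<^esub> cls g) \<cdot>\<^bsub>Q\<^esub> cls f = cls h \<cdot>\<^bsub>Q\<^esub> (cls g \<cdot>\<^bsub>Q\<^esub> cls f)"
    if m: "mor f X Y" "mor g Y Z" "mor h Z W" for f g h X Y Z W
    using cls_comp[OF m(3,2)] cls_comp[OF m(2,1)] cls_comp[OF mor_comp[OF m(3,2)] m(1)]
      cls_comp[OF m(3) mor_comp[OF m(2,1)]] cassoc[OF m(3,2,1)] by simp
  have 2: "cls g \<cdot>\<^bsub>Q\<^esub> Add Q (cls f) (cls f') = Add Q (cls g \<cdot>\<^bsub>Q\<^esub> cls f) (cls g \<cdot>\<^bsub>Q\<^esub> cls f')"
    if m: "mor f X Y" "mor f' X Y" "mor g Y Z" for f f' g X Y Z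
    using cls_add[OF m(1,2)] cls_comp[OF m(3,1)] cls_comp[OF m(3,2)] cadd[OF m(3,1,2)]
      cls_comp[OF m(3) mor_add[OF m(1,2)]] cls_add[OF mor_comp[OF m(3,1)] mor_comp[OF m(3,2)]] by simp
  have 3: "Add Q (cls g) (cls g') \<cdot>\<^bsub>Q\<^esub> cls f = Add Q (cls g \<cdot>\<^bsub>Q\<^esub> cls f) (cls g' \<cdot>\<^bsub>Q\<^esub> cls f)"
    if m: "mor f X Y" "mor g Y Z" "mor g' Y Z" for f g g' X Y Z
    using cls_add[OF m(2,3)] cls_comp[OF m(2,1)] cls_comp[OF m(3,1)] addc[OF m(2,3,1)]
      cls_comp[OF mor_add[OF m(2,3)] m(1)] cls_add[OF mor_comp[OF m(2,1)] mor_comp[OF m(3,1)]] by simp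
  have 4: "cls g \<cdot>\<^bsub>Q\<^esub> Scale Q a (cls f) = Scale Q a (cls g \<cdot>\<^bsub>Q\<^esub> cls f)"
    "Scale Q a (cls g) \<cdot>\<^bsub>Q\<^esub> cls f = Scale Q a (cls g \<cdot>\<^bsub>Q\<^esub> cls f)"
    if m: "mor f X Y" "mor g Y Z" for f g a X Y Z
    using cls_scale[OF m(1)] cls_scale[OF m(2)] cls_comp[OF m(2,1)] cls_comp[OF m(2) mor_scale[OF m(1)]]
      cls_comp[OF mor_scale[OF m(2)] m(1)] cls_scale[OF mor_comp[OF m(2,1)]] cscale[OF m(2,1)]
      scalec[OF m(2,1)] by simp_all
  have 5: "cls f \<boxtimes>\<^bsub>Q\<^esub> Add Q (cls g) (cls g') = Add Q (cls f \<boxtimes>\<^bsub>Q\<^esub> cls g) (cls f \<boxtimes>\<^bsub>Q\<^esub> cls g')"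
    "Add Q (cls g) (cls g') \<boxtimes>\<^bsub>Q\<^esub> cls f = Add Q (cls g \<boxtimes>\<^bsub>Q\<^esub> cls f) (cls g' \<boxtimes>\<^bsub>Q\<^esub> cls f)"
    if m: "mor f X Y" "mor g X' Y'" "mor g' X' Y'" for f g g' X Y X' Y'
    using cls_add[OF m(2,3)] cls_tens[OF m(1,2)] cls_tens[OF m(1,3)] cls_tens[OF m(2,1)] cls_tens[OF m(3,1)]
      cls_tens[OF mor_add[OF m(2,3)] m(1)] cls_tens[OF m(1) mor_add[OF m(2,3)]]
      cls_add[OF mor_tens[OF m(1,2)] mor_tens[OF m(1,3)]] cls_add[OF mor_tens[OF m(2,1)] mor_tens[OF m(3,1)]]
      tadd[OF m] addt[OF m(2,3,1)] by simp_all
  have 6: "cls f \<boxtimes>\<^bsub>Q\<^esub> Scale Q a (cls g) = Scale Q a (cls f \<boxtimes>\<^bsub>Q\<^esub> cls g)"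
    "Scale Q a (cls f) \<boxtimes>\<^bsub>Q\<^esub> cls g = Scale Q a (cls f \<boxtimes>\<^bsub>Q\<^esub> cls g)"
    if m: "mor f X Y" "mor g X' Y'" for f g a X Y X' Y'
    using cls_scale[OF m(1)] cls_scale[OF m(2)] cls_tens[OF m] cls_tens[OF m(1) mor_scale[OF m(2)]]
      cls_tens[OF mor_scale[OF m(1)] m(2)] cls_scale[OF mor_tens[OF m]] tscale[OF m] scalet[OF m]
    by simp_all
  have 7: "(cls g \<boxtimes>\<^bsub>Q\<^esub> cls g') \<cdot>\<^bsub>Q\<^esub> (cls f \<boxtimes>\<^bsub>Q\<^esub> cls f') = (cls g \<cdot>\<^bsub>Q\<^esub> cls f) \<boxtimes>\<^bsub>Q\<^esub> (cls g' \<cdot>\<^bsub>Q\<^esub> cls f')"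
    if m: "mor f X Y" "mor g Y Z" "mor f' X' Y'" "mor g' Y' Z'" for f g f' g' X Y Z X' Y' Z'
    using cls_tens[OF m(2,4)] cls_tens[OF m(1,3)] cls_comp[OF m(2,1)] cls_comp[OF m(4,3)]
      cls_comp[OF mor_tens[OF m(2,4)] mor_tens[OF m(1,3)]] inter[OF m(2,1,4,3)]
      cls_tens[OF mor_comp[OF m(2,1)] mor_comp[OF m(4,3)]] by simp
  have 8: "(cls f \<boxtimes>\<^bsub>Q\<^esub> cls f') \<boxtimes>\<^bsub>Q\<^esub> cls f'' = cls f \<boxtimes>\<^bsub>Q\<^esub> (cls f' \<boxtimes>\<^bsub>Q\<^esub> cls f'')"
    if m: "mor f X Y" "mor f' X' Y'" "mor f'' X'' Y''" for f f' f'' X Y X' Y' X'' Y''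
    using cls_tens[OF m(1,2)] cls_tens[OF m(2,3)] cls_tens[OF mor_tens[OF m(1,2)] m(3)]
      cls_tens[OF m(1) mor_tens[OF m(2,3)]] tassoc[OF m] by simp
  have 9: "Add Q (Add Q (cls f) (cls g)) (cls h) = Add Q (cls f) (Add Q (cls g) (cls h))"
    "Add Q (cls f) (cls g) = Add Q (cls g) (cls f)"
    "Scale Q a (Add Q (cls f) (cls g)) = Add Q (Scale Q a (cls f)) (Scale Q a (cls g))"
    if m: "mor f X Y" "mor g X Y" "mor h X Y" for f g h X Y a
    using cls_add[OF m(1,2)] cls_add[OF m(2,1)] cls_add[OF m(2,3)] cls_add[OF mor_add[OF m(1,2)] m(3)]
      cls_add[OF m(1) mor_add[OF m(2,3)]] add_assoc[of X Y f g h] add_comm[of X Y f g] m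
      cls_scale[OF mor_add[OF m(1,2)]] cls_scale[OF m(1)] cls_scale[OF m(2)]
      cls_add[OF mor_scale[OF m(1)] mor_scale[OF m(2)]] scale_add[of X Y f g a]
    by (simp_all add: mor_def)
  have 10: "Add Q (cls f) (cls (Zero C X Y)) = cls f" "Scale Q 1 (cls f) = cls f"
    "Scale Q 0 (cls f) = cls (Zero C X Y)" "Scale Q a (Scale Q b (cls f)) = Scale Q (a * b) (cls f)"
    "Scale Q (a + b) (cls f) = Add Q (Scale Q a (cls f)) (Scale Q b (cls f))"
    "cls (Ident C Y) \<cdot>\<^bsub>Q\<^esub> cls f = cls f" "cls f \<cdot>\<^bsub>Q\<^esub> cls (Ident C X) = cls f"
    "cls (Ident C (Unit C)) \<boxtimes>\<^bsub>Q\<^esub> cls f = cls f" "cls f \<boxtimes>\<^bsub>Q\<^esub> cls (Ident C (Unit C)) = cls f"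
    if m: "mor f X Y" for f X Y a b
    using cls_add[OF m mor_zero] cls_scale[OF m] cls_scale[OF mor_scale[OF m]]
      cls_add[OF mor_scale[OF m] mor_scale[OF m]] addz[OF m] scale0[OF m] scale1[OF m] scalescale[OF m]
      cls_comp[OF mor_ident m] cls_comp[OF m mor_ident] cls_tens[OF mor_ident m] cls_tens[OF m mor_ident]
      lid[OF m] rid[OF m] ltid[OF m] rtid[OF m] scale_sum[of X Y f a b] m unit_ob
    by (simp_all add: mor_def)
  have 11: "cls (Ident C X) \<boxtimes>\<^bsub>Q\<^esub> cls (Ident C Y) = cls (Ident C (X \<odot> Y))"
    if "X \<in> Ob C" "Y \<in> Ob C" for X Y
    using cls_tens[OF mor_ident mor_ident] that by (simp add: tens_ident)
  have 12: "cls g \<cdot>\<^bsub>Q\<^esub> cls f \<in> Hom Q X Z" if "mor f X Y" "mor g Y Z" for f g X Y Z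
    using cls_comp[OF that(2,1)] hom[OF mor_comp[OF that(2,1)]] by simp
  have 13: "Add Q (cls f) (cls g) \<in> Hom Q X Y" if "mor f X Y" "mor g X Y" for f g X Y
    using cls_add[OF that] hom[OF mor_add[OF that]] by simp
  have 14: "Scale Q a (cls f) \<in> Hom Q X Y" if "mor f X Y" for f a X Y
    using cls_scale[OF that] hom[OF mor_scale[OF that]] by simp
  have 15: "cls f \<boxtimes>\<^bsub>Q\<^esub> cls g \<in> Hom Q (X \<odot> X') (Y \<odot> Y')" if "mor f X Y" "mor g X' Y'" for f g X Y X' Y'
    using cls_tens[OF that] hom[OF mor_tens[OF that]] by simp
  show ?thesis
    by (rule strict_tensor_category.intro; unfold Q_simps)
     (((rule unit_ob; assumption?)),
      ((rule tens_ob; assumption?)),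
      ((rule tens_assoc; assumption?)),
      ((rule unit_tens; assumption?)),
      ((rule tens_unit; assumption?)),
      ((rule hom[OF mor_ident]; assumption?)),
      (((erule Q_homE, assumption, assumption, hypsubst)+), (rule 12; assumption?)),
      ((rule hom[OF mor_zero]; assumption?)),
      (((erule Q_homE, assumption, assumption, hypsubst)+), (rule 13; assumption?)),
      (((erule Q_homE, assumption, assumption, hypsubst)+), (rule 14; assumption?)),
      (((erule Q_homE, assumption, assumption, hypsubst)+), (rule 15; assumption?)),
      (((erule Q_homE, assumption, assumption, hypsubst)+), (rule 10(6); assumption?)),
      (((erule Q_homE, assumption, assumption, hypsubst)+), (rule 10(7); assumption?)),
      (((erule Q_homE, assumption, assumption, hypsubst)+), (rule 1; assumption?)),
      (((erule Q_homE, assumption, assumption, hypsubst)+), (rule 9(1); assumption?)),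
      (((erule Q_homE, assumption, assumption, hypsubst)+), (rule 9(2); assumption?)),
      (((erule Q_homE, assumption, assumption, hypsubst)+), (rule 10(1); assumption?)),
      (((erule Q_homE, assumption, assumption, hypsubst)+), (rule 10(2); assumption?)),
      (((erule Q_homE, assumption, assumption, hypsubst)+), (rule 10(4); assumption?)),
      (((erule Q_homE, assumption, assumption, hypsubst)+), (rule 10(3); assumption?)),
      (((erule Q_homE, assumption, assumption, hypsubst)+), (rule 10(5); assumption?)),
      (((erule Q_homE, assumption, assumption, hypsubst)+), (rule 9(3); assumption?)),
      (((erule Q_homE, assumption, assumption, hypsubst)+), (rule 2; assumption?)),
      (((erule Q_homE, assumption, assumption, hypsubst)+), (rule 3; assumption?)),
      (((erule Q_homE, assumption, assumption, hypsubst)+), (rule 4(1); assumption?)),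
      (((erule Q_homE, assumption, assumption, hypsubst)+), (rule 4(2); assumption?)),
      (((erule Q_homE, assumption, assumption, hypsubst)+), (rule 5(1); assumption?)),
      (((erule Q_homE, assumption, assumption, hypsubst)+), (rule 5(2); assumption?)),
      (((erule Q_homE, assumption, assumption, hypsubst)+), (rule 6(1); assumption?)),
      (((erule Q_homE, assumption, assumption, hypsubst)+), (rule 6(2); assumption?)),
      (((erule Q_homE, assumption, assumption, hypsubst)+), (rule 7; assumption?)),
      ((rule 11; assumption?)),
      (((erule Q_homE, assumption, assumption, hypsubst)+), (rule 8; assumption?)),
      (((erule Q_homE, assumption, assumption, hypsubst)+), (rule 10(8); assumption?)),
      (((erule Q_homE, assumption, assumption, hypsubst)+), (rule 10(9); assumption?)),
      ((rule arg_cong[where f = cls, OF assoc_strict]; assumption?)),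
      ((rule arg_cong[where f = cls, OF lunit_strict]; assumption?)),
      ((rule arg_cong[where f = cls, OF runit_strict]; assumption?)))
qed

lemma quotient_through:
  assumes "f \<in> through P X Y" "P \<subseteq> Ob C" "X \<in> Ob C" "Y \<in> Ob C"
  shows "cls f \<in> strict_tensor_category.through Q P X Y"
proof -
  interpret Q: strict_tensor_category Q by (rule quotient_strict)
  from assms show ?thesis
  proof (induction rule: through.induct)
    case through_zero
    then show ?case using Q.through_zero[of X Y P] by simp
  next
    case (through_add f L p i)
    then have m: "mor p X L" "mor i L Y" "mor f X Y"
      using mor_through by (auto simp: mor_def)
    have "Add Q (cls i \<cdot>\<^bsub>Q\<^esub> cls p) (cls f) \<in> Q.through P X Y"
      using through_add m by (intro Q.through_add cls_hom)
    then show ?case using cls_comp[OF m(2,1)] cls_add[OF mor_comp[OF m(2,1)] m(3)] by simp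
  qed
qed

end

section \<open>Graded objects as lists\<close>

lemma comprehension_product:
  "concat (map (\<lambda>x. map (f x) ys) xs) = map (\<lambda>(x, y). f x y) (List.product xs ys)"
  by (induction xs) auto

lemma pair_index_less: "(k::nat) < a \<Longrightarrow> l < b \<Longrightarrow> k * b + l < a * b"
proof -
  assume "k < a" "l < b"
  then have "k * b + l < k * b + b" by simp
  also have "\<dots> = Suc k * b" by simp
  also have "\<dots> \<le> a * b" using \<open>k < a\<close> by (intro mult_right_mono) auto
  finally show ?thesis .
qed

lemma pair_index_div: "l < b \<Longrightarrow> (k * b + l) div b = (k::nat)" "l < b \<Longrightarrow> (k * b + l) mod b = l"
  by (simp_all add: mult.commute[of k])

lemma div_mod_less: "i < a * b \<Longrightarrow> i div b < a \<and> i mod b < (b::nat)"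
  by (cases "b = 0") (auto simp: less_mult_imp_div_less)

context strict_tensor_category
begin

abbreviation msum :: "'o \<Rightarrow> 'o \<Rightarrow> 'm list \<Rightarrow> 'm" where
  "msum X Y fs \<equiv> foldr (Add C) fs (Zero C X Y)"

lemma mor_msum: "(\<And>f. f \<in> set fs \<Longrightarrow> mor f X Y) \<Longrightarrow> X \<in> Ob C \<Longrightarrow> Y \<in> Ob C \<Longrightarrow> mor (msum X Y fs) X Y"
  by (induction fs) (simp_all add: mor_zero mor_add)

lemma comp_msum:
  assumes "mor g Y Z" "X \<in> Ob C"
  shows "(\<And>f. f \<in> set fs \<Longrightarrow> mor f X Y) \<Longrightarrow> g \<cdot> msum X Y fs = msum X Z (map (\<lambda>f. g \<cdot> f) fs)"
proof (induction fs)
  case Nil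
  then show ?case using comp_zero[OF assms] by simp
next
  case (Cons f fs)
  have "mor (msum X Y fs) X Y" using Cons.prems assms by (intro mor_msum) (auto simp: mor_def)
  then show ?case using Cons cadd[OF assms(1), of f X "msum X Y fs"] by simp
qed

lemma scale_msum:
  assumes "X \<in> Ob C" "Y \<in> Ob C"
  shows "(\<And>f. f \<in> set fs \<Longrightarrow> mor f X Y) \<Longrightarrow> Scale C a (msum X Y fs) = msum X Y (map (Scale C a) fs)"
proof (induction fs)
  case Nil
  then show ?case using scale_Zero[OF assms] by simp
next
  case (Cons f fs)
  have "mor (msum X Y fs) X Y" using Cons.prems assms by (intro mor_msum) auto
  then show ?case using Cons scale_add[of X Y f "msum X Y fs" a] by (simp add: mor_def)
qed

lemma msum_zero: "X \<in> Ob C \<Longrightarrow> Y \<in> Ob C \<Longrightarrow> (\<And>f. f \<in> set fs \<Longrightarrow> f = Zero C X Y) \<Longrightarrow> msum X Y fs = Zero C X Y"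
proof (induction fs)
  case (Cons f fs)
  then have "f = Zero C X Y" "msum X Y fs = Zero C X Y" by auto
  then show ?case using zero_add[OF mor_zero[OF Cons.prems(1,2)]] by simp
qed simp

lemma msum_single:
  assumes l: "l < N" and m: "mor (f l) X Y" and z: "\<And>m. m < N \<Longrightarrow> m \<noteq> l \<Longrightarrow> f m = Zero C X Y"
  shows "msum X Y (map f [0..<N]) = f l"
proof -
  have ob: "X \<in> Ob C" "Y \<in> Ob C" using m by (auto simp: mor_def)
  have "[0..<N] = [0..<l] @ l # [Suc l..<N]"
    using l upt_add_eq_append[of 0 l "N - l"] by (simp add: upt_conv_Cons)
  moreover have "msum X Y (map f [Suc l..<N]) = Zero C X Y"
    by (rule msum_zero[OF ob]) (use z in auto)
  moreover have "foldr (Add C) (map f [0..<l]) (f l) = f l"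
  proof -
    have "(\<And>g. g \<in> set gs \<Longrightarrow> g = Zero C X Y) \<Longrightarrow> foldr (Add C) gs (f l) = f l" for gs
    proof (induction gs)
      case (Cons g gs)
      then have "g = Zero C X Y" "foldr (Add C) gs (f l) = f l" by auto
      then show ?case using zero_add[OF m] by simp
    qed simp
    from this[of "map f [0..<l]"] show ?thesis using z l by fastforce
  qed
  ultimately show ?thesis by (simp add: addz[OF m])
qed

definition gobs :: "nat \<Rightarrow> 'o graded set" where
  "gobs n = {xs. set xs \<subseteq> Ob C \<times> {0..<n}}"

definition entry :: "('o graded, 'm mat) arrow \<Rightarrow> nat \<Rightarrow> nat \<Rightarrow> 'm" where
  "entry f i j = body f $$ (i, j)"

abbreviation obj :: "'o graded \<Rightarrow> nat \<Rightarrow> 'o" where "obj xs i \<equiv> fst (xs ! i)"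
abbreviation deg :: "'o graded \<Rightarrow> nat \<Rightarrow> nat" where "deg xs i \<equiv> snd (xs ! i)"

lemma gobs_nth: "xs \<in> gobs n \<Longrightarrow> i < length xs \<Longrightarrow> obj xs i \<in> Ob C \<and> deg xs i < n"
  unfolding gobs_def using nth_mem[of i xs] subsetD[of "set xs" "Ob C \<times> {0..<n}" "xs ! i"]
  by (simp add: mem_Times_iff)

lemma gobsI: "(\<And>i. i < length xs \<Longrightarrow> obj xs i \<in> Ob C \<and> deg xs i < n) \<Longrightarrow> xs \<in> gobs n"
  unfolding gobs_def by (auto simp: in_set_conv_nth) (metis fst_conv, metis snd_conv)

lemma gh_arr: "f \<in> graded_hom C xs ys \<Longrightarrow> f = Arr xs ys (body f) \<and> src f = xs \<and> tgt f = ys \<and>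
    dim_row (body f) = length ys \<and> dim_col (body f) = length xs"
  by (auto simp: graded_hom_def)

lemma gh_entry:
  assumes "f \<in> graded_hom C xs ys" "xs \<in> gobs n" "ys \<in> gobs n" "i < length ys" "j < length xs"
  shows "mor (entry f i j) (obj xs j) (obj ys i)"
    and "deg xs j \<noteq> deg ys i \<Longrightarrow> entry f i j = Zero C (obj xs j) (obj ys i)"
proof -
  have e: "if deg xs j = deg ys i then entry f i j \<in> Hom C (obj xs j) (obj ys i)
        else entry f i j = Zero C (obj xs j) (obj ys i)"
    using assms(1,4,5) by (auto simp: graded_hom_def entry_def)
  then show "deg xs j \<noteq> deg ys i \<Longrightarrow> entry f i j = Zero C (obj xs j) (obj ys i)" by simp
  show "mor (entry f i j) (obj xs j) (obj ys i)"
    using e gobs_nth[OF assms(2,5)] gobs_nth[OF assms(3,4)] by (auto simp: mor_def zero_hom split: if_splits)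
qed

lemma gh_mat:
  assumes "\<And>i j. i < length ys \<Longrightarrow> j < length xs \<Longrightarrow> deg xs j = deg ys i \<Longrightarrow>
      mor (F i j) (obj xs j) (obj ys i)"
    and "\<And>i j. i < length ys \<Longrightarrow> j < length xs \<Longrightarrow> deg xs j \<noteq> deg ys i \<Longrightarrow>
      F i j = Zero C (obj xs j) (obj ys i)"
  shows "Arr xs ys (mat (length ys) (length xs) (\<lambda>(i, j). F i j)) \<in> graded_hom C xs ys"
  unfolding graded_hom_def using assms by (auto simp: mor_def)

lemma gh_eqI:
  assumes "f \<in> graded_hom C xs ys" "g \<in> graded_hom C xs ys"
    "\<And>i j. i < length ys \<Longrightarrow> j < length xs \<Longrightarrow> entry f i j = entry g i j"
  shows "f = g"
proof -
  have "body f = body g"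
    using gh_arr[OF assms(1)] gh_arr[OF assms(2)] assms(3) by (intro eq_matI) (auto simp: entry_def)
  then show ?thesis using gh_arr[OF assms(1)] gh_arr[OF assms(2)] by metis
qed

definition gid :: "'o graded \<Rightarrow> ('o graded, 'm mat) arrow" where
  "gid xs = graded_diag C xs xs (map (\<lambda>(X, g). Ident C X) xs)"

lemma gid_entry: "i < length xs \<Longrightarrow> j < length xs \<Longrightarrow>
    entry (gid xs) i j = (if i = j then Ident C (obj xs i) else Zero C (obj xs j) (obj xs i))"
  by (simp add: gid_def graded_diag_def entry_def split_beta)

lemma gid_hom: "xs \<in> gobs n \<Longrightarrow> gid xs \<in> graded_hom C xs xs"
proof -
  assume xs: "xs \<in> gobs n"
  have "gid xs = Arr xs xs (mat (length xs) (length xs)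
      (\<lambda>(i, j). if i = j then Ident C (obj xs i) else Zero C (obj xs j) (obj xs i)))"
    unfolding gid_def graded_diag_def by (auto intro!: eq_matI simp: split_beta)
  moreover have "\<dots> \<in> graded_hom C xs xs"
  proof (rule gh_mat)
    fix i j assume ij: "i < length xs" "j < length xs"
    have o: "obj xs i \<in> Ob C" "obj xs j \<in> Ob C" using gobs_nth[OF xs] ij by blast+
    show "mor (if i = j then Ident C (obj xs i) else Zero C (obj xs j) (obj xs i)) (obj xs j) (obj xs i)"
      using mor_ident[OF o(1)] mor_zero[OF o(2,1)] by (cases "i = j") simp_all
    show "deg xs j \<noteq> deg xs i \<Longrightarrow> (if i = j then Ident C (obj xs i) else Zero C (obj xs j) (obj xs i)) =
        Zero C (obj xs j) (obj xs i)" by (cases "i = j") simp_all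
  qed
  ultimately show ?thesis by simp
qed

lemma gcomp_arr: "graded_comp C g f = Arr (src f) (tgt g) (body (graded_comp C g f))"
  "dim_row (body (graded_comp C g f)) = length (tgt g)" "dim_col (body (graded_comp C g f)) = length (src f)"
  by (simp_all add: graded_comp_def)

lemma gcomp_entry:
  assumes "f \<in> graded_hom C xs ys" "g \<in> graded_hom C ys zs" "i < length zs" "j < length xs"
  shows "entry (graded_comp C g f) i j =
    msum (obj xs j) (obj zs i) (map (\<lambda>l. entry g i l \<cdot> entry f l j) [0..<length ys])"
  using assms gh_arr[OF assms(1)] gh_arr[OF assms(2)] by (simp add: graded_comp_def entry_def)

lemma gcomp_terms:
  assumes "f \<in> graded_hom C xs ys" "g \<in> graded_hom C ys zs" "xs \<in> gobs n" "ys \<in> gobs n" "zs \<in> gobs n"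
    "i < length zs" "j < length xs" "l < length ys"
  shows "mor (entry g i l \<cdot> entry f l j) (obj xs j) (obj zs i)"
    and "deg xs j \<noteq> deg ys l \<or> deg ys l \<noteq> deg zs i \<Longrightarrow>
      entry g i l \<cdot> entry f l j = Zero C (obj xs j) (obj zs i)"
proof -
  note f = gh_entry[OF assms(1,3,4,8,7)] and g = gh_entry[OF assms(2,4,5,6,8)]
  show "mor (entry g i l \<cdot> entry f l j) (obj xs j) (obj zs i)" by (rule mor_comp[OF g(1) f(1)])
  show "deg xs j \<noteq> deg ys l \<or> deg ys l \<noteq> deg zs i \<Longrightarrow>
      entry g i l \<cdot> entry f l j = Zero C (obj xs j) (obj zs i)"
    using f(2) g(2) comp_zero[OF g(1) morD(1)[OF f(1)]] zero_comp[OF f(1) morD(2)[OF g(1)]] by auto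
qed

lemma gcomp_hom:
  assumes "f \<in> graded_hom C xs ys" "g \<in> graded_hom C ys zs" "xs \<in> gobs n" "ys \<in> gobs n" "zs \<in> gobs n"
  shows "graded_comp C g f \<in> graded_hom C xs zs"
proof -
  have st: "src f = xs" "tgt g = zs" "tgt f = ys" using gh_arr[OF assms(1)] gh_arr[OF assms(2)] by auto
  have "graded_comp C g f = Arr xs zs (mat (length zs) (length xs) (\<lambda>(i, j). entry (graded_comp C g f) i j))"
    by (subst gcomp_arr(1)) (auto simp: st gcomp_arr(2,3) entry_def intro!: eq_matI)
  moreover have "\<dots> \<in> graded_hom C xs zs"
  proof (rule gh_mat)
    fix i j assume ij: "i < length zs" "j < length xs"
    have o: "obj xs j \<in> Ob C" "obj zs i \<in> Ob C" using gobs_nth assms(3,5) ij by blast+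
    note t = gcomp_terms[OF assms ij]
    show "mor (entry (graded_comp C g f) i j) (obj xs j) (obj zs i)"
      unfolding gcomp_entry[OF assms(1,2) ij] by (rule mor_msum) (use t(1) o in auto)
    assume "deg xs j \<noteq> deg zs i"
    then show "entry (graded_comp C g f) i j = Zero C (obj xs j) (obj zs i)"
      unfolding gcomp_entry[OF assms(1,2) ij] by (intro msum_zero o) (use t(2) in auto)
  qed
  ultimately show ?thesis by simp
qed

lemma gcomp_gid:
  assumes "f \<in> graded_hom C xs ys" "xs \<in> gobs n" "ys \<in> gobs n"
  shows "graded_comp C f (gid xs) = f"
proof (rule gh_eqI[OF gcomp_hom[OF gid_hom assms(1)] assms(1)])
  fix i j assume ij: "i < length ys" "j < length xs"
  note e = gh_entry(1)[OF assms ij(1)]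
  show "entry (graded_comp C f (gid xs)) i j = entry f i j"
    unfolding gcomp_entry[OF gid_hom[OF assms(2)] assms(1) ij]
    using msum_single[OF ij(2), of "\<lambda>l. entry f i l \<cdot> entry (gid xs) l j" "obj xs j" "obj ys i"] ij
      rid[OF e[OF ij(2)]] e comp_zero[OF e] gobs_nth[OF assms(2)]
    by (simp add: gid_entry)
qed (use assms in auto)

lemma gid_gcomp:
  assumes "f \<in> graded_hom C xs ys" "xs \<in> gobs n" "ys \<in> gobs n"
  shows "graded_comp C (gid ys) f = f"
proof (rule gh_eqI[OF gcomp_hom[OF assms(1) gid_hom] assms(1)])
  fix i j assume ij: "i < length ys" "j < length xs"
  note e = gh_entry(1)[OF assms _ ij(2)]
  show "entry (graded_comp C (gid ys) f) i j = entry f i j"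
    unfolding gcomp_entry[OF assms(1) gid_hom[OF assms(3)] ij]
    using msum_single[OF ij(1), of "\<lambda>l. entry (gid ys) i l \<cdot> entry f l j" "obj xs j" "obj ys i"] ij
      lid[OF e[OF ij(1)]] e zero_comp[OF e] gobs_nth[OF assms(3)]
    by (simp add: gid_entry)
qed (use assms in auto)

subsection \<open>Tensor products of lists\<close>

lemma gtens_product: "graded_tensor C n xs ys =
    map (\<lambda>((X, g), (Y, h)). (X \<odot> Y, (g + h) mod n)) (List.product xs ys)"
  unfolding graded_tensor_def
  using comprehension_product[of "\<lambda>(X, g) (Y, h). (X \<odot> Y, (g + h) mod n)" ys xs]
  by (simp add: case_prod_unfold)

lemma gtens_length [simp]: "length (graded_tensor C n xs ys) = length xs * length ys"
  by (simp add: gtens_product)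

lemma gtens_nth: "i < length xs * length ys \<Longrightarrow> graded_tensor C n xs ys ! i =
    (obj xs (i div length ys) \<odot> obj ys (i mod length ys), (deg xs (i div length ys) + deg ys (i mod length ys)) mod n)"
  by (simp add: gtens_product product_nth split_beta)

lemma gtens_nth_pair: "k < length xs \<Longrightarrow> l < length ys \<Longrightarrow> graded_tensor C n xs ys ! (k * length ys + l) =
    (obj xs k \<odot> obj ys l, (deg xs k + deg ys l) mod n)"
  using pair_index_less[of k "length xs" l "length ys"] by (simp add: gtens_nth pair_index_div)

lemma gtens_gobs: "xs \<in> gobs n \<Longrightarrow> ys \<in> gobs n \<Longrightarrow> graded_tensor C n xs ys \<in> gobs n"
proof (rule gobsI)
  fix i assume "xs \<in> gobs n" "ys \<in> gobs n" "i < length (graded_tensor C n xs ys)"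
  then have i: "i < length xs * length ys" by simp
  with \<open>xs \<in> gobs n\<close> \<open>ys \<in> gobs n\<close> show "obj (graded_tensor C n xs ys) i \<in> Ob C \<and> deg (graded_tensor C n xs ys) i < n"
    using div_mod_less[OF i] gobs_nth[of xs n "i div length ys"] gobs_nth[of ys n "i mod length ys"]
    by (auto simp: gtens_nth[OF i] intro: tens_ob)
qed

lemma gtens_assoc:
  assumes "xs \<in> gobs n" "ys \<in> gobs n" "zs \<in> gobs n"
  shows "graded_tensor C n (graded_tensor C n xs ys) zs = graded_tensor C n xs (graded_tensor C n ys zs)"
proof (rule nth_equalityI)
  fix i assume i: "i < length (graded_tensor C n (graded_tensor C n xs ys) zs)"
  let ?y = "length ys" and ?z = "length zs"
  have i': "i < length xs * ?y * ?z" using i by simp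
  have d: "i div ?z < length xs * ?y" "i mod ?z < ?z" using div_mod_less[OF i'] by auto
  have i'': "i < length xs * (?y * ?z)" using i' by (simp add: mult.assoc)
  have d2: "i div ?z div ?y < length xs" "i div ?z mod ?y < ?y" using div_mod_less[OF d(1)] by auto
  have r: "i mod (?y * ?z) = i div ?z mod ?y * ?z + i mod ?z"
    using mod_mult2_eq[of i ?z ?y] by (simp add: mult.commute)
  have e: "i div (?y * ?z) = i div ?z div ?y" "i mod (?y * ?z) div ?z = i div ?z mod ?y"
    "i mod (?y * ?z) mod ?z = i mod ?z"
    using div_mult2_eq[of i ?z ?y] unfolding r pair_index_div[OF d(2)] mult.commute[of ?z ?y] by blast+
  have m: "i mod (?y * ?z) < ?y * ?z" using div_mod_less[OF i''] by simp
  show "graded_tensor C n (graded_tensor C n xs ys) zs ! i = graded_tensor C n xs (graded_tensor C n ys zs) ! i"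
    using gobs_nth[OF assms(1) d2(1)] gobs_nth[OF assms(2) d2(2)] gobs_nth[OF assms(3) d(2)] i' i'' d m
    by (simp add: gtens_nth e tens_assoc mod_simps ac_simps)
qed (simp add: mult.assoc)

lemma gtens_unit:
  assumes "xs \<in> gobs n"
  shows "graded_tensor C n [(Unit C, 0)] xs = xs" "graded_tensor C n xs [(Unit C, 0)] = xs"
proof -
  note xs = assms
  show "graded_tensor C n [(Unit C, 0)] xs = xs"
    by (rule nth_equalityI) (use gobs_nth[OF xs] in \<open>simp_all add: gtens_nth unit_tens prod_eq_iff\<close>)
  show "graded_tensor C n xs [(Unit C, 0)] = xs"
    by (rule nth_equalityI) (use gobs_nth[OF xs] in \<open>simp_all add: gtens_nth tens_unit prod_eq_iff\<close>)
qed

lemma gtens_hom_entry: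
  assumes "f \<in> graded_hom C xs xs'" "g \<in> graded_hom C ys ys'"
    "i < length xs' * length ys'" "j < length xs * length ys"
  shows "kronecker (TensM C) (body f) (body g) $$ (i, j) =
    entry f (i div length ys') (j div length ys) \<boxtimes> entry g (i mod length ys') (j mod length ys)"
  using assms gh_arr[OF assms(1)] gh_arr[OF assms(2)] by (simp add: kronecker_def entry_def)

definition gtensm :: "nat \<Rightarrow> ('o graded, 'm mat) arrow \<Rightarrow> ('o graded, 'm mat) arrow \<Rightarrow> ('o graded, 'm mat) arrow" where
  "gtensm n f g = Arr (graded_tensor C n (src f) (src g)) (graded_tensor C n (tgt f) (tgt g))
     (kronecker (TensM C) (body f) (body g))"

lemma gtensm_entry:
  assumes "f \<in> graded_hom C xs xs'" "g \<in> graded_hom C ys ys'"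
    "i < length xs' * length ys'" "j < length xs * length ys"
  shows "entry (gtensm n f g) i j =
    entry f (i div length ys') (j div length ys) \<boxtimes> entry g (i mod length ys') (j mod length ys)"
  using gtens_hom_entry[OF assms] by (simp add: gtensm_def entry_def)

lemma gtensm_hom:
  assumes "f \<in> graded_hom C xs xs'" "g \<in> graded_hom C ys ys'"
    "xs \<in> gobs n" "xs' \<in> gobs n" "ys \<in> gobs n" "ys' \<in> gobs n"
  shows "gtensm n f g \<in> graded_hom C (graded_tensor C n xs ys) (graded_tensor C n xs' ys')"
proof -
  let ?s = "graded_tensor C n xs ys" and ?t = "graded_tensor C n xs' ys'"
  have "gtensm n f g = Arr ?s ?t (mat (length ?t) (length ?s) (\<lambda>(i, j). entry (gtensm n f g) i j))"
    using gh_arr[OF assms(1)] gh_arr[OF assms(2)]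
    by (auto simp: gtensm_def entry_def kronecker_def intro!: eq_matI)
  moreover have "\<dots> \<in> graded_hom C ?s ?t"
  proof (rule gh_mat)
    fix i j assume ij: "i < length ?t" "j < length ?s"
    then have i: "i < length xs' * length ys'" and j: "j < length xs * length ys" by auto
    note di = div_mod_less[OF i] and dj = div_mod_less[OF j]
    note f = gh_entry[OF assms(1,3,4) di[THEN conjunct1] dj[THEN conjunct1]]
      and g = gh_entry[OF assms(2,5,6) di[THEN conjunct2] dj[THEN conjunct2]]
    show "mor (entry (gtensm n f g) i j) (obj ?s j) (obj ?t i)"
      using mor_tens[OF f(1) g(1)] by (simp add: gtensm_entry[OF assms(1,2) i j] gtens_nth i j)
    assume "deg ?s j \<noteq> deg ?t i"
    then have "deg xs (j div length ys) \<noteq> deg xs' (i div length ys') \<or>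
        deg ys (j mod length ys) \<noteq> deg ys' (i mod length ys')"
      by (auto simp: gtens_nth i j)
    then show "entry (gtensm n f g) i j = Zero C (obj ?s j) (obj ?t i)"
    proof
      assume "deg xs (j div length ys) \<noteq> deg xs' (i div length ys')"
      from f(2)[OF this] show ?thesis
        using zero_tens[OF g(1), of "obj xs (j div length ys)" "obj xs' (i div length ys')"] morD[OF f(1)]
        by (simp add: gtensm_entry[OF assms(1,2) i j] gtens_nth i j)
    next
      assume "deg ys (j mod length ys) \<noteq> deg ys' (i mod length ys')"
      from g(2)[OF this] show ?thesis
        using tens_zero[OF f(1), of "obj ys (j mod length ys)" "obj ys' (i mod length ys')"] morD[OF g(1)]
        by (simp add: gtensm_entry[OF assms(1,2) i j] gtens_nth i j)
    qed
  qed
  ultimately show ?thesis by simp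
qed

subsection \<open>The graded product\<close>

lemma gp_simps [simp]:
  "Ob (graded_product C n \<omega>) = gobs n" "Hom (graded_product C n \<omega>) = graded_hom C"
  "Ident (graded_product C n \<omega>) = gid" "Comp (graded_product C n \<omega>) = graded_comp C"
  "TensO (graded_product C n \<omega>) = graded_tensor C n" "TensM (graded_product C n \<omega>) = gtensm n"
  "Unit (graded_product C n \<omega>) = [(Unit C, 0)]" "Assoc (graded_product C n \<omega>) = graded_assoc C n \<omega>"
  by (simp_all add: graded_product_def gobs_def gid_def[abs_def] gtensm_def[abs_def])

lemma gp_units:
  assumes "xs \<in> gobs n"
  shows "LUnit (graded_product C n \<omega>) xs = gid xs" "RUnit (graded_product C n \<omega>) xs = gid xs"
proof -
  have "map (\<lambda>(X, g). LUnit C X) xs = map (\<lambda>(X, g). Ident C X) xs"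
    "map (\<lambda>(X, g). RUnit C X) xs = map (\<lambda>(X, g). Ident C X) xs"
    using assms by (auto simp: gobs_def lunit_strict runit_strict)
  then show "LUnit (graded_product C n \<omega>) xs = gid xs" "RUnit (graded_product C n \<omega>) xs = gid xs"
    unfolding graded_product_def gid_def by (simp_all only: lincat.simps gtens_unit[OF assms])
qed

lemma gp_zero: "Zero (graded_product C n \<omega>) xs ys =
    Arr xs ys (mat (length ys) (length xs) (\<lambda>(i, j). Zero C (obj xs j) (obj ys i)))"
  by (simp add: graded_product_def)

lemma gp_add_entry:
  assumes "f \<in> graded_hom C xs ys" "g \<in> graded_hom C xs ys" "i < length ys" "j < length xs"
  shows "entry (Add (graded_product C n \<omega>) f g) i j = Add C (entry f i j) (entry g i j)"
  using gh_arr[OF assms(1)] gh_arr[OF assms(2)] assms(3,4) by (simp add: graded_product_def entry_def)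

text \<open>On singletons the associator is a scalar; without a twist it is the identity everywhere.\<close>

lemma gassoc_untwisted:
  assumes "xs \<in> gobs n" "ys \<in> gobs n" "zs \<in> gobs n"
  shows "graded_assoc C n (\<lambda>_ _ _. 1) xs ys zs = gid (graded_tensor C n xs (graded_tensor C n ys zs))"
proof -
  have "concat (map (\<lambda>(X, g). concat (map (\<lambda>(Y, h). map (\<lambda>(Z, l). Scale C 1 (Assoc C X Y Z)) zs) ys)) xs') =
      map (\<lambda>(X, g). Ident C X) (graded_tensor C n xs' (graded_tensor C n ys zs))"
    if "set xs' \<subseteq> set xs" for xs'
    using that
  proof (induction xs')
    case Nil
    then show ?case by (simp add: graded_tensor_def)
  next
    case (Cons x xs')
    obtain X g where x: "x = (X, g)" by (cases x)
    have X: "X \<in> Ob C" using Cons.prems assms(1) by (auto simp: gobs_def x)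
    have "concat (map (\<lambda>(Y, h). map (\<lambda>(Z, l). Scale C 1 (Assoc C X Y Z)) zs) ys') =
        map (\<lambda>(Y, h). Ident C (X \<odot> Y)) (graded_tensor C n ys' zs)" if "set ys' \<subseteq> set ys" for ys'
      using that
    proof (induction ys')
      case Nil
      then show ?case by (simp add: graded_tensor_def)
    next
      case (Cons y ys')
      obtain Y h where y: "y = (Y, h)" by (cases y)
      have Y: "Y \<in> Ob C" using Cons.prems assms(2) by (auto simp: gobs_def y)
      have "Scale C 1 (Assoc C X Y Z) = Ident C (X \<odot> (Y \<odot> Z))" if "(Z, l) \<in> set zs" for Z l
      proof -
        have "Z \<in> Ob C" using that assms(3) by (auto simp: gobs_def)
        with X Y show ?thesis using scale1[OF mor_ident] by (simp add: assoc_strict obs)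
      qed
      then have "map (\<lambda>(Z, l). Scale C 1 (Assoc C X Y Z)) zs = map (\<lambda>(Z, l). Ident C (X \<odot> (Y \<odot> Z))) zs"
        by auto
      with Cons show ?case by (simp add: graded_tensor_def y case_prod_unfold o_def)
    qed
    from this[of ys] Cons show ?case by (simp add: graded_tensor_def x case_prod_unfold o_def)
  qed
  from this[of xs] show ?thesis
    unfolding graded_assoc_def gid_def gtens_assoc[OF assms] by simp
qed

end

section \<open>A parity on the base category cuts out a fusion subcategory of the graded product\<close>

locale parity_category = strict_tensor_category C for C :: "('o, 'm, 'k::field) lincat" (structure) +
  fixes \<theta> :: "'o \<Rightarrow> 'm" and n :: nat
  assumes even_n: "even n" and pos_n: "0 < n"
    and parity_mor: "X \<in> Ob C \<Longrightarrow> mor (\<theta> X) X X"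
    and parity_natural: "mor f X Y \<Longrightarrow> \<theta> Y \<cdot> f = f \<cdot> \<theta> X"
    and parity_tens: "X \<in> Ob C \<Longrightarrow> Y \<in> Ob C \<Longrightarrow> \<theta> (X \<odot> Y) = \<theta> X \<boxtimes> \<theta> Y"
    and parity_unit: "\<theta> (Unit C) = Ident C (Unit C)"
begin

definition sign :: "nat \<Rightarrow> 'k" where "sign a = (-1) ^ a"

lemma sign_mod: "sign ((a + b) mod n) = sign a * sign b"
proof -
  have "sign ((a + b) mod n) = sign (a + b)"
    using even_n by (simp add: sign_def minus_one_power_iff dvd_mod_iff del: even_add)
  then show ?thesis by (simp add: sign_def power_add)
qed

lemma sign_square: "sign a * sign a = 1"
  by (simp add: sign_def flip: power_mult_distrib)

definition parity_objects :: "('o \<times> nat) list set" where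
  "parity_objects = {xs \<in> gobs n. \<forall>x\<in>set xs. \<theta> (fst x) = Scale C (sign (snd x)) (Ident C (fst x))}"

lemma parity_objectsD:
  assumes "xs \<in> parity_objects"
  shows "xs \<in> gobs n" "i < length xs \<Longrightarrow> \<theta> (obj xs i) = Scale C (sign (deg xs i)) (Ident C (obj xs i))"
  using assms nth_mem[of i xs] by (simp_all add: parity_objects_def)

lemma parity_objectsI:
  assumes "xs \<in> gobs n"
    "\<And>i. i < length xs \<Longrightarrow> \<theta> (obj xs i) = Scale C (sign (deg xs i)) (Ident C (obj xs i))"
  shows "xs \<in> parity_objects"
proof -
  have "\<theta> (fst x) = Scale C (sign (snd x)) (Ident C (fst x))" if "x \<in> set xs" for x
    using that assms(2) by (metis in_set_conv_nth)
  with assms(1) show ?thesis unfolding parity_objects_def by blast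
qed

lemma scale_ident_comp: "mor f X Y \<Longrightarrow> Scale C a (Ident C Y) \<cdot> f = Scale C a f"
  using scalec[OF mor_ident[OF morD(2)], of f X Y f X a] lid[of f X Y] by simp

lemma parity_msum:
  assumes "X \<in> Ob C" "V \<in> Ob C"
  shows "(\<And>h. h \<in> set fs \<Longrightarrow> mor h X V \<and> \<theta> V \<cdot> h = Scale C s h) \<Longrightarrow>
    \<theta> V \<cdot> msum X V fs = Scale C s (msum X V fs)"
proof (induction fs)
  case Nil
  then show ?case using comp_zero[OF parity_mor[OF assms(2)] assms(1)] scale_Zero[OF assms] by simp
next
  case (Cons h fs)
  have m: "mor h X V" "mor (msum X V fs) X V" using Cons.prems assms by (auto intro: mor_msum)
  then show ?case using Cons cadd[OF parity_mor[OF assms(2)] m] scale_add[of X V h "msum X V fs" s]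
    by (simp add: mor_def)
qed

lemma parity_objects_factor:
  assumes f: "f \<in> graded_hom C xs ys" and g: "g \<in> graded_hom C ys zs"
    and xs: "xs \<in> gobs n" and ys: "ys \<in> parity_objects" and zs: "zs \<in> gobs n"
    and ij: "i < length zs" "j < length xs"
  shows "\<theta> (obj zs i) \<cdot> entry (graded_comp C g f) i j =
    Scale C (sign (deg zs i)) (entry (graded_comp C g f) i j)"
proof -
  note y = parity_objectsD[OF ys]
  have o: "obj xs j \<in> Ob C" "obj zs i \<in> Ob C" using gobs_nth xs zs ij by blast+
  note t = gcomp_terms[OF f g xs y(1) zs ij]
  have trm: "\<theta> (obj zs i) \<cdot> (entry g i l \<cdot> entry f l j) =
      Scale C (sign (deg zs i)) (entry g i l \<cdot> entry f l j)" if l: "l < length ys" for l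
  proof -
    note fm = gh_entry(1)[OF f xs y(1) l ij(2)] and gm = gh_entry[OF g y(1) zs ij(1) l]
    have ol: "obj ys l \<in> Ob C" using gm(1) by (rule morD)
    have "\<theta> (obj zs i) \<cdot> (entry g i l \<cdot> entry f l j) = (\<theta> (obj zs i) \<cdot> entry g i l) \<cdot> entry f l j"
      using cassoc[OF parity_mor[OF o(2)] gm(1) fm] by simp
    also have "\<dots> = (entry g i l \<cdot> \<theta> (obj ys l)) \<cdot> entry f l j"
      using parity_natural[OF gm(1)] by simp
    also have "\<dots> = entry g i l \<cdot> Scale C (sign (deg ys l)) (entry f l j)"
      using cassoc[OF gm(1) parity_mor[OF ol] fm] scale_ident_comp[OF fm] y(2)[OF l] by simp
    also have "\<dots> = Scale C (sign (deg ys l)) (entry g i l \<cdot> entry f l j)"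
      by (rule cscale[OF gm(1) fm])
    also have "\<dots> = Scale C (sign (deg zs i)) (entry g i l \<cdot> entry f l j)"
      using t(2)[OF l] scale_Zero[OF o] by (cases "deg ys l = deg zs i") simp_all
    finally show ?thesis .
  qed
  show ?thesis unfolding gcomp_entry[OF f g ij]
    by (rule parity_msum[OF o]) (use t(1) trm in auto)
qed

lemma parity_objects_ident:
  assumes "zs \<in> gobs n"
    and "\<And>i. i < length zs \<Longrightarrow> \<theta> (obj zs i) \<cdot> entry (gid zs) i i = Scale C (sign (deg zs i)) (entry (gid zs) i i)"
  shows "zs \<in> parity_objects"
proof (rule parity_objectsI[OF assms(1)])
  fix i assume i: "i < length zs"
  have o: "obj zs i \<in> Ob C" using gobs_nth[OF assms(1) i] by blast
  show "\<theta> (obj zs i) = Scale C (sign (deg zs i)) (Ident C (obj zs i))"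
    using assms(2)[OF i] rid[OF parity_mor[OF o]] by (simp add: gid_entry i)
qed

text \<open>Both zigzag identities present the identity of the dual as a composite through a triple tensor
  product; on the diagonal only the summands survive whose three indices match, and there the parity
  is carried over the (co)evaluation, which is homogeneous of degree 0.\<close>

lemma parity_coev:
  assumes xs: "xs \<in> parity_objects" and ys: "ys \<in> gobs n"
    and c: "c \<in> graded_hom C [(Unit C, 0)] (graded_tensor C n xs ys)"
    and kl: "k < length xs" "l < length ys"
  defines "e \<equiv> entry c (k * length ys + l) 0"
  shows "mor e (Unit C) (obj xs k \<odot> obj ys l)"
    "(Ident C (obj xs k) \<boxtimes> \<theta> (obj ys l)) \<cdot> e = Scale C (sign (deg ys l)) e"
proof -
  note x = parity_objectsD[OF xs]
  have oV: "obj xs k \<in> Ob C" and oW: "obj ys l \<in> Ob C" using gobs_nth x(1) ys kl by blast+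
  have u: "[(Unit C, 0)] \<in> gobs n" using pos_n unit_ob by (auto simp: gobs_def)
  have ob: "obj xs k \<odot> obj ys l \<in> Ob C" by (rule tens_ob[OF oV oW])
  note ce = gh_entry[OF c u gtens_gobs[OF x(1) ys], of "k * length ys + l" 0]
  show m: "mor e (Unit C) (obj xs k \<odot> obj ys l)"
    using ce(1) kl pair_index_less[OF kl] by (simp add: e_def gtens_nth_pair)
  have mI: "mor (Ident C (obj xs k) \<boxtimes> \<theta> (obj ys l)) (obj xs k \<odot> obj ys l) (obj xs k \<odot> obj ys l)"
    by (rule mor_tens[OF mor_ident[OF oV] parity_mor[OF oW]])
  show "(Ident C (obj xs k) \<boxtimes> \<theta> (obj ys l)) \<cdot> e = Scale C (sign (deg ys l)) e"
  proof (cases "(deg xs k + deg ys l) mod n = 0")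
    case True
    have s: "sign (deg xs k) * sign (deg ys l) = 1" using sign_mod[of "deg xs k" "deg ys l"] True
      by (simp add: sign_def)
    have "e = \<theta> (obj xs k \<odot> obj ys l) \<cdot> e"
      using parity_natural[OF m] rid[OF m] by (simp add: parity_unit)
    also have "\<dots> = Scale C (sign (deg xs k)) ((Ident C (obj xs k) \<boxtimes> \<theta> (obj ys l)) \<cdot> e)"
      using scalet[OF mor_ident[OF oV] parity_mor[OF oW], of "sign (deg xs k)"] scalec[OF mI m]
      by (simp add: parity_tens[OF oV oW] x(2)[OF kl(1)])
    finally have *: "e = Scale C (sign (deg xs k)) ((Ident C (obj xs k) \<boxtimes> \<theta> (obj ys l)) \<cdot> e)" .
    have "Scale C (sign (deg ys l)) e = Scale C (sign (deg ys l) * sign (deg xs k)) ((Ident C (obj xs k) \<boxtimes> \<theta> (obj ys l)) \<cdot> e)"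
      by (subst *) (rule scalescale[OF mor_comp[OF mI m]])
    then show ?thesis using s scale1[OF mor_comp[OF mI m]] by (simp add: mult.commute)
  next
    case False
    then have "e = Zero C (Unit C) (obj xs k \<odot> obj ys l)"
      using ce(2) kl pair_index_less[OF kl] by (simp add: e_def gtens_nth_pair)
    then show ?thesis using comp_zero[OF mI unit_ob] scale_Zero[OF unit_ob ob] by simp
  qed
qed

lemma parity_coev':
  assumes xs: "xs \<in> parity_objects" and ys: "ys \<in> gobs n"
    and c: "c \<in> graded_hom C [(Unit C, 0)] (graded_tensor C n ys xs)"
    and kl: "k < length xs" "l < length ys"
  defines "e \<equiv> entry c (l * length xs + k) 0"
  shows "mor e (Unit C) (obj ys l \<odot> obj xs k)"
    "(\<theta> (obj ys l) \<boxtimes> Ident C (obj xs k)) \<cdot> e = Scale C (sign (deg ys l)) e"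
proof -
  note x = parity_objectsD[OF xs]
  have oV: "obj xs k \<in> Ob C" and oW: "obj ys l \<in> Ob C" using gobs_nth x(1) ys kl by blast+
  have u: "[(Unit C, 0)] \<in> gobs n" using pos_n unit_ob by (auto simp: gobs_def)
  have ob: "obj ys l \<odot> obj xs k \<in> Ob C" by (rule tens_ob[OF oW oV])
  note ce = gh_entry[OF c u gtens_gobs[OF ys x(1)], of "l * length xs + k" 0]
  show m: "mor e (Unit C) (obj ys l \<odot> obj xs k)"
    using ce(1) kl pair_index_less[OF kl(2,1)] by (simp add: e_def gtens_nth_pair)
  have mI: "mor (\<theta> (obj ys l) \<boxtimes> Ident C (obj xs k)) (obj ys l \<odot> obj xs k) (obj ys l \<odot> obj xs k)"
    by (rule mor_tens[OF parity_mor[OF oW] mor_ident[OF oV]])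
  show "(\<theta> (obj ys l) \<boxtimes> Ident C (obj xs k)) \<cdot> e = Scale C (sign (deg ys l)) e"
  proof (cases "(deg ys l + deg xs k) mod n = 0")
    case True
    have s: "sign (deg ys l) * sign (deg xs k) = 1" using sign_mod[of "deg ys l" "deg xs k"] True
      by (simp add: sign_def)
    have "e = \<theta> (obj ys l \<odot> obj xs k) \<cdot> e"
      using parity_natural[OF m] rid[OF m] by (simp add: parity_unit)
    also have "\<dots> = Scale C (sign (deg xs k)) ((\<theta> (obj ys l) \<boxtimes> Ident C (obj xs k)) \<cdot> e)"
      using tscale[OF parity_mor[OF oW] mor_ident[OF oV], of "sign (deg xs k)"] scalec[OF mI m]
      by (simp add: parity_tens[OF oW oV] x(2)[OF kl(1)])
    finally have *: "e = Scale C (sign (deg xs k)) ((\<theta> (obj ys l) \<boxtimes> Ident C (obj xs k)) \<cdot> e)" .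
    have "Scale C (sign (deg ys l)) e = Scale C (sign (deg ys l) * sign (deg xs k)) ((\<theta> (obj ys l) \<boxtimes> Ident C (obj xs k)) \<cdot> e)"
      by (subst *) (rule scalescale[OF mor_comp[OF mI m]])
    then show ?thesis using s scale1[OF mor_comp[OF mI m]] by simp
  next
    case False
    then have "e = Zero C (Unit C) (obj ys l \<odot> obj xs k)"
      using ce(2) kl pair_index_less[OF kl(2,1)] by (simp add: e_def gtens_nth_pair)
    then show ?thesis using comp_zero[OF mI unit_ob] scale_Zero[OF unit_ob ob] by simp
  qed
qed

text \<open>A summand of a zigzag composite.\<close>

lemma parity_zigzag_term:
  assumes V: "V \<in> Ob C" and W: "W \<in> Ob C"
    and e: "mor e (W \<odot> V) (Unit C)" and c: "mor c (Unit C) (V \<odot> W)"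
    and s: "(Ident C V \<boxtimes> \<theta> W) \<cdot> c = Scale C s c"
  shows "\<theta> W \<cdot> ((e \<boxtimes> Ident C W) \<cdot> (Ident C W \<boxtimes> c)) = Scale C s ((e \<boxtimes> Ident C W) \<cdot> (Ident C W \<boxtimes> c))"
proof -
  note iV = mor_ident[OF V] and iW = mor_ident[OF W] and t = parity_mor[OF W]
  have eW: "mor (e \<boxtimes> Ident C W) (W \<odot> (V \<odot> W)) W"
    using mor_tens[OF e iW] V W by (simp add: unit_tens tens_assoc)
  have Wc: "mor (Ident C W \<boxtimes> c) W (W \<odot> (V \<odot> W))" using mor_tens[OF iW c] W by (simp add: tens_unit)
  have Vt: "mor (Ident C V \<boxtimes> \<theta> W) (V \<odot> W) (V \<odot> W)" by (rule mor_tens[OF iV t])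
  have Wt: "mor (Ident C W \<boxtimes> (Ident C V \<boxtimes> \<theta> W)) (W \<odot> (V \<odot> W)) (W \<odot> (V \<odot> W))" by (rule mor_tens[OF iW Vt])
  have "\<theta> W \<cdot> (e \<boxtimes> Ident C W) = (e \<boxtimes> Ident C W) \<cdot> (Ident C (W \<odot> V) \<boxtimes> \<theta> W)"
    using tens_right_left[OF e t] tens_left_right[OF e t] ltid[OF t] by simp
  also have "Ident C (W \<odot> V) \<boxtimes> \<theta> W = Ident C W \<boxtimes> (Ident C V \<boxtimes> \<theta> W)"
    using tassoc[OF iW iV t] tens_ident[OF W V] by simp
  finally have "\<theta> W \<cdot> ((e \<boxtimes> Ident C W) \<cdot> (Ident C W \<boxtimes> c)) =
      (e \<boxtimes> Ident C W) \<cdot> ((Ident C W \<boxtimes> (Ident C V \<boxtimes> \<theta> W)) \<cdot> (Ident C W \<boxtimes> c))"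
    using cassoc[OF t eW Wc] cassoc[OF eW Wt Wc] by simp
  also have "(Ident C W \<boxtimes> (Ident C V \<boxtimes> \<theta> W)) \<cdot> (Ident C W \<boxtimes> c) = Scale C s (Ident C W \<boxtimes> c)"
    using inter[OF iW iW Vt c] lid[OF iW] s tscale[OF iW c] by simp
  finally show ?thesis using cscale[OF eW Wc] by simp
qed

lemma parity_zigzag_term':
  assumes V: "V \<in> Ob C" and W: "W \<in> Ob C"
    and e: "mor e (V \<odot> W) (Unit C)" and c: "mor c (Unit C) (W \<odot> V)"
    and s: "(\<theta> W \<boxtimes> Ident C V) \<cdot> c = Scale C s c"
  shows "\<theta> W \<cdot> ((Ident C W \<boxtimes> e) \<cdot> (c \<boxtimes> Ident C W)) = Scale C s ((Ident C W \<boxtimes> e) \<cdot> (c \<boxtimes> Ident C W))"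
proof -
  note iV = mor_ident[OF V] and iW = mor_ident[OF W] and t = parity_mor[OF W]
  have We: "mor (Ident C W \<boxtimes> e) (W \<odot> (V \<odot> W)) W"
    using mor_tens[OF iW e] V W by (simp add: tens_unit)
  have cW: "mor (c \<boxtimes> Ident C W) W (W \<odot> (V \<odot> W))" using mor_tens[OF c iW] V W by (simp add: unit_tens tens_assoc)
  have tV: "mor (\<theta> W \<boxtimes> Ident C V) (W \<odot> V) (W \<odot> V)" by (rule mor_tens[OF t iV])
  have tW: "mor ((\<theta> W \<boxtimes> Ident C V) \<boxtimes> Ident C W) (W \<odot> (V \<odot> W)) (W \<odot> (V \<odot> W))"
    using mor_tens[OF tV iW] V W by (simp add: tens_assoc)
  have "\<theta> W \<cdot> (Ident C W \<boxtimes> e) = (Ident C W \<boxtimes> e) \<cdot> (\<theta> W \<boxtimes> Ident C (V \<odot> W))"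
    using tens_right_left[OF t e] tens_left_right[OF t e] rtid[OF t] by simp
  also have "\<theta> W \<boxtimes> Ident C (V \<odot> W) = (\<theta> W \<boxtimes> Ident C V) \<boxtimes> Ident C W"
    using tassoc[OF t iV iW] tens_ident[OF V W] by simp
  finally have "\<theta> W \<cdot> ((Ident C W \<boxtimes> e) \<cdot> (c \<boxtimes> Ident C W)) =
      (Ident C W \<boxtimes> e) \<cdot> (((\<theta> W \<boxtimes> Ident C V) \<boxtimes> Ident C W) \<cdot> (c \<boxtimes> Ident C W))"
    using cassoc[OF t We cW] cassoc[OF We tW cW] by simp
  also have "((\<theta> W \<boxtimes> Ident C V) \<boxtimes> Ident C W) \<cdot> (c \<boxtimes> Ident C W) = Scale C s (c \<boxtimes> Ident C W)"
    using inter[OF tV c iW iW] lid[OF iW] s scalet[OF c iW] by simp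
  finally show ?thesis using cscale[OF We cW] by simp
qed

lemma parity_dual_left:
  assumes xs: "xs \<in> parity_objects" and ys: "ys \<in> gobs n"
    and dual: "dual_objects (graded_product C n (\<lambda>_ _ _. 1)) xs ys"
  shows "ys \<in> parity_objects"
proof -
  let ?G = "graded_product C n (\<lambda>_ _ _. 1)" and ?u = "[(Unit C, 0::nat)]"
  let ?yx = "graded_tensor C n ys xs" and ?xy = "graded_tensor C n xs ys"
  let ?T = "graded_tensor C n ys ?xy"
  have x: "xs \<in> gobs n" by (rule parity_objectsD[OF xs])
  have u: "?u \<in> gobs n" using pos_n unit_ob by (auto simp: gobs_def)
  note ob = x ys u gtens_gobs[OF ys x] gtens_gobs[OF x ys] gtens_gobs[OF ys gtens_gobs[OF x ys]]
  have TT: "graded_tensor C n ?yx ys = ?T" by (rule gtens_assoc[OF ys x ys])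
  obtain e c where e: "e \<in> graded_hom C ?yx ?u" and c: "c \<in> graded_hom C ?u ?xy"
    and z: "graded_comp C (graded_comp C (graded_comp C (LUnit ?G ys) (gtensm n e (gid ys)))
        (inverse_arrow ?G ?T ?T (graded_assoc C n (\<lambda>_ _ _. 1) ys xs ys))) (gtensm n (gid ys) c) = RUnit ?G ys"
    using dual by (auto simp: dual_objects_def TT)
  define A where "A = gtensm n e (gid ys)"
  define B where "B = gtensm n (gid ys) c"
  have A: "A \<in> graded_hom C ?T ys"
    using gtensm_hom[OF e gid_hom[OF ys] ob(4,3,2,2)] by (simp add: A_def TT gtens_unit[OF ys])
  have B: "B \<in> graded_hom C ys ?T"
    using gtensm_hom[OF gid_hom[OF ys] c ob(2,2,3,5)] by (simp add: B_def gtens_unit[OF ys])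
  have inv: "inverse_arrow ?G ?T ?T (gid ?T) = gid ?T"
    unfolding inverse_arrow_def mutually_inverse_def
  proof (rule the_equality)
    show "gid ?T \<in> Hom ?G ?T ?T \<and> gid ?T \<in> Hom ?G ?T ?T \<and>
        gid ?T \<cdot>\<^bsub>?G\<^esub> gid ?T = Ident ?G ?T \<and> gid ?T \<cdot>\<^bsub>?G\<^esub> gid ?T = Ident ?G ?T"
      using gid_hom[OF ob(6)] gcomp_gid[OF gid_hom[OF ob(6)] ob(6,6)] by simp
    fix g assume "gid ?T \<in> Hom ?G ?T ?T \<and> g \<in> Hom ?G ?T ?T \<and>
        g \<cdot>\<^bsub>?G\<^esub> gid ?T = Ident ?G ?T \<and> gid ?T \<cdot>\<^bsub>?G\<^esub> g = Ident ?G ?T"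
    then show "g = gid ?T" using gcomp_gid[OF _ ob(6,6), of g] by simp
  qed
  have AB: "graded_comp C A B = gid ys"
    using z gid_gcomp[OF A ob(6,2)] gcomp_gid[OF A ob(6,2)]
    by (simp add: gp_units[OF ys] gassoc_untwisted[OF ys x ys] inv A_def[symmetric] B_def[symmetric])
  show ?thesis
  proof (rule parity_objects_ident[OF ys])
    fix i assume i: "i < length ys"
    let ?W = "obj ys i" and ?s = "sign (deg ys i)"
    have W: "?W \<in> Ob C" using gobs_nth[OF ys i] by blast
    note t = gcomp_terms[OF B A ys ob(6) ys i i]
    have trm: "\<theta> ?W \<cdot> (entry A i m \<cdot> entry B m i) = Scale C ?s (entry A i m \<cdot> entry B m i)"
      if m: "m < length ?T" for m
    proof -
      let ?j = "m div (length xs * length ys)" and ?r = "m mod (length xs * length ys)"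
      have m': "m < length ys * (length xs * length ys)" using m by simp
      note dm = div_mod_less[OF m'] and dr = div_mod_less[of ?r "length xs" "length ys"]
      let ?k = "?r div length ys" and ?l = "?r mod length ys"
      have kl: "?k < length xs" "?l < length ys" using dm dr by auto
      have mm: "m = (?j * length xs + ?k) * length ys + ?l"
        using div_mult_mod_eq[of m "length xs * length ys"] div_mult_mod_eq[of ?r "length ys"]
        by (simp add: algebra_simps)
      have lt: "?j * length xs + ?k < length ys * length xs" by (rule pair_index_less) (use dm kl in auto)
      have md: "m div length ys = ?j * length xs + ?k" "m mod length ys = ?l"
        using pair_index_div[OF kl(2), of "?j * length xs + ?k"] mm by auto
      have eA: "entry A i m = entry e 0 (?j * length xs + ?k) \<boxtimes> entry (gid ys) i ?l"
        using gtensm_entry[OF e gid_hom[OF ys], of i m] i m' md by (simp add: A_def mult.assoc)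
      have eB: "entry B m i = entry (gid ys) ?j i \<boxtimes> entry c ?r 0"
        using gtensm_entry[OF gid_hom[OF ys] c, of m i] i m' by (simp add: B_def)
      have oj: "obj ys ?j \<in> Ob C" "obj ys ?l \<in> Ob C" "obj xs ?k \<in> Ob C"
        using gobs_nth[OF ys] gobs_nth[OF x] dm kl by blast+
      have me: "mor (entry e 0 (?j * length xs + ?k)) (obj ys ?j \<odot> obj xs ?k) (Unit C)"
        using gh_entry(1)[OF e ob(4,3), of 0 "?j * length xs + ?k"] lt dm kl
        by (simp add: gtens_nth_pair)
      have mc: "mor (entry c ?r 0) (Unit C) (obj xs ?k \<odot> obj ys ?l)"
        using gh_entry(1)[OF c ob(3,5), of ?r 0] dm by (simp add: gtens_nth)
      have oT: "obj ?T m \<in> Ob C" using gobs_nth[OF ob(6) m] by blast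
      have mA: "mor (entry A i m) (obj ?T m) ?W" and mB: "mor (entry B m i) ?W (obj ?T m)"
        using gh_entry(1)[OF A ob(6) ys i m] gh_entry(1)[OF B ys ob(6) m i] by auto
      have Tm: "obj ?T m = obj ys ?j \<odot> (obj xs ?k \<odot> obj ys ?l)"
        using m' dm by (simp add: gtens_nth)
      have zero: "\<theta> ?W \<cdot> Zero C ?W ?W = Scale C ?s (Zero C ?W ?W)"
        using comp_zero[OF parity_mor[OF W] W] scale_Zero[OF W W] by simp
      show ?thesis
      proof (cases "?l = i \<and> ?j = i")
        case True
        have r: "?k * length ys + ?l = ?r" by simp
        have li: "?l = i" "?j = i" using True by auto
        note c2 = parity_coev(2)[OF xs ys c kl, unfolded r, unfolded li]
        have "\<theta> ?W \<cdot> ((entry e 0 (i * length xs + ?k) \<boxtimes> Ident C ?W) \<cdot> (Ident C ?W \<boxtimes> entry c ?r 0)) =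
          Scale C ?s ((entry e 0 (i * length xs + ?k) \<boxtimes> Ident C ?W) \<cdot> (Ident C ?W \<boxtimes> entry c ?r 0))"
          by (rule parity_zigzag_term[OF oj(3) W me[unfolded li] mc[unfolded li] c2])
        then show ?thesis using True i by (simp add: eA eB gid_entry)
      next
        case False
        then have "entry A i m = Zero C (obj ?T m) ?W \<or> entry B m i = Zero C ?W (obj ?T m)"
        proof (cases "?l = i")
          case True
          with False have "?j \<noteq> i" by simp
          then have "entry B m i = Zero C ?W (obj ys ?j) \<boxtimes> entry c ?r 0"
            using dm i by (simp add: eB gid_entry)
          then show ?thesis using zero_tens[OF mc W oj(1)] W by (simp add: tens_unit Tm)
        next
          case False
          then have "entry A i m = entry e 0 (?j * length xs + ?k) \<boxtimes> Zero C (obj ys ?l) ?W"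
            using kl i by (simp add: eA gid_entry)
          then show ?thesis using tens_zero[OF me oj(2) W] W oj by (simp add: unit_tens Tm tens_assoc)
        qed
        then have "entry A i m \<cdot> entry B m i = Zero C ?W ?W"
          using zero_comp[OF mB W] comp_zero[OF mA W] by auto
        then show ?thesis using zero by simp
      qed
    qed
    show "\<theta> ?W \<cdot> entry (gid ys) i i = Scale C ?s (entry (gid ys) i i)"
      unfolding AB[symmetric] gcomp_entry[OF B A i i] by (rule parity_msum[OF W W]) (use t(1) trm in auto)
  qed
qed

lemma parity_dual_right:
  assumes xs: "xs \<in> parity_objects" and ys: "ys \<in> gobs n"
    and dual: "dual_objects (graded_product C n (\<lambda>_ _ _. 1)) ys xs"
  shows "ys \<in> parity_objects"
proof -
  let ?G = "graded_product C n (\<lambda>_ _ _. 1)" and ?u = "[(Unit C, 0::nat)]"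
  let ?yx = "graded_tensor C n ys xs" and ?xy = "graded_tensor C n xs ys"
  let ?T = "graded_tensor C n ys ?xy"
  have x: "xs \<in> gobs n" by (rule parity_objectsD[OF xs])
  have u: "?u \<in> gobs n" using pos_n unit_ob by (auto simp: gobs_def)
  note ob = x ys u gtens_gobs[OF ys x] gtens_gobs[OF x ys] gtens_gobs[OF ys gtens_gobs[OF x ys]]
  have TT: "graded_tensor C n ?yx ys = ?T" by (rule gtens_assoc[OF ys x ys])
  obtain e c where e: "e \<in> graded_hom C ?xy ?u" and c: "c \<in> graded_hom C ?u ?yx"
    and z: "graded_comp C (graded_comp C (graded_comp C (RUnit ?G ys) (gtensm n (gid ys) e))
        (graded_assoc C n (\<lambda>_ _ _. 1) ys xs ys)) (gtensm n c (gid ys)) = LUnit ?G ys"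
    using dual by (auto simp: dual_objects_def TT)
  define A where "A = gtensm n (gid ys) e"
  define B where "B = gtensm n c (gid ys)"
  have A: "A \<in> graded_hom C ?T ys"
    using gtensm_hom[OF gid_hom[OF ys] e ob(2,2,5,3)] by (simp add: A_def gtens_unit[OF ys])
  have B: "B \<in> graded_hom C ys ?T"
    using gtensm_hom[OF c gid_hom[OF ys] ob(3,4,2,2)] by (simp add: B_def TT gtens_unit[OF ys])
  have AB: "graded_comp C A B = gid ys"
    using z gid_gcomp[OF A ob(6,2)] gcomp_gid[OF A ob(6,2)]
    by (simp add: gp_units[OF ys] gassoc_untwisted[OF ys x ys] A_def[symmetric] B_def[symmetric])
  show ?thesis
  proof (rule parity_objects_ident[OF ys])
    fix i assume i: "i < length ys"
    let ?W = "obj ys i" and ?s = "sign (deg ys i)"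
    have W: "?W \<in> Ob C" using gobs_nth[OF ys i] by blast
    note t = gcomp_terms[OF B A ys ob(6) ys i i]
    have trm: "\<theta> ?W \<cdot> (entry A i m \<cdot> entry B m i) = Scale C ?s (entry A i m \<cdot> entry B m i)"
      if m: "m < length ?T" for m
    proof -
      let ?j = "m div (length xs * length ys)" and ?r = "m mod (length xs * length ys)"
      have m': "m < length ys * (length xs * length ys)" using m by simp
      note dm = div_mod_less[OF m'] and dr = div_mod_less[of ?r "length xs" "length ys"]
      let ?k = "?r div length ys" and ?l = "?r mod length ys"
      have kl: "?k < length xs" "?l < length ys" using dm dr by auto
      have mm: "m = (?j * length xs + ?k) * length ys + ?l"
        using div_mult_mod_eq[of m "length xs * length ys"] div_mult_mod_eq[of ?r "length ys"]
        by (simp add: algebra_simps)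
      have lt: "?j * length xs + ?k < length ys * length xs" by (rule pair_index_less) (use dm kl in auto)
      have md: "m div length ys = ?j * length xs + ?k" "m mod length ys = ?l"
        using pair_index_div[OF kl(2), of "?j * length xs + ?k"] mm by auto
      have eA: "entry A i m = entry (gid ys) i ?j \<boxtimes> entry e 0 ?r"
        using gtensm_entry[OF gid_hom[OF ys] e, of i m] i m' by (simp add: A_def)
      have eB: "entry B m i = entry c (?j * length xs + ?k) 0 \<boxtimes> entry (gid ys) ?l i"
        using gtensm_entry[OF c gid_hom[OF ys], of m i] i m' md by (simp add: B_def mult.assoc)
      have oj: "obj ys ?j \<in> Ob C" "obj ys ?l \<in> Ob C" "obj xs ?k \<in> Ob C"
        using gobs_nth[OF ys] gobs_nth[OF x] dm kl by blast+
      have me: "mor (entry e 0 ?r) (obj xs ?k \<odot> obj ys ?l) (Unit C)"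
        using gh_entry(1)[OF e ob(5,3), of 0 ?r] dm by (simp add: gtens_nth)
      have mc: "mor (entry c (?j * length xs + ?k) 0) (Unit C) (obj ys ?j \<odot> obj xs ?k)"
        using gh_entry(1)[OF c ob(3,4), of "?j * length xs + ?k" 0] lt dm kl
        by (simp add: gtens_nth_pair)
      have oT: "obj ?T m \<in> Ob C" using gobs_nth[OF ob(6) m] by blast
      have mA: "mor (entry A i m) (obj ?T m) ?W" and mB: "mor (entry B m i) ?W (obj ?T m)"
        using gh_entry(1)[OF A ob(6) ys i m] gh_entry(1)[OF B ys ob(6) m i] by auto
      have Tm: "obj ?T m = obj ys ?j \<odot> (obj xs ?k \<odot> obj ys ?l)"
        using m' dm by (simp add: gtens_nth)
      have zero: "\<theta> ?W \<cdot> Zero C ?W ?W = Scale C ?s (Zero C ?W ?W)"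
        using comp_zero[OF parity_mor[OF W] W] scale_Zero[OF W W] by simp
      show ?thesis
      proof (cases "?l = i \<and> ?j = i")
        case True
        have li: "?l = i" "?j = i" using True by auto
        have jj: "?j < length ys" using dm by auto
        note c2 = parity_coev'(2)[OF xs ys c kl(1) jj, unfolded li]
        have "\<theta> ?W \<cdot> ((Ident C ?W \<boxtimes> entry e 0 ?r) \<cdot> (entry c (i * length xs + ?k) 0 \<boxtimes> Ident C ?W)) =
          Scale C ?s ((Ident C ?W \<boxtimes> entry e 0 ?r) \<cdot> (entry c (i * length xs + ?k) 0 \<boxtimes> Ident C ?W))"
          by (rule parity_zigzag_term'[OF oj(3) W me[unfolded li] mc[unfolded li] c2])
        then show ?thesis using True i by (simp add: eA eB gid_entry)
      next
        case False
        then have "entry A i m = Zero C (obj ?T m) ?W \<or> entry B m i = Zero C ?W (obj ?T m)"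
        proof (cases "?j = i")
          case True
          with False have "?l \<noteq> i" by simp
          then have "entry B m i = entry c (?j * length xs + ?k) 0 \<boxtimes> Zero C ?W (obj ys ?l)"
            using kl i by (simp add: eB gid_entry)
          then show ?thesis using tens_zero[OF mc W oj(2)] W oj by (simp add: unit_tens Tm tens_assoc)
        next
          case False
          then have "entry A i m = Zero C (obj ys ?j) ?W \<boxtimes> entry e 0 ?r"
            using dm i by (simp add: eA gid_entry)
          then show ?thesis using zero_tens[OF me oj(1) W] W oj by (simp add: tens_unit Tm)
        qed
        then have "entry A i m \<cdot> entry B m i = Zero C ?W ?W"
          using zero_comp[OF mB W] comp_zero[OF mA W] by auto
        then show ?thesis using zero by simp
      qed
    qed
    show "\<theta> ?W \<cdot> entry (gid ys) i i = Scale C ?s (entry (gid ys) i i)"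
      unfolding AB[symmetric] gcomp_entry[OF B A i i] by (rule parity_msum[OF W W]) (use t(1) trm in auto)
  qed
qed

theorem fusion_subcategory_parity_objects:
  "fusion_subcategory (graded_product C n (\<lambda>_ _ _. 1)) parity_objects"
  unfolding fusion_subcategory_def
proof (intro conjI ballI impI)
  let ?G = "graded_product C n (\<lambda>_ _ _. 1)"
  show "parity_objects \<subseteq> Ob ?G" by (auto dest: parity_objectsD)
  show "Unit ?G \<in> parity_objects"
    using scale1[OF mor_ident[OF unit_ob]] pos_n
    by (auto simp: parity_objects_def gobs_def unit_ob parity_unit sign_def)
next
  fix xs ys assume xy: "xs \<in> parity_objects" "ys \<in> parity_objects"
  note x = parity_objectsD[OF xy(1)] and y = parity_objectsD[OF xy(2)]
  have "graded_tensor C n xs ys \<in> parity_objects"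
  proof (rule parity_objectsI[OF gtens_gobs[OF x(1) y(1)]])
    fix i assume "i < length (graded_tensor C n xs ys)"
    then have i: "i < length xs * length ys" by simp
    let ?k = "i div length ys" and ?l = "i mod length ys"
    have kl: "?k < length xs" "?l < length ys" using div_mod_less[OF i] by auto
    have o: "obj xs ?k \<in> Ob C" "obj ys ?l \<in> Ob C" using gobs_nth x(1) y(1) kl by blast+
    note iV = mor_ident[OF o(1)] and iW = mor_ident[OF o(2)]
    show "\<theta> (obj (graded_tensor C n xs ys) i) =
        Scale C (sign (deg (graded_tensor C n xs ys) i)) (Ident C (obj (graded_tensor C n xs ys) i))"
      using scalet[OF iV mor_scale[OF iW]] tscale[OF iV iW] scalescale[OF mor_tens[OF iV iW]]
      by (simp add: gtens_nth i parity_tens o x(2)[OF kl(1)] y(2)[OF kl(2)] sign_mod tens_ident)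
  qed
  then show "xs \<odot>\<^bsub>graded_product C n (\<lambda>_ _ _. 1)\<^esub> ys \<in> parity_objects" by simp
next
  let ?G = "graded_product C n (\<lambda>_ _ _. 1)"
  fix xs ys zs assume xy: "xs \<in> parity_objects" "ys \<in> parity_objects" and "zs \<in> Ob ?G"
    and "direct_sum ?G xs ys zs"
  then have zs: "zs \<in> gobs n" by simp
  obtain i j p r where i: "i \<in> graded_hom C xs zs" and j: "j \<in> graded_hom C ys zs"
    and p: "p \<in> graded_hom C zs xs" and r: "r \<in> graded_hom C zs ys"
    and s: "Add ?G (graded_comp C i p) (graded_comp C j r) = gid zs"
    using \<open>direct_sum ?G xs ys zs\<close> by (auto simp: direct_sum_def)
  note x = parity_objectsD(1)[OF xy(1)] and y = parity_objectsD(1)[OF xy(2)]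
  note ip = gcomp_hom[OF p i zs x zs] and jr = gcomp_hom[OF r j zs y zs]
  show "zs \<in> parity_objects"
  proof (rule parity_objects_ident[OF zs])
    fix k assume k: "k < length zs"
    have V: "obj zs k \<in> Ob C" using gobs_nth[OF zs k] by blast
    note e1 = gh_entry(1)[OF ip zs zs k k] and e2 = gh_entry(1)[OF jr zs zs k k]
    show "\<theta> (obj zs k) \<cdot> entry (gid zs) k k = Scale C (sign (deg zs k)) (entry (gid zs) k k)"
      unfolding s[symmetric] gp_add_entry[OF ip jr k k]
      using cadd[OF parity_mor[OF V] e1 e2] scale_add[OF V V morD(3)[OF e1] morD(3)[OF e2]]
        parity_objects_factor[OF p i zs xy(1) zs k k] parity_objects_factor[OF r j zs xy(2) zs k k] by simp
  qed
next
  let ?G = "graded_product C n (\<lambda>_ _ _. 1)"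
  fix zs ys assume "zs \<in> Ob ?G" and y: "ys \<in> parity_objects" and "direct_summand ?G zs ys"
  then have zs: "zs \<in> gobs n" by simp
  obtain i p where i: "i \<in> graded_hom C zs ys" and p: "p \<in> graded_hom C ys zs"
    and s: "graded_comp C p i = gid zs"
    using \<open>direct_summand ?G zs ys\<close> by (auto simp: direct_summand_def)
  show "zs \<in> parity_objects"
    by (rule parity_objects_ident[OF zs]) (unfold s[symmetric], rule parity_objects_factor[OF i p zs y zs])
next
  let ?G = "graded_product C n (\<lambda>_ _ _. 1)"
  fix xs ys assume x: "xs \<in> parity_objects" and "ys \<in> Ob ?G" and d: "dual_objects ?G xs ys \<or> dual_objects ?G ys xs"
  then have y: "ys \<in> gobs n" by simp
  show "ys \<in> parity_objects" using d parity_dual_left[OF x y] parity_dual_right[OF x y] by blast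
qed

end

section \<open>Fusion subcategories of the graded product are determined by singletons\<close>

context strict_tensor_category
begin

definition incl :: "'o graded \<Rightarrow> 'o graded \<Rightarrow> (nat \<Rightarrow> nat) \<Rightarrow> ('o graded, 'm mat) arrow" where
  "incl xs ys \<phi> = Arr xs ys (mat (length ys) (length xs)
     (\<lambda>(i, j). if i = \<phi> j then Ident C (obj xs j) else Zero C (obj xs j) (obj ys i)))"

definition proj :: "'o graded \<Rightarrow> 'o graded \<Rightarrow> (nat \<Rightarrow> nat) \<Rightarrow> ('o graded, 'm mat) arrow" where
  "proj xs ys \<phi> = Arr ys xs (mat (length xs) (length ys)
     (\<lambda>(j, i). if i = \<phi> j then Ident C (obj xs j) else Zero C (obj ys i) (obj xs j)))"

definition sublist_map :: "'o graded \<Rightarrow> 'o graded \<Rightarrow> (nat \<Rightarrow> nat) \<Rightarrow> bool" where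
  "sublist_map xs ys \<phi> \<longleftrightarrow> (\<forall>j<length xs. \<phi> j < length ys \<and> ys ! \<phi> j = xs ! j)"

lemma incl_entry: "i < length ys \<Longrightarrow> j < length xs \<Longrightarrow>
    entry (incl xs ys \<phi>) i j = (if i = \<phi> j then Ident C (obj xs j) else Zero C (obj xs j) (obj ys i))"
  by (simp add: incl_def entry_def)

lemma proj_entry: "i < length ys \<Longrightarrow> j < length xs \<Longrightarrow>
    entry (proj xs ys \<phi>) j i = (if i = \<phi> j then Ident C (obj xs j) else Zero C (obj ys i) (obj xs j))"
  by (simp add: proj_def entry_def)

lemma incl_hom:
  assumes "xs \<in> gobs n" "ys \<in> gobs n" "sublist_map xs ys \<phi>"
  shows "incl xs ys \<phi> \<in> graded_hom C xs ys"
  unfolding incl_def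
proof (rule gh_mat)
  fix i j assume ij: "i < length ys" "j < length xs"
  have o: "obj xs j \<in> Ob C" "obj ys i \<in> Ob C" using gobs_nth assms ij by blast+
  have s: "i = \<phi> j \<Longrightarrow> ys ! i = xs ! j" using assms(3) ij by (simp add: sublist_map_def)
  show "mor (if i = \<phi> j then Ident C (obj xs j) else Zero C (obj xs j) (obj ys i)) (obj xs j) (obj ys i)"
    using s mor_ident[OF o(1)] mor_zero[OF o] by (cases "i = \<phi> j") simp_all
  show "deg xs j \<noteq> deg ys i \<Longrightarrow> (if i = \<phi> j then Ident C (obj xs j) else Zero C (obj xs j) (obj ys i)) =
      Zero C (obj xs j) (obj ys i)" using s by (cases "i = \<phi> j") simp_all
qed

lemma proj_hom:
  assumes "xs \<in> gobs n" "ys \<in> gobs n" "sublist_map xs ys \<phi>"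
  shows "proj xs ys \<phi> \<in> graded_hom C ys xs"
  unfolding proj_def
proof (rule gh_mat)
  fix j i assume ij: "j < length xs" "i < length ys"
  have o: "obj xs j \<in> Ob C" "obj ys i \<in> Ob C" using gobs_nth assms ij by blast+
  have s: "i = \<phi> j \<Longrightarrow> ys ! i = xs ! j" using assms(3) ij by (simp add: sublist_map_def)
  show "mor (if i = \<phi> j then Ident C (obj xs j) else Zero C (obj ys i) (obj xs j)) (obj ys i) (obj xs j)"
    using s mor_ident[OF o(1)] mor_zero[OF o(2,1)] by (cases "i = \<phi> j") simp_all
  show "deg ys i \<noteq> deg xs j \<Longrightarrow> (if i = \<phi> j then Ident C (obj xs j) else Zero C (obj ys i) (obj xs j)) =
      Zero C (obj ys i) (obj xs j)" using s by (cases "i = \<phi> j") simp_all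
qed

lemma gcomp_incl_entry:
  assumes "xs \<in> gobs n" "ys \<in> gobs n" "zs \<in> gobs n" "sublist_map xs ys \<phi>" "f \<in> graded_hom C ys zs"
    "i < length zs" "j < length xs"
  shows "entry (graded_comp C f (incl xs ys \<phi>)) i j = entry f i (\<phi> j)"
proof -
  have l: "\<phi> j < length ys" "ys ! \<phi> j = xs ! j" using assms by (auto simp: sublist_map_def)
  note f = gh_entry(1)[OF assms(5,2,3,6)]
  have o: "obj xs j \<in> Ob C" using gobs_nth assms by blast
  show ?thesis
    unfolding gcomp_entry[OF incl_hom[OF assms(1,2,4)] assms(5-7)]
    using msum_single[of "\<phi> j" "length ys" "\<lambda>l. entry f i l \<cdot> entry (incl xs ys \<phi>) l j" "obj xs j" "obj zs i"]
      l f[OF l(1)] rid[OF f[OF l(1)]] comp_zero[OF f o] assms(7)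
    by (simp add: incl_entry)
qed

lemma proj_gcomp_entry:
  assumes "xs \<in> gobs n" "ys \<in> gobs n" "zs \<in> gobs n" "sublist_map xs ys \<phi>" "f \<in> graded_hom C zs ys"
    "j < length xs" "i < length zs"
  shows "entry (graded_comp C (proj xs ys \<phi>) f) j i = entry f (\<phi> j) i"
proof -
  have l: "\<phi> j < length ys" "ys ! \<phi> j = xs ! j" using assms by (auto simp: sublist_map_def)
  note f = gh_entry(1)[OF assms(5,3,2) _ assms(7)]
  have o: "obj xs j \<in> Ob C" using gobs_nth assms by blast
  show ?thesis
    unfolding gcomp_entry[OF assms(5) proj_hom[OF assms(1,2,4)] assms(6,7)]
    using msum_single[of "\<phi> j" "length ys" "\<lambda>l. entry (proj xs ys \<phi>) j l \<cdot> entry f l i" "obj zs i" "obj xs j"]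
      l f[OF l(1)] lid[OF f[OF l(1)]] zero_comp[OF f o] assms(6)
    by (simp add: proj_entry)
qed

lemma proj_incl:
  assumes "xs \<in> gobs n" "ys \<in> gobs n" "sublist_map xs ys \<phi>" "inj_on \<phi> {..<length xs}"
  shows "graded_comp C (proj xs ys \<phi>) (incl xs ys \<phi>) = gid xs"
proof (rule gh_eqI[OF gcomp_hom[OF incl_hom proj_hom] gid_hom])
  fix i j assume ij: "i < length xs" "j < length xs"
  then have "\<phi> i < length ys" "ys ! \<phi> i = xs ! i" "\<phi> i = \<phi> j \<longleftrightarrow> i = j"
    using assms by (auto simp: sublist_map_def inj_on_def)
  then show "entry (graded_comp C (proj xs ys \<phi>) (incl xs ys \<phi>)) i j = entry (gid xs) i j"
    using proj_gcomp_entry[OF assms(1,2,1,3) incl_hom[OF assms(1-3)] ij] ij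
    by (simp add: incl_entry gid_entry)
qed (use assms in auto)

lemma direct_summand_sublist:
  assumes "xs \<in> gobs n" "ys \<in> gobs n" "sublist_map xs ys \<phi>" "inj_on \<phi> {..<length xs}"
  shows "direct_summand (graded_product C n \<omega>) xs ys"
  unfolding direct_summand_def
  using incl_hom[OF assms(1-3)] proj_hom[OF assms(1-3)] proj_incl[OF assms]
  by (intro bexI[of _ "incl xs ys \<phi>"] bexI[of _ "proj xs ys \<phi>"]) simp_all

lemma direct_sum_Cons:
  assumes x: "[x] \<in> gobs n" and ys: "ys \<in> gobs n"
  shows "direct_sum (graded_product C n \<omega>) [x] ys (x # ys)"
proof -
  let ?zs = "x # ys" and ?a = "\<lambda>_::nat. 0::nat"
  let ?G = "graded_product C n \<omega>"
  have zs: "?zs \<in> gobs n" using assms by (auto simp: gobs_def)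
  have a: "sublist_map [x] ?zs ?a" "inj_on ?a {..<length [x]}" by (auto simp: sublist_map_def inj_on_def)
  have b: "sublist_map ys ?zs Suc" "inj_on Suc {..<length ys}" by (auto simp: sublist_map_def)
  note ia = incl_hom[OF x zs a(1)] and pa = proj_hom[OF x zs a(1)]
  note ib = incl_hom[OF ys zs b(1)] and pb = proj_hom[OF ys zs b(1)]
  have oz: "obj ?zs i \<in> Ob C" if "i < length ?zs" for i using gobs_nth[OF zs that] by blast
  have z: "Zero ?G us vs \<in> graded_hom C us vs"
    "i < length vs \<Longrightarrow> j < length us \<Longrightarrow> entry (Zero ?G us vs) i j = Zero C (obj us j) (obj vs i)"
    if "us \<in> gobs n" "vs \<in> gobs n" for us vs i j
    unfolding gp_zero using that gobs_nth[OF that(1)] gobs_nth[OF that(2)]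
    by (auto intro!: gh_mat simp: mor_zero entry_def)
  have 1: "graded_comp C (proj ys ?zs Suc) (incl [x] ?zs ?a) = Zero ?G [x] ys"
  proof (rule gh_eqI[OF gcomp_hom[OF ia pb x zs ys] z(1)[OF x ys]])
    fix i j assume ij: "i < length ys" "j < length [x]"
    then show "entry (graded_comp C (proj ys ?zs Suc) (incl [x] ?zs ?a)) i j = entry (Zero ?G [x] ys) i j"
      using proj_gcomp_entry[OF ys zs x b(1) ia ij] z(2)[OF x ys ij] by (simp add: incl_entry)
  qed
  have 2: "graded_comp C (proj [x] ?zs ?a) (incl ys ?zs Suc) = Zero ?G ys [x]"
  proof (rule gh_eqI[OF gcomp_hom[OF ib pa ys zs x] z(1)[OF ys x]])
    fix i j assume ij: "i < length [x]" "j < length ys"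
    then show "entry (graded_comp C (proj [x] ?zs ?a) (incl ys ?zs Suc)) i j = entry (Zero ?G ys [x]) i j"
      using proj_gcomp_entry[OF x zs ys a(1) ib ij] z(2)[OF ys x ij] by (simp add: incl_entry)
  qed
  note ipa = gcomp_hom[OF pa ia zs x zs] and ipb = gcomp_hom[OF pb ib zs ys zs]
  have 3: "Add ?G (graded_comp C (incl [x] ?zs ?a) (proj [x] ?zs ?a)) (graded_comp C (incl ys ?zs Suc) (proj ys ?zs Suc)) =
      gid ?zs" (is "Add ?G ?p ?q = _")
  proof (rule gh_eqI[OF _ gid_hom[OF zs]])
    show "Add ?G ?p ?q \<in> graded_hom C ?zs ?zs"
    proof -
      have "Add ?G ?p ?q = Arr ?zs ?zs (mat (length ?zs) (length ?zs) (\<lambda>(i, j). Add C (entry ?p i j) (entry ?q i j)))"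
        using gh_arr[OF ipa] by (auto simp: graded_product_def entry_def intro!: eq_matI)
      moreover have "\<dots> \<in> graded_hom C ?zs ?zs"
      proof (rule gh_mat)
        fix i j assume ij: "i < length ?zs" "j < length ?zs"
        note e = gh_entry[OF ipa zs zs ij] gh_entry[OF ipb zs zs ij]
        show "mor (Add C (entry ?p i j) (entry ?q i j)) (obj ?zs j) (obj ?zs i)"
          by (rule mor_add[OF e(1,3)])
        show "deg ?zs j \<noteq> deg ?zs i \<Longrightarrow> Add C (entry ?p i j) (entry ?q i j) = Zero C (obj ?zs j) (obj ?zs i)"
          using e(2,4) addz[OF mor_zero[OF oz[OF ij(2)] oz[OF ij(1)]]] by simp
      qed
      ultimately show ?thesis by simp
    qed
    fix i j assume ij: "i < length ?zs" "j < length ?zs"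
    have p: "entry ?p i j = entry (incl [x] ?zs ?a) i 0 \<cdot> entry (proj [x] ?zs ?a) 0 j"
      using gcomp_entry[OF pa ia ij] addz[OF gcomp_terms(1)[OF pa ia zs x zs ij, of 0]] by simp
    have q: "entry ?q i j = msum (obj ?zs j) (obj ?zs i)
        (map (\<lambda>l. entry (incl ys ?zs Suc) i l \<cdot> entry (proj ys ?zs Suc) l j) [0..<length ys])"
      using gcomp_entry[OF pb ib ij] by simp
    note t = gcomp_terms(1)[OF pb ib zs ys zs ij]
    have oi: "obj ?zs i \<in> Ob C" "obj ?zs j \<in> Ob C" "fst x \<in> Ob C" using oz ij oz[of 0] by auto
    have q0: "entry ?q i j = Zero C (obj ?zs j) (obj ?zs i)" if "i = 0 \<or> i \<noteq> j"
      unfolding q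
    proof (rule msum_zero[OF oi(2,1)])
      fix f assume "f \<in> set (map (\<lambda>l. entry (incl ys ?zs Suc) i l \<cdot> entry (proj ys ?zs Suc) l j) [0..<length ys])"
      then obtain l where l: "l < length ys" "f = entry (incl ys ?zs Suc) i l \<cdot> entry (proj ys ?zs Suc) l j" by auto
      have ol: "obj ys l \<in> Ob C" using oz[of "Suc l"] l by simp
      have "entry (incl ys ?zs Suc) i l = Zero C (obj ys l) (obj ?zs i) \<or>
          entry (proj ys ?zs Suc) l j = Zero C (obj ?zs j) (obj ys l)"
        using that l ij by (auto simp: incl_entry proj_entry)
      then show "f = Zero C (obj ?zs j) (obj ?zs i)"
        using l(2) zero_comp[OF gh_entry(1)[OF pb zs ys l(1) ij(2)] oi(1)]
          comp_zero[OF gh_entry(1)[OF ib ys zs ij(1) l(1)] oi(2)] by auto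
    qed
    have m1: "mor (Ident C (fst x)) (fst x) (fst x)" by (rule mor_ident[OF oi(3)])
    show "entry (Add ?G ?p ?q) i j = entry (gid ?zs) i j"
    proof (cases i)
      case 0
      then show ?thesis
        unfolding gp_add_entry[OF ipa ipb ij] p using q0 ij oi zero_comp[OF mor_zero[OF oi(2,3)] oi(3)]
          lid[OF m1] addz[OF m1] addz[OF mor_zero[OF oi(2,1)]] lid[OF mor_zero[OF oi(2,3)]]
        by (cases "j = 0") (simp_all add: incl_entry proj_entry gid_entry)
    next
      case (Suc i')
      have p0: "entry ?p i j = Zero C (obj ?zs j) (obj ?zs i)"
        unfolding p using ij Suc zero_comp[OF gh_entry(1)[OF pa zs x _ ij(2), of 0] oi(1)] by (simp add: incl_entry)
      show ?thesis
      proof (cases "i = j")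
        case True
        have i': "i' < length ys" using ij Suc by simp
        have oi': "obj ys i' \<in> Ob C" using oi(1) Suc by simp
        have "entry ?q i j = entry (incl ys ?zs Suc) i i' \<cdot> entry (proj ys ?zs Suc) i' j"
          unfolding q
        proof (rule msum_single[where f = "\<lambda>l. entry (incl ys ?zs Suc) i l \<cdot> entry (proj ys ?zs Suc) l j", OF i' t[OF i']])
          fix m assume m: "m < length ys" "m \<noteq> i'"
          then show "entry (incl ys ?zs Suc) i m \<cdot> entry (proj ys ?zs Suc) m j = Zero C (obj ?zs j) (obj ?zs i)"
            using zero_comp[OF gh_entry(1)[OF pb zs ys m(1) ij(2)] oi(1)] ij Suc by (simp add: incl_entry)
        qed
        also have "\<dots> = Ident C (obj ?zs i)"
        proof -
          have "j = Suc i'" "i = Suc i'" using True Suc by simp_all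
          then show ?thesis using i' lid[OF mor_ident[OF oi']] by (simp add: incl_entry proj_entry)
        qed
        finally show ?thesis
          unfolding gp_add_entry[OF ipa ipb ij] p0 using True ij zero_add[OF mor_ident[OF oi(1)]]
          by (simp add: gid_entry)
      next
        case False
        then show ?thesis
          unfolding gp_add_entry[OF ipa ipb ij] p0 using q0 ij addz[OF mor_zero[OF oi(2,1)]]
          by (simp add: gid_entry)
      qed
    qed
  qed
  show ?thesis
    unfolding direct_sum_def
    using ia ib pa pb proj_incl[OF x zs a] proj_incl[OF ys zs b] 1 2 3
    by (intro bexI[of _ "incl [x] ?zs ?a"] bexI[of _ "incl ys ?zs Suc"]
        bexI[of _ "proj [x] ?zs ?a"] bexI[of _ "proj ys ?zs Suc"]) simp_all
qed

lemma through_list: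
  assumes "f \<in> through P V W"
  shows "\<exists>ts. (\<forall>(L, i, p)\<in>set ts. L \<in> P \<and> i \<in> Hom C L W \<and> p \<in> Hom C V L) \<and>
    f = msum V W (map (\<lambda>(L, i, p). i \<cdot> p) ts)"
  using assms
proof (induction rule: through.induct)
  case through_zero
  show ?case by (rule exI[of _ "[]"]) simp
next
  case (through_add f L p i)
  then obtain ts where "\<forall>(L, i, p)\<in>set ts. L \<in> P \<and> i \<in> Hom C L W \<and> p \<in> Hom C V L"
    "f = msum V W (map (\<lambda>(L, i, p). i \<cdot> p) ts)" by blast
  with through_add show ?case by (intro exI[of _ "(L, i, p) # ts"]) simp
qed

lemma direct_summand_through:
  assumes "Ident C V \<in> through P V V" "P \<subseteq> Ob C" "V \<in> Ob C" "a < n"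
  shows "\<exists>ys. set ys \<subseteq> P \<times> {a} \<and> direct_summand (graded_product C n \<omega>) [(V, a)] ys"
proof -
  obtain ts where ts: "\<forall>(L, i, p)\<in>set ts. L \<in> P \<and> i \<in> Hom C L V \<and> p \<in> Hom C V L"
    and id: "Ident C V = msum V V (map (\<lambda>(L, i, p). i \<cdot> p) ts)"
    using through_list[OF assms(1)] by blast
  define ys where "ys = map (\<lambda>t. (fst t, a)) ts"
  define I where "I = Arr [(V, a)] ys (mat (length ys) (length [(V, a)]) (\<lambda>(k, _). snd (snd (ts ! k))))"
  define Q where "Q = Arr ys [(V, a)] (mat (length [(V, a)]) (length ys) (\<lambda>(_, k). fst (snd (ts ! k))))"
  have tk: "fst (ts ! k) \<in> P" "fst (snd (ts ! k)) \<in> Hom C (fst (ts ! k)) V" "snd (snd (ts ! k)) \<in> Hom C V (fst (ts ! k))"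
    if "k < length ts" for k
    using ts nth_mem[OF that] by (auto simp: split_beta)
  have y: "set ys \<subseteq> P \<times> {a}" using ts by (auto simp: ys_def)
  have yg: "ys \<in> gobs n" "[(V, a)] \<in> gobs n" using y assms by (auto simp: gobs_def)
  have yk: "ys ! k = (fst (ts ! k), a)" if "k < length ts" for k using that by (simp add: ys_def)
  have ly: "length ys = length ts" by (simp add: ys_def)
  have m: "mor (fst (snd (ts ! k))) (fst (ts ! k)) V" "mor (snd (snd (ts ! k))) V (fst (ts ! k))" if "k < length ts" for k
    using tk[OF that] assms by (auto simp: mor_def)
  have I: "I \<in> graded_hom C [(V, a)] ys" unfolding I_def
    by (rule gh_mat) (use m yk ly in auto)
  have Q: "Q \<in> graded_hom C ys [(V, a)]" unfolding Q_def
    by (rule gh_mat) (use m yk ly in auto)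
  have "graded_comp C Q I = gid [(V, a)]"
  proof (rule gh_eqI[OF gcomp_hom[OF I Q yg(2,1,2)] gid_hom[OF yg(2)]])
    fix i j assume ij: "i < length [(V, a)]" "j < length [(V, a)]"
    have "map (\<lambda>l. entry Q i l \<cdot> entry I l j) [0..<length ys] = map (\<lambda>(L, i, p). i \<cdot> p) ts"
      using ij by (intro nth_equalityI) (auto simp: ly I_def Q_def entry_def split_beta)
    then show "entry (graded_comp C Q I) i j = entry (gid [(V, a)]) i j"
      unfolding gcomp_entry[OF I Q ij] using ij id by (simp add: gid_entry)
  qed
  then have "direct_summand (graded_product C n \<omega>) [(V, a)] ys"
    unfolding direct_summand_def using I Q by (intro bexI[of _ I] bexI[of _ Q]) simp_all
  with y show ?thesis by blast
qed

lemma full_subcat_relations: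
  "direct_sum (full_subcat C' S) = direct_sum C'" "direct_summand (full_subcat C' S) = direct_summand C'"
  by (simp_all add: fun_eq_iff direct_sum_def direct_summand_def)

lemma fusion_subcat_closed:
  assumes "fusion_subcategory (full_subcat (graded_product C n \<omega>) OB) S"
  shows "S \<subseteq> OB" "[(Unit C, 0)] \<in> S"
    "xs \<in> S \<Longrightarrow> ys \<in> S \<Longrightarrow> graded_tensor C n xs ys \<in> S"
    "xs \<in> S \<Longrightarrow> ys \<in> S \<Longrightarrow> zs \<in> OB \<Longrightarrow> direct_sum (graded_product C n \<omega>) xs ys zs \<Longrightarrow> zs \<in> S"
    "xs \<in> OB \<Longrightarrow> ys \<in> S \<Longrightarrow> direct_summand (graded_product C n \<omega>) xs ys \<Longrightarrow> xs \<in> S"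
  using assms unfolding fusion_subcategory_def full_subcat_relations full_subcat_simps gp_simps by blast+

lemma fusion_subcat_Nil:
  assumes S: "fusion_subcategory (full_subcat (graded_product C n \<omega>) OB) S" and OB: "OB \<subseteq> gobs n" "[] \<in> OB"
  shows "[] \<in> S"
proof -
  note cl = fusion_subcat_closed[OF S]
  have "[(Unit C, 0)] \<in> gobs n" using cl(1,2) OB by blast
  then have "direct_summand (graded_product C n \<omega>) [] [(Unit C, 0)]"
    using OB by (intro direct_summand_sublist[of _ _ _ id]) (auto simp: sublist_map_def)
  then show ?thesis by (rule cl(5)[OF OB(2) cl(2)])
qed

lemma fusion_subcat_singleton:
  assumes S: "fusion_subcategory (full_subcat (graded_product C n \<omega>) OB) S" and OB: "OB \<subseteq> gobs n"
    and xs: "xs \<in> S" "x \<in> set xs" "[x] \<in> OB"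
  shows "[x] \<in> S"
proof -
  obtain i where i: "i < length xs" "x = xs ! i" using xs(2) by (metis in_set_conv_nth)
  have g: "xs \<in> gobs n" "[x] \<in> gobs n" using fusion_subcat_closed(1)[OF S] OB xs(1,3) by blast+
  have "direct_summand (graded_product C n \<omega>) [x] xs"
    by (rule direct_summand_sublist[OF g(2,1), of "\<lambda>_. i"]) (use i in \<open>simp_all add: sublist_map_def inj_on_def\<close>)
  then show ?thesis by (rule fusion_subcat_closed(5)[OF S xs(3,1)])
qed

lemma fusion_subcat_list:
  assumes S: "fusion_subcategory (full_subcat (graded_product C n \<omega>) OB) S" and OB: "OB \<subseteq> gobs n"
    and Ol: "\<And>ys. ys \<in> gobs n \<Longrightarrow> (\<And>y. y \<in> set ys \<Longrightarrow> [y] \<in> S) \<Longrightarrow> ys \<in> OB"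
  shows "(\<And>x. x \<in> set xs \<Longrightarrow> [x] \<in> S) \<Longrightarrow> xs \<in> S"
proof (induction xs)
  case Nil
  then show ?case using fusion_subcat_Nil[OF S OB] Ol[of "[]"] by (simp add: gobs_def)
next
  case (Cons x xs)
  have x: "[x] \<in> S" and xs: "xs \<in> S" using Cons by simp_all
  then have g: "[x] \<in> gobs n" "xs \<in> gobs n" using fusion_subcat_closed(1)[OF S] OB by blast+
  then have "x # xs \<in> gobs n" by (simp add: gobs_def)
  then have "x # xs \<in> OB" using Ol Cons.prems by blast
  then show ?case by (rule fusion_subcat_closed(4)[OF S x xs _ direct_sum_Cons[OF g]])
qed

lemma fusion_subcat_through:
  assumes S: "fusion_subcategory (full_subcat (graded_product C n \<omega>) OB) S" and OB: "OB \<subseteq> gobs n"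
    and Ol: "\<And>ys. ys \<in> gobs n \<Longrightarrow> (\<And>y. y \<in> set ys \<Longrightarrow> [y] \<in> S) \<Longrightarrow> ys \<in> OB"
    and V: "Ident C V \<in> through P V V" "P \<subseteq> Ob C" "[(V, a)] \<in> OB" and P: "\<And>L. L \<in> P \<Longrightarrow> [(L, a)] \<in> S"
  shows "[(V, a)] \<in> S"
proof -
  have "[(V, a)] \<in> gobs n" using V(3) OB by blast
  then have "V \<in> Ob C" "a < n" by (auto simp: gobs_def)
  then obtain ys where ys: "set ys \<subseteq> P \<times> {a}" "direct_summand (graded_product C n \<omega>) [(V, a)] ys"
    using direct_summand_through[OF V(1,2)] by blast
  have sing: "[x] \<in> S" if x: "x \<in> set ys" for x
  proof -
    from x ys(1) obtain L where "x = (L, a)" "L \<in> P" by auto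
    then show ?thesis using P by simp
  qed
  have "ys \<in> S" by (rule fusion_subcat_list[OF S OB]) (rule Ol, assumption, blast, rule sing, assumption)
  then show ?thesis by (rule fusion_subcat_closed(5)[OF S V(3) _ ys(2)])
qed

lemma fusion_subcat_tens:
  assumes "fusion_subcategory (full_subcat (graded_product C n \<omega>) OB) S" "[(V, a)] \<in> S" "[(W, b)] \<in> S"
  shows "[(V \<odot> W, (a + b) mod n)] \<in> S"
  using fusion_subcat_closed(3)[OF assms] by (simp add: graded_tensor_def)

end

section \<open>Braidings on the graded product in terms of homogeneous objects\<close>

locale graded_braiding = strict_tensor_category C for C :: "('o, 'm, 'k::field) lincat" (structure) +
  fixes n :: nat and \<omega> :: "nat \<Rightarrow> nat \<Rightarrow> nat \<Rightarrow> 'k" and OB :: "'o graded set"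
    and c :: "'o graded \<Rightarrow> 'o graded \<Rightarrow> ('o graded, 'm mat) arrow"
  assumes pos_n: "0 < n" and omega_nonzero: "\<omega> a b d \<noteq> 0"
    and OB_gobs: "OB \<subseteq> gobs n"
    and OB_unit: "[(Unit C, 0)] \<in> OB"
    and OB_tens: "xs \<in> OB \<Longrightarrow> ys \<in> OB \<Longrightarrow> graded_tensor C n xs ys \<in> OB"
    and OB_singleton: "xs \<in> OB \<Longrightarrow> x \<in> set xs \<Longrightarrow> [x] \<in> OB"
    and braided: "braiding (full_subcat (graded_product C n \<omega>) OB) c"
begin

abbreviation "T \<equiv> graded_tensor C n"

lemma gobs_OB: "xs \<in> OB \<Longrightarrow> xs \<in> gobs n" using OB_gobs by blast

lemma braiding_iso:
  assumes "xs \<in> OB" "ys \<in> OB"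
  shows "c xs ys \<in> graded_hom C (T xs ys) (T ys xs)"
    "\<exists>g\<in>graded_hom C (T ys xs) (T xs ys).
        graded_comp C g (c xs ys) = gid (T xs ys) \<and> graded_comp C (c xs ys) g = gid (T ys xs)"
  using braided assms unfolding braiding_def iso_arrow_def mutually_inverse_def full_subcat_simps gp_simps
  by blast+

lemma braiding_natural:
  assumes "xs \<in> OB" "xs' \<in> OB" "ys \<in> OB" "ys' \<in> OB" "f \<in> graded_hom C xs xs'" "g \<in> graded_hom C ys ys'"
  shows "graded_comp C (c xs' ys') (gtensm n f g) = graded_comp C (gtensm n g f) (c xs ys)"
  using braided assms unfolding braiding_def full_subcat_simps gp_simps by blast

lemma braiding_hexagon:
  assumes "xs \<in> OB" "ys \<in> OB" "zs \<in> OB"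
  shows "graded_comp C (graded_comp C (graded_assoc C n \<omega> ys zs xs) (c xs (T ys zs))) (graded_assoc C n \<omega> xs ys zs) =
      graded_comp C (graded_comp C (gtensm n (gid ys) (c xs zs)) (graded_assoc C n \<omega> ys xs zs)) (gtensm n (c xs ys) (gid zs))"
    "graded_comp C (graded_comp C
        (inverse_arrow (full_subcat (graded_product C n \<omega>) OB) (T (T zs xs) ys) (T zs (T xs ys)) (graded_assoc C n \<omega> zs xs ys))
        (c (T xs ys) zs))
        (inverse_arrow (full_subcat (graded_product C n \<omega>) OB) (T (T xs ys) zs) (T xs (T ys zs)) (graded_assoc C n \<omega> xs ys zs)) =
      graded_comp C (graded_comp C (gtensm n (c xs zs) (gid ys))
        (inverse_arrow (full_subcat (graded_product C n \<omega>) OB) (T (T xs zs) ys) (T xs (T zs ys)) (graded_assoc C n \<omega> xs zs ys)))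
        (gtensm n (gid xs) (c ys zs))"
  using braided assms unfolding braiding_def full_subcat_simps gp_simps by blast+

lemma gcomp_entry_single:
  assumes "f \<in> graded_hom C xs ys" "g \<in> graded_hom C ys zs" "xs \<in> gobs n" "ys \<in> gobs n" "zs \<in> gobs n"
    "length xs = 1" "length ys = 1" "length zs = 1"
  shows "entry (graded_comp C g f) 0 0 = entry g 0 0 \<cdot> entry f 0 0"
  using gcomp_entry[OF assms(1,2), of 0 0] addz[OF gcomp_terms(1)[OF assms(1-5), of 0 0 0]] assms by simp

lemma gtensm_entry_single:
  assumes "f \<in> graded_hom C xs xs'" "g \<in> graded_hom C ys ys'"
    "length xs = 1" "length ys = 1" "length xs' = 1" "length ys' = 1"
  shows "entry (gtensm n f g) 0 0 = entry f 0 0 \<boxtimes> entry g 0 0"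
  using gtensm_entry[OF assms(1,2), of 0 0] assms by simp

definition homog :: "'o \<Rightarrow> nat \<Rightarrow> bool" where "homog V a \<longleftrightarrow> [(V, a)] \<in> OB"

lemma homogD: "homog V a \<Longrightarrow> [(V, a)] \<in> OB" "homog V a \<Longrightarrow> [(V, a)] \<in> gobs n"
  "homog V a \<Longrightarrow> V \<in> Ob C" "homog V a \<Longrightarrow> a < n"
  using OB_gobs by (auto simp: homog_def gobs_def)

lemma T_single: "T [(V, a)] [(W, b)] = [(V \<odot> W, (a + b) mod n)]"
  by (simp add: graded_tensor_def)

lemma homog_tens: "homog V a \<Longrightarrow> homog W b \<Longrightarrow> homog (V \<odot> W) ((a + b) mod n)"
  using OB_tens[of "[(V, a)]" "[(W, b)]"] by (simp add: homog_def T_single)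

definition kk :: "'o \<Rightarrow> nat \<Rightarrow> 'o \<Rightarrow> nat \<Rightarrow> 'm" where
  "kk V a W b = entry (c [(V, a)] [(W, b)]) 0 0"

lemma mor_kk:
  assumes "homog V a" "homog W b"
  shows "mor (kk V a W b) (V \<odot> W) (W \<odot> V)"
proof -
  note h = homogD(1)[OF assms(1)] homogD(1)[OF assms(2)]
  have "T [(V, a)] [(W, b)] \<in> gobs n" "T [(W, b)] [(V, a)] \<in> gobs n"
    using h OB_tens gobs_OB by blast+
  then show ?thesis
    using gh_entry(1)[OF braiding_iso(1)[OF h], of n 0 0] by (simp add: kk_def T_single)
qed

lemma kk_iso:
  assumes "homog V a" "homog W b"
  shows "\<exists>g. mor g (W \<odot> V) (V \<odot> W) \<and> g \<cdot> kk V a W b = Ident C (V \<odot> W) \<and> kk V a W b \<cdot> g = Ident C (W \<odot> V)"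
proof -
  note h = homogD(1)[OF assms(1)] homogD(1)[OF assms(2)]
  let ?VW = "T [(V, a)] [(W, b)]" and ?WV = "T [(W, b)] [(V, a)]"
  have o: "?VW \<in> gobs n" "?WV \<in> gobs n" using h OB_tens gobs_OB by blast+
  have l: "length ?VW = 1" "length ?WV = 1" by (simp_all add: T_single)
  obtain g where g: "g \<in> graded_hom C ?WV ?VW" "graded_comp C g (c [(V, a)] [(W, b)]) = gid ?VW"
    "graded_comp C (c [(V, a)] [(W, b)]) g = gid ?WV"
    using braiding_iso(2)[OF h] by blast
  note cc = braiding_iso(1)[OF h]
  have "mor (entry g 0 0) (W \<odot> V) (V \<odot> W)"
    using gh_entry(1)[OF g(1) o(2,1), of 0 0] by (simp add: T_single)
  moreover have "entry g 0 0 \<cdot> kk V a W b = Ident C (V \<odot> W)"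
    using gcomp_entry_single[OF cc g(1) o(1,2,1) l(1,2,1)] g(2) gid_entry[of 0 ?VW 0] by (simp add: kk_def T_single)
  moreover have "kk V a W b \<cdot> entry g 0 0 = Ident C (W \<odot> V)"
    using gcomp_entry_single[OF g(1) cc o(2,1,2) l(2,1,2)] g(3) gid_entry[of 0 ?WV 0] by (simp add: kk_def T_single)
  ultimately show ?thesis by blast
qed

lemma single_hom:
  assumes "mor f V W"
  shows "Arr [(V, a)] [(W, a)] (mat (length [(W, a)]) (length [(V, a)]) (\<lambda>(i, j). f)) \<in> graded_hom C [(V, a)] [(W, a)]"
    "entry (Arr [(V, a)] [(W, a)] (mat (length [(W, a)]) (length [(V, a)]) (\<lambda>(i, j). f))) 0 0 = f"
  by (rule gh_mat) (use assms in \<open>simp_all add: entry_def\<close>)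

lemma kk_natural:
  assumes "homog V a" "homog V' a" "homog W b" "homog W' b" and f: "mor f V V'" and g: "mor g W W'"
  shows "kk V' a W' b \<cdot> (f \<boxtimes> g) = (g \<boxtimes> f) \<cdot> kk V a W b"
proof -
  note h = homogD(1)[OF assms(1)] homogD(1)[OF assms(2)] homogD(1)[OF assms(3)] homogD(1)[OF assms(4)]
  note o = h[THEN gobs_OB] and t = OB_tens[THEN gobs_OB]
  note F = single_hom[OF f, of a] and G = single_hom[OF g, of b]
  let ?F = "Arr [(V, a)] [(V', a)] (mat (length [(V', a)]) (length [(V, a)]) (\<lambda>(i, j). f))"
  let ?G = "Arr [(W, b)] [(W', b)] (mat (length [(W', b)]) (length [(W, b)]) (\<lambda>(i, j). g))"
  have e: "entry (gtensm n ?F ?G) 0 0 = f \<boxtimes> g" "entry (gtensm n ?G ?F) 0 0 = g \<boxtimes> f"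
    using gtensm_entry_single[OF F(1) G(1)] gtensm_entry_single[OF G(1) F(1)] F(2) G(2) by simp_all
  have "entry (graded_comp C (c [(V', a)] [(W', b)]) (gtensm n ?F ?G)) 0 0 = kk V' a W' b \<cdot> (f \<boxtimes> g)"
    using gcomp_entry_single[OF gtensm_hom[OF F(1) G(1) o(1,2,3,4)] braiding_iso(1)[OF h(2,4)]
        t[OF h(1,3)] t[OF h(2,4)] t[OF h(4,2)]] e by (simp add: T_single kk_def)
  moreover have "entry (graded_comp C (gtensm n ?G ?F) (c [(V, a)] [(W, b)])) 0 0 = (g \<boxtimes> f) \<cdot> kk V a W b"
    using gcomp_entry_single[OF braiding_iso(1)[OF h(1,3)] gtensm_hom[OF G(1) F(1) o(3,4,1,2)]
        t[OF h(1,3)] t[OF h(3,1)] t[OF h(4,2)]] e by (simp add: T_single kk_def)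
  ultimately show ?thesis using braiding_natural[OF h F(1) G(1)] by simp
qed

text \<open>The associativity constraint of homogeneous objects is the scalar \<open>\<omega>\<close>, its inverse the inverse
  scalar.\<close>

lemma assoc_single:
  assumes "homog V a" "homog W b" "homog U d"
  defines "t \<equiv> T [(V, a)] (T [(W, b)] [(U, d)])"
  shows "graded_assoc C n \<omega> [(V, a)] [(W, b)] [(U, d)] \<in> graded_hom C t t"
    "entry (graded_assoc C n \<omega> [(V, a)] [(W, b)] [(U, d)]) 0 0 = Scale C (\<omega> a b d) (Ident C (V \<odot> (W \<odot> U)))"
    "inverse_arrow (full_subcat (graded_product C n \<omega>) OB) t t (graded_assoc C n \<omega> [(V, a)] [(W, b)] [(U, d)]) \<in> graded_hom C t t"
    "entry (inverse_arrow (full_subcat (graded_product C n \<omega>) OB) t t (graded_assoc C n \<omega> [(V, a)] [(W, b)] [(U, d)])) 0 0 =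
      Scale C (inverse (\<omega> a b d)) (Ident C (V \<odot> (W \<odot> U)))"
proof -
  let ?A = "graded_assoc C n \<omega> [(V, a)] [(W, b)] [(U, d)]"
  let ?G = "full_subcat (graded_product C n \<omega>) OB"
  note ob = homogD(3)[OF assms(1)] homogD(3)[OF assms(2)] homogD(3)[OF assms(3)]
  note ho = homogD(1)[OF assms(1)] homogD(1)[OF assms(2)] homogD(1)[OF assms(3)]
  have tO: "t \<in> OB" unfolding t_def by (intro OB_tens ho)
  then have tg: "t \<in> gobs n" by (rule gobs_OB)
  define X where "X = V \<odot> (W \<odot> U)"
  have oX: "X \<in> Ob C" unfolding X_def by (intro tens_ob ob)
  have t1: "t = [(X, (a + (b + d) mod n) mod n)]" by (simp add: t_def T_single X_def)
  have t2: "T (T [(V, a)] [(W, b)]) [(U, d)] = t"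
    unfolding t_def by (intro gtens_assoc gobs_OB ho)
  have A: "?A = Arr t t (mat (length t) (length t) (\<lambda>(i, j). Scale C (\<omega> a b d) (Ident C X)))"
    unfolding graded_assoc_def graded_diag_def t2 t_def[symmetric]
    by (rule arg_cong[of _ _ "Arr t t"], rule eq_matI) (auto simp: t1 assoc_strict ob X_def)
  have mS: "mor (Scale C s (Ident C X)) X X" for s by (rule mor_scale[OF mor_ident[OF oX]])
  have hom: "Arr t t (mat (length t) (length t) (\<lambda>(i, j). Scale C s (Ident C X))) \<in> graded_hom C t t" for s
    by (rule gh_mat) (use mS in \<open>simp_all add: t1\<close>)
  have ent: "entry (Arr t t (mat (length t) (length t) (\<lambda>(i, j). f))) 0 0 = f" for f
    by (simp add: entry_def t1)
  show h1: "?A \<in> graded_hom C t t" unfolding A by (rule hom)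
  show e1: "entry ?A 0 0 = Scale C (\<omega> a b d) (Ident C (V \<odot> (W \<odot> U)))" unfolding A ent X_def ..
  define B where "B = Arr t t (mat (length t) (length t) (\<lambda>(i, j). Scale C (inverse (\<omega> a b d)) (Ident C X)))"
  have B: "B \<in> graded_hom C t t" "entry B 0 0 = Scale C (inverse (\<omega> a b d)) (Ident C X)"
    unfolding B_def by (rule hom, rule ent)
  have lt: "length t = 1" by (simp add: t1)
  have eqI: "f = g" if "f \<in> graded_hom C t t" "g \<in> graded_hom C t t" "entry f 0 0 = entry g 0 0" for f g
    by (rule gh_eqI[OF that(1,2)]) (use that(3) lt in auto)
  have gi: "entry (gid t) 0 0 = Ident C X" using gid_entry[of 0 t 0] lt by (simp add: t1)
  have ss: "Scale C s (Ident C X) \<cdot> Scale C r (Ident C X) = Scale C (s * r) (Ident C X)" for s r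
    using scalec[OF mor_ident[OF oX] mS] lid[OF mS] scalescale[OF mor_ident[OF oX]] by simp
  have e1': "entry ?A 0 0 = Scale C (\<omega> a b d) (Ident C X)" using e1 by (simp add: X_def)
  have 1: "graded_comp C ?A B = gid t"
    by (rule eqI[OF gcomp_hom[OF B(1) h1 tg tg tg] gid_hom[OF tg]])
       (simp add: gcomp_entry_single[OF B(1) h1 tg tg tg lt lt lt] B(2) e1' ss gi omega_nonzero scale1[OF mor_ident[OF oX]])
  have 2: "graded_comp C B ?A = gid t"
    by (rule eqI[OF gcomp_hom[OF h1 B(1) tg tg tg] gid_hom[OF tg]])
       (simp add: gcomp_entry_single[OF h1 B(1) tg tg tg lt lt lt] B(2) e1' ss gi omega_nonzero scale1[OF mor_ident[OF oX]])
  have inv: "inverse_arrow ?G t t ?A = B"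
    unfolding inverse_arrow_def mutually_inverse_def full_subcat_simps gp_simps
  proof (rule the_equality)
    show "?A \<in> graded_hom C t t \<and> B \<in> graded_hom C t t \<and> graded_comp C B ?A = gid t \<and> graded_comp C ?A B = gid t"
      using h1 B 1 2 by simp
  next
    fix g assume g: "?A \<in> graded_hom C t t \<and> g \<in> graded_hom C t t \<and> graded_comp C g ?A = gid t \<and> graded_comp C ?A g = gid t"
    then have g1: "g \<in> graded_hom C t t" by blast
    have mg: "mor (entry g 0 0) X X" using gh_entry(1)[OF g1 tg tg, of 0 0] lt by (simp add: t1)
    have "entry g 0 0 \<cdot> Scale C (\<omega> a b d) (Ident C X) = Ident C X"
      using gcomp_entry_single[OF h1 g1 tg tg tg lt lt lt] g e1' gi by simp
    then have "Scale C (\<omega> a b d) (entry g 0 0) = Ident C X"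
      using cscale[OF mg mor_ident[OF oX]] rid[OF mg] by simp
    then have "entry g 0 0 = Scale C (inverse (\<omega> a b d)) (Ident C X)"
      using scalescale[OF mg, of "inverse (\<omega> a b d)" "\<omega> a b d"] scale1[OF mg] omega_nonzero by simp
    then show "g = B" using B by (intro eqI[OF g1]) simp_all
  qed
  show "inverse_arrow ?G t t ?A \<in> graded_hom C t t" unfolding inv by (rule B(1))
  show "entry (inverse_arrow ?G t t ?A) 0 0 = Scale C (inverse (\<omega> a b d)) (Ident C (V \<odot> (W \<odot> U)))"
    unfolding inv B(2) X_def ..
qed

lemma scaled_comp3:
  assumes "mor f X Y"
  shows "(Scale C r (Ident C Y) \<cdot> f) \<cdot> Scale C s (Ident C X) = Scale C (r * s) f"
proof -
  note o = morD(1,2)[OF assms] and i = mor_ident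
  have "Scale C r (Ident C Y) \<cdot> f = Scale C r f" using scalec[OF i[OF o(2)] assms] lid[OF assms] by simp
  moreover have "Scale C r f \<cdot> Scale C s (Ident C X) = Scale C s (Scale C r f)"
    using cscale[OF mor_scale[OF assms] i[OF o(1)]] rid[OF mor_scale[OF assms]] by simp
  ultimately show ?thesis using scalescale[OF assms] by (simp add: mult.commute)
qed

lemma scaled_middle:
  assumes "mor g Y Z" "mor f X Y"
  shows "(g \<cdot> Scale C s (Ident C Y)) \<cdot> f = Scale C s (g \<cdot> f)"
  using cscale[OF assms(1) mor_ident[OF morD(1)[OF assms(1)]]] rid[OF assms(1)] scalec[OF assms] by simp

lemma kk_hexagon:
  assumes V: "homog V a" and W: "homog W b" and U: "homog U d"
  shows "Scale C (\<omega> b d a * \<omega> a b d) (kk V a (W \<odot> U) ((b + d) mod n)) =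
      Scale C (\<omega> b a d) ((Ident C W \<boxtimes> kk V a U d) \<cdot> (kk V a W b \<boxtimes> Ident C U))"
    "Scale C (inverse (\<omega> d a b) * inverse (\<omega> a b d)) (kk (V \<odot> W) ((a + b) mod n) U d) =
      Scale C (inverse (\<omega> a d b)) ((kk V a U d \<boxtimes> Ident C W) \<cdot> (Ident C V \<boxtimes> kk W b U d))"
proof -
  let ?X = "[(V, a)]" and ?Y = "[(W, b)]" and ?Z = "[(U, d)]"
  let ?G = "full_subcat (graded_product C n \<omega>) OB"
  note h = homogD(1)[OF V] homogD(1)[OF W] homogD(1)[OF U]
  note ob = homogD(3)[OF V] homogD(3)[OF W] homogD(3)[OF U]
  note g = h[THEN gobs_OB] and t = OB_tens[THEN gobs_OB]
  have as: "T (T x y) z = T x (T y z)" if "x \<in> OB" "y \<in> OB" "z \<in> OB" for x y z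
    using that by (intro gtens_assoc gobs_OB)
  have t3: "T x (T y z) \<in> gobs n" if "x \<in> OB" "y \<in> OB" "z \<in> OB" for x y z
    using that by (intro gobs_OB OB_tens)
  have l3: "length (T x (T y z)) = 1" "length (T x y) = 1"
    if "x \<in> {?X, ?Y, ?Z}" "y \<in> {?X, ?Y, ?Z}" "z \<in> {?X, ?Y, ?Z}" for x y z
    using that by auto
  have L: "length (T x y) = 1" if "length x = 1" "length y = 1" for x y :: "'o graded" using that by simp
  have L1: "length ?X = 1" "length ?Y = 1" "length ?Z = 1" by simp_all
  have gi: "gid x \<in> graded_hom C x x" "entry (gid x) 0 0 = Ident C (obj x 0)" if "x \<in> OB" "length x = 1" for x
    using gid_hom[OF gobs_OB[OF that(1)]] gid_entry[of 0 x 0] that(2) by simp_all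
  have cross: "T ?X ?Y = [(V \<odot> W, (a + b) mod n)]" "T ?Y ?Z = [(W \<odot> U, (b + d) mod n)]" by (simp_all add: T_single)
  note homs = homog_tens[OF V W] homog_tens[OF W U]
  note kVU = mor_kk[OF V U] and kVW = mor_kk[OF V W] and kWU = mor_kk[OF W U]
  \<comment> \<open>first hexagon\<close>
  note A1 = assoc_single[OF W U V] and A2 = assoc_single[OF V W U] and A3 = assoc_single[OF W V U]
  have c1: "c ?X (T ?Y ?Z) \<in> graded_hom C (T ?X (T ?Y ?Z)) (T ?Y (T ?Z ?X))"
    using braiding_iso(1)[OF h(1) OB_tens[OF h(2,3)]] by (simp only: as[OF h(2,3,1)])
  have e1: "entry (c ?X (T ?Y ?Z)) 0 0 = kk V a (W \<odot> U) ((b + d) mod n)"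
    by (simp add: kk_def cross)
  have m1: "mor (kk V a (W \<odot> U) ((b + d) mod n)) (V \<odot> (W \<odot> U)) (W \<odot> (U \<odot> V))"
    using mor_kk[OF V homs(2)] ob by (simp add: tens_assoc)
  have l1: "entry (graded_comp C (graded_comp C (graded_assoc C n \<omega> ?Y ?Z ?X) (c ?X (T ?Y ?Z))) (graded_assoc C n \<omega> ?X ?Y ?Z)) 0 0
      = Scale C (\<omega> b d a * \<omega> a b d) (kk V a (W \<odot> U) ((b + d) mod n))"
    using gcomp_entry_single[OF A2(1) gcomp_hom[OF c1 A1(1) t3 t3 t3] t3 t3 t3] gcomp_entry_single[OF c1 A1(1) t3 t3 t3] h
      scaled_comp3[OF m1] by (simp add: A1(2) A2(2) e1)
  have gYc: "gtensm n (gid ?Y) (c ?X ?Z) \<in> graded_hom C (T ?Y (T ?X ?Z)) (T ?Y (T ?Z ?X))"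
    by (rule gtensm_hom[OF gi(1)[OF h(2) L1(2)] braiding_iso(1)[OF h(1,3)] g(2,2) t[OF h(1,3)] t[OF h(3,1)]])
  have gcZ: "gtensm n (c ?X ?Y) (gid ?Z) \<in> graded_hom C (T ?X (T ?Y ?Z)) (T ?Y (T ?X ?Z))"
    using gtensm_hom[OF braiding_iso(1)[OF h(1,2)] gi(1)[OF h(3) L1(3)] t[OF h(1,2)] t[OF h(2,1)] g(3,3)]
    by (simp only: as[OF h(1,2,3)] as[OF h(2,1,3)])
  have eYc: "entry (gtensm n (gid ?Y) (c ?X ?Z)) 0 0 = Ident C W \<boxtimes> kk V a U d"
    using gtensm_entry_single[OF gi(1)[OF h(2) L1(2)] braiding_iso(1)[OF h(1,3)]] gi(2)[OF h(2) L1(2)] by (simp add: kk_def)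
  have ecZ: "entry (gtensm n (c ?X ?Y) (gid ?Z)) 0 0 = kk V a W b \<boxtimes> Ident C U"
    using gtensm_entry_single[OF braiding_iso(1)[OF h(1,2)] gi(1)[OF h(3) L1(3)]] gi(2)[OF h(3) L1(3)] by (simp add: kk_def)
  have mYc: "mor (Ident C W \<boxtimes> kk V a U d) (W \<odot> (V \<odot> U)) (W \<odot> (U \<odot> V))"
    by (rule mor_tens[OF mor_ident[OF ob(2)] kVU])
  have mcZ: "mor (kk V a W b \<boxtimes> Ident C U) (V \<odot> (W \<odot> U)) (W \<odot> (V \<odot> U))"
    using mor_tens[OF kVW mor_ident[OF ob(3)]] ob by (simp add: tens_assoc)
  have r1: "entry (graded_comp C (graded_comp C (gtensm n (gid ?Y) (c ?X ?Z)) (graded_assoc C n \<omega> ?Y ?X ?Z)) (gtensm n (c ?X ?Y) (gid ?Z))) 0 0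
      = Scale C (\<omega> b a d) ((Ident C W \<boxtimes> kk V a U d) \<cdot> (kk V a W b \<boxtimes> Ident C U))"
    using gcomp_entry_single[OF gcZ gcomp_hom[OF A3(1) gYc t3 t3 t3] t3 t3 t3] gcomp_entry_single[OF A3(1) gYc t3 t3 t3] h
      scaled_middle[OF mYc mcZ] by (simp add: A3(2) eYc ecZ)
  show "Scale C (\<omega> b d a * \<omega> a b d) (kk V a (W \<odot> U) ((b + d) mod n)) =
      Scale C (\<omega> b a d) ((Ident C W \<boxtimes> kk V a U d) \<cdot> (kk V a W b \<boxtimes> Ident C U))"
    using l1 r1 braiding_hexagon(1)[OF h] by simp
  \<comment> \<open>second hexagon\<close>
  note B1 = assoc_single[OF U V W] and B3 = assoc_single[OF V U W]
  have c2: "c (T ?X ?Y) ?Z \<in> graded_hom C (T ?X (T ?Y ?Z)) (T ?Z (T ?X ?Y))"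
    using braiding_iso(1)[OF OB_tens[OF h(1,2)] h(3)] by (simp only: as[OF h(1,2,3)])
  have e2: "entry (c (T ?X ?Y) ?Z) 0 0 = kk (V \<odot> W) ((a + b) mod n) U d"
    by (simp add: kk_def cross)
  have m2: "mor (kk (V \<odot> W) ((a + b) mod n) U d) (V \<odot> (W \<odot> U)) (U \<odot> (V \<odot> W))"
    using mor_kk[OF homs(1) U] ob by (simp add: tens_assoc)
  let ?i1 = "inverse_arrow ?G (T ?Z (T ?X ?Y)) (T ?Z (T ?X ?Y)) (graded_assoc C n \<omega> ?Z ?X ?Y)"
  let ?i2 = "inverse_arrow ?G (T ?X (T ?Y ?Z)) (T ?X (T ?Y ?Z)) (graded_assoc C n \<omega> ?X ?Y ?Z)"
  let ?i3 = "inverse_arrow ?G (T ?X (T ?Z ?Y)) (T ?X (T ?Z ?Y)) (graded_assoc C n \<omega> ?X ?Z ?Y)"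
  have l2: "entry (graded_comp C (graded_comp C ?i1 (c (T ?X ?Y) ?Z)) ?i2) 0 0
      = Scale C (inverse (\<omega> d a b) * inverse (\<omega> a b d)) (kk (V \<odot> W) ((a + b) mod n) U d)"
    using gcomp_entry_single[OF A2(3) gcomp_hom[OF c2 B1(3) t3 t3 t3] t3 t3 t3] gcomp_entry_single[OF c2 B1(3) t3 t3 t3] h
      scaled_comp3[OF m2] by (simp add: B1(4) A2(4) e2)
  have gcY: "gtensm n (c ?X ?Z) (gid ?Y) \<in> graded_hom C (T ?X (T ?Z ?Y)) (T ?Z (T ?X ?Y))"
    using gtensm_hom[OF braiding_iso(1)[OF h(1,3)] gi(1)[OF h(2) L1(2)] t[OF h(1,3)] t[OF h(3,1)] g(2,2)]
    by (simp only: as[OF h(1,3,2)] as[OF h(3,1,2)])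
  have gXc: "gtensm n (gid ?X) (c ?Y ?Z) \<in> graded_hom C (T ?X (T ?Y ?Z)) (T ?X (T ?Z ?Y))"
    by (rule gtensm_hom[OF gi(1)[OF h(1) L1(1)] braiding_iso(1)[OF h(2,3)] g(1,1) t[OF h(2,3)] t[OF h(3,2)]])
  have ecY: "entry (gtensm n (c ?X ?Z) (gid ?Y)) 0 0 = kk V a U d \<boxtimes> Ident C W"
    using gtensm_entry_single[OF braiding_iso(1)[OF h(1,3)] gi(1)[OF h(2) L1(2)]] gi(2)[OF h(2) L1(2)] by (simp add: kk_def)
  have eXc: "entry (gtensm n (gid ?X) (c ?Y ?Z)) 0 0 = Ident C V \<boxtimes> kk W b U d"
    using gtensm_entry_single[OF gi(1)[OF h(1) L1(1)] braiding_iso(1)[OF h(2,3)]] gi(2)[OF h(1) L1(1)] by (simp add: kk_def)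
  have mcY: "mor (kk V a U d \<boxtimes> Ident C W) (V \<odot> (U \<odot> W)) (U \<odot> (V \<odot> W))"
    using mor_tens[OF kVU mor_ident[OF ob(2)]] ob by (simp add: tens_assoc)
  have mXc: "mor (Ident C V \<boxtimes> kk W b U d) (V \<odot> (W \<odot> U)) (V \<odot> (U \<odot> W))"
    by (rule mor_tens[OF mor_ident[OF ob(1)] kWU])
  have r2: "entry (graded_comp C (graded_comp C (gtensm n (c ?X ?Z) (gid ?Y)) ?i3) (gtensm n (gid ?X) (c ?Y ?Z))) 0 0
      = Scale C (inverse (\<omega> a d b)) ((kk V a U d \<boxtimes> Ident C W) \<cdot> (Ident C V \<boxtimes> kk W b U d))"
    using gcomp_entry_single[OF gXc gcomp_hom[OF B3(3) gcY t3 t3 t3] t3 t3 t3] gcomp_entry_single[OF B3(3) gcY t3 t3 t3] h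
      scaled_middle[OF mcY mXc] by (simp add: B3(4) ecY eXc)
  show "Scale C (inverse (\<omega> d a b) * inverse (\<omega> a b d)) (kk (V \<odot> W) ((a + b) mod n) U d) =
      Scale C (inverse (\<omega> a d b)) ((kk V a U d \<boxtimes> Ident C W) \<cdot> (Ident C V \<boxtimes> kk W b U d))"
    using l2 r2 braiding_hexagon(2)[OF h] by (simp add: as[OF h(1,2,3)] as[OF h(3,1,2)] as[OF h(1,3,2)])
qed

end

context graded_braiding
begin

subsection \<open>Scalar double braidings\<close>

definition dbl :: "'o \<Rightarrow> nat \<Rightarrow> 'o \<Rightarrow> nat \<Rightarrow> 'm" where
  "dbl V a W b = kk W b V a \<cdot> kk V a W b"

definition scalar_dbl :: "'o \<Rightarrow> nat \<Rightarrow> 'o \<Rightarrow> nat \<Rightarrow> 'k \<Rightarrow> bool" where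
  "scalar_dbl V a W b s \<longleftrightarrow> dbl V a W b = Scale C s (Ident C (V \<odot> W))"

lemma mor_dbl: "homog V a \<Longrightarrow> homog W b \<Longrightarrow> mor (dbl V a W b) (V \<odot> W) (V \<odot> W)"
  unfolding dbl_def by (rule mor_comp[OF mor_kk mor_kk])

lemma cancel_scales:
  assumes "mor P Y Z" "mor P' Y Z" "mor Q X Y" "mor Q' X Y" "x \<noteq> 0" "y \<noteq> 0"
    and "Scale C x P = Scale C y P'" "Scale C (inverse x) Q = Scale C (inverse y) Q'"
  shows "P \<cdot> Q = P' \<cdot> Q'"
proof -
  have e: "Scale C r R \<cdot> Scale C (inverse r) S = R \<cdot> S" if "mor R Y Z" "mor S X Y" "r \<noteq> 0" for r R S
    using scalec[OF that(1) mor_scale[OF that(2)]] cscale[OF that(1,2)] scalescale[OF mor_comp[OF that(1,2)]]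
      scale1[OF mor_comp[OF that(1,2)]] that(3) by simp
  have "P \<cdot> Q = Scale C x P \<cdot> Scale C (inverse x) Q" using e[OF assms(1,3,5)] by simp
  also have "\<dots> = Scale C y P' \<cdot> Scale C (inverse y) Q'" using assms(7,8) by simp
  also have "\<dots> = P' \<cdot> Q'" by (rule e[OF assms(2,4,6)])
  finally show ?thesis .
qed

text \<open>In the double braiding with a tensor product the scalars of the two hexagons cancel.\<close>

lemma scalar_dbl_tens_left:
  assumes V: "homog V a" and W: "homog W b" and U: "homog U d"
    and s: "scalar_dbl V a U d s" and t: "scalar_dbl W b U d t"
  shows "scalar_dbl (V \<odot> W) ((a + b) mod n) U d (s * t)"
proof -
  note o = homogD(3)[OF V] homogD(3)[OF W] homogD(3)[OF U]
  note VW = homog_tens[OF V W]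
  note iV = mor_ident[OF o(1)] and iW = mor_ident[OF o(2)]
  have m1: "mor (Ident C V \<boxtimes> kk U d W b) (V \<odot> (U \<odot> W)) (V \<odot> (W \<odot> U))"
    by (rule mor_tens[OF iV mor_kk[OF U W]])
  have m2: "mor (kk U d V a \<boxtimes> Ident C W) (U \<odot> (V \<odot> W)) (V \<odot> (U \<odot> W))"
    using mor_tens[OF mor_kk[OF U V] iW] o by (simp add: tens_assoc)
  have m3: "mor (kk V a U d \<boxtimes> Ident C W) (V \<odot> (U \<odot> W)) (U \<odot> (V \<odot> W))"
    using mor_tens[OF mor_kk[OF V U] iW] o by (simp add: tens_assoc)
  have m4: "mor (Ident C V \<boxtimes> kk W b U d) (V \<odot> (W \<odot> U)) (V \<odot> (U \<odot> W))"
    by (rule mor_tens[OF iV mor_kk[OF W U]])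
  have p: "mor (kk U d (V \<odot> W) ((a + b) mod n)) (U \<odot> (V \<odot> W)) (V \<odot> (W \<odot> U))"
    "mor (kk (V \<odot> W) ((a + b) mod n) U d) (V \<odot> (W \<odot> U)) (U \<odot> (V \<odot> W))"
    using mor_kk[OF U VW] mor_kk[OF VW U] o by (simp_all add: tens_assoc)
  have "dbl (V \<odot> W) ((a + b) mod n) U d =
      ((Ident C V \<boxtimes> kk U d W b) \<cdot> (kk U d V a \<boxtimes> Ident C W)) \<cdot> ((kk V a U d \<boxtimes> Ident C W) \<cdot> (Ident C V \<boxtimes> kk W b U d))"
    unfolding dbl_def
    by (rule cancel_scales[OF p(1) mor_comp[OF m1 m2] p(2) mor_comp[OF m3 m4], of "\<omega> a b d * \<omega> d a b" "\<omega> a d b"])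
       (use kk_hexagon(1)[OF U V W] kk_hexagon(2)[OF V W U] omega_nonzero in \<open>simp_all add: mult.commute\<close>)
  also have "\<dots> = (Ident C V \<boxtimes> kk U d W b) \<cdot> (((kk U d V a \<boxtimes> Ident C W) \<cdot> (kk V a U d \<boxtimes> Ident C W)) \<cdot> (Ident C V \<boxtimes> kk W b U d))"
    using cassoc[OF m1 m2 mor_comp[OF m3 m4]] cassoc[OF m2 m3 m4] by simp
  also have "(kk U d V a \<boxtimes> Ident C W) \<cdot> (kk V a U d \<boxtimes> Ident C W) = Scale C s (Ident C (V \<odot> (U \<odot> W)))"
    using inter[OF mor_kk[OF U V] mor_kk[OF V U] iW iW] lid[OF iW] s o scalet[OF mor_ident[OF tens_ob[OF o(1,3)]] iW]
    by (simp add: scalar_dbl_def dbl_def tens_ident tens_assoc obs)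
  also have "Scale C s (Ident C (V \<odot> (U \<odot> W))) \<cdot> (Ident C V \<boxtimes> kk W b U d) = Scale C s (Ident C V \<boxtimes> kk W b U d)"
    using scalec[OF mor_ident m4] lid[OF m4] o by (simp add: obs)
  also have "(Ident C V \<boxtimes> kk U d W b) \<cdot> Scale C s (Ident C V \<boxtimes> kk W b U d) =
      Scale C s ((Ident C V \<boxtimes> kk U d W b) \<cdot> (Ident C V \<boxtimes> kk W b U d))" by (rule cscale[OF m1 m4])
  also have "(Ident C V \<boxtimes> kk U d W b) \<cdot> (Ident C V \<boxtimes> kk W b U d) = Scale C t (Ident C (V \<odot> (W \<odot> U)))"
    using inter[OF iV iV mor_kk[OF U W] mor_kk[OF W U]] lid[OF iV] t o tscale[OF iV mor_ident[OF tens_ob[OF o(2,3)]]]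
    by (simp add: scalar_dbl_def dbl_def tens_ident obs)
  finally show ?thesis
    using scalescale[OF mor_ident[OF tens_ob[OF o(1) tens_ob[OF o(2,3)]]]] o
    by (simp add: scalar_dbl_def tens_assoc)
qed

lemma scalar_dbl_tens_right:
  assumes V: "homog V a" and W: "homog W b" and U: "homog U d"
    and s: "scalar_dbl V a W b s" and t: "scalar_dbl V a U d t"
  shows "scalar_dbl V a (W \<odot> U) ((b + d) mod n) (s * t)"
proof -
  note o = homogD(3)[OF V] homogD(3)[OF W] homogD(3)[OF U]
  note WU = homog_tens[OF W U]
  note iW = mor_ident[OF o(2)] and iU = mor_ident[OF o(3)]
  have m1: "mor (kk W b V a \<boxtimes> Ident C U) (W \<odot> (V \<odot> U)) (V \<odot> (W \<odot> U))"
    using mor_tens[OF mor_kk[OF W V] iU] o by (simp add: tens_assoc)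
  have m2: "mor (Ident C W \<boxtimes> kk U d V a) (W \<odot> (U \<odot> V)) (W \<odot> (V \<odot> U))"
    by (rule mor_tens[OF iW mor_kk[OF U V]])
  have m3: "mor (Ident C W \<boxtimes> kk V a U d) (W \<odot> (V \<odot> U)) (W \<odot> (U \<odot> V))"
    by (rule mor_tens[OF iW mor_kk[OF V U]])
  have m4: "mor (kk V a W b \<boxtimes> Ident C U) (V \<odot> (W \<odot> U)) (W \<odot> (V \<odot> U))"
    using mor_tens[OF mor_kk[OF V W] iU] o by (simp add: tens_assoc)
  have p: "mor (kk (W \<odot> U) ((b + d) mod n) V a) (W \<odot> (U \<odot> V)) (V \<odot> (W \<odot> U))"
    "mor (kk V a (W \<odot> U) ((b + d) mod n)) (V \<odot> (W \<odot> U)) (W \<odot> (U \<odot> V))"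
    using mor_kk[OF WU V] mor_kk[OF V WU] o by (simp_all add: tens_assoc)
  have "dbl V a (W \<odot> U) ((b + d) mod n) =
      ((kk W b V a \<boxtimes> Ident C U) \<cdot> (Ident C W \<boxtimes> kk U d V a)) \<cdot> ((Ident C W \<boxtimes> kk V a U d) \<cdot> (kk V a W b \<boxtimes> Ident C U))"
    unfolding dbl_def
    by (rule cancel_scales[OF p(1) mor_comp[OF m1 m2] p(2) mor_comp[OF m3 m4],
          of "inverse (\<omega> b d a * \<omega> a b d)" "inverse (\<omega> b a d)"])
       (use kk_hexagon(1)[OF V W U] kk_hexagon(2)[OF W U V] omega_nonzero in \<open>simp_all add: mult.commute\<close>)
  also have "\<dots> = (kk W b V a \<boxtimes> Ident C U) \<cdot> (((Ident C W \<boxtimes> kk U d V a) \<cdot> (Ident C W \<boxtimes> kk V a U d)) \<cdot> (kk V a W b \<boxtimes> Ident C U))"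
    using cassoc[OF m1 m2 mor_comp[OF m3 m4]] cassoc[OF m2 m3 m4] by simp
  also have "(Ident C W \<boxtimes> kk U d V a) \<cdot> (Ident C W \<boxtimes> kk V a U d) = Scale C t (Ident C (W \<odot> (V \<odot> U)))"
    using inter[OF iW iW mor_kk[OF U V] mor_kk[OF V U]] lid[OF iW] t o tscale[OF iW mor_ident[OF tens_ob[OF o(1,3)]]]
    by (simp add: scalar_dbl_def dbl_def tens_ident obs)
  also have "Scale C t (Ident C (W \<odot> (V \<odot> U))) \<cdot> (kk V a W b \<boxtimes> Ident C U) = Scale C t (kk V a W b \<boxtimes> Ident C U)"
    using scalec[OF mor_ident m4] lid[OF m4] o by (simp add: obs)
  also have "(kk W b V a \<boxtimes> Ident C U) \<cdot> Scale C t (kk V a W b \<boxtimes> Ident C U) =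
      Scale C t ((kk W b V a \<boxtimes> Ident C U) \<cdot> (kk V a W b \<boxtimes> Ident C U))" by (rule cscale[OF m1 m4])
  also have "(kk W b V a \<boxtimes> Ident C U) \<cdot> (kk V a W b \<boxtimes> Ident C U) = Scale C s (Ident C (V \<odot> (W \<odot> U)))"
    using inter[OF mor_kk[OF W V] mor_kk[OF V W] iU iU] lid[OF iU] s o scalet[OF mor_ident[OF tens_ob[OF o(1,2)]] iU]
    by (simp add: scalar_dbl_def dbl_def tens_ident tens_assoc obs)
  finally show ?thesis
    using scalescale[OF mor_ident[OF tens_ob[OF o(1) tens_ob[OF o(2,3)]]]] o
    by (simp add: scalar_dbl_def mult.commute)
qed

lemma dbl_natural:
  assumes "homog V a" "homog V' a" "homog W b" "homog W' b" "mor f V V'" "mor g W W'"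
  shows "dbl V' a W' b \<cdot> (f \<boxtimes> g) = (f \<boxtimes> g) \<cdot> dbl V a W b"
proof -
  have "dbl V' a W' b \<cdot> (f \<boxtimes> g) = kk W' b V' a \<cdot> (kk V' a W' b \<cdot> (f \<boxtimes> g))"
    unfolding dbl_def by (rule cassoc[OF mor_kk[OF assms(4,2)] mor_kk[OF assms(2,4)] mor_tens[OF assms(5,6)]])
  also have "\<dots> = kk W' b V' a \<cdot> ((g \<boxtimes> f) \<cdot> kk V a W b)"
    using kk_natural[OF assms] by simp
  also have "\<dots> = (kk W' b V' a \<cdot> (g \<boxtimes> f)) \<cdot> kk V a W b"
    by (rule cassoc[OF mor_kk[OF assms(4,2)] mor_tens[OF assms(6,5)] mor_kk[OF assms(1,3)], symmetric])
  also have "\<dots> = ((f \<boxtimes> g) \<cdot> kk W b V a) \<cdot> kk V a W b"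
    using kk_natural[OF assms(3,4,1,2,6,5)] by simp
  also have "\<dots> = (f \<boxtimes> g) \<cdot> dbl V a W b"
    unfolding dbl_def by (rule cassoc[OF mor_tens[OF assms(5,6)] mor_kk[OF assms(3,1)] mor_kk[OF assms(1,3)]])
  finally show ?thesis .
qed

lemma scalar_dbl_through:
  assumes V: "homog V a" and W: "homog W b"
    and PV: "Ident C V \<in> through P V V" "P \<subseteq> Ob C" "\<And>L. L \<in> P \<Longrightarrow> homog L a"
    and PW: "Ident C W \<in> through Q W W" "Q \<subseteq> Ob C" "\<And>M. M \<in> Q \<Longrightarrow> homog M b"
    and s: "\<And>L M. L \<in> P \<Longrightarrow> M \<in> Q \<Longrightarrow> scalar_dbl L a M b s"
  shows "scalar_dbl V a W b s"
proof -
  note oV = homogD(3)[OF V] and oW = homogD(3)[OF W]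
  let ?D = "dbl V a W b"
  have D: "mor ?D (V \<odot> W) (V \<odot> W)" by (rule mor_dbl[OF V W])
  have base: "?D \<cdot> ((i \<cdot> p) \<boxtimes> (j \<cdot> r)) = Scale C s ((i \<cdot> p) \<boxtimes> (j \<cdot> r))"
    if L: "L \<in> P" "mor p V L" "mor i L V" and M: "M \<in> Q" "mor r W M" "mor j M W" for L i p M j r
  proof -
    have hL: "homog L a" "homog M b" using PV(3) PW(3) L(1) M(1) by blast+
    note ij = mor_tens[OF L(3) M(3)] and pr = mor_tens[OF L(2) M(2)]
    have "?D \<cdot> ((i \<cdot> p) \<boxtimes> (j \<cdot> r)) = (?D \<cdot> (i \<boxtimes> j)) \<cdot> (p \<boxtimes> r)"
      using inter[OF L(3,2) M(3,2)] cassoc[OF D ij pr] by simp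
    also have "?D \<cdot> (i \<boxtimes> j) = (i \<boxtimes> j) \<cdot> Scale C s (Ident C (L \<odot> M))"
      using dbl_natural[OF hL(1) V hL(2) W L(3) M(3)] s[OF L(1) M(1)] by (simp add: scalar_dbl_def)
    also have "\<dots> = Scale C s (i \<boxtimes> j)"
      using cscale[OF ij mor_ident[OF morD(1)[OF ij]]] rid[OF ij] by simp
    finally show ?thesis using scalec[OF ij pr] inter[OF L(3,2) M(3,2)] by simp
  qed
  have step1: "?D \<cdot> ((i \<cdot> p) \<boxtimes> g) = Scale C s ((i \<cdot> p) \<boxtimes> g)"
    if L: "L \<in> P" "mor p V L" "mor i L V" and g: "g \<in> through Q W W" for L i p g
    using g
  proof (induction rule: through.induct)
    case through_zero
    note ip = mor_comp[OF L(3,2)]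
    show ?case
      using tens_zero[OF ip oW oW] comp_zero[OF D morD(1)[OF D]] scale_Zero[OF morD(1)[OF D] morD(1)[OF D]] by simp
  next
    case (through_add f M r j)
    then have M: "M \<in> Q" "mor r W M" "mor j M W" and f: "mor f W W"
      using PW(2) oW mor_through by (auto simp: mor_def)
    note ip = mor_comp[OF L(3,2)] and jr = mor_comp[OF M(3,2)]
    note t1 = mor_tens[OF ip jr] and t2 = mor_tens[OF ip f]
    show ?case
      using tadd[OF ip jr f] cadd[OF D t1 t2] base[OF L M] through_add.IH
        scale_add[OF morD(1)[OF D] morD(1)[OF D] morD(3)[OF t1] morD(3)[OF t2]] by simp
  qed
  have step2: "?D \<cdot> (f \<boxtimes> Ident C W) = Scale C s (f \<boxtimes> Ident C W)" if f: "f \<in> through P V V" for f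
    using f
  proof (induction rule: through.induct)
    case through_zero
    show ?case
      using zero_tens[OF mor_ident[OF oW] oV oV] comp_zero[OF D morD(1)[OF D]] scale_Zero[OF morD(1)[OF D] morD(1)[OF D]] by simp
  next
    case (through_add f L p i)
    then have L: "L \<in> P" "mor p V L" "mor i L V" and f: "mor f V V"
      using PV(2) oV mor_through by (auto simp: mor_def)
    note ip = mor_comp[OF L(3,2)] and iW = mor_ident[OF oW]
    note t1 = mor_tens[OF ip iW] and t2 = mor_tens[OF f iW]
    show ?case
      using addt[OF ip f iW] cadd[OF D t1 t2] step1[OF L PW(1)] through_add.IH
        scale_add[OF morD(1)[OF D] morD(1)[OF D] morD(3)[OF t1] morD(3)[OF t2]] by simp
  qed
  show ?thesis
    using step2[OF PV(1)] rid[OF D] tens_ident[OF oV oW] by (simp add: scalar_dbl_def)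
qed

lemma through_Ident: "L \<in> Ob C \<Longrightarrow> Ident C L \<in> through {L} L L"
  using through_single[OF mor_ident mor_ident, of L "{L}"] lid[OF mor_ident] by simp

lemma dbl_nonzero:
  assumes "homog V a" "homog W b" "scalar_dbl V a W b 0"
  shows "Ident C (V \<odot> W) = Zero C (V \<odot> W) (V \<odot> W)"
proof -
  note o = tens_ob[OF homogD(3)[OF assms(1)] homogD(3)[OF assms(2)]]
  obtain g h where g: "mor g (W \<odot> V) (V \<odot> W)" "g \<cdot> kk V a W b = Ident C (V \<odot> W)"
    and h: "mor h (V \<odot> W) (W \<odot> V)" "h \<cdot> kk W b V a = Ident C (W \<odot> V)"
    using kk_iso[OF assms(1,2)] kk_iso[OF assms(2,1)] by blast
  note k1 = mor_kk[OF assms(1,2)] and k2 = mor_kk[OF assms(2,1)]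
  have "Ident C (V \<odot> W) = g \<cdot> ((h \<cdot> kk W b V a) \<cdot> kk V a W b)"
    using g h lid[OF k1] by simp
  also have "\<dots> = g \<cdot> (h \<cdot> dbl V a W b)"
    using cassoc[OF h(1) k2 k1] by (simp add: dbl_def)
  also have "dbl V a W b = Zero C (V \<odot> W) (V \<odot> W)"
    using assms(3) scale0[OF mor_ident[OF o]] by (simp add: scalar_dbl_def)
  finally show ?thesis using comp_zero[OF h(1) o] comp_zero[OF g(1) o] by simp
qed

subsection \<open>Braidings of lists\<close>

lemma braiding_entry:
  assumes xs: "xs \<in> OB" and ys: "ys \<in> OB" and kl: "k < length xs" "l < length ys"
    and i: "i < length ys * length xs"
  shows "entry (c xs ys) i (k * length ys + l) =
    (if i = l * length xs + k then kk (obj xs k) (deg xs k) (obj ys l) (deg ys l)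
     else Zero C (obj xs k \<odot> obj ys l) (obj (T ys xs) i))"
proof -
  let ?x = "[xs ! k]" and ?y = "[ys ! l]"
  let ?f = "incl ?x xs (\<lambda>_. k)" and ?g = "incl ?y ys (\<lambda>_. l)"
  have x: "?x \<in> OB" and y: "?y \<in> OB" using OB_singleton xs ys kl nth_mem by blast+
  note g = gobs_OB[OF xs] gobs_OB[OF ys] gobs_OB[OF x] gobs_OB[OF y]
  have hf: "?f \<in> graded_hom C ?x xs" and hg: "?g \<in> graded_hom C ?y ys"
    by (rule incl_hom; use g kl in \<open>simp add: sublist_map_def\<close>)+
  have o: "obj xs k \<in> Ob C" "obj ys l \<in> Ob C" using gobs_nth g(1,2) kl by blast+
  \<comment> \<open>the tensor product of two coordinate inclusions is a coordinate inclusion\<close>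
  have fg: "gtensm n (incl [us ! r] us (\<lambda>_. r)) (incl [vs ! s] vs (\<lambda>_. s)) =
      incl (T [us ! r] [vs ! s]) (T us vs) (\<lambda>_. r * length vs + s)"
    and sub: "sublist_map (T [us ! r] [vs ! s]) (T us vs) (\<lambda>_. r * length vs + s)"
    if us: "us \<in> gobs n" and vs: "vs \<in> gobs n" and rs: "r < length us" "s < length vs" for us vs r s
  proof -
    have ou: "[us ! r] \<in> gobs n" "[vs ! s] \<in> gobs n" using us vs rs by (auto simp: gobs_def)
    have oo: "obj us i \<in> Ob C" if "i < length us" for i using gobs_nth[OF us that] by blast
    have oo': "obj vs i \<in> Ob C" if "i < length vs" for i using gobs_nth[OF vs that] by blast
    show sub: "sublist_map (T [us ! r] [vs ! s]) (T us vs) (\<lambda>_. r * length vs + s)"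
      using rs pair_index_less[OF rs] by (simp add: sublist_map_def gtens_nth_pair T_single[of "obj us r" "deg us r" "obj vs s" "deg vs s", simplified])
    have h: "incl [us ! r] us (\<lambda>_. r) \<in> graded_hom C [us ! r] us" "incl [vs ! s] vs (\<lambda>_. s) \<in> graded_hom C [vs ! s] vs"
      by (rule incl_hom; use ou us vs rs in \<open>simp add: sublist_map_def\<close>)+
    show "gtensm n (incl [us ! r] us (\<lambda>_. r)) (incl [vs ! s] vs (\<lambda>_. s)) =
        incl (T [us ! r] [vs ! s]) (T us vs) (\<lambda>_. r * length vs + s)"
    proof (rule gh_eqI[OF gtensm_hom[OF h ou(1) us ou(2) vs] incl_hom[OF gtens_gobs[OF ou] gtens_gobs[OF us vs] sub]])
      fix i j assume "i < length (T us vs)" "j < length (T [us ! r] [vs ! s])"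
      then have i: "i < length us * length vs" and j: "j = 0" by simp_all
      note d = div_mod_less[OF i]
      have eq: "i = r * length vs + s \<longleftrightarrow> i div length vs = r \<and> i mod length vs = s"
        using pair_index_div[OF rs(2)] div_mult_mod_eq[of i "length vs"] by (metis mult.commute)
      have e: "entry (gtensm n (incl [us ! r] us (\<lambda>_. r)) (incl [vs ! s] vs (\<lambda>_. s))) i j =
          (if i div length vs = r then Ident C (obj us r) else Zero C (obj us r) (obj us (i div length vs))) \<boxtimes>
          (if i mod length vs = s then Ident C (obj vs s) else Zero C (obj vs s) (obj vs (i mod length vs)))"
        using gtensm_entry[OF h, of i j] i j d by (simp add: incl_entry)
      have z1: "Zero C (obj us r) (obj us (i div length vs)) \<boxtimes> Ident C (obj vs s) =
          Zero C (obj us r \<odot> obj vs s) (obj us (i div length vs) \<odot> obj vs s)"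
        using zero_tens[OF mor_ident[OF oo'[OF rs(2)]] oo[OF rs(1)]] oo d by blast
      have z2: "f \<boxtimes> Zero C (obj vs s) (obj vs (i mod length vs)) =
          Zero C (obj us r \<odot> obj vs s) (W \<odot> obj vs (i mod length vs))" if "mor f (obj us r) W" for f W
        using tens_zero[OF that oo'[OF rs(2)]] oo' d by blast
      have "mor (Zero C (obj us r) (obj us (i div length vs))) (obj us r) (obj us (i div length vs))"
        using mor_zero oo rs d by blast
      note z2 = z2[OF mor_ident[OF oo[OF rs(1)]]] z2[OF this]
      show "entry (gtensm n (incl [us ! r] us (\<lambda>_. r)) (incl [vs ! s] vs (\<lambda>_. s))) i j =
          entry (incl (T [us ! r] [vs ! s]) (T us vs) (\<lambda>_. r * length vs + s)) i j"
        using i j z1 z2 oo[OF rs(1)] oo'[OF rs(2)] unfolding e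
        by (auto simp: incl_entry gtens_nth eq tens_ident)
    qed
  qed
  note cx = braiding_iso(1)[OF xs ys] and c1 = braiding_iso(1)[OF x y]
  have tg: "T us vs \<in> gobs n" if "us \<in> OB" "vs \<in> OB" for us vs using that by (intro gobs_OB OB_tens)
  have "entry (c xs ys) i (k * length ys + l) = entry (graded_comp C (c xs ys) (gtensm n ?f ?g)) i 0"
    unfolding fg[OF g(1,2) kl]
    using gcomp_incl_entry[OF tg[OF x y] tg[OF xs ys] tg[OF ys xs] sub[OF g(1,2) kl] cx, of i 0] i by simp
  also have "\<dots> = entry (graded_comp C (gtensm n ?g ?f) (c ?x ?y)) i 0"
    using braiding_natural[OF x xs y ys hf hg] by simp
  also have "\<dots> = entry (incl (T ?y ?x) (T ys xs) (\<lambda>_. l * length xs + k)) i 0 \<cdot> entry (c ?x ?y) 0 0"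
  proof -
    note I = incl_hom[OF tg[OF y x] tg[OF ys xs] sub[OF g(2,1) kl(2,1)]]
    show ?thesis unfolding fg[OF g(2,1) kl(2,1)]
      using gcomp_entry[OF c1 I, of i 0] addz[OF gcomp_terms(1)[OF c1 I tg[OF x y] tg[OF y x] tg[OF ys xs], of i 0 0]] i
      by simp
  qed
  also have "entry (c ?x ?y) 0 0 = kk (obj xs k) (deg xs k) (obj ys l) (deg ys l)" by (simp add: kk_def)
  finally have e: "entry (c xs ys) i (k * length ys + l) =
      entry (incl (T ?y ?x) (T ys xs) (\<lambda>_. l * length xs + k)) i 0 \<cdot> kk (obj xs k) (deg xs k) (obj ys l) (deg ys l)" .
  have hx: "homog (obj xs k) (deg xs k)" "homog (obj ys l) (deg ys l)" using x y by (simp_all add: homog_def)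
  note m = mor_kk[OF hx]
  have oi: "obj (T ys xs) i \<in> Ob C" using gobs_nth[OF tg[OF ys xs], of i] i by simp
  show ?thesis unfolding e using i lid[OF m] zero_comp[OF m oi] by (simp add: incl_entry gtens_nth)
qed

lemma double_braiding_trivial:
  assumes xs: "xs \<in> OB" and ys: "ys \<in> OB"
    and s: "\<And>x y. x \<in> set xs \<Longrightarrow> y \<in> set ys \<Longrightarrow> scalar_dbl (fst x) (snd x) (fst y) (snd y) 1"
  shows "graded_comp C (c ys xs) (c xs ys) = gid (T xs ys)"
proof -
  have tg: "T us vs \<in> gobs n" if "us \<in> OB" "vs \<in> OB" for us vs using that by (intro gobs_OB OB_tens)
  note t = tg[OF xs ys] tg[OF ys xs]
  note c1 = braiding_iso(1)[OF xs ys] and c2 = braiding_iso(1)[OF ys xs]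
  show ?thesis
  proof (rule gh_eqI[OF gcomp_hom[OF c1 c2 t t(1)] gid_hom[OF t(1)]])
    fix i j assume ij: "i < length (T xs ys)" "j < length (T xs ys)"
    then have i: "i < length xs * length ys" and j: "j < length xs * length ys" by simp_all
    let ?k = "j div length ys" and ?l = "j mod length ys"
    have kl: "?k < length xs" "?l < length ys" using div_mod_less[OF j] by auto
    have jj: "j = ?k * length ys + ?l" by simp
    let ?m = "?l * length xs + ?k"
    have m: "?m < length ys * length xs" by (rule pair_index_less[OF kl(2,1)])
    let ?V = "obj xs ?k" and ?a = "deg xs ?k" and ?W = "obj ys ?l" and ?b = "deg ys ?l"
    have hx: "homog ?V ?a" "homog ?W ?b"
      using OB_singleton[OF xs nth_mem[OF kl(1)]] OB_singleton[OF ys nth_mem[OF kl(2)]] by (simp_all add: homog_def)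
    have e1: "entry (c xs ys) m' j = (if m' = ?m then kk ?V ?a ?W ?b else Zero C (?V \<odot> ?W) (obj (T ys xs) m'))"
      if "m' < length ys * length xs" for m'
      using braiding_entry[OF xs ys kl that] jj by simp
    have e2: "entry (c ys xs) i ?m = (if i = j then kk ?W ?b ?V ?a else Zero C (?W \<odot> ?V) (obj (T xs ys) i))"
      using braiding_entry[OF ys xs kl(2,1) i] jj by simp
    have tj: "obj (T xs ys) j = ?V \<odot> ?W" using j by (simp add: gtens_nth)
    have oi: "obj (T xs ys) i \<in> Ob C" "?V \<odot> ?W \<in> Ob C" using gobs_nth[OF t(1)] ij tj by metis+
    have "entry (graded_comp C (c ys xs) (c xs ys)) i j = entry (c ys xs) i ?m \<cdot> entry (c xs ys) ?m j"
      unfolding gcomp_entry[OF c1 c2 ij]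
    proof (rule msum_single[where f = "\<lambda>l. entry (c ys xs) i l \<cdot> entry (c xs ys) l j"])
      show "?m < length (T ys xs)" using m by simp
      show "mor (entry (c ys xs) i ?m \<cdot> entry (c xs ys) ?m j) (obj (T xs ys) j) (obj (T xs ys) i)"
        by (rule gcomp_terms(1)[OF c1 c2 t t(1) ij]) (use m in simp)
      fix m' assume m': "m' < length (T ys xs)" "m' \<noteq> ?m"
      then have "entry (c xs ys) m' j = Zero C (obj (T xs ys) j) (obj (T ys xs) m')" using e1 tj by simp
      then show "entry (c ys xs) i m' \<cdot> entry (c xs ys) m' j = Zero C (obj (T xs ys) j) (obj (T xs ys) i)"
        using comp_zero[OF gh_entry(1)[OF c2 t(2,1) ij(1) m'(1)], of "obj (T xs ys) j"] oi tj by simp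
    qed
    also have "\<dots> = (if i = j then dbl ?V ?a ?W ?b else Zero C (?V \<odot> ?W) (obj (T xs ys) i))"
      using e1[OF m] e2 zero_comp[OF mor_kk[OF hx] oi(1)] by (simp add: dbl_def)
    also have "dbl ?V ?a ?W ?b = Ident C (?V \<odot> ?W)"
      using s[OF nth_mem[OF kl(1)] nth_mem[OF kl(2)]] scale1[OF mor_ident[OF oi(2)]] by (simp add: scalar_dbl_def)
    finally show "entry (graded_comp C (c ys xs) (c xs ys)) i j = entry (gid (T xs ys)) i j"
      using ij tj by (simp add: gid_entry)
  qed
qed

end

section \<open>Categories in which every object is a sum of copies of the unit\<close>

lemma Vec_hom_trivial:
  assumes eq: "monoidally_equivalent D (Vec :: (nat, (nat, 'k::field mat) arrow, 'k) lincat)"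
    and U: "Unit D \<in> Ob D" and X: "X \<in> Ob D"
    and triv: "\<And>f g. f \<in> Hom D (Unit D) X \<Longrightarrow> g \<in> Hom D (Unit D) X \<Longrightarrow> f = g"
    and fg: "f \<in> Hom D X X" "g \<in> Hom D X X"
  shows "f = g"
proof -
  obtain F F' J u where mf: "monoidal_functor D (Vec :: (nat, (nat, 'k mat) arrow, 'k) lincat) F F' J u"
    and bij: "\<forall>X\<in>Ob D. \<forall>Y\<in>Ob D. bij_betw F' (Hom D X Y) (Hom (Vec :: (nat, (nat, 'k mat) arrow, 'k) lincat) (F X) (F Y))"
    using eq unfolding monoidally_equivalent_def by blast
  let ?m = "F (Unit D)" and ?k = "F X"
  have hv: "Hom (Vec :: (nat, (nat, 'k mat) arrow, 'k) lincat) r s = Arr r s ` carrier_mat s r" for r s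
    by (simp add: Vec_def)
  have "iso_arrow (Vec :: (nat, (nat, 'k mat) arrow, 'k) lincat) 1 ?m u"
    using mf unfolding monoidal_functor_def by (simp add: Vec_def)
  then obtain g' where "mutually_inverse (Vec :: (nat, (nat, 'k mat) arrow, 'k) lincat) 1 ?m u g'"
    unfolding iso_arrow_def by blast
  then have mi: "u \<in> Arr 1 ?m ` carrier_mat ?m 1" "g' \<in> Arr ?m 1 ` carrier_mat 1 ?m"
    "g' \<cdot>\<^bsub>Vec\<^esub> u = Ident (Vec :: (nat, (nat, 'k mat) arrow, 'k) lincat) 1"
    unfolding mutually_inverse_def hv by blast+
  obtain A B where A: "A \<in> carrier_mat ?m 1" "u = Arr 1 ?m A" and B: "B \<in> carrier_mat 1 ?m" "g' = Arr ?m 1 B"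
    using mi(1,2) by blast
  have "B * A = (1\<^sub>m 1 :: 'k mat)" using mi(3) unfolding A(2) B(2) Vec_def by simp
  note AB = A(1) B(1) this
  have "?m \<noteq> 0"
  proof
    assume "?m = 0"
    with AB(1,2) have "(B * A) $$ (0, 0) = 0" by (simp add: scalar_prod_def)
    with AB(3) show False by simp
  qed
  have k0: "?k = 0"
  proof (rule ccontr)
    assume k: "?k \<noteq> 0"
    have "Arr ?m ?k (0\<^sub>m ?k ?m :: 'k mat) \<in> F' ` Hom D (Unit D) X" "Arr ?m ?k (mat ?k ?m (\<lambda>_. 1 :: 'k)) \<in> F' ` Hom D (Unit D) X"
      using bij U X hv by (auto simp: bij_betw_def)
    then obtain f1 f2 where f: "Arr ?m ?k (0\<^sub>m ?k ?m :: 'k mat) = F' f1" "f1 \<in> Hom D (Unit D) X"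
      "Arr ?m ?k (mat ?k ?m (\<lambda>_. 1 :: 'k)) = F' f2" "f2 \<in> Hom D (Unit D) X"
      by (elim imageE)
    have "f1 = f2" by (rule triv[OF f(2,4)])
    with f(1,3) have "Arr ?m ?k (0\<^sub>m ?k ?m :: 'k mat) = Arr ?m ?k (mat ?k ?m (\<lambda>_. 1))" by simp
    then have "(0\<^sub>m ?k ?m :: 'k mat) $$ (0, 0) = mat ?k ?m (\<lambda>_. 1) $$ (0, 0)" by simp
    then show False using k \<open>?m \<noteq> 0\<close> by simp
  qed
  have "F' f \<in> Arr 0 0 ` carrier_mat 0 0" "F' g \<in> Arr 0 0 ` carrier_mat 0 0"
  proof -
    have "F' ` Hom D X X = Arr 0 0 ` carrier_mat 0 0" using bij X hv[of ?k ?k] k0 by (simp add: bij_betw_def)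
    then show "F' f \<in> Arr 0 0 ` carrier_mat 0 0" "F' g \<in> Arr 0 0 ` carrier_mat 0 0" using fg by blast+
  qed
  then have "F' f = F' g" by (auto intro!: eq_matI)
  moreover have "inj_on F' (Hom D X X)" using bij X by (simp add: bij_betw_def)
  ultimately show "f = g" using fg by (auto dest: inj_onD)
qed

section \<open>Ising-like categories\<close>

locale ising_like = parity_category C \<theta> n
  for C :: "('o, 'm, 'k::field) lincat" (structure) and \<theta> :: "'o \<Rightarrow> 'm" and n :: nat +
  fixes W Z :: 'o
  assumes W_ob: "W \<in> Ob C" and Z_ob: "Z \<in> Ob C"
    and not_char_2: "(1::'k) \<noteq> -1"
    and parity_W: "\<theta> W = Ident C W" and parity_Z: "\<theta> Z = Scale C (-1) (Ident C Z)"
    and nonzero: "L \<in> {Unit C, W, Z} \<Longrightarrow> Ident C L \<noteq> Zero C L L"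
    and split: "L \<in> {Unit C, W, Z} \<Longrightarrow> mor p V L \<Longrightarrow> p \<noteq> Zero C V L \<Longrightarrow> \<exists>i. mor i L V \<and> p \<cdot> i = Ident C L"
    and decomposition: "V \<in> Ob C \<Longrightarrow> Ident C V \<in> through {Unit C, W, Z} V V"
    and hom_unit_W: "mor f (Unit C) W \<Longrightarrow> f = Zero C (Unit C) W"
    and end_Z: "mor f Z Z \<Longrightarrow> \<exists>s. f = Scale C s (Ident C Z)"
    and end_WZ: "mor f (W \<odot> Z) (W \<odot> Z) \<Longrightarrow> \<exists>s. f = Scale C s (Ident C (W \<odot> Z))"
    and summand_ZZ: "L \<in> {Unit C, W} \<Longrightarrow> \<exists>i p. mor i L (Z \<odot> Z) \<and> mor p (Z \<odot> Z) L \<and> p \<cdot> i = Ident C L"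
    and summand_WW: "\<exists>i p. mor i (Unit C) (W \<odot> W) \<and> mor p (W \<odot> W) (Unit C) \<and> p \<cdot> i = Ident C (Unit C)"
    and power_of_2: "\<exists>N\<ge>1. n = 2 ^ N"
begin

definition summands :: "'o \<Rightarrow> 'o set" where
  "summands V = {L \<in> {Unit C, W, Z}. \<exists>i p. mor i L V \<and> mor p V L \<and> p \<cdot> i = Ident C L}"

lemma simple_ob: "{Unit C, W, Z} \<subseteq> Ob C" using unit_ob W_ob Z_ob by blast

text \<open>Non-zero maps to simple objects split, so an object is a sum of simple direct summands.\<close>

lemma through_summands:
  assumes V: "V \<in> Ob C"
  shows "Ident C V \<in> through (summands V) V V"
proof -
  have "f \<in> through {Unit C, W, Z} V V \<Longrightarrow> f \<in> through (summands V) V V" for f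
  proof (induction rule: through.induct)
    case through_zero
    show ?case by (rule through.through_zero)
  next
    case (through_add f L p i)
    have m: "mor p V L" "mor i L V" "mor f V V"
      using through_add V simple_ob mor_through by (auto simp: mor_def)
    show ?case
    proof (cases "p = Zero C V L")
      case True
      then have "i \<cdot> p = Zero C V V" using comp_zero[OF m(2) V] by simp
      then show ?thesis using through_add zero_add[OF m(3)] by simp
    next
      case False
      then have "L \<in> summands V" using split[OF through_add(2) m(1)] m through_add(2) by (auto simp: summands_def)
      with through_add show ?thesis by (intro through.through_add)
    qed
  qed
  then show ?thesis using decomposition[OF V] by blast
qed

lemma summand_through: "mor i L V \<Longrightarrow> mor p V L \<Longrightarrow> p \<cdot> i = Ident C L \<Longrightarrow> Ident C L \<in> through {V} L L"
  using through_single[of i L V p L "{V}"] by simp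

lemma scale_ident_inj:
  assumes "L \<in> {Unit C, W, Z}" "Scale C s (Ident C L) = Scale C r (Ident C L)"
  shows "s = r"
proof (rule ccontr)
  assume "s \<noteq> r"
  have L: "L \<in> Ob C" using assms(1) simple_ob by blast
  note i = mor_ident[OF L]
  have "Scale C (s - r) (Ident C L) = Add C (Scale C s (Ident C L)) (Scale C (- r) (Ident C L))"
    using scale_sum[OF L L ident_hom[OF L], of s "- r"] by simp
  also have "\<dots> = Add C (Scale C r (Ident C L)) (Scale C (- r) (Ident C L))" using assms(2) by simp
  also have "\<dots> = Scale C (r + - r) (Ident C L)" by (rule scale_sum[OF L L ident_hom[OF L], symmetric])
  also have "\<dots> = Zero C L L" using scale0[OF i] by simp
  finally have "Scale C (inverse (s - r)) (Scale C (s - r) (Ident C L)) = Zero C L L"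
    using scale_Zero[OF L L] by simp
  then have "Ident C L = Zero C L L" using scalescale[OF i] scale1[OF i] \<open>s \<noteq> r\<close> by simp
  then show False using nonzero[OF assms(1)] by simp
qed

lemma parity_summand:
  assumes V: "\<theta> V = Scale C s (Ident C V)" and L: "L \<in> summands V"
  shows "\<theta> L = Scale C s (Ident C L)"
proof -
  obtain i p where m: "mor i L V" "mor p V L" "p \<cdot> i = Ident C L" using L by (auto simp: summands_def)
  have oL: "L \<in> Ob C" using m(1) by (rule morD)
  have "\<theta> L = \<theta> L \<cdot> (p \<cdot> i)" using m(3) rid[OF parity_mor[OF oL]] by simp
  also have "\<dots> = (p \<cdot> \<theta> V) \<cdot> i"
    using cassoc[OF parity_mor[OF oL] m(2,1)] parity_natural[OF m(2)] by simp
  also have "p \<cdot> \<theta> V = Scale C s p"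
    unfolding V using cscale[OF m(2) mor_ident[OF morD(1)[OF m(2)]]] rid[OF m(2)] by simp
  also have "Scale C s p \<cdot> i = Scale C s (p \<cdot> i)" by (rule scalec[OF m(2,1)])
  finally show ?thesis using m(3) by simp
qed

lemma sign_simps: "sign a = (if even a then 1 else -1)"
  by (simp add: sign_def minus_one_power_iff)

lemma parity_degree:
  assumes "L \<in> {Unit C, W, Z}" "\<theta> L = Scale C (sign a) (Ident C L)"
  shows "even a \<longleftrightarrow> L \<in> {Unit C, W}"
proof -
  have one: "\<theta> L = Scale C 1 (Ident C L)" if "L \<in> {Unit C, W}"
    using that parity_W parity_unit scale1[OF mor_ident] unit_ob W_ob by auto
  have "even a" if "L \<in> {Unit C, W}"
  proof (rule ccontr)
    assume "odd a"
    then have "Scale C 1 (Ident C L) = Scale C (-1) (Ident C L)"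
      using assms(2) unfolding one[OF that] by (simp only: sign_simps if_False)
    from scale_ident_inj[OF assms(1) this] show False using not_char_2 by simp
  qed
  moreover have "odd a" if "L = Z"
  proof
    assume "even a"
    then have "Scale C (-1) (Ident C Z) = Scale C 1 (Ident C Z)"
      using assms(2) unfolding that parity_Z by (simp only: sign_simps if_True)
    from scale_ident_inj[OF _ this] show False using not_char_2 by simp
  qed
  ultimately show ?thesis using assms(1) by blast
qed

end

lemma fusion_subcategory_Inter:
  assumes "\<F> \<noteq> {}" "\<And>S. S \<in> \<F> \<Longrightarrow> fusion_subcategory C S"
  shows "fusion_subcategory C (\<Inter>\<F>)"
  using assms unfolding fusion_subcategory_def by blast

locale ising_braided = ising_like C \<theta> n W Z + graded_braiding C n \<omega> OB c
  for C :: "('o, 'm, 'k::field) lincat" (structure) and \<theta> :: "'o \<Rightarrow> 'm" and n :: nat and W Z :: 'o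
    and \<omega> :: "nat \<Rightarrow> nat \<Rightarrow> nat \<Rightarrow> 'k" and OB and c +
  assumes OB_fusion: "fusion_subcategory (graded_product C n (\<lambda>_ _ _. 1)) OB"
    and OB_parity: "OB \<subseteq> parity_objects"
    and OB_Z: "[(Z, 1)] \<in> OB"
begin

lemma n_ge_2: "n \<ge> 2"
proof -
  obtain N where "N \<ge> 1" "n = 2 ^ N" using power_of_2 by blast
  then show ?thesis using self_le_power[of "2::nat" N] by simp
qed

lemma OB_fusion': "fusion_subcategory (full_subcat (graded_product C n (\<lambda>_ _ _. 1)) (gobs n)) OB"
proof -
  have eq: "full_subcat (graded_product C n (\<lambda>_ _ _. 1)) (gobs n) = graded_product C n (\<lambda>_ _ _. 1)"
    unfolding full_subcat_def graded_product_def gobs_def by simp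
  show ?thesis unfolding eq by (rule OB_fusion)
qed

lemma OB_list:
  assumes "ys \<in> gobs n" "\<And>y. y \<in> set ys \<Longrightarrow> [y] \<in> OB" shows "ys \<in> OB"
  by (rule fusion_subcat_list[OF OB_fusion' subset_refl]) (use assms in auto)

lemma homog_summand:
  assumes "homog V a" "mor i L V" "mor p V L" "p \<cdot> i = Ident C L"
  shows "homog L a"
proof -
  have "[(L, a)] \<in> gobs n" using homogD(4)[OF assms(1)] morD(1)[OF assms(2)] by (simp add: gobs_def)
  from fusion_subcat_through[OF OB_fusion' subset_refl _ summand_through[OF assms(2-4)] _ this]
  show ?thesis using assms(1) homogD(3)[OF assms(1)] unfolding homog_def by blast
qed

lemma homog_parity: "homog V a \<Longrightarrow> \<theta> V = Scale C (sign a) (Ident C V)"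
  using OB_parity parity_objectsD(2)[of "[(V, a)]" 0] by (auto simp: homog_def)

lemma homog_Z: "homog Z 1" using OB_Z by (simp add: homog_def)

lemma homog_unit: "homog (Unit C) 0" using OB_unit by (simp add: homog_def)

lemma homog_even:
  assumes "L \<in> {Unit C, W}"
  shows "homog L (2 mod n)"
proof -
  have "homog (Z \<odot> Z) (2 mod n)" using homog_tens[OF homog_Z homog_Z] by (simp add: numeral_2_eq_2)
  then show ?thesis using summand_ZZ[OF assms] homog_summand by blast
qed

lemma homog_unit_even: "homog (Unit C) ((2 * k) mod n)"
proof (induction k)
  case 0
  then show ?case using homog_unit by simp
next
  case (Suc k)
  have "homog (Unit C) (((2 * k) mod n + 2 mod n) mod n)"
    using homog_tens[OF Suc homog_even[of "Unit C"]] tens_unit[OF unit_ob] by simp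
  moreover have "((2 * k) mod n + 2 mod n) mod n = (2 * Suc k) mod n" by (simp add: mod_simps)
  ultimately show ?case by simp
qed

lemma scalar_dbl_unique:
  assumes "scalar_dbl V a Z 1 s" "scalar_dbl V a Z 1 r" "V \<odot> Z = Z"
  shows "s = r"
  using scale_ident_inj[of Z s r] assms by (simp add: scalar_dbl_def)

lemma scalar_dbl_through_single:
  assumes h: "homog V a" "homog W' b" "homog L a" "homog M b"
    and V: "Ident C V \<in> through {L} V V" and W: "Ident C W' \<in> through {M} W' W'"
    and s: "scalar_dbl L a M b s"
  shows "scalar_dbl V a W' b s"
  by (rule scalar_dbl_through[OF h(1,2) V _ _ W]) (use h s homogD(3) in auto)

lemma unit_centralizes_Z: "scalar_dbl (Unit C) 0 Z 1 1"
proof -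
  have "mor (dbl (Unit C) 0 Z 1) Z Z" using mor_dbl[OF homog_unit homog_Z] Z_ob by (simp add: unit_tens)
  then obtain s where s: "scalar_dbl (Unit C) 0 Z 1 s"
    using end_Z Z_ob by (auto simp: scalar_dbl_def unit_tens)
  have "scalar_dbl (Unit C) 0 Z 1 (s * s)"
    using scalar_dbl_tens_left[OF homog_unit homog_unit homog_Z s s] by (simp add: unit_tens unit_ob)
  then have "s * s = s" using scalar_dbl_unique s Z_ob unit_tens by blast
  moreover have "s \<noteq> 0" using dbl_nonzero[OF homog_unit homog_Z] s nonzero[of Z] Z_ob by (auto simp: unit_tens)
  ultimately show ?thesis using s by simp
qed

text \<open>An invertible object \<open>g\<close> with \<open>g \<otimes> g \<cong> \<one>\<close> has double braiding \<open>\<psi> = \<plusminus>1\<close> with \<open>Z\<close>, hence \<open>\<psi>\<^sup>2 = 1\<close>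
  with \<open>Z \<otimes> Z\<close> and with everything of even degree.\<close>

lemma order_2_centralizes_even:
  assumes L: "L \<in> {Unit C, W}" and h: "homog L a" and a: "(a + a) mod n = 0"
    and M: "M \<in> {Unit C, W}" and hM: "homog M b" and b: "even b"
  shows "scalar_dbl L a M b 1"
proof -
  have oL: "L \<in> Ob C" using h by (rule homogD)
  have "\<exists>s. dbl L a Z 1 = Scale C s (Ident C (L \<odot> Z))"
    using mor_dbl[OF h homog_Z] end_Z[of "dbl L a Z 1"] end_WZ[of "dbl L a Z 1"] L Z_ob by (auto simp: unit_tens)
  then obtain \<psi> where psi: "scalar_dbl L a Z 1 \<psi>" by (auto simp: scalar_dbl_def)
  have LL: "homog (L \<odot> L) 0" using homog_tens[OF h h] a by simp
  have "\<exists>i p. mor i (Unit C) (L \<odot> L) \<and> mor p (L \<odot> L) (Unit C) \<and> p \<cdot> i = Ident C (Unit C)"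
  proof (cases "L = W")
    case True
    then show ?thesis using summand_WW by simp
  next
    case False
    with L have "L = Unit C" by simp
    then show ?thesis using mor_ident[OF unit_ob] lid[OF mor_ident[OF unit_ob]] unit_tens[OF unit_ob] by metis
  qed
  then have t: "Ident C (Unit C) \<in> through {L \<odot> L} (Unit C) (Unit C)" using summand_through by blast
  have "scalar_dbl (L \<odot> L) 0 Z 1 (\<psi> * \<psi>)"
    using scalar_dbl_tens_left[OF h h homog_Z psi psi] a by simp
  then have "scalar_dbl (Unit C) 0 Z 1 (\<psi> * \<psi>)"
    by (rule scalar_dbl_through_single[OF homog_unit homog_Z LL homog_Z t through_Ident[OF Z_ob]])
  then have psi2: "\<psi> * \<psi> = 1" using scalar_dbl_unique unit_centralizes_Z Z_ob unit_tens by blast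
  have ZZ: "homog (Z \<odot> Z) (2 mod n)" using homog_tens[OF homog_Z homog_Z] by (simp add: numeral_2_eq_2)
  have "scalar_dbl L a (Z \<odot> Z) (2 mod n) (\<psi> * \<psi>)"
    using scalar_dbl_tens_right[OF h homog_Z homog_Z psi psi] by (simp add: numeral_2_eq_2)
  then have two: "scalar_dbl L a M' (2 mod n) 1" if "M' \<in> {Unit C, W}" for M'
    using scalar_dbl_through_single[OF h homog_even[OF that] h ZZ through_Ident[OF oL]]
      summand_ZZ[OF that] summand_through psi2 by metis
  have one: "scalar_dbl L a (Unit C) ((2 * Suc k) mod n) 1" for k
  proof (induction k)
    case 0
    then show ?case using two[of "Unit C"] by simp
  next
    case (Suc k)
    have "scalar_dbl L a (Unit C \<odot> Unit C) (((2 * Suc k) mod n + 2 mod n) mod n) (1 * 1)"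
      by (rule scalar_dbl_tens_right[OF h homog_unit_even homog_even Suc two]) simp_all
    moreover have "((2 * Suc k) mod n + 2 mod n) mod n = (2 * Suc (Suc k)) mod n" by (simp add: mod_simps)
    ultimately show ?case by (simp add: unit_tens unit_ob)
  qed
  have bn: "b < n" using hM by (rule homogD)
  \<comment> \<open>the degree \<open>b\<close> is \<open>2 + (2 k + 2)\<close> modulo \<open>n\<close> for a natural number \<open>k\<close>\<close>
  obtain k where k: "b + n + n = 4 + 2 * k"
  proof -
    have "even (b + n + n)" "b + n + n \<ge> 4" using b even_n n_ge_2 by simp_all
    then have "even (b + n + n - 4)" using dvd_diff_nat[of 2 "b + n + n" 4] by simp
    then obtain k where "b + n + n - 4 = 2 * k" by (rule evenE)
    then show ?thesis using that[of k] \<open>b + n + n \<ge> 4\<close> by simp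
  qed
  have "scalar_dbl L a (M \<odot> Unit C) ((2 mod n + (2 * Suc k) mod n) mod n) (1 * 1)"
    by (rule scalar_dbl_tens_right[OF h homog_even[OF M] homog_unit_even two[OF M] one])
  moreover have "(2 mod n + (2 * Suc k) mod n) mod n = b"
  proof -
    have "(2 mod n + (2 * Suc k) mod n) mod n = (2 + 2 * Suc k) mod n" by (rule mod_add_eq)
    also have "2 + 2 * Suc k = b + n + n" using k by simp
    finally have "(2 mod n + (2 * Suc k) mod n) mod n = (b + n + n) mod n" .
    then show ?thesis using bn by simp
  qed
  ultimately show ?thesis using M unit_ob W_ob by (auto simp: tens_unit)
qed

context
  fixes S
  assumes S: "fusion_subcategory (full_subcat (graded_product C n \<omega>) OB) S"
begin

lemma S_homog: "[(V, a)] \<in> S \<Longrightarrow> homog V a"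
  using fusion_subcat_closed(1)[OF S] by (auto simp: homog_def)

lemma S_list_OB: "ys \<in> gobs n \<Longrightarrow> (\<And>y. y \<in> set ys \<Longrightarrow> [y] \<in> S) \<Longrightarrow> ys \<in> OB"
  by (rule OB_list) (use fusion_subcat_closed(1)[OF S] in auto)

lemma S_summand:
  assumes "[(V, a)] \<in> S" "mor i L V" "mor p V L" "p \<cdot> i = Ident C L"
  shows "[(L, a)] \<in> S"
proof -
  have "homog L a" by (rule homog_summand[OF S_homog[OF assms(1)] assms(2-4)])
  then have "[(L, a)] \<in> OB" by (rule homogD)
  from fusion_subcat_through[OF S OB_gobs _ summand_through[OF assms(2-4)] _ this] S_list_OB
  show ?thesis using assms(1) morD(2)[OF assms(2)] by blast
qed

lemma S_summands: "[(V, a)] \<in> S \<Longrightarrow> L \<in> summands V \<Longrightarrow> [(L, a)] \<in> S"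
  using S_summand by (auto simp: summands_def)

lemma S_tens: "[(V, a)] \<in> S \<Longrightarrow> [(W', b)] \<in> S \<Longrightarrow> [(V \<odot> W', (a + b) mod n)] \<in> S"
  by (rule fusion_subcat_tens[OF S])

lemma S_unit: "[(Unit C, 0)] \<in> S" by (rule fusion_subcat_closed(2)[OF S])

lemma simple_degree:
  assumes "[(L, a)] \<in> S" "L \<in> {Unit C, W, Z}"
  shows "even a \<longleftrightarrow> L \<in> {Unit C, W}"
  using parity_degree[OF assms(2)] homog_parity[OF S_homog[OF assms(1)]] by blast

text \<open>A fusion subcategory that contains \<open>Z\<close> in some degree is everything.\<close>

lemma S_everything:
  assumes Za: "[(Z, a)] \<in> S"
  shows "S = OB"
proof -
  have oa: "odd a"
  proof -
    have "Z \<notin> {Unit C, W}"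
    proof
      assume "Z \<in> {Unit C, W}"
      then have "\<theta> Z = Scale C 1 (Ident C Z)" using parity_unit parity_W scale1[OF mor_ident[OF Z_ob]] by auto
      then show False using scale_ident_inj[of Z 1 "-1"] parity_Z not_char_2 by simp
    qed
    then show ?thesis using simple_degree[OF Za] by blast
  qed
  have sq: "[(L, (b + b) mod n)] \<in> S" if "[(Z, b)] \<in> S" "L \<in> {Unit C, W}" for b L
    using S_tens[OF that(1,1)] summand_ZZ[OF that(2)] S_summand by blast
  have Zk: "[(Z, (a + k * (a + a)) mod n)] \<in> S" for k
  proof (induction k)
    case 0
    then show ?case using Za homogD(4)[OF S_homog[OF Za]] by simp
  next
    case (Suc k)
    have "[(Z \<odot> Unit C, ((a + k * (a + a)) mod n + (a + a) mod n) mod n)] \<in> S"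
      by (rule S_tens[OF Suc sq[OF Za]]) simp
    moreover have "((a + k * (a + a)) mod n + (a + a) mod n) mod n = (a + Suc k * (a + a)) mod n"
      using mod_add_eq[of "a + k * (a + a)" n "a + a"] by (simp add: algebra_simps)
    ultimately show ?case by (simp add: tens_unit Z_ob)
  qed
  have Z1: "[(Z, 1)] \<in> S"
  proof -
    obtain N where N: "n = 2 ^ N" using power_of_2 by blast
    have "coprime a n" unfolding N using oa by (simp add: coprime_right_2_iff_odd)
    then have "\<exists>x. [a * x = 1] (mod n)" using cong_solve_coprime_nat[of a n] by simp
    then obtain x where x: "[a * x = 1] (mod n)" by blast
    then have x1: "(a * x) mod n = 1" using n_ge_2 by (simp add: cong_def)
    have "odd (a * x)" using x1 even_n by (metis dvd_mod_iff odd_one)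
    then obtain k where k: "x = 2 * k + 1" by (auto elim: oddE)
    have "a + k * (a + a) = a * x" by (simp add: k algebra_simps)
    then have "(a + k * (a + a)) mod n = 1" using x1 by simp
    then show ?thesis using Zk[of k] by simp
  qed
  have U: "[(Unit C, (2 * k) mod n)] \<in> S" for k
  proof (induction k)
    case 0
    then show ?case using S_unit by simp
  next
    case (Suc k)
    have "[(Unit C \<odot> Unit C, ((2 * k) mod n + (1 + 1) mod n) mod n)] \<in> S"
      by (rule S_tens[OF Suc sq[OF Z1]]) simp
    moreover have "((2 * k) mod n + (1 + 1) mod n) mod n = (2 * Suc k) mod n"
      unfolding mod_add_eq by simp
    ultimately show ?case by (simp add: unit_tens unit_ob)
  qed
  have simple: "[(L, b)] \<in> S" if L: "L \<in> {Unit C, W, Z}" and b: "b < n" and par: "even b \<longleftrightarrow> L \<in> {Unit C, W}" for L b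
  proof (cases "even b")
    case True
    then have L: "L \<in> {Unit C, W}" using par by simp
    have "even (b + n)" using True even_n by simp
    then have "even (b + n - 2)" using dvd_diff_nat[of 2 "b + n" 2] by simp
    then obtain k where k: "b + n - 2 = 2 * k" by (rule evenE)
    have "[(L \<odot> Unit C, ((1 + 1) mod n + (2 * k) mod n) mod n)] \<in> S" by (rule S_tens[OF sq[OF Z1 L] U])
    moreover have "((1 + 1) mod n + (2 * k) mod n) mod n = b"
    proof -
      have "((1 + 1) mod n + (2 * k) mod n) mod n = (1 + 1 + 2 * k) mod n" by (rule mod_add_eq)
      also have "1 + 1 + 2 * k = b + n" using k n_ge_2 by simp
      finally show ?thesis using b by simp
    qed
    ultimately show ?thesis using L unit_ob W_ob by (auto simp: tens_unit)
  next
    case False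
    then have "L = Z" using par L by auto
    obtain k where k: "b = 2 * k + 1" using False by (rule oddE)
    have "[(Z \<odot> Unit C, (1 + (2 * k) mod n) mod n)] \<in> S" by (rule S_tens[OF Z1 U])
    moreover have "(1 + (2 * k) mod n) mod n = b" using b k by (simp add: mod_simps)
    ultimately show ?thesis using \<open>L = Z\<close> by (simp add: tens_unit Z_ob)
  qed
  have sing: "[(V, b)] \<in> S" if V: "homog V b" for V b
  proof -
    have "[(L, b)] \<in> S" if L: "L \<in> summands V" for L
      using simple[of L b] L homogD(4)[OF V] parity_degree[of L b] parity_summand[OF homog_parity[OF V] L]
      by (auto simp: summands_def)
    moreover have "summands V \<subseteq> Ob C" using simple_ob by (auto simp: summands_def)
    ultimately show ?thesis
      using fusion_subcat_through[OF S OB_gobs _ through_summands[OF homogD(3)[OF V]] _ homogD(1)[OF V]] S_list_OB by blast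
  qed
  have "xs \<in> S" if "xs \<in> OB" for xs
  proof (rule fusion_subcat_list[OF S OB_gobs])
    show "ys \<in> gobs n \<Longrightarrow> (\<And>y. y \<in> set ys \<Longrightarrow> [y] \<in> S) \<Longrightarrow> ys \<in> OB" for ys by (rule S_list_OB)
    fix x assume "x \<in> set xs"
    then have "[x] \<in> OB" using OB_singleton that by blast
    then show "[x] \<in> S" using sing[of "fst x" "snd x"] by (simp add: homog_def)
  qed
  then show ?thesis using fusion_subcat_closed(1)[OF S] by blast
qed

lemma S_centralizer:
  assumes xs: "xs \<in> S" and s: "\<And>x y. x \<in> set xs \<Longrightarrow> [y] \<in> S \<Longrightarrow> scalar_dbl (fst x) (snd x) (fst y) (snd y) 1"
    and ys: "ys \<in> S"
  shows "graded_comp C (c ys xs) (c xs ys) = gid (T xs ys)"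
proof (rule double_braiding_trivial)
  show O: "xs \<in> OB" "ys \<in> OB" using fusion_subcat_closed(1)[OF S] xs ys by blast+
  fix x y assume x: "x \<in> set xs" and y: "y \<in> set ys"
  have "[y] \<in> S" by (rule fusion_subcat_singleton[OF S OB_gobs ys y OB_singleton[OF O(2) y]])
  then show "scalar_dbl (fst x) (snd x) (fst y) (snd y) 1" by (rule s[OF x])
qed

text \<open>Without \<open>Z\<close>, non-degeneracy leaves only the unit: an element of order 2 would be transparent.\<close>

lemma S_transparent:
  assumes noZ: "\<And>a. [(Z, a)] \<notin> S"
    and nd: "monoidally_equivalent (Mueger_center (full_subcat (graded_product C n \<omega>) S) c) (Vec :: (nat, (nat, 'k mat) arrow, 'k) lincat)"
  shows "Mueger_center (full_subcat (graded_product C n \<omega>) S) c = full_subcat (graded_product C n \<omega>) S"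
proof -
  let ?I = "full_subcat (graded_product C n \<omega>) S"
  define M where "M = {xs \<in> S. \<forall>ys\<in>S. graded_comp C (c ys xs) (c xs ys) = gid (T xs ys)}"
  have center: "Mueger_center ?I c = full_subcat (graded_product C n \<omega>) M"
    by (simp add: Mueger_center_def M_def full_subcat_def)
  have simple: "L \<in> {Unit C, W}" "even b" if "[(V, b)] \<in> S" "L \<in> summands V" for L V b
  proof -
    have L: "[(L, b)] \<in> S" "L \<in> {Unit C, W, Z}" using S_summands[OF that] that(2) by (auto simp: summands_def)
    then show "L \<in> {Unit C, W}" using noZ by auto
    then show "even b" using simple_degree[OF L] by blast
  qed
  have sub: "summands V \<subseteq> Ob C" for V using simple_ob by (auto simp: summands_def)
  have order2: "[(L, a)] \<in> M" if La: "[(L, a)] \<in> S" and L: "L \<in> {Unit C, W}" and a: "(a + a) mod n = 0" for L a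
  proof -
    have "graded_comp C (c ys [(L, a)]) (c [(L, a)] ys) = gid (T [(L, a)] ys)" if "ys \<in> S" for ys
    proof (rule S_centralizer[OF La _ that])
      fix x y assume x: "x \<in> set [(L, a)]" and y: "[y] \<in> S"
      obtain V b where yV: "y = (V, b)" by (cases y)
      note V = S_homog[OF y[unfolded yV]]
      have "scalar_dbl L a V b 1"
      proof (rule scalar_dbl_through[OF S_homog[OF La] V through_Ident _ _ through_summands sub])
        show "L \<in> Ob C" "{L} \<subseteq> Ob C" "V \<in> Ob C" using homogD(3)[OF S_homog[OF La]] homogD(3)[OF V] by auto
        show "L' \<in> {L} \<Longrightarrow> homog L' a" for L' using S_homog[OF La] by simp
        show hM: "M' \<in> summands V \<Longrightarrow> homog M' b" for M' using S_homog S_summands y yV by blast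
        show "L' \<in> {L} \<Longrightarrow> M' \<in> summands V \<Longrightarrow> scalar_dbl L' a M' b 1" for L' M'
          using order_2_centralizes_even[OF L S_homog[OF La] a] simple[OF y[unfolded yV]] hM by blast
      qed
      then show "scalar_dbl (fst x) (snd x) (fst y) (snd y) 1" using x yV by simp
    qed
    then show ?thesis using La by (simp add: M_def)
  qed
  have unit_M: "[(Unit C, 0)] \<in> M" by (rule order2[OF S_unit]) simp_all
  have M_unit: "L = Unit C \<and> a = 0" if La: "[(L, a)] \<in> M" and L: "L \<in> {Unit C, W}" for L a
  proof (rule ccontr)
    assume ne: "\<not> (L = Unit C \<and> a = 0)"
    have g: "[(L, a)] \<in> gobs n" "[(Unit C, 0)] \<in> gobs n"
      using La unit_M fusion_subcat_closed(1)[OF S] OB_gobs by (auto simp: M_def)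
    have oL: "L \<in> Ob C" using L unit_ob W_ob by blast
    have triv: "f = Arr [(Unit C, 0)] [(L, a)] (mat 1 1 (\<lambda>_. Zero C (Unit C) L))"
      if f: "f \<in> graded_hom C [(Unit C, 0)] [(L, a)]" for f
    proof -
      note e = gh_entry[OF f g(2,1), of 0 0]
      have "entry f 0 0 = Zero C (Unit C) L"
        using e ne L hom_unit_W by (cases "a = 0") auto
      then have "body f = mat 1 1 (\<lambda>_. Zero C (Unit C) L)"
        using gh_arr[OF f] by (intro eq_matI) (auto simp: entry_def)
      then show ?thesis using gh_arr[OF f] by metis
    qed
    have z: "Arr [(L, a)] [(L, a)] (mat (length [(L, a)]) (length [(L, a)]) (\<lambda>(i, j). Zero C L L)) \<in> graded_hom C [(L, a)] [(L, a)]"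
      by (rule single_hom(1)[OF mor_zero[OF oL oL]])
    have "gid [(L, a)] = Arr [(L, a)] [(L, a)] (mat (length [(L, a)]) (length [(L, a)]) (\<lambda>(i, j). Zero C L L))"
    proof (rule Vec_hom_trivial[OF nd[unfolded center]])
      show "Unit (full_subcat (graded_product C n \<omega>) M) \<in> Ob (full_subcat (graded_product C n \<omega>) M)"
        using unit_M by simp
      show "[(L, a)] \<in> Ob (full_subcat (graded_product C n \<omega>) M)" using La by simp
      show "gid [(L, a)] \<in> Hom (full_subcat (graded_product C n \<omega>) M) [(L, a)] [(L, a)]"
        using gid_hom[OF g(1)] by simp
      show "Arr [(L, a)] [(L, a)] (mat (length [(L, a)]) (length [(L, a)]) (\<lambda>(i, j). Zero C L L))
          \<in> Hom (full_subcat (graded_product C n \<omega>) M) [(L, a)] [(L, a)]" using z by simp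
      fix f g' assume "f \<in> Hom (full_subcat (graded_product C n \<omega>) M) (Unit (full_subcat (graded_product C n \<omega>) M)) [(L, a)]"
        "g' \<in> Hom (full_subcat (graded_product C n \<omega>) M) (Unit (full_subcat (graded_product C n \<omega>) M)) [(L, a)]"
      then have "f \<in> graded_hom C [(Unit C, 0)] [(L, a)]" "g' \<in> graded_hom C [(Unit C, 0)] [(L, a)]" by simp_all
      then show "f = g'" using triv by metis
    qed
    then have "entry (gid [(L, a)]) 0 0 = Zero C L L" using single_hom(2)[OF mor_zero[OF oL oL]] by simp
    then have "Ident C L = Zero C L L" by (simp add: gid_entry)
    then show False using nonzero[of L] L by blast
  qed
  have torsion: "L = Unit C \<and> a = 0" if "[(L, a)] \<in> S" "L \<in> {Unit C, W}" "(2 ^ m * a) mod n = 0" for m L a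
    using that
  proof (induction m arbitrary: L a)
    case 0
    then have "a = 0" using homogD(4)[OF S_homog] by fastforce
    then show ?case using M_unit[OF order2[OF 0(1,2)]] 0 by simp
  next
    case (Suc m)
    have LL: "[(L \<odot> L, (a + a) mod n)] \<in> S" by (rule S_tens[OF Suc.prems(1,1)])
    have "[(Unit C, (a + a) mod n)] \<in> S"
    proof (cases "L = W")
      case True
      then show ?thesis using LL summand_WW S_summand by blast
    next
      case False
      then show ?thesis using LL Suc.prems(2) by (auto simp: unit_tens unit_ob)
    qed
    moreover have "(2 ^ m * ((a + a) mod n)) mod n = 0"
    proof -
      have "2 ^ m * (a + a) = 2 ^ Suc m * a" by (simp add: algebra_simps)
      then show ?thesis using Suc.prems(3) mod_mult_right_eq[of "2 ^ m" "a + a" n] by metis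
    qed
    ultimately have "(a + a) mod n = 0" using Suc.IH[of "Unit C" "(a + a) mod n"] by simp
    then show ?case by (rule M_unit[OF order2[OF Suc.prems(1,2)] Suc.prems(2)])
  qed
  obtain N where N: "n = 2 ^ N" using power_of_2 by blast
  have only_unit: "L = Unit C \<and> b = 0" if "[(V, b)] \<in> S" "L \<in> summands V" for L V b
    using torsion[of L b N] S_summands[OF that] simple[OF that] N by simp
  have "M = S"
  proof
    show "M \<subseteq> S" by (auto simp: M_def)
    have "xs \<in> M" if xs: "xs \<in> S" for xs
    proof -
      have "graded_comp C (c ys xs) (c xs ys) = gid (T xs ys)" if "ys \<in> S" for ys
      proof (rule S_centralizer[OF xs _ that])
        fix x y assume x: "x \<in> set xs" and y: "[y] \<in> S"
        obtain V a where xV: "x = (V, a)" by (cases x)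
        obtain V' b where yV: "y = (V', b)" by (cases y)
        have "xs \<in> OB" using fusion_subcat_closed(1)[OF S] xs by blast
        then have x': "[(V, a)] \<in> S" using fusion_subcat_singleton[OF S OB_gobs xs x] OB_singleton x xV by blast
        note y' = y[unfolded yV]
        have "scalar_dbl V a V' b 1"
        proof (rule scalar_dbl_through[OF S_homog[OF x'] S_homog[OF y'] through_summands sub _ through_summands sub])
          show "V \<in> Ob C" "V' \<in> Ob C" using homogD(3) S_homog x' y' by blast+
          show h1: "L \<in> summands V \<Longrightarrow> homog L a" for L using S_homog S_summands x' by blast
          show h2: "L \<in> summands V' \<Longrightarrow> homog L b" for L using S_homog S_summands y' by blast
          fix L L' assume L: "L \<in> summands V" "L' \<in> summands V'"
          have "scalar_dbl (Unit C) 0 (Unit C) 0 1"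
            by (rule order_2_centralizes_even[OF _ homog_unit _ _ homog_unit]) simp_all
          then show "scalar_dbl L a L' b 1" using only_unit[OF x' L(1)] only_unit[OF y' L(2)] by simp
        qed
        then show "scalar_dbl (fst x) (snd x) (fst y) (snd y) 1" using xV yV by simp
      qed
      then show ?thesis using xs by (simp add: M_def)
    qed
    then show "S \<subseteq> M" by blast
  qed
  then show ?thesis by (simp add: center)
qed

end

theorem prime: "prime_braided (full_subcat (graded_product C n \<omega>) OB) c"
  unfolding prime_braided_def
proof (intro allI impI, elim conjE)
  fix S
  assume S: "fusion_subcategory (full_subcat (graded_product C n \<omega>) OB) S"
    and nd: "non_degenerate (full_subcat (full_subcat (graded_product C n \<omega>) OB) S) c"
  have ff: "full_subcat (full_subcat (graded_product C n \<omega>) OB) S = full_subcat (graded_product C n \<omega>) S"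
    by (simp add: full_subcat_def)
  show "monoidally_equivalent (full_subcat (full_subcat (graded_product C n \<omega>) OB) S)
      (Vec :: (nat, (nat, 'k mat) arrow, 'k) lincat) \<or> S = Ob (full_subcat (graded_product C n \<omega>) OB)"
  proof (cases "\<exists>a. [(Z, a)] \<in> S")
    case True
    then show ?thesis using S_everything[OF S] by auto
  next
    case False
    then show ?thesis using S_transparent[OF S] nd unfolding ff non_degenerate_def by auto
  qed
qed

end

section \<open>Kronecker products\<close>

abbreviation kron :: "'k::field mat \<Rightarrow> 'k mat \<Rightarrow> 'k mat" where "kron \<equiv> kronecker (*)"

lemma kron_dim [simp]: "dim_row (kron A B) = dim_row A * dim_row B" "dim_col (kron A B) = dim_col A * dim_col B"
  by (simp_all add: kronecker_def)

lemma kron_index: "i < dim_row A * dim_row B \<Longrightarrow> j < dim_col A * dim_col B \<Longrightarrow>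
    kron A B $$ (i, j) = A $$ (i div dim_row B, j div dim_col B) * B $$ (i mod dim_row B, j mod dim_col B)"
  by (simp add: kronecker_def)

lemma kron_carrier: "A \<in> carrier_mat a b \<Longrightarrow> B \<in> carrier_mat c d \<Longrightarrow> kron A B \<in> carrier_mat (a * c) (b * d)"
  by (intro carrier_matI) simp_all

lemma sum_pairs: "(\<Sum>k<b * e. f (k div e) (k mod e)) = (\<Sum>x<b. \<Sum>y<e. f x (y::nat) :: 'a::comm_monoid_add)"
proof -
  have inner: "(\<Sum>k = x * e..<x * e + e. f (k div e) (k mod e)) = (\<Sum>y<e. f x y)" for x
  proof -
    have "(\<Sum>k = x * e..<x * e + e. f (k div e) (k mod e)) = (\<Sum>y = 0..<e. f ((y + x * e) div e) ((y + x * e) mod e))"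
      using sum.shift_bounds_nat_ivl[of "\<lambda>k. f (k div e) (k mod e)" 0 "x * e" e] by (simp add: add.commute)
    also have "\<dots> = (\<Sum>y = 0..<e. f x y)" by (rule sum.cong) auto
    finally show ?thesis by (simp add: atLeast0LessThan)
  qed
  show ?thesis unfolding sum.nat_group[symmetric] inner ..
qed

lemma mult_index: "A \<in> carrier_mat a b \<Longrightarrow> B \<in> carrier_mat b c \<Longrightarrow> i < a \<Longrightarrow> j < c \<Longrightarrow>
    (A * B) $$ (i, j) = (\<Sum>k<b. A $$ (i, k) * B $$ (k, j))"
  by (simp add: scalar_prod_def atLeast0LessThan)

lemma kron_mult:
  assumes A: "A \<in> carrier_mat a b" and A': "A' \<in> carrier_mat b c" and B: "B \<in> carrier_mat d e" and B': "B' \<in> carrier_mat e f"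
  shows "kron A B * kron A' B' = kron (A * A') (B * B')"
proof (rule eq_matI)
  fix i j assume "i < dim_row (kron (A * A') (B * B'))" "j < dim_col (kron (A * A') (B * B'))"
  then have i: "i < a * d" and j: "j < c * f" using A A' B B' by auto
  note di = div_mod_less[OF i] and dj = div_mod_less[OF j]
  have "(kron A B * kron A' B') $$ (i, j) = (\<Sum>k<b * e. kron A B $$ (i, k) * kron A' B' $$ (k, j))"
    by (rule mult_index[OF kron_carrier[OF A B] kron_carrier[OF A' B'] i j])
  also have "\<dots> = (\<Sum>k<b * e. (A $$ (i div d, k div e) * A' $$ (k div e, j div f)) * (B $$ (i mod d, k mod e) * B' $$ (k mod e, j mod f)))"
    using A A' B B' i j by (intro sum.cong) (auto simp: kron_index)
  also have "\<dots> = (\<Sum>x<b. \<Sum>y<e. (A $$ (i div d, x) * A' $$ (x, j div f)) * (B $$ (i mod d, y) * B' $$ (y, j mod f)))"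
    by (rule sum_pairs)
  also have "\<dots> = (\<Sum>x<b. A $$ (i div d, x) * A' $$ (x, j div f)) * (\<Sum>y<e. B $$ (i mod d, y) * B' $$ (y, j mod f))"
    by (rule sum_product[symmetric])
  also have "\<dots> = (A * A') $$ (i div d, j div f) * (B * B') $$ (i mod d, j mod f)"
    using mult_index[OF A A'] mult_index[OF B B'] di dj by simp
  also have "\<dots> = kron (A * A') (B * B') $$ (i, j)"
    using A A' B B' i j by (simp add: kron_index)
  finally show "(kron A B * kron A' B') $$ (i, j) = kron (A * A') (B * B') $$ (i, j)" .
qed (use A A' B B' in auto)

lemma triple_index:
  assumes "(i::nat) < x * y * z"
  shows "i div (y * z) = i div z div y" "i mod (y * z) div z = i div z mod y" "i mod (y * z) mod z = i mod z"
proof -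
  have m: "i mod z < z" using div_mod_less[OF assms] by simp
  have r: "i mod (y * z) = i div z mod y * z + i mod z"
    using mod_mult2_eq[of i z y] by (simp add: mult.commute)
  show "i div (y * z) = i div z div y" using div_mult2_eq[of i z y] by (simp add: mult.commute)
  show "i mod (y * z) div z = i div z mod y" "i mod (y * z) mod z = i mod z"
    unfolding r using pair_index_div[OF m] by blast+
qed

lemma kron_assoc: "kron (kron A B) D = kron A (kron B D)"
proof (rule eq_matI)
  fix i j assume "i < dim_row (kron A (kron B D))" "j < dim_col (kron A (kron B D))"
  then have i: "i < dim_row A * dim_row B * dim_row D" and j: "j < dim_col A * dim_col B * dim_col D"
    by (auto simp: mult.assoc)
  have i': "i < dim_row A * (dim_row B * dim_row D)" "j < dim_col A * (dim_col B * dim_col D)"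
    using i j by (simp_all add: mult.assoc)
  note di = div_mod_less[OF i] and dj = div_mod_less[OF j] and ei = div_mod_less[OF i'(1)] and ej = div_mod_less[OF i'(2)]
  show "kron (kron A B) D $$ (i, j) = kron A (kron B D) $$ (i, j)"
    using i j i' di dj ei ej by (simp add: kron_index triple_index[OF i] triple_index[OF j] mult.assoc)
qed (simp_all add: mult.assoc)

lemma kron_one: "kron (1\<^sub>m a) (1\<^sub>m b) = (1\<^sub>m (a * b) :: 'k::field mat)"
proof (rule eq_matI)
  fix i j assume "i < dim_row (1\<^sub>m (a * b) :: 'k mat)" "j < dim_col (1\<^sub>m (a * b) :: 'k mat)"
  then have i: "i < a * b" and j: "j < a * b" by auto
  have "i = j \<longleftrightarrow> i div b = j div b \<and> i mod b = j mod b"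
    using div_mult_mod_eq[of i b] div_mult_mod_eq[of j b] by metis
  then show "kron (1\<^sub>m a) (1\<^sub>m b) $$ (i, j) = (1\<^sub>m (a * b) :: 'k mat) $$ (i, j)"
    using i j div_mod_less[OF i] div_mod_less[OF j] by (simp add: kron_index)
qed simp_all

lemma kron_unit: "kron (1\<^sub>m 1) A = A" "kron A (1\<^sub>m 1) = A"
  by (rule eq_matI; simp add: kron_index)+

lemma kron_zero: "kron (0\<^sub>m a b) B = 0\<^sub>m (a * dim_row B) (b * dim_col B)" "kron B (0\<^sub>m a b) = 0\<^sub>m (dim_row B * a) (dim_col B * b)"
  by (rule eq_matI; use div_mod_less in \<open>force simp: kron_index\<close>)+

lemma kron_add:
  assumes "A \<in> carrier_mat a b" "A' \<in> carrier_mat a b" "B \<in> carrier_mat c d"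
  shows "kron (A + A') B = kron A B + kron A' B" "kron B (A + A') = kron B A + kron B A'"
  by (rule eq_matI; use assms div_mod_less in \<open>force simp: kron_index algebra_simps\<close>)+

lemma kron_smult: "kron (s \<cdot>\<^sub>m A) B = s \<cdot>\<^sub>m kron A B" "kron B (s \<cdot>\<^sub>m A) = s \<cdot>\<^sub>m kron B A"
  by (rule eq_matI; use div_mod_less in \<open>force simp: kron_index\<close>)+

section \<open>Representations of the quantum group form a strict category\<close>

definition intertw :: "'k::field uq_module \<Rightarrow> 'k uq_module \<Rightarrow> 'k mat \<Rightarrow> bool" where
  "intertw V W A \<longleftrightarrow> A \<in> carrier_mat (dimen W) (dimen V) \<and>
     A * actE V = actE W * A \<and> A * actF V = actF W * A \<and>
     A * actK V = actK W * A \<and> A * actKinv V = actKinv W * A"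

lemma uq_hom_iff: "f \<in> uq_hom V W \<longleftrightarrow> (\<exists>A. f = Arr V W A \<and> intertw V W A)"
  by (auto simp: uq_hom_def intertw_def)

lemma Rep_simps [simp]:
  "Ob (Rep_Uq q) = uq_modules q" "Hom (Rep_Uq q) = uq_hom" "Ident (Rep_Uq q) V = Arr V V (1\<^sub>m (dimen V))"
  "Zero (Rep_Uq q) V W = Arr V W (0\<^sub>m (dimen W) (dimen V))" "TensO (Rep_Uq q) = uq_tensor"
  "Unit (Rep_Uq q) = uq_trivial"
  "Arr Y' Z B \<cdot>\<^bsub>Rep_Uq q\<^esub> Arr X Y A = Arr X Z (B * A)"
  "Add (Rep_Uq q) (Arr X Y A) (Arr X' Y' B) = Arr X Y (A + B)"
  "Scale (Rep_Uq q) a (Arr X Y A) = Arr X Y (a \<cdot>\<^sub>m A)"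
  "Arr X Y A \<boxtimes>\<^bsub>Rep_Uq q\<^esub> Arr X' Y' B = Arr (uq_tensor X X') (uq_tensor Y Y') (kron A B)"
  "LUnit (Rep_Uq q) V = Arr (uq_tensor uq_trivial V) V (1\<^sub>m (dimen V))"
  "RUnit (Rep_Uq q) V = Arr (uq_tensor V uq_trivial) V (1\<^sub>m (dimen V))"
  "Assoc (Rep_Uq q) U V W = Arr (uq_tensor (uq_tensor U V) W) (uq_tensor U (uq_tensor V W)) (1\<^sub>m (dimen U * dimen V * dimen W))"
  by (simp_all add: Rep_Uq_def)

lemma uq_tensor_simps [simp]:
  "dimen (uq_tensor V W) = dimen V * dimen W"
  "actE (uq_tensor V W) = kron (actE V) (actK W) + kron (1\<^sub>m (dimen V)) (actE W)"
  "actF (uq_tensor V W) = kron (actF V) (1\<^sub>m (dimen W)) + kron (actKinv V) (actF W)"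
  "actK (uq_tensor V W) = kron (actK V) (actK W)" "actKinv (uq_tensor V W) = kron (actKinv V) (actKinv W)"
  by (simp_all add: uq_tensor_def)

lemma uq_trivial_simps [simp]: "dimen uq_trivial = 1" "actE uq_trivial = 0\<^sub>m 1 1" "actF uq_trivial = 0\<^sub>m 1 1"
  "actK uq_trivial = 1\<^sub>m 1" "actKinv uq_trivial = 1\<^sub>m 1"
  by (simp_all add: uq_trivial_def)

lemma uq_modulesD:
  assumes "V \<in> uq_modules q"
  shows "actE V \<in> carrier_mat (dimen V) (dimen V)" "actF V \<in> carrier_mat (dimen V) (dimen V)"
    "actK V \<in> carrier_mat (dimen V) (dimen V)" "actKinv V \<in> carrier_mat (dimen V) (dimen V)"
    "actK V * actKinv V = 1\<^sub>m (dimen V)" "actKinv V * actK V = 1\<^sub>m (dimen V)"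
    "actK V * actE V = q\<^sup>2 \<cdot>\<^sub>m (actE V * actK V)"
    "actK V * actF V = inverse (q\<^sup>2) \<cdot>\<^sub>m (actF V * actK V)"
    "actE V * actF V - actF V * actE V = inverse (q - inverse q) \<cdot>\<^sub>m (actK V - actKinv V)"
  using assms by (simp_all add: uq_modules_def)

lemma intertw_comp:
  assumes A: "intertw X Y A" and B: "intertw Y Z B"
    and X: "X \<in> uq_modules q" and Y: "Y \<in> uq_modules q" and Z: "Z \<in> uq_modules q"
  shows "intertw X Z (B * A)"
proof -
  have c: "A \<in> carrier_mat (dimen Y) (dimen X)" "B \<in> carrier_mat (dimen Z) (dimen Y)"
    using A B by (simp_all add: intertw_def)
  have step: "(B * A) * M = M'' * (B * A)"
    if "M \<in> carrier_mat (dimen X) (dimen X)" "M' \<in> carrier_mat (dimen Y) (dimen Y)" "M'' \<in> carrier_mat (dimen Z) (dimen Z)"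
      "A * M = M' * A" "B * M' = M'' * B" for M M' M''
  proof -
    have "(B * A) * M = B * (A * M)" by (rule assoc_mult_mat[OF c(2,1) that(1)])
    also have "\<dots> = (B * M') * A" unfolding that(4) by (rule assoc_mult_mat[OF c(2) that(2) c(1), symmetric])
    also have "\<dots> = M'' * (B * A)" unfolding that(5) by (rule assoc_mult_mat[OF that(3) c(2,1)])
    finally show ?thesis .
  qed
  note x = uq_modulesD[OF X] and y = uq_modulesD[OF Y] and z = uq_modulesD[OF Z]
  show ?thesis unfolding intertw_def
    using c step[OF x(1) y(1) z(1)] step[OF x(2) y(2) z(2)] step[OF x(3) y(3) z(3)] step[OF x(4) y(4) z(4)] A B
    by (auto simp: intertw_def)
qed

lemma intertw_ident: "V \<in> uq_modules q \<Longrightarrow> intertw V V (1\<^sub>m (dimen V))"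
  using uq_modulesD[of V q] by (simp add: intertw_def)

lemma intertw_zero: "V \<in> uq_modules q \<Longrightarrow> W \<in> uq_modules q \<Longrightarrow> intertw V W (0\<^sub>m (dimen W) (dimen V))"
  using uq_modulesD[of V q] uq_modulesD[of W q] by (simp add: intertw_def)

lemma intertw_add:
  assumes "intertw V W A" "intertw V W B" "V \<in> uq_modules q" "W \<in> uq_modules q"
  shows "intertw V W (A + B)"
proof -
  note v = uq_modulesD[OF assms(3)] and w = uq_modulesD[OF assms(4)]
  have c: "A \<in> carrier_mat (dimen W) (dimen V)" "B \<in> carrier_mat (dimen W) (dimen V)"
    using assms by (auto simp: intertw_def)
  show ?thesis using assms(1,2) unfolding intertw_def
    by (auto simp: add_mult_distrib_mat[OF c] mult_add_distrib_mat[OF _ c] v(1-4) w(1-4)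
        add_mult_distrib_mat[OF c v(1)] add_mult_distrib_mat[OF c v(2)] add_mult_distrib_mat[OF c v(3)] add_mult_distrib_mat[OF c v(4)]
        mult_add_distrib_mat[OF w(1) c] mult_add_distrib_mat[OF w(2) c] mult_add_distrib_mat[OF w(3) c] mult_add_distrib_mat[OF w(4) c])
qed

lemma intertw_smult:
  assumes "intertw V W A" "V \<in> uq_modules q" "W \<in> uq_modules q"
  shows "intertw V W (s \<cdot>\<^sub>m A)"
proof -
  note v = uq_modulesD[OF assms(2)] and w = uq_modulesD[OF assms(3)]
  have c: "A \<in> carrier_mat (dimen W) (dimen V)" using assms by (auto simp: intertw_def)
  show ?thesis using assms(1) unfolding intertw_def
    by (auto simp: mult_smult_assoc_mat[OF c v(1)] mult_smult_assoc_mat[OF c v(2)] mult_smult_assoc_mat[OF c v(3)] mult_smult_assoc_mat[OF c v(4)]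
        mult_smult_distrib[OF w(1) c] mult_smult_distrib[OF w(2) c] mult_smult_distrib[OF w(3) c] mult_smult_distrib[OF w(4) c])
qed

lemma intertw_tens:
  assumes A: "intertw X Y A" and B: "intertw X' Y' B"
    and X: "X \<in> uq_modules q" and Y: "Y \<in> uq_modules q" and X': "X' \<in> uq_modules q" and Y': "Y' \<in> uq_modules q"
  shows "intertw (uq_tensor X X') (uq_tensor Y Y') (kron A B)"
proof -
  note x = uq_modulesD[OF X] and y = uq_modulesD[OF Y] and x' = uq_modulesD[OF X'] and y' = uq_modulesD[OF Y']
  have a: "A \<in> carrier_mat (dimen Y) (dimen X)" "A * actE X = actE Y * A" "A * actF X = actF Y * A"
      "A * actK X = actK Y * A" "A * actKinv X = actKinv Y * A"
    and b: "B \<in> carrier_mat (dimen Y') (dimen X')" "B * actE X' = actE Y' * B" "B * actF X' = actF Y' * B"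
      "B * actK X' = actK Y' * B" "B * actKinv X' = actKinv Y' * B"
    using A B by (simp_all add: intertw_def)
  have k: "kron A B * kron M N = kron M' N' * kron A B"
    if "M \<in> carrier_mat (dimen X) (dimen X)" "N \<in> carrier_mat (dimen X') (dimen X')"
      "M' \<in> carrier_mat (dimen Y) (dimen Y)" "N' \<in> carrier_mat (dimen Y') (dimen Y')"
      "A * M = M' * A" "B * N = N' * B" for M N M' N'
    using kron_mult[OF a(1) that(1) b(1) that(2)] kron_mult[OF that(3) a(1) that(4) b(1)] that(5,6) by simp
  note c = kron_carrier[OF a(1) b(1)]
  have one: "A * 1\<^sub>m (dimen X) = 1\<^sub>m (dimen Y) * A" "B * 1\<^sub>m (dimen X') = 1\<^sub>m (dimen Y') * B" using a b by simp_all
  note i = one_carrier_mat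
  show ?thesis unfolding intertw_def uq_tensor_simps
    using c
      k[OF x(1) x'(3) y(1) y'(3) a(2) b(4)] k[OF i x'(1) i y'(1) one(1) b(2)]
      k[OF x(2) i y(2) i a(3) one(2)] k[OF x(4) x'(2) y(4) y'(2) a(5) b(3)]
      k[OF x(3) x'(3) y(3) y'(3) a(4) b(4)] k[OF x(4) x'(4) y(4) y'(4) a(5) b(5)]
      mult_add_distrib_mat[OF c kron_carrier[OF x(1) x'(3)] kron_carrier[OF i x'(1)]]
      mult_add_distrib_mat[OF c kron_carrier[OF x(2) i] kron_carrier[OF x(4) x'(2)]]
      add_mult_distrib_mat[OF kron_carrier[OF y(1) y'(3)] kron_carrier[OF i y'(1)] c]
      add_mult_distrib_mat[OF kron_carrier[OF y(2) i] kron_carrier[OF y(4) y'(2)] c]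
    by simp
qed

lemma uq_tensor_assoc:
  assumes U: "U \<in> uq_modules q" and V: "V \<in> uq_modules q" and W: "W \<in> uq_modules q"
  shows "uq_tensor (uq_tensor U V) W = uq_tensor U (uq_tensor V W)"
proof -
  note u = uq_modulesD[OF U] and v = uq_modulesD[OF V] and w = uq_modulesD[OF W]
  note i = one_carrier_mat
  have E: "actE (uq_tensor (uq_tensor U V) W) = actE (uq_tensor U (uq_tensor V W))"
    using kron_add(1)[OF kron_carrier[OF u(1) v(3)] kron_carrier[OF i v(1)] w(3)]
      kron_add(2)[OF kron_carrier[OF v(1) w(3)] kron_carrier[OF i w(1)] i[of "dimen U"]]
      assoc_add_mat[OF kron_carrier[OF u(1) kron_carrier[OF v(3) w(3)]] kron_carrier[OF i[of "dimen U"] kron_carrier[OF v(1) w(3)]]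
        kron_carrier[OF i[of "dimen U"] kron_carrier[OF i[of "dimen V"] w(1)]]]
    by (simp add: kron_assoc kron_one[symmetric])
  have F: "actF (uq_tensor (uq_tensor U V) W) = actF (uq_tensor U (uq_tensor V W))"
    using kron_add(1)[OF kron_carrier[OF u(2) i] kron_carrier[OF u(4) v(2)] i[of "dimen W"]]
      kron_add(2)[OF kron_carrier[OF v(2) i] kron_carrier[OF v(4) w(2)] u(4)]
      assoc_add_mat[OF kron_carrier[OF u(2) kron_carrier[OF i[of "dimen V"] i[of "dimen W"]]]
        kron_carrier[OF u(4) kron_carrier[OF v(2) i[of "dimen W"]]] kron_carrier[OF u(4) kron_carrier[OF v(4) w(2)]]]
    by (simp add: kron_assoc kron_one[symmetric])
  show ?thesis using E F by (intro uq_module.equality) (simp_all add: kron_assoc mult.assoc uq_tensor_def)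
qed

lemma uq_tensor_unit:
  assumes "V \<in> uq_modules q"
  shows "uq_tensor uq_trivial V = V" "uq_tensor V uq_trivial = V"
  using uq_modulesD[OF assms] kron_unit[of "actE V"] kron_unit[of "actF V"] kron_unit[of "actK V"] kron_unit[of "actKinv V"]
  by (auto intro!: uq_module.equality simp: kron_zero uq_tensor_def uq_trivial_def)

lemma smult_smult_mat: "a \<cdot>\<^sub>m (b \<cdot>\<^sub>m A) = (a * b :: 'k::field) \<cdot>\<^sub>m A"
  by (rule eq_matI) auto

lemma add_diff_mat: "A \<in> carrier_mat a b \<Longrightarrow> B \<in> carrier_mat a b \<Longrightarrow> A = B + (A - B :: 'k::field mat)"
  by (rule eq_matI) auto

lemma smult_mat_trivial: "0 \<cdot>\<^sub>m A = (0\<^sub>m (dim_row A) (dim_col A) :: 'k::field mat)" "1 \<cdot>\<^sub>m A = A"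
  by (rule eq_matI; simp)+

lemma uq_tensor_modules:
  fixes q :: "'k::field"
  assumes q: "q \<noteq> 0" and V: "V \<in> uq_modules q" and W: "W \<in> uq_modules q"
  shows "uq_tensor V W \<in> uq_modules q"
proof -
  let ?n = "dimen V" and ?m = "dimen W"
  define E F K K' where "E = actE V" and "F = actF V" and "K = actK V" and "K' = actKinv V"
  define E2 F2 K2 K2' where "E2 = actE W" and "F2 = actF W" and "K2 = actK W" and "K2' = actKinv W"
  note v = uq_modulesD[OF V, folded E_def F_def K_def K'_def] and w = uq_modulesD[OF W, folded E2_def F2_def K2_def K2'_def]
  note i = one_carrier_mat
  let ?EE = "kron E K2 + kron (1\<^sub>m ?n) E2" and ?FF = "kron F (1\<^sub>m ?m) + kron K' F2"
  note cE = kron_carrier[OF v(1) w(3)] kron_carrier[OF i[of ?n] w(1)] and cF = kron_carrier[OF v(2) i[of ?m]] kron_carrier[OF v(4) w(2)]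
  note cK = kron_carrier[OF v(3) w(3)] and cK' = kron_carrier[OF v(4) w(4)]
  note km = kron_mult
  have KK: "kron K K2 * kron K' K2' = 1\<^sub>m (?n * ?m)" "kron K' K2' * kron K K2 = 1\<^sub>m (?n * ?m)"
    using km[OF v(3) v(4) w(3) w(4)] km[OF v(4) v(3) w(4) w(3)] v(5,6) w(5,6) by (simp_all add: kron_one)
  have KE: "kron K K2 * ?EE = q\<^sup>2 \<cdot>\<^sub>m (?EE * kron K K2)"
  proof -
    have "kron K K2 * ?EE = kron (K * E) (K2 * K2) + kron K (K2 * E2)"
      using mult_add_distrib_mat[OF cK cE] km[OF v(3) v(1) w(3) w(3)] km[OF v(3) i w(3) w(1)] v(3) by simp
    also have "\<dots> = q\<^sup>2 \<cdot>\<^sub>m kron (E * K) (K2 * K2) + q\<^sup>2 \<cdot>\<^sub>m kron K (E2 * K2)"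
      by (simp add: v(7) w(7) kron_smult)
    also have "\<dots> = q\<^sup>2 \<cdot>\<^sub>m (kron (E * K) (K2 * K2) + kron K (E2 * K2))"
      by (rule add_smult_distrib_left_mat[symmetric]) (rule kron_carrier mult_carrier_mat v w)+
    also have "kron (E * K) (K2 * K2) + kron K (E2 * K2) = ?EE * kron K K2"
      using add_mult_distrib_mat[OF cE cK] km[OF v(1) v(3) w(3) w(3)] km[OF i v(3) w(1) w(3)] v(3) by simp
    finally show ?thesis .
  qed
  have KF: "kron K K2 * ?FF = inverse (q\<^sup>2) \<cdot>\<^sub>m (?FF * kron K K2)"
  proof -
    have "kron K K2 * ?FF = kron (K * F) K2 + kron (K * K') (K2 * F2)"
      using mult_add_distrib_mat[OF cK cF] km[OF v(3) v(2) w(3) i] km[OF v(3) v(4) w(3) w(2)] w(3) by simp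
    also have "\<dots> = inverse (q\<^sup>2) \<cdot>\<^sub>m kron (F * K) K2 + inverse (q\<^sup>2) \<cdot>\<^sub>m kron (K' * K) (F2 * K2)"
      by (simp add: v(5,6,8) w(8) kron_smult)
    also have "\<dots> = inverse (q\<^sup>2) \<cdot>\<^sub>m (kron (F * K) K2 + kron (K' * K) (F2 * K2))"
      by (rule add_smult_distrib_left_mat[symmetric]) (rule kron_carrier mult_carrier_mat v w)+
    also have "kron (F * K) K2 + kron (K' * K) (F2 * K2) = ?FF * kron K K2"
      using add_mult_distrib_mat[OF cF cK] km[OF v(2) v(3) i w(3)] km[OF v(4) v(3) w(2) w(3)] w(3) by simp
    finally show ?thesis .
  qed
  have EK': "E * K' = q\<^sup>2 \<cdot>\<^sub>m (K' * E)"
  proof -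
    have "E * K' = (K' * K) * (E * K')" using v by simp
    also have "\<dots> = K' * ((K * E) * K')"
      using assoc_mult_mat[OF v(4,3) mult_carrier_mat[OF v(1,4)]] assoc_mult_mat[OF v(3,1,4)] by simp
    also have "(K * E) * K' = q\<^sup>2 \<cdot>\<^sub>m ((E * K) * K')"
      unfolding v(7) by (rule mult_smult_assoc_mat[OF mult_carrier_mat[OF v(1,3)] v(4)])
    also have "(E * K) * K' = E" using assoc_mult_mat[OF v(1,3,4)] v(1,5) by simp
    also have "K' * (q\<^sup>2 \<cdot>\<^sub>m E) = q\<^sup>2 \<cdot>\<^sub>m (K' * E)" by (rule mult_smult_distrib[OF v(4,1)])
    finally show ?thesis .
  qed
  define X X2 where "X = E * F - F * E" and "X2 = E2 * F2 - F2 * E2"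
  let ?s = "inverse (q - inverse q)"
  have X: "X = ?s \<cdot>\<^sub>m (K - K')" "X2 = ?s \<cdot>\<^sub>m (K2 - K2')" unfolding X_def X2_def by (rule v(9), rule w(9))
  have cX: "X \<in> carrier_mat ?n ?n" "X2 \<in> carrier_mat ?m ?m" unfolding X_def X2_def by (rule minus_carrier_mat[OF mult_carrier_mat[OF v(2,1)]], rule minus_carrier_mat[OF mult_carrier_mat[OF w(2,1)]])
  have EF: "E * F = F * E + X" "E2 * F2 = F2 * E2 + X2"
    unfolding X_def X2_def
    by (rule add_diff_mat[OF mult_carrier_mat mult_carrier_mat]; fact v w)+
  have cd: "K - K' \<in> carrier_mat ?n ?n" "K2 - K2' \<in> carrier_mat ?m ?m"
    by (rule minus_carrier_mat[OF v(4)], rule minus_carrier_mat[OF w(4)])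
  have dK: "(K - K') + K' = K" "(K2 - K2') + K2' = K2" by (rule eq_matI; use v w in auto)+
  define a b cc d e f g h where "a = kron (E * F) K2" and "b = kron (K' * E) (F2 * K2)" and "cc = kron F E2"
    and "d = kron K' (E2 * F2)" and "e = kron (F * E) K2" and "f = kron K' (F2 * E2)"
    and "g = kron X K2" and "h = kron K' X2"
  have carr: "a \<in> carrier_mat (?n * ?m) (?n * ?m)" "b \<in> carrier_mat (?n * ?m) (?n * ?m)" "cc \<in> carrier_mat (?n * ?m) (?n * ?m)"
    "d \<in> carrier_mat (?n * ?m) (?n * ?m)" "e \<in> carrier_mat (?n * ?m) (?n * ?m)" "f \<in> carrier_mat (?n * ?m) (?n * ?m)"
    "g \<in> carrier_mat (?n * ?m) (?n * ?m)" "h \<in> carrier_mat (?n * ?m) (?n * ?m)"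
    unfolding a_def b_def cc_def d_def e_def f_def g_def h_def by (rule kron_carrier mult_carrier_mat v w cX)+
  have ad: "a = e + g" "d = f + h"
    using kron_add(1)[OF mult_carrier_mat[OF v(2,1)] cX(1) w(3)] kron_add(2)[OF mult_carrier_mat[OF w(2,1)] cX(2) v(4)]
    by (simp_all add: a_def d_def e_def f_def g_def h_def EF)
  have "kron (E * K') (K2 * F2) = b"
    using q by (simp add: b_def EK' w(8) kron_smult smult_smult_mat smult_mat_trivial)
  then have p1: "?EE * ?FF = (a + b) + (cc + d)"
    using add_mult_distrib_mat[OF cE add_carrier_mat[OF cF(2), of "kron F (1\<^sub>m ?m)"]]
      mult_add_distrib_mat[OF cE(1) cF] mult_add_distrib_mat[OF cE(2) cF]
      km[OF v(1) v(2) w(3) i] km[OF v(1) v(4) w(3) w(2)] km[OF i v(2) w(1) i] km[OF i v(4) w(1) w(2)] v w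
    by (simp add: a_def cc_def d_def)
  have p2: "?FF * ?EE = (e + cc) + (b + f)"
    using add_mult_distrib_mat[OF cF add_carrier_mat[OF cE(2), of "kron E K2"]]
      mult_add_distrib_mat[OF cF(1) cE] mult_add_distrib_mat[OF cF(2) cE]
      km[OF v(2) v(1) i w(3)] km[OF v(2) i i w(1)] km[OF v(4) v(1) w(2) w(3)] km[OF v(4) i w(2) w(1)] v w
    by (simp add: b_def cc_def e_def f_def)
  have gh: "g + h = ?s \<cdot>\<^sub>m (kron K K2 - kron K' K2')"
  proof -
    have 1: "kron K K2 = kron (K - K') K2 + kron K' K2" using kron_add(1)[OF cd(1) v(4) w(3)] dK by simp
    have 2: "kron K' K2 = kron K' (K2 - K2') + kron K' K2'" using kron_add(2)[OF cd(2) w(4) v(4)] dK by simp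
    have g: "g = ?s \<cdot>\<^sub>m kron (K - K') K2" "h = ?s \<cdot>\<^sub>m kron K' (K2 - K2')"
      by (simp_all add: g_def h_def X kron_smult)
    have c: "kron (K - K') K2 \<in> carrier_mat (?n * ?m) (?n * ?m)" "kron K' (K2 - K2') \<in> carrier_mat (?n * ?m) (?n * ?m)"
      by (rule kron_carrier cd v w)+
    have lin: "s \<cdot>\<^sub>m P + s \<cdot>\<^sub>m Q = s \<cdot>\<^sub>m (P + (Q + R) - R)"
      if "P \<in> carrier_mat N N" "Q \<in> carrier_mat N N" "R \<in> carrier_mat N N" for s :: 'k and P Q R N
      by (rule eq_matI) (use that in \<open>auto simp: algebra_simps\<close>)
    show ?thesis unfolding g 1 2 by (rule lin[OF c cK'])
  qed
  have "?EE * ?FF - ?FF * ?EE = g + h"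
    unfolding p1 p2 ad by (rule eq_matI) (use carr in auto)
  then have EFFE: "?EE * ?FF - ?FF * ?EE = ?s \<cdot>\<^sub>m (kron K K2 - kron K' K2')" using gh by simp
  show ?thesis
    unfolding uq_modules_def using cE cF cK cK' KK KE KF EFFE
    by (simp add: E_def F_def K_def K'_def E2_def F2_def K2_def K2'_def)
qed

lemma uq_trivial_module: "uq_trivial \<in> uq_modules q"
  by (auto simp: uq_modules_def intro!: eq_matI)

lemma intertw_carrier: "intertw X Y A \<Longrightarrow> A \<in> carrier_mat (dimen Y) (dimen X)"
  by (simp add: intertw_def)

lemma uq_homE: "f \<in> uq_hom X Y \<Longrightarrow> (\<And>A. intertw X Y A \<Longrightarrow> f = Arr X Y A \<Longrightarrow> P) \<Longrightarrow> P"
  by (auto simp: uq_hom_iff)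

lemma uq_homI: "intertw X Y A \<Longrightarrow> Arr X Y A \<in> uq_hom X Y"
  by (auto simp: uq_hom_iff)

lemma smult_zero_mat: "A \<in> carrier_mat a b \<Longrightarrow> 0 \<cdot>\<^sub>m A = (0\<^sub>m a b :: 'k::field mat)"
  by (rule eq_matI) auto

lemma Arr_cong: "A = B \<Longrightarrow> Arr X Y A = Arr X Y B"
  by simp

theorem Rep_Uq_strict:
  assumes q: "q \<noteq> 0"
  shows "strict_tensor_category (Rep_Uq q)"
proof -
  note c = intertw_carrier
  show ?thesis
    by (rule strict_tensor_category.intro; (simp only: Rep_simps)?; (elim uq_homE)?; (hypsubst)?; (simp only: Rep_simps)?)
      (rule uq_trivial_module,
       rule uq_tensor_modules[OF q], assumption, assumption,
       rule uq_tensor_assoc, assumption, assumption, assumption,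
       rule uq_tensor_unit, assumption,
       rule uq_tensor_unit, assumption,
       rule uq_homI, rule intertw_ident, assumption,
       rule uq_homI, rule intertw_comp, assumption, assumption, assumption, assumption, assumption,
       rule uq_homI, rule intertw_zero, assumption, assumption,
       rule uq_homI, rule intertw_add, assumption, assumption, assumption, assumption,
       rule uq_homI, rule intertw_smult, assumption, assumption, assumption,
       rule uq_homI, rule intertw_tens, assumption, assumption, assumption, assumption, assumption, assumption,
       (rule Arr_cong, (rule left_mult_one_mat; (rule c, assumption))),
       (rule Arr_cong, (rule right_mult_one_mat; (rule c, assumption))),
       (rule Arr_cong, (rule assoc_mult_mat; (rule c, assumption))),
       (rule Arr_cong, (rule assoc_add_mat; (rule c, assumption))),
       (rule Arr_cong, (rule comm_add_mat; (rule c, assumption))),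
       (rule Arr_cong, (rule right_add_zero_mat; (rule c, assumption))),
       (rule Arr_cong, rule smult_mat_trivial),
       (rule Arr_cong, rule smult_smult_mat),
       (rule Arr_cong, rule smult_zero_mat, rule c, assumption),
       (rule Arr_cong, (rule add_smult_distrib_right_mat; (rule c, assumption))),
       (rule Arr_cong, (rule add_smult_distrib_left_mat; (rule c, assumption))),
       (rule Arr_cong, (rule mult_add_distrib_mat; (rule c, assumption))),
       (rule Arr_cong, (rule add_mult_distrib_mat; (rule c, assumption))),
       (rule Arr_cong, (rule mult_smult_distrib; (rule c, assumption))),
       (rule Arr_cong, (rule mult_smult_assoc_mat; (rule c, assumption))),
       (rule Arr_cong, (rule kron_add; (rule c, assumption))),
       (rule Arr_cong, (rule kron_add; (rule c, assumption))),
       (rule Arr_cong, rule kron_smult),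
       (rule Arr_cong, rule kron_smult),
       (rule Arr_cong, (rule kron_mult; (rule c, assumption))),
       (simp only: kron_one uq_tensor_simps),
       (simp only: uq_tensor_assoc kron_assoc),
       (simp only: uq_tensor_unit kron_unit uq_trivial_simps),
       (simp only: uq_tensor_unit kron_unit uq_trivial_simps),
       (simp only: uq_tensor_assoc uq_tensor_simps mult.assoc),
       (simp only: uq_tensor_unit),
       (simp only: uq_tensor_unit))
qed

section \<open>Traces and blocks\<close>

definition tr :: "'k::field mat \<Rightarrow> 'k" where "tr A = (\<Sum>i<dim_row A. A $$ (i, i))"

lemma tr_diag: "sum_list (diag_mat A) = tr A"
  by (simp add: diag_mat_def tr_def sum_list_distinct_conv_sum_set atLeast0LessThan)

lemma tr_mult_commute:
  assumes A: "A \<in> carrier_mat a b" and B: "B \<in> carrier_mat b a"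
  shows "tr (A * B) = tr (B * A)"
proof -
  have "tr (A * B) = (\<Sum>i<a. \<Sum>k<b. A $$ (i, k) * B $$ (k, i))"
    using A B mult_index[OF A B] by (simp add: tr_def)
  also have "\<dots> = (\<Sum>k<b. \<Sum>i<a. B $$ (k, i) * A $$ (i, k))"
    by (subst sum.swap) (simp add: mult.commute)
  also have "\<dots> = tr (B * A)" using A B mult_index[OF B A] by (simp add: tr_def)
  finally show ?thesis .
qed

lemma tr_add: "A \<in> carrier_mat a a \<Longrightarrow> B \<in> carrier_mat a a \<Longrightarrow> tr (A + B) = tr A + tr B"
  by (simp add: tr_def sum.distrib)

lemma tr_smult: "tr (s \<cdot>\<^sub>m A) = s * tr A" if "A \<in> carrier_mat a a"
  using that by (simp add: tr_def sum_distrib_left)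

lemma tr_zero: "tr (0\<^sub>m a a) = 0"
  by (simp add: tr_def)

lemma sum_pairs': "(\<Sum>k<b * e. g k) = (\<Sum>x<b. \<Sum>y<e. g (x * e + (y::nat)) :: 'a::comm_monoid_add)"
  using sum_pairs[of "\<lambda>x y. g (x * e + y)" e b] by simp

text \<open>Blocks of a matrix on a tensor product with a plane, on the right and on the left.\<close>

definition rblk :: "nat \<Rightarrow> nat \<Rightarrow> 'k mat \<Rightarrow> nat \<Rightarrow> nat \<Rightarrow> 'k mat" where
  "rblk n m h i j = mat n m (\<lambda>(a, b). h $$ (a * 2 + i, b * 2 + j))"

definition lblk :: "nat \<Rightarrow> nat \<Rightarrow> 'k mat \<Rightarrow> nat \<Rightarrow> nat \<Rightarrow> 'k mat" where
  "lblk n m h i j = mat n m (\<lambda>(a, b). h $$ (i * n + a, j * m + b))"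

lemma blk_carrier [simp]: "rblk n m h i j \<in> carrier_mat n m" "lblk n m h i j \<in> carrier_mat n m"
  by (simp_all add: rblk_def lblk_def)

lemma lessThan_2: "{..<2::nat} = {0, 1}" by auto

lemma rblk_kron_mult:
  assumes M: "M \<in> carrier_mat n l" and N: "N \<in> carrier_mat 2 2" and h: "h \<in> carrier_mat (l * 2) (m * 2)"
    and ij: "i < 2" "j < 2" and ab: "a < n" "b < m"
  shows "(kron M N * h) $$ (a * 2 + i, b * 2 + j) =
    N $$ (i, 0) * (M * rblk l m h 0 j) $$ (a, b) + N $$ (i, 1) * (M * rblk l m h 1 j) $$ (a, b)"
proof -
  note ai = pair_index_less[OF ab(1) ij(1)] and bj = pair_index_less[OF ab(2) ij(2)]
  have r: "(M * rblk l m h y j) $$ (a, b) = (\<Sum>x<l. M $$ (a, x) * h $$ (x * 2 + y, b * 2 + j))" for y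
    unfolding mult_index[OF M blk_carrier(1) ab] using ab by (intro sum.cong) (simp_all add: rblk_def)
  have "(kron M N * h) $$ (a * 2 + i, b * 2 + j) = (\<Sum>x<l. \<Sum>y<2. M $$ (a, x) * N $$ (i, y) * h $$ (x * 2 + y, b * 2 + j))"
    unfolding mult_index[OF kron_carrier[OF M N] h ai bj] sum_pairs' using M N ab ij
    by (intro sum.cong refl) (simp add: kron_index pair_index_less pair_index_div)
  also have "\<dots> = (\<Sum>y<2. \<Sum>x<l. M $$ (a, x) * N $$ (i, y) * h $$ (x * 2 + y, b * 2 + j))" by (rule sum.swap)
  also have "\<dots> = (\<Sum>y<2. N $$ (i, y) * (M * rblk l m h y j) $$ (a, b))"
    unfolding r sum_distrib_left by (intro sum.cong refl) (simp add: mult_ac)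
  finally show ?thesis by (simp add: lessThan_2)
qed

lemma rblk_mult_kron:
  assumes M: "M \<in> carrier_mat l m" and N: "N \<in> carrier_mat 2 2" and h: "h \<in> carrier_mat (n * 2) (l * 2)"
    and ij: "i < 2" "j < 2" and ab: "a < n" "b < m"
  shows "(h * kron M N) $$ (a * 2 + i, b * 2 + j) =
    N $$ (0, j) * (rblk n l h i 0 * M) $$ (a, b) + N $$ (1, j) * (rblk n l h i 1 * M) $$ (a, b)"
proof -
  note ai = pair_index_less[OF ab(1) ij(1)] and bj = pair_index_less[OF ab(2) ij(2)]
  have r: "(rblk n l h i y * M) $$ (a, b) = (\<Sum>x<l. h $$ (a * 2 + i, x * 2 + y) * M $$ (x, b))" for y
    unfolding mult_index[OF blk_carrier(1) M ab] using ab by (intro sum.cong) (simp_all add: rblk_def)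
  have "(h * kron M N) $$ (a * 2 + i, b * 2 + j) = (\<Sum>x<l. \<Sum>y<2. h $$ (a * 2 + i, x * 2 + y) * (M $$ (x, b) * N $$ (y, j)))"
    unfolding mult_index[OF h kron_carrier[OF M N] ai bj] sum_pairs' using M N ab ij
    by (intro sum.cong refl) (simp add: kron_index pair_index_less pair_index_div)
  also have "\<dots> = (\<Sum>y<2. \<Sum>x<l. h $$ (a * 2 + i, x * 2 + y) * (M $$ (x, b) * N $$ (y, j)))" by (rule sum.swap)
  also have "\<dots> = (\<Sum>y<2. N $$ (y, j) * (rblk n l h i y * M) $$ (a, b))"
    unfolding r sum_distrib_left by (intro sum.cong refl) (simp add: mult_ac)
  finally show ?thesis by (simp add: lessThan_2)
qed

lemma lblk_kron_mult:
  assumes M: "M \<in> carrier_mat n l" and N: "N \<in> carrier_mat 2 2" and h: "h \<in> carrier_mat (2 * l) (2 * m)"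
    and ij: "i < 2" "j < 2" and ab: "a < n" "b < m"
  shows "(kron N M * h) $$ (i * n + a, j * m + b) =
    N $$ (i, 0) * (M * lblk l m h 0 j) $$ (a, b) + N $$ (i, 1) * (M * lblk l m h 1 j) $$ (a, b)"
proof -
  note ai = pair_index_less[OF ij(1) ab(1)] and bj = pair_index_less[OF ij(2) ab(2)]
  have r: "(M * lblk l m h y j) $$ (a, b) = (\<Sum>x<l. M $$ (a, x) * h $$ (y * l + x, j * m + b))" for y
    unfolding mult_index[OF M blk_carrier(2) ab] using ab by (intro sum.cong) (simp_all add: lblk_def)
  have "(kron N M * h) $$ (i * n + a, j * m + b) = (\<Sum>y<2. \<Sum>x<l. N $$ (i, y) * M $$ (a, x) * h $$ (y * l + x, j * m + b))"
    unfolding mult_index[OF kron_carrier[OF N M] h ai bj] sum_pairs' using M N ab ij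
    by (intro sum.cong refl) (simp add: kron_index pair_index_less pair_index_div)
  also have "\<dots> = (\<Sum>y<2. N $$ (i, y) * (M * lblk l m h y j) $$ (a, b))"
    unfolding r sum_distrib_left by (intro sum.cong refl) (simp add: mult_ac)
  finally show ?thesis by (simp add: lessThan_2)
qed

lemma lblk_mult_kron:
  assumes M: "M \<in> carrier_mat l m" and N: "N \<in> carrier_mat 2 2" and h: "h \<in> carrier_mat (2 * n) (2 * l)"
    and ij: "i < 2" "j < 2" and ab: "a < n" "b < m"
  shows "(h * kron N M) $$ (i * n + a, j * m + b) =
    N $$ (0, j) * (lblk n l h i 0 * M) $$ (a, b) + N $$ (1, j) * (lblk n l h i 1 * M) $$ (a, b)"
proof -
  note ai = pair_index_less[OF ij(1) ab(1)] and bj = pair_index_less[OF ij(2) ab(2)]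
  have r: "(lblk n l h i y * M) $$ (a, b) = (\<Sum>x<l. h $$ (i * n + a, y * l + x) * M $$ (x, b))" for y
    unfolding mult_index[OF blk_carrier(2) M ab] using ab by (intro sum.cong) (simp_all add: lblk_def)
  have "(h * kron N M) $$ (i * n + a, j * m + b) = (\<Sum>y<2. \<Sum>x<l. h $$ (i * n + a, y * l + x) * (N $$ (y, j) * M $$ (x, b)))"
    unfolding mult_index[OF h kron_carrier[OF N M] ai bj] sum_pairs' using M N ab ij
    by (intro sum.cong refl) (simp add: kron_index pair_index_less pair_index_div)
  also have "\<dots> = (\<Sum>y<2. N $$ (y, j) * (lblk n l h i y * M) $$ (a, b))"
    unfolding r sum_distrib_left by (intro sum.cong refl) (simp add: mult_ac)
  finally show ?thesis by (simp add: lessThan_2)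
qed

lemma tr_kron_mult:
  assumes M: "M \<in> carrier_mat n n" and N: "N \<in> carrier_mat 2 2" "N $$ (0, 1) = 0" "N $$ (1, 0) = 0"
  shows "y \<in> carrier_mat (n * 2) (n * 2) \<Longrightarrow> tr (kron M N * y) =
      N $$ (0, 0) * tr (M * rblk n n y 0 0) + N $$ (1, 1) * tr (M * rblk n n y 1 1)"
    "y \<in> carrier_mat (2 * n) (2 * n) \<Longrightarrow> tr (kron N M * y) =
      N $$ (0, 0) * tr (M * lblk n n y 0 0) + N $$ (1, 1) * tr (M * lblk n n y 1 1)"
proof -
  assume y: "y \<in> carrier_mat (n * 2) (n * 2)"
  have "dim_row (kron M N * y) = n * 2" using M N by simp
  then have "tr (kron M N * y) = (\<Sum>x<n. \<Sum>i<2. (kron M N * y) $$ (x * 2 + i, x * 2 + i))"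
    unfolding tr_def by (simp only: sum_pairs')
  also have "\<dots> = (\<Sum>x<n. (kron M N * y) $$ (x * 2 + 0, x * 2 + 0) + (kron M N * y) $$ (x * 2 + 1, x * 2 + 1))"
    by (simp add: lessThan_2)
  also have "\<dots> = (\<Sum>x<n. N $$ (0, 0) * (M * rblk n n y 0 0) $$ (x, x) + N $$ (1, 1) * (M * rblk n n y 1 1) $$ (x, x))"
  proof (intro sum.cong refl)
    fix x assume "x \<in> {..<n}"
    then have x: "x < n" by simp
    have lt: "(0::nat) < 2" "(1::nat) < 2" by simp_all
    show "(kron M N * y) $$ (x * 2 + 0, x * 2 + 0) + (kron M N * y) $$ (x * 2 + 1, x * 2 + 1) =
        N $$ (0, 0) * (M * rblk n n y 0 0) $$ (x, x) + N $$ (1, 1) * (M * rblk n n y 1 1) $$ (x, x)"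
      unfolding rblk_kron_mult[OF M N(1) y lt(1,1) x x] rblk_kron_mult[OF M N(1) y lt(2,2) x x]
      by (simp only: N mult_zero_left add_0_left add_0_right)
  qed
  finally show "tr (kron M N * y) = N $$ (0, 0) * tr (M * rblk n n y 0 0) + N $$ (1, 1) * tr (M * rblk n n y 1 1)"
    using M by (simp add: tr_def sum.distrib sum_distrib_left)
next
  assume y: "y \<in> carrier_mat (2 * n) (2 * n)"
  have "dim_row (kron N M * y) = 2 * n" using M N by simp
  then have "tr (kron N M * y) = (\<Sum>i<2. \<Sum>x<n. (kron N M * y) $$ (i * n + x, i * n + x))"
    unfolding tr_def by (simp only: sum_pairs')
  also have "\<dots> = (\<Sum>x<n. (kron N M * y) $$ (0 * n + x, 0 * n + x)) + (\<Sum>x<n. (kron N M * y) $$ (1 * n + x, 1 * n + x))"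
    by (simp add: lessThan_2)
  also have "\<dots> = (\<Sum>x<n. N $$ (0, 0) * (M * lblk n n y 0 0) $$ (x, x)) + (\<Sum>x<n. N $$ (1, 1) * (M * lblk n n y 1 1) $$ (x, x))"
  proof (intro arg_cong2[where f = plus] sum.cong refl)
    fix x assume "x \<in> {..<n}"
    then have x: "x < n" by simp
    have lt: "(0::nat) < 2" "(1::nat) < 2" by simp_all
    show "(kron N M * y) $$ (0 * n + x, 0 * n + x) = N $$ (0, 0) * (M * lblk n n y 0 0) $$ (x, x)"
      "(kron N M * y) $$ (1 * n + x, 1 * n + x) = N $$ (1, 1) * (M * lblk n n y 1 1) $$ (x, x)"
      unfolding lblk_kron_mult[OF M N(1) y lt(1,1) x x] lblk_kron_mult[OF M N(1) y lt(2,2) x x]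
      by (simp_all only: N mult_zero_left add_0_left add_0_right)
  qed
  finally show "tr (kron N M * y) = N $$ (0, 0) * tr (M * lblk n n y 0 0) + N $$ (1, 1) * tr (M * lblk n n y 1 1)"
    using M by (simp add: tr_def sum_distrib_left)
qed

lemma lin_index:
  fixes A B :: "'k::field mat"
  shows "A \<in> carrier_mat n m \<Longrightarrow> B \<in> carrier_mat n m \<Longrightarrow> a < n \<Longrightarrow> b < m \<Longrightarrow>
    (s \<cdot>\<^sub>m A + t \<cdot>\<^sub>m B) $$ (a, b) = s * A $$ (a, b) + t * B $$ (a, b)"
  by simp

lemma lin_mult_index:
  fixes A B M :: "'k::field mat"
  assumes "A \<in> carrier_mat n l" "B \<in> carrier_mat n l" "M \<in> carrier_mat l m" "a < n" "b < m"
  shows "((s \<cdot>\<^sub>m A + t \<cdot>\<^sub>m B) * M) $$ (a, b) = s * (A * M) $$ (a, b) + t * (B * M) $$ (a, b :: nat)"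
proof -
  note c = assms(1-3)
  have "(s \<cdot>\<^sub>m A + t \<cdot>\<^sub>m B) * M = s \<cdot>\<^sub>m (A * M) + t \<cdot>\<^sub>m (B * M)"
    using add_mult_distrib_mat[OF smult_carrier_mat[OF c(1)] smult_carrier_mat[OF c(2)] c(3)]
      mult_smult_assoc_mat[OF c(1,3)] mult_smult_assoc_mat[OF c(2,3)] by simp
  then show ?thesis
    using lin_index[OF mult_carrier_mat[OF c(1,3)] mult_carrier_mat[OF c(2,3)] assms(4,5)] by metis
qed

lemma mult_lin_index:
  fixes A B M :: "'k::field mat"
  assumes "A \<in> carrier_mat l m" "B \<in> carrier_mat l m" "M \<in> carrier_mat n l" "a < n" "b < m"
  shows "(M * (s \<cdot>\<^sub>m A + t \<cdot>\<^sub>m B)) $$ (a, b) = s * (M * A) $$ (a, b) + t * (M * B) $$ (a, b :: nat)"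
proof -
  note c = assms(1-3)
  have "M * (s \<cdot>\<^sub>m A + t \<cdot>\<^sub>m B) = s \<cdot>\<^sub>m (M * A) + t \<cdot>\<^sub>m (M * B)"
    using mult_add_distrib_mat[OF c(3) smult_carrier_mat[OF c(1)] smult_carrier_mat[OF c(2)]]
      mult_smult_distrib[OF c(3,1)] mult_smult_distrib[OF c(3,2)] by simp
  then show ?thesis
    using lin_index[OF mult_carrier_mat[OF c(3,1)] mult_carrier_mat[OF c(3,2)] assms(4,5)] by metis
qed

lemma lin_commute:
  fixes A B :: "'k::field mat"
  assumes "A \<in> carrier_mat n m" "B \<in> carrier_mat n m" "M \<in> carrier_mat m m" "M' \<in> carrier_mat n n"
    and "\<And>a b. a < n \<Longrightarrow> b < m \<Longrightarrow>
      s * (A * M) $$ (a, b) + t * (B * M) $$ (a, b) = s * (M' * A) $$ (a, b) + t * (M' * B) $$ (a, b)"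
  shows "(s \<cdot>\<^sub>m A + t \<cdot>\<^sub>m B) * M = M' * (s \<cdot>\<^sub>m A + t \<cdot>\<^sub>m B)"
proof (rule eq_matI)
  fix a b assume "a < dim_row (M' * (s \<cdot>\<^sub>m A + t \<cdot>\<^sub>m B))" "b < dim_col (M' * (s \<cdot>\<^sub>m A + t \<cdot>\<^sub>m B))"
  then have ab: "a < n" "b < m" using assms by auto
  show "((s \<cdot>\<^sub>m A + t \<cdot>\<^sub>m B) * M) $$ (a, b) = (M' * (s \<cdot>\<^sub>m A + t \<cdot>\<^sub>m B)) $$ (a, b)"
    using lin_mult_index[OF assms(1-3) ab] mult_lin_index[OF assms(1,2,4) ab] assms(5)[OF ab] by metis
qed (use assms in auto)

lemma add_index: "B \<in> carrier_mat n m \<Longrightarrow> i < n \<Longrightarrow> j < m \<Longrightarrow> (A + B) $$ (i, j) = A $$ (i, j) + B $$ (i, j)"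
  by simp

lemma tr_lin:
  fixes A B B' K :: "'k::field mat"
  assumes B: "B \<in> carrier_mat n m" "B' \<in> carrier_mat n m" and A: "A \<in> carrier_mat m n" and K: "K \<in> carrier_mat n n"
  shows "tr (K * ((s \<cdot>\<^sub>m B + t \<cdot>\<^sub>m B') * A)) = s * tr (K * (B * A)) + t * tr (K * (B' * A))"
proof -
  note c = mult_carrier_mat[OF B(1) A] mult_carrier_mat[OF B(2) A]
  have e: "(s \<cdot>\<^sub>m B + t \<cdot>\<^sub>m B') * A = s \<cdot>\<^sub>m (B * A) + t \<cdot>\<^sub>m (B' * A)"
    using add_mult_distrib_mat[OF smult_carrier_mat[OF B(1)] smult_carrier_mat[OF B(2)] A]
      mult_smult_assoc_mat[OF B(1) A] mult_smult_assoc_mat[OF B(2) A] by simp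
  have "(\<Sum>i<n. (K * (s \<cdot>\<^sub>m (B * A) + t \<cdot>\<^sub>m (B' * A))) $$ (i, i)) =
      (\<Sum>i<n. s * (K * (B * A)) $$ (i, i) + t * (K * (B' * A)) $$ (i, i))"
    by (intro sum.cong refl mult_lin_index[OF c K]) simp_all
  then show ?thesis unfolding e tr_def using K
    by (simp del: index_mult_mat(1) add: sum.distrib sum_distrib_left)
qed

text \<open>An equation between sums of Kronecker products, entry by entry.\<close>

lemma kron_sum_index:
  fixes h :: "'k::field mat"
  assumes "h \<in> carrier_mat (n * r) (m * r)" "M1 \<in> carrier_mat m m" "M2 \<in> carrier_mat m m"
    "L1 \<in> carrier_mat n n" "L2 \<in> carrier_mat n n" "N1 \<in> carrier_mat r r" "N2 \<in> carrier_mat r r"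
    "h * (kron M1 N1 + kron M2 N2) = (kron L1 N1 + kron L2 N2) * h" "i < n * r" "j < m * r"
  shows "(h * kron M1 N1) $$ (i, j) + (h * kron M2 N2) $$ (i, j) = (kron L1 N1 * h) $$ (i, j) + (kron L2 N2 * h) $$ (i, j)"
proof -
  note k = kron_carrier[OF assms(2,6)] kron_carrier[OF assms(3,7)] kron_carrier[OF assms(4,6)] kron_carrier[OF assms(5,7)]
  note hc = assms(1)
  have "(h * kron M1 N1 + h * kron M2 N2) $$ (i, j) = (kron L1 N1 * h + kron L2 N2 * h) $$ (i, j)"
    using assms(8) mult_add_distrib_mat[OF hc k(1,2)] add_mult_distrib_mat[OF k(3,4) hc] by simp
  then show ?thesis
    unfolding add_index[OF mult_carrier_mat[OF hc k(2)] assms(9,10)] add_index[OF mult_carrier_mat[OF k(4) hc] assms(9,10)] .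
qed

lemma kron_sum_index':
  fixes h :: "'k::field mat"
  assumes "h \<in> carrier_mat (r * n) (r * m)" "M1 \<in> carrier_mat m m" "M2 \<in> carrier_mat m m"
    "L1 \<in> carrier_mat n n" "L2 \<in> carrier_mat n n" "N1 \<in> carrier_mat r r" "N2 \<in> carrier_mat r r"
    "h * (kron N1 M1 + kron N2 M2) = (kron N1 L1 + kron N2 L2) * h" "i < r * n" "j < r * m"
  shows "(h * kron N1 M1) $$ (i, j) + (h * kron N2 M2) $$ (i, j) = (kron N1 L1 * h) $$ (i, j) + (kron N2 L2 * h) $$ (i, j)"
proof -
  note k = kron_carrier[OF assms(6,2)] kron_carrier[OF assms(7,3)] kron_carrier[OF assms(6,4)] kron_carrier[OF assms(7,5)]
  note hc = assms(1)
  have "(h * kron N1 M1 + h * kron N2 M2) $$ (i, j) = (kron N1 L1 * h + kron N2 L2 * h) $$ (i, j)"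
    using assms(8) mult_add_distrib_mat[OF hc k(1,2)] add_mult_distrib_mat[OF k(3,4) hc] by simp
  then show ?thesis
    unfolding add_index[OF mult_carrier_mat[OF hc k(2)] assms(9,10)] add_index[OF mult_carrier_mat[OF k(4) hc] assms(9,10)] .
qed

section \<open>Negligible morphisms form a tensor ideal\<close>

locale eighth_root =
  fixes p :: "'k::field_char_0"
  assumes p4: "p ^ 4 = -1"
begin

lemma p_nonzero: "p \<noteq> 0" using p4 by (auto simp: power_0_left)

lemma inverse_p: "inverse p = - (p ^ 3)"
proof -
  have "p * (- (p ^ 3)) = 1" using p4 by (simp add: power_numeral_reduce)
  then show ?thesis using inverse_unique by blast
qed

abbreviation "Zv \<equiv> uq_vector p"

lemma Zv_entries:
  "dimen Zv = 2"
  "actE Zv \<in> carrier_mat 2 2" "actF Zv \<in> carrier_mat 2 2" "actK Zv \<in> carrier_mat 2 2" "actKinv Zv \<in> carrier_mat 2 2"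
  "actE Zv $$ (0, 0) = 0" "actE Zv $$ (0, 1) = 1" "actE Zv $$ (1, 0) = 0" "actE Zv $$ (1, 1) = 0"
  "actF Zv $$ (0, 0) = 0" "actF Zv $$ (0, 1) = 0" "actF Zv $$ (1, 0) = 1" "actF Zv $$ (1, 1) = 0"
  "actK Zv $$ (0, 0) = p" "actK Zv $$ (0, 1) = 0" "actK Zv $$ (1, 0) = 0" "actK Zv $$ (1, 1) = inverse p"
  "actKinv Zv $$ (0, 0) = inverse p" "actKinv Zv $$ (0, 1) = 0" "actKinv Zv $$ (1, 0) = 0" "actKinv Zv $$ (1, 1) = p"
  by (simp_all add: uq_vector_def mat_of_rows_list_def numeral_2_eq_2)

lemma p_difference: "(p - inverse p) * inverse (p - inverse p) = 1"
proof -
  have "p * p \<noteq> 1" using p4 by (auto simp: power_numeral_reduce mult.assoc)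
  then have "p - inverse p \<noteq> 0" using p_nonzero by (auto simp: field_simps)
  then show ?thesis by simp
qed

lemma Zv_module: "Zv \<in> uq_modules p"
proof -
  have i2: "i < 2 \<longleftrightarrow> i = 0 \<or> i = 1" for i :: nat by auto
  have m: "(A * B) $$ (i, j) = A $$ (i, 0) * B $$ (0, j) + A $$ (i, 1) * B $$ (1, j)"
    if "A \<in> carrier_mat 2 2" "B \<in> carrier_mat 2 2" "i < 2" "j < 2" for A B :: "'k mat" and i j
    using mult_index[OF that] by (simp add: lessThan_2)
  have d: "inverse (p - inverse p) * (p - inverse p) = 1" "inverse (p - inverse p) * (inverse p - p) = -1"
    using p_difference by (simp_all add: algebra_simps)
  have pp: "p\<^sup>2 * inverse p = p" "inverse (p\<^sup>2) * p = inverse p" "p * inverse p = 1" "inverse p * p = 1"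
    using p_nonzero by (simp_all add: power2_eq_square)
  note Zc = Zv_entries(2-5)
  note mm = m[OF Zc(1,2)] m[OF Zc(2,1)] m[OF Zc(1,3)] m[OF Zc(3,1)] m[OF Zc(2,3)] m[OF Zc(3,2)] m[OF Zc(3,4)] m[OF Zc(4,3)]
  note dims = carrier_matD[OF Zc(1)] carrier_matD[OF Zc(2)] carrier_matD[OF Zc(3)] carrier_matD[OF Zc(4)]
  have e: "A = B" if "A \<in> carrier_mat 2 2" "B \<in> carrier_mat 2 2"
    "A $$ (0,0) = B $$ (0,0)" "A $$ (0,1) = B $$ (0,1)" "A $$ (1,0) = B $$ (1,0)" "A $$ (1,1) = B $$ (1,1)" for A B :: "'k mat"
    by (rule eq_matI) (use that i2 in auto)
  note c = mult_carrier_mat smult_carrier_mat minus_carrier_mat one_carrier_mat Zc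
  show ?thesis unfolding uq_modules_def mem_Collect_eq Zv_entries(1)
    by (intro conjI e c; (simp del: index_mult_mat(1) One_nat_def add: mm Zv_entries dims d pp)?) (use Zc in auto)
qed

definition negl :: "'k uq_module \<Rightarrow> 'k uq_module \<Rightarrow> 'k mat \<Rightarrow> bool" where
  "negl V W A \<longleftrightarrow> (\<forall>B. intertw W V B \<longrightarrow> tr (actK V * (B * A)) = 0)"

lemma smult_nonzero_cancel:
  assumes "s \<noteq> 0" "s \<cdot>\<^sub>m A = s \<cdot>\<^sub>m (B :: 'k mat)"
  shows "A = B"
  using arg_cong[OF assms(2), of "\<lambda>M. inverse s \<cdot>\<^sub>m M"] assms(1) by (simp add: smult_smult_mat smult_mat_trivial)

lemma intertw_rblk:
  assumes V: "V \<in> uq_modules p" and W: "W \<in> uq_modules p" and h: "intertw (uq_tensor W Zv) (uq_tensor V Zv) h"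
  shows "intertw W V (p \<cdot>\<^sub>m rblk (dimen V) (dimen W) h 0 0 + inverse p \<cdot>\<^sub>m rblk (dimen V) (dimen W) h 1 1)"
proof -
  let ?n = "dimen V" and ?m = "dimen W"
  let ?h = "rblk ?n ?m h"
  note v = uq_modulesD[OF V] and w = uq_modulesD[OF W]
  have hc: "h \<in> carrier_mat (?n * 2) (?m * 2)" using h by (simp add: intertw_def Zv_entries)
  note kl = rblk_kron_mult[OF _ _ hc] and kr = rblk_mult_kron[OF _ _ hc]
  have i2: "1\<^sub>m 2 \<in> carrier_mat 2 2" "1\<^sub>m 2 $$ (0, 0) = (1::'k)" "1\<^sub>m 2 $$ (0, 1) = (0::'k)" "1\<^sub>m 2 $$ (1, 0) = (0::'k)" "1\<^sub>m 2 $$ (1, 1) = (1::'k)" by simp_all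
  note one = one_carrier_mat
  note Zc = Zv_entries(2-5)
  have lt: "(0::nat) < 2" "(1::nat) < 2" by simp_all
  have oo: "1\<^sub>m ?n * ?h i j = ?h i j" "?h i j * 1\<^sub>m ?m = ?h i j" for i j
    using left_mult_one_mat[OF blk_carrier(1)] right_mult_one_mat[OF blk_carrier(1)] by blast+
  have E: "h * (kron (actE W) (actK Zv) + kron (1\<^sub>m ?m) (actE Zv)) = (kron (actE V) (actK Zv) + kron (1\<^sub>m ?n) (actE Zv)) * h"
    and F: "h * (kron (actF W) (1\<^sub>m 2) + kron (actKinv W) (actF Zv)) = (kron (actF V) (1\<^sub>m 2) + kron (actKinv V) (actF Zv)) * h"
    and K: "h * kron (actK W) (actK Zv) = kron (actK V) (actK Zv) * h"
    and K': "h * kron (actKinv W) (actKinv Zv) = kron (actKinv V) (actKinv Zv) * h"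
    using h by (simp_all add: intertw_def Zv_entries)
  let ?X = "p \<cdot>\<^sub>m ?h 0 0 + inverse p \<cdot>\<^sub>m ?h 1 1"
  note b = blk_carrier(1)
  note sE = kron_sum_index[OF hc w(1) one v(1) one Zc(3,1) E] and sF = kron_sum_index[OF hc w(2,4) v(2,4) i2(1) Zc(2) F]
  have lin_E: "x = a + c \<Longrightarrow> y + c = b \<Longrightarrow> x + y = a + b" for x y a b c :: 'k by (simp add: add_ac)
  have lin_F: "u + k = f \<Longrightarrow> g = f' + k' \<Longrightarrow> x * k = y * k' \<Longrightarrow> x * u + y * g = x * f + y * f'" for u k f g f' k' x y :: 'k
    by (auto simp: algebra_simps)
  note ev = Zv_entries(6-) i2(2-) oo mult_zero_left mult_1_left add_0_left add_0_right
  have XE: "?X * actE W = actE V * ?X"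
  proof (rule lin_commute[OF b b w(1) v(1)])
    fix a b assume ab: "a < ?n" "b < ?m"
    note l = pair_index_less[OF ab(1)] pair_index_less[OF ab(2)]
    have "p * (?h 0 0 * actE W) $$ (a, b) = p * (actE V * ?h 0 0) $$ (a, b) + ?h 1 0 $$ (a, b)"
      using sE[OF l(1)[OF lt(1)] l(2)[OF lt(1)]]
      unfolding kl[OF v(1) Zc(3) lt(1,1) ab] kl[OF one Zc(1) lt(1,1) ab] kr[OF w(1) Zc(3) lt(1,1) ab] kr[OF one Zc(1) lt(1,1) ab]
      by (simp only: ev)
    moreover have "inverse p * (?h 1 1 * actE W) $$ (a, b) + ?h 1 0 $$ (a, b) = inverse p * (actE V * ?h 1 1) $$ (a, b)"
      using sE[OF l(1)[OF lt(2)] l(2)[OF lt(2)]]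
      unfolding kl[OF v(1) Zc(3) lt(2,2) ab] kl[OF one Zc(1) lt(2,2) ab] kr[OF w(1) Zc(3) lt(2,2) ab] kr[OF one Zc(1) lt(2,2) ab]
      by (simp only: ev)
    ultimately show "p * (?h 0 0 * actE W) $$ (a, b) + inverse p * (?h 1 1 * actE W) $$ (a, b) =
        p * (actE V * ?h 0 0) $$ (a, b) + inverse p * (actE V * ?h 1 1) $$ (a, b)" by (rule lin_E)
  qed
  have XF: "?X * actF W = actF V * ?X"
  proof (rule lin_commute[OF b b w(2) v(2)])
    fix a b assume ab: "a < ?n" "b < ?m"
    note l = pair_index_less[OF ab(1)] pair_index_less[OF ab(2)]
    have "(?h 0 0 * actF W) $$ (a, b) + (?h 0 1 * actKinv W) $$ (a, b) = (actF V * ?h 0 0) $$ (a, b)"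
      using sF[OF l(1)[OF lt(1)] l(2)[OF lt(1)]]
      unfolding kl[OF v(2) i2(1) lt(1,1) ab] kl[OF v(4) Zc(2) lt(1,1) ab] kr[OF w(2) i2(1) lt(1,1) ab] kr[OF w(4) Zc(2) lt(1,1) ab]
      by (simp only: ev)
    moreover have "(?h 1 1 * actF W) $$ (a, b) = (actF V * ?h 1 1) $$ (a, b) + (actKinv V * ?h 0 1) $$ (a, b)"
      using sF[OF l(1)[OF lt(2)] l(2)[OF lt(2)]]
      unfolding kl[OF v(2) i2(1) lt(2,2) ab] kl[OF v(4) Zc(2) lt(2,2) ab] kr[OF w(2) i2(1) lt(2,2) ab] kr[OF w(4) Zc(2) lt(2,2) ab]
      by (simp only: ev add.commute)
    moreover have "p * (?h 0 1 * actKinv W) $$ (a, b) = inverse p * (actKinv V * ?h 0 1) $$ (a, b)"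
      using arg_cong[OF K', of "\<lambda>M. M $$ (a * 2 + 0, b * 2 + 1)"]
      unfolding kl[OF v(4) Zc(4) lt ab] kr[OF w(4) Zc(4) lt ab] by (simp only: ev)
    ultimately show "p * (?h 0 0 * actF W) $$ (a, b) + inverse p * (?h 1 1 * actF W) $$ (a, b) =
        p * (actF V * ?h 0 0) $$ (a, b) + inverse p * (actF V * ?h 1 1) $$ (a, b)" by (rule lin_F)
  qed
  have XK: "?X * actK W = actK V * ?X"
  proof (rule lin_commute[OF b b w(3) v(3)])
    fix a b assume ab: "a < ?n" "b < ?m"
    have "p * (?h 0 0 * actK W) $$ (a, b) = p * (actK V * ?h 0 0) $$ (a, b)"
      using arg_cong[OF K, of "\<lambda>M. M $$ (a * 2 + 0, b * 2 + 0)"]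
      unfolding kl[OF v(3) Zc(3) lt(1,1) ab] kr[OF w(3) Zc(3) lt(1,1) ab] by (simp only: ev)
    moreover have "inverse p * (?h 1 1 * actK W) $$ (a, b) = inverse p * (actK V * ?h 1 1) $$ (a, b)"
      using arg_cong[OF K, of "\<lambda>M. M $$ (a * 2 + 1, b * 2 + 1)"]
      unfolding kl[OF v(3) Zc(3) lt(2,2) ab] kr[OF w(3) Zc(3) lt(2,2) ab] by (simp only: ev)
    ultimately show "p * (?h 0 0 * actK W) $$ (a, b) + inverse p * (?h 1 1 * actK W) $$ (a, b) =
        p * (actK V * ?h 0 0) $$ (a, b) + inverse p * (actK V * ?h 1 1) $$ (a, b)" by (rule arg_cong2[where f = plus])
  qed
  have XK': "?X * actKinv W = actKinv V * ?X"
  proof (rule lin_commute[OF b b w(4) v(4)])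
    fix a b assume ab: "a < ?n" "b < ?m"
    have "(?h 0 0 * actKinv W) $$ (a, b) = (actKinv V * ?h 0 0) $$ (a, b)"
      using arg_cong[OF K', of "\<lambda>M. M $$ (a * 2 + 0, b * 2 + 0)"] p_nonzero
      unfolding kl[OF v(4) Zc(4) lt(1,1) ab] kr[OF w(4) Zc(4) lt(1,1) ab]
      by (simp only: ev mult_cancel_left inverse_nonzero_iff_nonzero) simp
    moreover have "(?h 1 1 * actKinv W) $$ (a, b) = (actKinv V * ?h 1 1) $$ (a, b)"
      using arg_cong[OF K', of "\<lambda>M. M $$ (a * 2 + 1, b * 2 + 1)"] p_nonzero
      unfolding kl[OF v(4) Zc(4) lt(2,2) ab] kr[OF w(4) Zc(4) lt(2,2) ab]
      by (simp only: ev mult_cancel_left) simp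
    ultimately show "p * (?h 0 0 * actKinv W) $$ (a, b) + inverse p * (?h 1 1 * actKinv W) $$ (a, b) =
        p * (actKinv V * ?h 0 0) $$ (a, b) + inverse p * (actKinv V * ?h 1 1) $$ (a, b)" by simp
  qed
  show ?thesis unfolding intertw_def using XE XF XK XK' by (auto intro: add_carrier_mat)
qed

lemma intertw_lblk:
  assumes V: "V \<in> uq_modules p" and W: "W \<in> uq_modules p" and h: "intertw (uq_tensor Zv W) (uq_tensor Zv V) h"
  shows "intertw W V (inverse p \<cdot>\<^sub>m lblk (dimen V) (dimen W) h 0 0 + p \<cdot>\<^sub>m lblk (dimen V) (dimen W) h 1 1)"
    "W = V \<Longrightarrow> tr (actK V * lblk (dimen V) (dimen V) h 0 0) = tr (actK V * lblk (dimen V) (dimen V) h 1 1)"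
proof -
  let ?n = "dimen V" and ?m = "dimen W"
  let ?h = "lblk ?n ?m h"
  note v = uq_modulesD[OF V] and w = uq_modulesD[OF W]
  have hc: "h \<in> carrier_mat (2 * ?n) (2 * ?m)" using h by (simp add: intertw_def Zv_entries)
  note kl = lblk_kron_mult[OF _ _ hc] and kr = lblk_mult_kron[OF _ _ hc]
  have i2: "1\<^sub>m 2 \<in> carrier_mat 2 2" "1\<^sub>m 2 $$ (0, 0) = (1::'k)" "1\<^sub>m 2 $$ (0, 1) = (0::'k)" "1\<^sub>m 2 $$ (1, 0) = (0::'k)" "1\<^sub>m 2 $$ (1, 1) = (1::'k)" by simp_all
  note one = one_carrier_mat
  note Zc = Zv_entries(2-5)
  have lt: "(0::nat) < 2" "(1::nat) < 2" by simp_all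
  have oo: "1\<^sub>m ?n * ?h i j = ?h i j" "?h i j * 1\<^sub>m ?m = ?h i j" for i j
    using left_mult_one_mat[OF blk_carrier(2)] right_mult_one_mat[OF blk_carrier(2)] by blast+
  have E: "h * (kron (actE Zv) (actK W) + kron (1\<^sub>m 2) (actE W)) = (kron (actE Zv) (actK V) + kron (1\<^sub>m 2) (actE V)) * h"
    and F: "h * (kron (actF Zv) (1\<^sub>m ?m) + kron (actKinv Zv) (actF W)) = (kron (actF Zv) (1\<^sub>m ?n) + kron (actKinv Zv) (actF V)) * h"
    and K: "h * kron (actK Zv) (actK W) = kron (actK Zv) (actK V) * h"
    and K': "h * kron (actKinv Zv) (actKinv W) = kron (actKinv Zv) (actKinv V) * h"
    using h by (simp_all add: intertw_def Zv_entries)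
  let ?X = "inverse p \<cdot>\<^sub>m ?h 0 0 + p \<cdot>\<^sub>m ?h 1 1"
  note b = blk_carrier(2)
  note sE = kron_sum_index'[OF hc w(3,1) v(3,1) Zc(1) i2(1) E] and sF = kron_sum_index'[OF hc one w(2) one v(2) Zc(2,4) F]
  have lin_E: "u = k + f \<Longrightarrow> k' + g = f' \<Longrightarrow> x * k' = y * k \<Longrightarrow> y * u + x * g = y * f + x * f'" for u k f g f' k' x y :: 'k
    by (auto simp: algebra_simps)
  have lin_F: "c + x = a \<Longrightarrow> y = c + b \<Longrightarrow> x + y = a + b" for x y a b c :: 'k by (auto simp: add_ac)
  note ev = Zv_entries(6-) i2(2-) oo mult_zero_left mult_1_left add_0_left add_0_right
  have XE: "?X * actE W = actE V * ?X"
  proof (rule lin_commute[OF b b w(1) v(1)])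
    fix a b assume ab: "a < ?n" "b < ?m"
    note l = pair_index_less[OF _ ab(1)] pair_index_less[OF _ ab(2)]
    have "(?h 0 0 * actE W) $$ (a, b) = (actK V * ?h 1 0) $$ (a, b) + (actE V * ?h 0 0) $$ (a, b)"
      using sE[OF l(1)[OF lt(1)] l(2)[OF lt(1)]]
      unfolding kl[OF v(3) Zc(1) lt(1,1) ab] kl[OF v(1) i2(1) lt(1,1) ab] kr[OF w(3) Zc(1) lt(1,1) ab] kr[OF w(1) i2(1) lt(1,1) ab]
      by (simp only: ev)
    moreover have "(?h 1 0 * actK W) $$ (a, b) + (?h 1 1 * actE W) $$ (a, b) = (actE V * ?h 1 1) $$ (a, b)"
      using sE[OF l(1)[OF lt(2)] l(2)[OF lt(2)]]
      unfolding kl[OF v(3) Zc(1) lt(2,2) ab] kl[OF v(1) i2(1) lt(2,2) ab] kr[OF w(3) Zc(1) lt(2,2) ab] kr[OF w(1) i2(1) lt(2,2) ab]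
      by (simp only: ev)
    moreover have "p * (?h 1 0 * actK W) $$ (a, b) = inverse p * (actK V * ?h 1 0) $$ (a, b)"
      using arg_cong[OF K, of "\<lambda>M. M $$ (1 * ?n + a, 0 * ?m + b)"]
      unfolding kl[OF v(3) Zc(3) lt(2,1) ab] kr[OF w(3) Zc(3) lt(2,1) ab] by (simp only: ev)
    ultimately show "inverse p * (?h 0 0 * actE W) $$ (a, b) + p * (?h 1 1 * actE W) $$ (a, b) =
        inverse p * (actE V * ?h 0 0) $$ (a, b) + p * (actE V * ?h 1 1) $$ (a, b)" by (rule lin_E)
  qed
  have XF: "?X * actF W = actF V * ?X"
  proof (rule lin_commute[OF b b w(2) v(2)])
    fix a b assume ab: "a < ?n" "b < ?m"
    note l = pair_index_less[OF _ ab(1)] pair_index_less[OF _ ab(2)]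
    have "?h 0 1 $$ (a, b) + inverse p * (?h 0 0 * actF W) $$ (a, b) = inverse p * (actF V * ?h 0 0) $$ (a, b)"
      using sF[OF l(1)[OF lt(1)] l(2)[OF lt(1)]]
      unfolding kl[OF one Zc(2) lt(1,1) ab] kl[OF v(2) Zc(4) lt(1,1) ab] kr[OF one Zc(2) lt(1,1) ab] kr[OF w(2) Zc(4) lt(1,1) ab]
      by (simp only: ev)
    moreover have "p * (?h 1 1 * actF W) $$ (a, b) = ?h 0 1 $$ (a, b) + p * (actF V * ?h 1 1) $$ (a, b)"
      using sF[OF l(1)[OF lt(2)] l(2)[OF lt(2)]]
      unfolding kl[OF one Zc(2) lt(2,2) ab] kl[OF v(2) Zc(4) lt(2,2) ab] kr[OF one Zc(2) lt(2,2) ab] kr[OF w(2) Zc(4) lt(2,2) ab]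
      by (simp only: ev)
    ultimately show "inverse p * (?h 0 0 * actF W) $$ (a, b) + p * (?h 1 1 * actF W) $$ (a, b) =
        inverse p * (actF V * ?h 0 0) $$ (a, b) + p * (actF V * ?h 1 1) $$ (a, b)" by (rule lin_F)
  qed
  have K0: "p * (?h 0 0 * actK W) $$ (a, b) = p * (actK V * ?h 0 0) $$ (a, b)"
    and K1: "inverse p * (?h 1 1 * actK W) $$ (a, b) = inverse p * (actK V * ?h 1 1) $$ (a, b)"
    and K'0: "inverse p * (?h 0 0 * actKinv W) $$ (a, b) = inverse p * (actKinv V * ?h 0 0) $$ (a, b)"
    and K'1: "p * (?h 1 1 * actKinv W) $$ (a, b) = p * (actKinv V * ?h 1 1) $$ (a, b)"
    if ab: "a < ?n" "b < ?m" for a b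
    using arg_cong[OF K, of "\<lambda>M. M $$ (0 * ?n + a, 0 * ?m + b)"] arg_cong[OF K, of "\<lambda>M. M $$ (1 * ?n + a, 1 * ?m + b)"]
      arg_cong[OF K', of "\<lambda>M. M $$ (0 * ?n + a, 0 * ?m + b)"] arg_cong[OF K', of "\<lambda>M. M $$ (1 * ?n + a, 1 * ?m + b)"]
    unfolding kl[OF v(3) Zc(3) lt(1,1) ab] kl[OF v(3) Zc(3) lt(2,2) ab] kr[OF w(3) Zc(3) lt(1,1) ab] kr[OF w(3) Zc(3) lt(2,2) ab]
      kl[OF v(4) Zc(4) lt(1,1) ab] kl[OF v(4) Zc(4) lt(2,2) ab] kr[OF w(4) Zc(4) lt(1,1) ab] kr[OF w(4) Zc(4) lt(2,2) ab]
    by (simp_all only: ev)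
  have XK: "?X * actK W = actK V * ?X"
    by (rule lin_commute[OF b b w(3) v(3)]) (use K0 K1 p_nonzero in \<open>simp del: index_mult_mat(1)\<close>)
  have XK': "?X * actKinv W = actKinv V * ?X"
    by (rule lin_commute[OF b b w(4) v(4)]) (use K'0 K'1 p_nonzero in \<open>simp del: index_mult_mat(1)\<close>)
  show "intertw W V ?X" unfolding intertw_def using XE XF XK XK' by (auto intro: add_carrier_mat)
  assume WV: "W = V"
  have e: "(?h 0 0 * actK V) $$ (a, a) + (?h 0 1 * actE V) $$ (a, a) = (actK V * ?h 1 1) $$ (a, a) + (actE V * ?h 0 1) $$ (a, a)"
    if a: "a < ?n" for a
  proof -
    have ab: "a < ?n" "a < ?m" using a WV by simp_all
    note l = pair_index_less[OF _ ab(1)] pair_index_less[OF _ ab(2)]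
    show ?thesis
      using sE[OF l(1)[OF lt(1)] l(2)[OF lt(2)]]
      unfolding kl[OF v(3) Zc(1) lt ab] kl[OF v(1) i2(1) lt ab] kr[OF w(3) Zc(1) lt ab] kr[OF w(1) i2(1) lt ab]
      by (simp only: ev WV)
  qed
  have b': "?h i j \<in> carrier_mat ?n ?n" for i j using b[of ?n ?m h i j] WV by simp
  have tr_n: "tr M = (\<Sum>x<?n. M $$ (x, x))" if "M \<in> carrier_mat ?n ?n" for M :: "'k mat"
    using that by (simp add: tr_def)
  have "tr (?h 0 0 * actK V) + tr (?h 0 1 * actE V) = tr (actK V * ?h 1 1) + tr (actE V * ?h 0 1)"
    unfolding tr_n[OF mult_carrier_mat[OF b' v(3)]] tr_n[OF mult_carrier_mat[OF b' v(1)]]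
      tr_n[OF mult_carrier_mat[OF v(3) b']] tr_n[OF mult_carrier_mat[OF v(1) b']] sum.distrib[symmetric]
    by (rule sum.cong[OF refl], rule e) simp
  then have "tr (?h 0 0 * actK V) = tr (actK V * ?h 1 1)"
    using tr_mult_commute[OF b' v(1), of 0 1] by simp
  then show "tr (actK V * lblk ?n ?n h 0 0) = tr (actK V * lblk ?n ?n h 1 1)"
    using tr_mult_commute[OF b' v(3), of 0 0] WV by simp
qed

lemma negl_tensor_right:
  assumes A: "negl V W A" "intertw V W A" and V: "V \<in> uq_modules p" and W: "W \<in> uq_modules p"
  shows "negl (uq_tensor V Zv) (uq_tensor W Zv) (kron A (1\<^sub>m 2))"
  unfolding negl_def
proof (intro allI impI)
  fix h assume h: "intertw (uq_tensor W Zv) (uq_tensor V Zv) h"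
  let ?n = "dimen V" and ?m = "dimen W"
  let ?h = "rblk ?n ?m h"
  note v = uq_modulesD[OF V] and Ac = intertw_carrier[OF A(2)]
  have hc: "h \<in> carrier_mat (?n * 2) (?m * 2)" using h by (simp add: intertw_def Zv_entries)
  have kc: "kron A (1\<^sub>m 2) \<in> carrier_mat (?m * 2) (?n * 2)" by (rule kron_carrier[OF Ac one_carrier_mat])
  have blk: "rblk ?n ?n (h * kron A (1\<^sub>m 2)) i i = ?h i i * A" if i: "i < 2" for i
  proof (rule eq_matI)
    fix a b assume "a < dim_row (?h i i * A)" "b < dim_col (?h i i * A)"
    then have ab: "a < ?n" "b < ?n" using Ac by (auto simp: rblk_def)
    have i2: "i = 0 \<or> i = 1" using i by auto
    show "rblk ?n ?n (h * kron A (1\<^sub>m 2)) i i $$ (a, b) = (?h i i * A) $$ (a, b)"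
      using rblk_mult_kron[OF Ac one_carrier_mat hc i i ab] ab i2
      by (auto simp: rblk_def simp del: index_mult_mat(1))
  qed (use Ac in \<open>auto simp: rblk_def\<close>)
  have lt: "(0::nat) < 2" "(1::nat) < 2" by simp_all
  have "tr (kron (actK V) (actK Zv) * (h * kron A (1\<^sub>m 2))) = p * tr (actK V * (?h 0 0 * A)) + inverse p * tr (actK V * (?h 1 1 * A))"
    using tr_kron_mult(1)[OF v(3) Zv_entries(4) Zv_entries(15,16) mult_carrier_mat[OF hc kc]]
    unfolding blk[OF lt(1)] blk[OF lt(2)] Zv_entries .
  also have "\<dots> = tr (actK V * ((p \<cdot>\<^sub>m ?h 0 0 + inverse p \<cdot>\<^sub>m ?h 1 1) * A))"
    by (rule tr_lin[OF blk_carrier(1) blk_carrier(1) Ac v(3), symmetric])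
  also have "\<dots> = 0" using A(1) intertw_rblk[OF V W h] by (simp add: negl_def)
  finally show "tr (actK (uq_tensor V Zv) * (h * kron A (1\<^sub>m 2))) = 0" by simp
qed

text \<open>On the left the partial trace weighted by \<open>K\<^sup>-\<^sup>1\<close> is the one that is a morphism; since the
  vector representation is spherical, it can replace the one weighted by \<open>K\<close>.\<close>

lemma negl_tensor_left:
  assumes A: "negl V W A" "intertw V W A" and V: "V \<in> uq_modules p" and W: "W \<in> uq_modules p"
  shows "negl (uq_tensor Zv V) (uq_tensor Zv W) (kron (1\<^sub>m 2) A)"
  unfolding negl_def
proof (intro allI impI)
  fix h assume h: "intertw (uq_tensor Zv W) (uq_tensor Zv V) h"
  let ?n = "dimen V" and ?m = "dimen W"
  let ?h = "lblk ?n ?m h" and ?y = "h * kron (1\<^sub>m 2) A"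
  note v = uq_modulesD[OF V] and Ac = intertw_carrier[OF A(2)]
  have hc: "h \<in> carrier_mat (2 * ?n) (2 * ?m)" using h by (simp add: intertw_def Zv_entries)
  have kc: "kron (1\<^sub>m 2) A \<in> carrier_mat (2 * ?m) (2 * ?n)" by (rule kron_carrier[OF one_carrier_mat Ac])
  have blk: "lblk ?n ?n ?y i i = ?h i i * A" if i: "i < 2" for i
  proof (rule eq_matI)
    fix a b assume "a < dim_row (?h i i * A)" "b < dim_col (?h i i * A)"
    then have ab: "a < ?n" "b < ?n" using Ac by (auto simp: lblk_def)
    have i2: "i = 0 \<or> i = 1" using i by auto
    show "lblk ?n ?n ?y i i $$ (a, b) = (?h i i * A) $$ (a, b)"
      using lblk_mult_kron[OF Ac one_carrier_mat hc i i ab] ab i2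
      by (auto simp: lblk_def simp del: index_mult_mat(1))
  qed (use Ac in \<open>auto simp: lblk_def\<close>)
  have lt: "(0::nat) < 2" "(1::nat) < 2" by simp_all
  have y: "intertw (uq_tensor Zv V) (uq_tensor Zv V) ?y"
    using intertw_comp[OF intertw_tens[OF intertw_ident[OF Zv_module] A(2) Zv_module Zv_module V W] h
        uq_tensor_modules[OF p_nonzero Zv_module V] uq_tensor_modules[OF p_nonzero Zv_module W] uq_tensor_modules[OF p_nonzero Zv_module V]]
    by (simp add: Zv_entries)
  have sph: "tr (actK V * (?h 0 0 * A)) = tr (actK V * (?h 1 1 * A))"
    using intertw_lblk(2)[OF V V y refl] unfolding blk[OF lt(1)] blk[OF lt(2)] .
  have "tr (kron (actK Zv) (actK V) * ?y) = p * tr (actK V * (?h 0 0 * A)) + inverse p * tr (actK V * (?h 1 1 * A))"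
    using tr_kron_mult(2)[OF v(3) Zv_entries(4) Zv_entries(15,16) mult_carrier_mat[OF hc kc]]
    unfolding blk[OF lt(1)] blk[OF lt(2)] Zv_entries .
  also have "\<dots> = inverse p * tr (actK V * (?h 0 0 * A)) + p * tr (actK V * (?h 1 1 * A))"
    using sph by simp
  also have "\<dots> = tr (actK V * ((inverse p \<cdot>\<^sub>m ?h 0 0 + p \<cdot>\<^sub>m ?h 1 1) * A))"
    by (rule tr_lin[OF blk_carrier(2) blk_carrier(2) Ac v(3), symmetric])
  also have "\<dots> = 0" using A(1) intertw_lblk(1)[OF V W h] by (simp add: negl_def)
  finally show "tr (actK (uq_tensor Zv V) * (h * kron (1\<^sub>m 2) A)) = 0" by simp
qed

end

section \<open>Explicit matrices\<close>

text \<open>Tabulation of a function, unfolded by the simplifier only when the length is a literal.\<close>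

definition tab :: "nat \<Rightarrow> (nat \<Rightarrow> 'a) \<Rightarrow> 'a list" where "tab n f = map f [0..<n]"

lemma tab_cong: "n = m \<Longrightarrow> tab n f = tab m f" by simp

lemma tab_simps [simp]: "length (tab n f) = n" "i < n \<Longrightarrow> tab n f ! i = f i"
  by (simp_all add: tab_def)

lemma tab_eval: "tab 1 f = [f 0]" "tab 2 f = [f 0, f 1]" "tab 3 f = [f 0, f 1, f 2]" "tab 4 f = [f 0, f 1, f 2, f 3]"
  "tab 6 f = [f 0, f 1, f 2, f 3, f 4, f 5]" "tab 8 f = [f 0, f 1, f 2, f 3, f 4, f 5, f 6, f 7]"
  "tab 9 f = [f 0, f 1, f 2, f 3, f 4, f 5, f 6, f 7, f 8]"
  by (simp_all add: tab_def upt_rec numeral_eq_Suc)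

abbreviation mrl :: "nat \<Rightarrow> 'k list list \<Rightarrow> 'k::field mat" where "mrl \<equiv> mat_of_rows_list"

lemma mrl_mult: "length ys = n \<Longrightarrow> mrl n xs * mrl k ys =
    mrl k (tab (length xs) (\<lambda>i. tab (k) (\<lambda>j. sum_list (tab n (\<lambda>l. xs ! i ! l * ys ! l ! j)))))"
  by (rule eq_matI) (simp_all add: mat_of_rows_list_def scalar_prod_def tab_def interv_sum_list_conv_sum_set_nat)

lemma mrl_kron: "kron (mrl n xs) (mrl k ys) =
    mrl (n * k) (tab (length xs * length ys) (\<lambda>i. tab (n * k) (\<lambda>j. xs ! (i div length ys) ! (j div k) * ys ! (i mod length ys) ! (j mod k))))"
proof (rule eq_matI)
  fix i j assume a: "i < dim_row (mrl (n * k) (tab (length xs * length ys) (\<lambda>i. tab (n * k) (\<lambda>j. xs ! (i div length ys) ! (j div k) * ys ! (i mod length ys) ! (j mod k)))))" "j < dim_col (mrl (n * k) (tab (length xs * length ys) (\<lambda>i. tab (n * k) (\<lambda>j. xs ! (i div length ys) ! (j div k) * ys ! (i mod length ys) ! (j mod k)))))"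
  then have "i < length xs * length ys" "j < n * k" by (simp_all add: mat_of_rows_list_def)
  with div_mod_less[OF this(1)] div_mod_less[OF this(2)] 
  show "kron (mrl n xs) (mrl k ys) $$ (i, j) =
    mrl (n * k) (tab (length xs * length ys) (\<lambda>i. tab (n * k) (\<lambda>j. xs ! (i div length ys) ! (j div k) * ys ! (i mod length ys) ! (j mod k)))) $$ (i, j)"
    by (simp add: mat_of_rows_list_def kron_index)
qed (simp_all add: mat_of_rows_list_def)

lemma mrl_add: "length xs = length ys \<Longrightarrow> mrl n xs + mrl n ys =
    mrl n (tab (length xs) (\<lambda>i. tab (n) (\<lambda>j. xs ! i ! j + ys ! i ! j)))"
  and mrl_minus: "length xs = length ys \<Longrightarrow> mrl n xs - mrl n ys =
    mrl n (tab (length xs) (\<lambda>i. tab (n) (\<lambda>j. xs ! i ! j - ys ! i ! j)))"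
  and mrl_smult: "s \<cdot>\<^sub>m mrl n xs = mrl n (tab (length xs) (\<lambda>i. tab (n) (\<lambda>j. s * xs ! i ! j)))"
  and mrl_one: "1\<^sub>m n = mrl n (tab (n) (\<lambda>i. tab (n) (\<lambda>j. if i = j then 1 else 0)))"
  and mrl_zero: "0\<^sub>m m n = mrl n (tab (m) (\<lambda>i. tab (n) (\<lambda>j. 0)))"
  by (rule eq_matI; simp add: mat_of_rows_list_def)+

lemma mrl_carrier: "mrl n xs \<in> carrier_mat m n \<longleftrightarrow> length xs = m"
  using carrier_matD(1)[of "mrl n xs" m n] carrier_matI[of "mrl n xs" m n] by (auto simp: mat_of_rows_list_def)

lemma mrl_index: "i < length xs \<Longrightarrow> j < n \<Longrightarrow> mrl n xs $$ (i, j) = xs ! i ! j"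
  by (simp add: mat_of_rows_list_def)

lemma mrl_tr: "length xs = n \<Longrightarrow> tr (mrl n xs) = sum_list (tab n (\<lambda>i. xs ! i ! i))"
  by (simp add: tr_def mat_of_rows_list_def tab_def interv_sum_list_conv_sum_set_nat atLeast0LessThan)

lemmas mrl_simps = mrl_mult mrl_kron mrl_add mrl_minus mrl_smult mrl_one mrl_zero mrl_carrier mrl_tr

lemma length_eval: "length [] = 0" "length (x # xs) = length xs + 1" by simp_all

lemma nth_one: "(x # xs) ! 1 = xs ! 0" by simp

declare tab_cong [cong] One_nat_def [simp del] list.size(4) [simp del]

context eighth_root
begin

lemma p_simps: "inverse p = - (p * (p * p))" "p\<^sup>2 = p * p" "p * (p * (p * p)) = -1" "p * (p * (p * (p * x))) = - x"
proof -
  show q: "p * (p * (p * p)) = -1" using p4 by (simp add: power_numeral_reduce)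
  show "p * (p * (p * (p * x))) = - x" using arg_cong[OF q, of "\<lambda>y. y * x"] by (simp add: mult.assoc)
qed (simp_all add: inverse_p power3_eq_cube power2_eq_square mult.assoc)

lemmas mat_evals = length_eval mrl_simps tab_eval nth_one p_simps algebra_simps

definition d :: 'k where "d = p - p * (p * p)"

lemma d_square: "d * d = 2" by (simp add: d_def p_simps algebra_simps)

lemma d_nonzero: "d \<noteq> 0" using d_square by auto

definition cup :: "'k mat" where "cup = mrl 1 [[0], [p], [-1], [0]]"
definition cap :: "'k mat" where "cap = mrl 4 [[0, -1, inverse p, 0]]"

lemma Zv_simps: "dimen Zv = 2" "actE Zv = mrl 2 [[0, 1], [0, 0]]" "actF Zv = mrl 2 [[0, 0], [1, 0]]"
  "actK Zv = mrl 2 [[p, 0], [0, inverse p]]" "actKinv Zv = mrl 2 [[inverse p, 0], [0, p]]"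
  by (simp_all add: uq_vector_def)

lemma cup_cap: "intertw uq_trivial (uq_tensor Zv Zv) cup" "intertw (uq_tensor Zv Zv) uq_trivial cap"
  "kron (1\<^sub>m 2) cap * kron cup (1\<^sub>m 2) = 1\<^sub>m 2" "kron cap (1\<^sub>m 2) * kron (1\<^sub>m 2) cup = 1\<^sub>m 2"
  "cap * cup = (- d) \<cdot>\<^sub>m 1\<^sub>m 1"
  unfolding intertw_def uq_tensor_simps Zv_simps cup_def cap_def uq_trivial_simps d_def
  by (simp_all add: mat_evals)

lemma p_difference_smult: "e \<cdot>\<^sub>m A = inverse (p - inverse p) \<cdot>\<^sub>m B" if "B = (p - inverse p) \<cdot>\<^sub>m (e \<cdot>\<^sub>m A)" for A B :: "'k mat"
proof -
  have "inverse (p - inverse p) * ((p - inverse p) * e) = ((p - inverse p) * inverse (p - inverse p)) * e"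
    by (simp only: mult_ac)
  also have "\<dots> = e" unfolding p_difference by (rule mult_1_left)
  finally show ?thesis unfolding that smult_smult_mat by (simp only:)
qed

definition Wv :: "'k uq_module" where
  "Wv = \<lparr>dimen = 3, actE = mrl 3 [[0, d, 0], [0, 0, 1], [0, 0, 0]], actF = mrl 3 [[0, 0, 0], [1, 0, 0], [0, d, 0]],
     actK = mrl 3 [[p * p, 0, 0], [0, 1, 0], [0, 0, - (p * p)]], actKinv = mrl 3 [[- (p * p), 0, 0], [0, 1, 0], [0, 0, p * p]]\<rparr>"

lemma Wv_simps: "dimen Wv = 3" "actE Wv = mrl 3 [[0, d, 0], [0, 0, 1], [0, 0, 0]]" "actF Wv = mrl 3 [[0, 0, 0], [1, 0, 0], [0, d, 0]]"
  "actK Wv = mrl 3 [[p * p, 0, 0], [0, 1, 0], [0, 0, - (p * p)]]" "actKinv Wv = mrl 3 [[- (p * p), 0, 0], [0, 1, 0], [0, 0, p * p]]"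
  by (simp_all add: Wv_def)

lemma Wv_module: "Wv \<in> uq_modules p"
proof -
  have 1: "actE Wv * actF Wv - actF Wv * actE Wv = 1 \<cdot>\<^sub>m mrl 3 [[d, 0, 0], [0, 0, 0], [0, 0, - d]]"
    unfolding Wv_simps d_def by (simp add: mat_evals)
  have 2: "actE Wv * actF Wv - actF Wv * actE Wv = inverse (p - inverse p) \<cdot>\<^sub>m (actK Wv - actKinv Wv)"
    unfolding 1 by (rule p_difference_smult, unfold Wv_simps d_def) (simp add: mat_evals)
  have 3: "actK Wv * actE Wv = p\<^sup>2 \<cdot>\<^sub>m (actE Wv * actK Wv)" "p\<^sup>2 \<cdot>\<^sub>m (actK Wv * actF Wv) = actF Wv * actK Wv"
     "actK Wv * actKinv Wv = 1\<^sub>m 3" "actKinv Wv * actK Wv = 1\<^sub>m 3"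
    unfolding Wv_simps d_def by (simp_all add: mat_evals)
  have 4: "actK Wv * actF Wv = inverse (p\<^sup>2) \<cdot>\<^sub>m (actF Wv * actK Wv)"
    unfolding 3(2)[symmetric] smult_smult_mat using p_nonzero by (simp add: smult_mat_trivial)
  have "{actE Wv, actF Wv, actK Wv, actKinv Wv} \<subseteq> carrier_mat 3 3"
    unfolding Wv_simps by (simp add: mat_evals)
  then show ?thesis unfolding uq_modules_def using 2 3 4 by (simp add: Wv_simps(1))
qed

definition iW :: "'k mat" where "iW = mrl 3 [[1, 0, 0], [0, inverse p, 0], [0, 1, 0], [0, 0, 1]]"
definition pW :: "'k mat" where "pW = mrl 4 [[d, 0, 0, 0], [0, 1, p, 0], [0, 0, 0, d]]"

lemma iW_pW: "intertw Wv (uq_tensor Zv Zv) iW" "intertw (uq_tensor Zv Zv) Wv pW"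
  "pW * iW = d \<cdot>\<^sub>m 1\<^sub>m 3" "d \<cdot>\<^sub>m 1\<^sub>m 4 = iW * pW + (-1) \<cdot>\<^sub>m (cup * cap)"
  unfolding intertw_def uq_tensor_simps Zv_simps Wv_simps cup_def cap_def iW_def pW_def d_def
  by (simp_all add: mat_evals)

definition cupW :: "'k mat" where "cupW = mrl 1 [[0], [0], [- d], [0], [1], [0], [d * (p * p)], [0], [0]]"
definition capW :: "'k mat" where "capW = mrl 9 [[0, 0, - (p * p), 0, d, 0, - 1, 0, 0]]"

lemma cup_capW: "intertw uq_trivial (uq_tensor Wv Wv) cupW" "intertw (uq_tensor Wv Wv) uq_trivial capW"
  "capW * cupW = d \<cdot>\<^sub>m 1\<^sub>m 1"
  unfolding intertw_def uq_tensor_simps uq_trivial_simps Wv_simps cupW_def capW_def d_def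
  by (simp_all add: mat_evals)

definition iZ :: "'k mat" where
  "iZ = mrl 2 [[0, 0], [- (1 + p * p), 0], [1, 0], [0, - (p * p)], [0, d], [0, 0]]"
definition pZ :: "'k mat" where "pZ = mrl 6 [[0, -1, - (p * p), 0, 0, 0], [0, 0, 0, -1, inverse p, 0]]"
definition i3 :: "'k mat" where
  "i3 = mrl 4 [[1, 0, 0, 0], [0, - (p * p), 0, 0], [0, 1, 0, 0], [0, 0, inverse p, 0], [0, 0, 1, 0], [0, 0, 0, 1]]"
definition p3 :: "'k mat" where
  "p3 = mrl 6 [[1, 0, 0, 0, 0, 0], [0, 1, 1 + p * p, 0, 0, 0], [0, 0, 0, d, p * p, 0], [0, 0, 0, 0, 0, 1]]"
definition K3 :: "'k mat" where "K3 = mrl 4 [[p * (p * p), 0, 0, 0], [0, p, 0, 0], [0, 0, - (p * (p * p)), 0], [0, 0, 0, - p]]"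
definition E3 :: "'k mat" where "E3 = mrl 4 [[0, 1, 0, 0], [0, 0, d, 0], [0, 0, 0, 1], [0, 0, 0, 0]]"

lemma iZ_pZ: "intertw Zv (uq_tensor Wv Zv) iZ" "intertw (uq_tensor Wv Zv) Zv pZ"
  "pZ * iZ = 1\<^sub>m 2" "1\<^sub>m 6 = iZ * pZ + i3 * p3"
  "p3 * actK (uq_tensor Wv Zv) = K3 * p3" "p3 * actE (uq_tensor Wv Zv) = E3 * p3"
  "actK (uq_tensor Wv Zv) * i3 = i3 * K3" "actE (uq_tensor Wv Zv) * i3 = i3 * E3" "tr K3 = 0"
  unfolding intertw_def uq_tensor_simps Zv_simps Wv_simps iZ_def pZ_def i3_def p3_def K3_def E3_def d_def
  by (simp_all add: mat_evals) (simp_all add: minus_diff_commute)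

lemma scalar_1: "intertw uq_trivial uq_trivial A \<Longrightarrow> \<exists>s. A = s \<cdot>\<^sub>m 1\<^sub>m 1"
  by (intro exI[of _ "A $$ (0, 0)"] eq_matI) (auto simp: intertw_def One_nat_def)

lemma less_eval: "i < (2::nat) \<longleftrightarrow> i = 0 \<or> i = 1" "i < (3::nat) \<longleftrightarrow> i = 0 \<or> i = 1 \<or> i = 2"
  "i < (4::nat) \<longleftrightarrow> i = 0 \<or> i = 1 \<or> i = 2 \<or> i = 3"
  by auto

text \<open>Every square matrix is a literal in its entries.\<close>

lemma mat_literal: "A \<in> carrier_mat m n \<Longrightarrow> A = mrl n (tab m (\<lambda>i. tab n (\<lambda>j. A $$ (i, j))))"
  by (rule eq_matI) (auto simp: mat_of_rows_list_def)

lemma mrl_inject: "length xs = length ys \<Longrightarrow> \<forall>r\<in>set xs \<union> set ys. length r = n \<Longrightarrow> mrl n xs = mrl n ys \<longleftrightarrow> xs = ys"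
proof
  assume l: "length xs = length ys" "\<forall>r\<in>set xs \<union> set ys. length r = n" and e: "mrl n xs = mrl n ys"
  have "xs ! i ! j = ys ! i ! j" if "i < length ys" "j < n" for i j
    using arg_cong[OF e, of "\<lambda>M. M $$ (i, j)"] that l by (simp add: mat_of_rows_list_def)
  then show "xs = ys" using l by (intro nth_equalityI) auto
qed simp

lemma p_distinct: "p * p \<noteq> 1" "p * p \<noteq> - 1" "p * p \<noteq> 0" "p * (p * p) \<noteq> p" "p * (p * p) \<noteq> - p" "(2::'k) \<noteq> 0" "p \<noteq> - p" "p \<noteq> 0"
proof -
  show 1: "p * p \<noteq> 1" "p * p \<noteq> - 1" "p * p \<noteq> 0" using p_simps(3) by (auto simp: mult.assoc[symmetric])
  show "p \<noteq> 0" by (rule p_nonzero)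
  show "p * (p * p) \<noteq> p" "p * (p * p) \<noteq> - p"
    using 1 p_nonzero by (metis mult_cancel_left1, metis mult_cancel_left mult_minus_right mult.right_neutral)
  show "p \<noteq> - p" using p_nonzero by simp
qed simp

lemma scalar_Z: "intertw Zv Zv A \<Longrightarrow> \<exists>s. A = s \<cdot>\<^sub>m 1\<^sub>m 2"
proof -
  assume A: "intertw Zv Zv A"
  define f where "f = (\<lambda>i j. A $$ (i, j))"
  have a: "A = mrl 2 [[f 0 0, f 0 1], [f 1 0, f 1 1]]"
    using mat_literal[OF intertw_carrier[OF A]] unfolding f_def by (simp add: Zv_simps tab_eval)
  have "A * actE Zv = actE Zv * A" using A by (simp add: intertw_def)
  then have "f 1 0 = 0" "f 0 0 = f 1 1" unfolding a Zv_simps by (simp_all add: mat_evals mrl_inject)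
  moreover have "A * actF Zv = actF Zv * A" using A by (simp add: intertw_def)
  then have "f 0 1 = 0" unfolding a Zv_simps by (simp add: mat_evals mrl_inject)
  ultimately have "A = f 1 1 \<cdot>\<^sub>m 1\<^sub>m 2" unfolding a by (simp add: mat_evals)
  then show ?thesis by blast
qed

lemma scalar_W: "intertw Wv Wv A \<Longrightarrow> \<exists>s. A = s \<cdot>\<^sub>m 1\<^sub>m 3"
proof -
  assume A: "intertw Wv Wv A"
  define f where "f = (\<lambda>i j. A $$ (i, j))"
  have a: "A = mrl 3 [[f 0 0, f 0 1, f 0 2], [f 1 0, f 1 1, f 1 2], [f 2 0, f 2 1, f 2 2]]"
    using mat_literal[OF intertw_carrier[OF A]] unfolding f_def by (simp add: Wv_simps tab_eval)
  have "A * actE Wv = actE Wv * A" using A by (simp add: intertw_def)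
  then have "f 1 0 = 0" "f 2 0 = 0" "f 2 1 = 0" "f 0 0 = f 1 1" "f 1 1 = f 2 2" 
    unfolding a Wv_simps using d_nonzero by (simp_all add: mat_evals mrl_inject)
  moreover have "A * actF Wv = actF Wv * A" using A by (simp add: intertw_def)
  then have "f 0 1 = 0" "f 0 2 = 0" "f 1 2 = 0" unfolding a Wv_simps using d_nonzero by (simp_all add: mat_evals mrl_inject)
  ultimately have "A = f 2 2 \<cdot>\<^sub>m 1\<^sub>m 3" unfolding a by (simp add: mat_evals)
  then show ?thesis by blast
qed

lemma hom_trivial_W: "intertw uq_trivial Wv A \<Longrightarrow> A = 0\<^sub>m 3 1"
proof -
  assume A: "intertw uq_trivial Wv A"
  define f where "f = (\<lambda>i j. A $$ (i, j))"
  have a: "A = mrl 1 [[f 0 0], [f 1 0], [f 2 0]]"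
    using mat_literal[OF intertw_carrier[OF A]] unfolding f_def by (simp add: Wv_simps tab_eval)
  have "A * actE uq_trivial = actE Wv * A" "A * actF uq_trivial = actF Wv * A"
    using A unfolding intertw_def by blast+
  then have "f 1 0 = 0" "f 2 0 = 0" "f 0 0 = 0"
    unfolding a Wv_simps uq_trivial_simps using d_nonzero by (simp_all add: mat_evals mrl_inject)
  then show ?thesis unfolding a by (simp add: mat_evals)
qed

lemma scalar_3:
  assumes A: "A \<in> carrier_mat 4 4" and K: "A * K3 = K3 * A" and E: "A * E3 = E3 * A"
  shows "\<exists>s. A = s \<cdot>\<^sub>m 1\<^sub>m 4"
proof -
  define f where "f = (\<lambda>i j. A $$ (i, j))"
  have a: "A = mrl 4 [[f 0 0, f 0 1, f 0 2, f 0 3], [f 1 0, f 1 1, f 1 2, f 1 3], [f 2 0, f 2 1, f 2 2, f 2 3], [f 3 0, f 3 1, f 3 2, f 3 3]]"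
    using mat_literal[OF A] unfolding f_def by (simp add: tab_eval)
  have "f i j = 0" if "i < 4" "j < 4" "i \<noteq> j" for i j
  proof -
    have distinct: "p * (p * p) \<noteq> p" "p * (p * p) \<noteq> - p" "p * (p * p) \<noteq> - (p * (p * p))" "p \<noteq> - (p * (p * p))" "p \<noteq> - p"
        "- (p * (p * p)) \<noteq> - p"
      using p_distinct by (simp_all add: eq_neg_iff_add_eq_0 add.commute)
    have dg: "K3 $$ (i, i) = [p * (p * p), p, - (p * (p * p)), - p] ! i" "k \<noteq> i \<Longrightarrow> k < 4 \<Longrightarrow> K3 $$ (k, i) = 0 \<and> K3 $$ (i, k) = 0" if "i < 4" for i k
      using that by (auto simp: K3_def mrl_index length_eval nth_one less_eval)
    have "(A * K3) $$ (i, j) = (\<Sum>k<4. A $$ (i, k) * K3 $$ (k, j))"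
      using that A by (intro mult_index[of _ 4 4 _ 4]) (simp_all add: K3_def mat_evals)
    also have "\<dots> = A $$ (i, j) * K3 $$ (j, j)"
      using that dg[of j] by (subst sum.remove[of _ j]) (auto intro!: sum.neutral)
    finally have 1: "(A * K3) $$ (i, j) = A $$ (i, j) * K3 $$ (j, j)" .
    have "(K3 * A) $$ (i, j) = (\<Sum>k<4. K3 $$ (i, k) * A $$ (k, j))"
      using that A by (intro mult_index[of _ 4 4 _ 4]) (simp_all add: K3_def mat_evals)
    also have "\<dots> = K3 $$ (i, i) * A $$ (i, j)"
      using that dg[of i] by (subst sum.remove[of _ i]) (auto intro!: sum.neutral)
    finally have "A $$ (i, j) * K3 $$ (j, j) = A $$ (i, j) * K3 $$ (i, i)" using 1 K by (metis mult.commute)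
    moreover have "K3 $$ (j, j) \<noteq> K3 $$ (i, i)"
      using that distinct distinct[symmetric] unfolding dg(1)[OF that(1)] dg(1)[OF that(2)] by (auto simp: less_eval nth_one)
    ultimately show ?thesis unfolding f_def by (metis mult_cancel_left)
  qed
  then have z: "f 0 1 = 0" "f 0 2 = 0" "f 0 3 = 0" "f 1 0 = 0" "f 1 2 = 0" "f 1 3 = 0"
    "f 2 0 = 0" "f 2 1 = 0" "f 2 3 = 0" "f 3 0 = 0" "f 3 1 = 0" "f 3 2 = 0" by simp_all
  have "f 0 0 = f 1 1" "f 1 1 = f 2 2" "f 2 2 = f 3 3"
    using E d_nonzero unfolding a E3_def z by (simp_all add: mat_evals mrl_inject)
  then have "A = f 3 3 \<cdot>\<^sub>m 1\<^sub>m 4" unfolding a z by (simp add: mat_evals)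
  then show ?thesis by blast
qed

lemma traces: "tr (actK uq_trivial :: 'k mat) = 1" "tr (actK Zv) = d" "tr (actK Wv) = 1"
  unfolding uq_trivial_simps Zv_simps Wv_simps d_def by (simp_all add: mat_evals)

lemma sign_K4: "actK uq_trivial * actK uq_trivial * (actK uq_trivial * actK uq_trivial) = (1\<^sub>m 1 :: 'k mat)"
  "actK Wv * actK Wv * (actK Wv * actK Wv) = 1\<^sub>m 3"
  "actK Zv * actK Zv * (actK Zv * actK Zv) = (-1) \<cdot>\<^sub>m 1\<^sub>m 2"
  unfolding uq_trivial_simps Zv_simps Wv_simps by (simp_all add: mat_evals)

text \<open>The complement of \<open>Z\<close> in \<open>W \<otimes> Z\<close> is the four-dimensional simple module, of quantum dimension zero.\<close>

lemma negl_complement: "negl (uq_tensor Wv Zv) (uq_tensor Wv Zv) (i3 * p3)"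
  unfolding negl_def
proof (intro allI impI)
  let ?V = "uq_tensor Wv Zv"
  fix h assume h: "intertw ?V ?V h"
  have c: "i3 \<in> carrier_mat 6 4" "p3 \<in> carrier_mat 4 6" "h \<in> carrier_mat 6 6" "K3 \<in> carrier_mat 4 4" "E3 \<in> carrier_mat 4 4"
    using intertw_carrier[OF h] by (simp_all add: i3_def p3_def K3_def E3_def mat_evals Wv_simps Zv_simps)
  have v: "actK ?V \<in> carrier_mat 6 6" "actE ?V \<in> carrier_mat 6 6"
    using uq_modulesD(3,1)[OF uq_tensor_modules[OF p_nonzero Wv_module Zv_module]] by (simp_all add: Wv_simps Zv_simps)
  let ?X = "p3 * (h * i3)"
  have X: "?X \<in> carrier_mat 4 4" by (rule mult_carrier_mat[OF c(2) mult_carrier_mat[OF c(3,1)]])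
  have comm: "?X * M = M * ?X" if M: "M \<in> carrier_mat 4 4" "N \<in> carrier_mat 6 6" "N * i3 = i3 * M" "p3 * N = M * p3" "h * N = N * h" for M N
  proof -
    have "?X * M = p3 * (h * (i3 * M))"
      using assoc_mult_mat[OF c(2) mult_carrier_mat[OF c(3,1)] M(1)] assoc_mult_mat[OF c(3,1) M(1)] by simp
    also have "\<dots> = p3 * ((h * N) * i3)" unfolding M(3)[symmetric] by (simp only: assoc_mult_mat[OF c(3) M(2) c(1)])
    also have "\<dots> = (p3 * N) * (h * i3)"
      unfolding M(5) assoc_mult_mat[OF M(2) c(3,1)] by (rule assoc_mult_mat[OF c(2) M(2) mult_carrier_mat[OF c(3,1)], symmetric])
    also have "\<dots> = M * ?X" unfolding M(4) by (rule assoc_mult_mat[OF M(1) c(2) mult_carrier_mat[OF c(3,1)]])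
    finally show ?thesis .
  qed
  have hK: "h * actK ?V = actK ?V * h" "h * actE ?V = actE ?V * h" using h unfolding intertw_def by blast+
  obtain s where s: "?X = s \<cdot>\<^sub>m 1\<^sub>m 4"
    using scalar_3[OF X comm[OF c(4) v(1) iZ_pZ(7,5) hK(1)] comm[OF c(5) v(2) iZ_pZ(8,6) hK(2)]] by blast
  have "tr (actK ?V * (h * (i3 * p3))) = tr ((actK ?V * (h * i3)) * p3)"
    using assoc_mult_mat[OF c(3,1,2)] assoc_mult_mat[OF v(1) mult_carrier_mat[OF c(3,1)] c(2)] by simp
  also have "\<dots> = tr (p3 * (actK ?V * (h * i3)))"
    by (rule tr_mult_commute[OF mult_carrier_mat[OF v(1) mult_carrier_mat[OF c(3,1)]] c(2)])
  also have "p3 * (actK ?V * (h * i3)) = K3 * ?X"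
    unfolding assoc_mult_mat[OF c(2) v(1) mult_carrier_mat[OF c(3,1)], symmetric] iZ_pZ(5)
    by (rule assoc_mult_mat[OF c(4,2) mult_carrier_mat[OF c(3,1)]])
  also have "\<dots> = s \<cdot>\<^sub>m K3" unfolding s using c(4) by (simp add: mult_smult_distrib[OF c(4) one_carrier_mat])
  also have "tr (s \<cdot>\<^sub>m K3) = s * tr K3" using c(4) by (simp add: tr_def sum_distrib_left)
  finally show "tr (actK ?V * (h * (i3 * p3))) = 0" by (simp add: iZ_pZ(9))
qed

end

declare One_nat_def [simp] list.size(4) [simp]
declare tab_cong [cong del]

lemma (in strict_tensor_category) through_full_subcat:
  assumes "f \<in> through P V W"
  shows "strict_tensor_category (full_subcat C S) \<Longrightarrow> f \<in> strict_tensor_category.through (full_subcat C S) P V W"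
proof -
  assume "strict_tensor_category (full_subcat C S)"
  then interpret S: strict_tensor_category "full_subcat C S" .
  show ?thesis using assms
  proof (induction rule: through.induct)
    case through_zero
    show ?case using S.through_zero[of V W P] by simp
  next
    case (through_add f L p i)
    then show ?case using S.through_add[of f P V W L p i] by simp
  qed
qed

context eighth_root
begin

lemma negl_zero: "V \<in> uq_modules p \<Longrightarrow> negl V W (0\<^sub>m (dimen W) (dimen V))"
  using uq_modulesD(3)[of V p] by (auto simp: negl_def tr_def dest!: intertw_carrier)

lemma negl_smult:
  assumes "negl V W A" "intertw V W A" "V \<in> uq_modules p"
  shows "negl V W (s \<cdot>\<^sub>m A)"
  unfolding negl_def
proof (intro allI impI)
  fix B assume B: "intertw W V B"
  note v = uq_modulesD(3)[OF assms(3)] and a = intertw_carrier[OF assms(2)] and b = intertw_carrier[OF B]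
  have "actK V * (B * (s \<cdot>\<^sub>m A)) = s \<cdot>\<^sub>m (actK V * (B * A))"
    using mult_smult_distrib[OF b a] mult_smult_distrib[OF v mult_carrier_mat[OF b a]] by simp
  then show "tr (actK V * (B * (s \<cdot>\<^sub>m A))) = 0"
    using assms(1) B tr_smult[OF mult_carrier_mat[OF v mult_carrier_mat[OF b a]]] by (simp add: negl_def)
qed

lemma negl_add:
  assumes "negl V W A" "intertw V W A" "negl V W A'" "intertw V W A'" "V \<in> uq_modules p"
  shows "negl V W (A + A')"
  unfolding negl_def
proof (intro allI impI)
  fix B assume B: "intertw W V B"
  note v = uq_modulesD(3)[OF assms(5)] and a = intertw_carrier[OF assms(2)] intertw_carrier[OF assms(4)] and b = intertw_carrier[OF B]
  note c = mult_carrier_mat[OF b a(1)] mult_carrier_mat[OF b a(2)]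
  have "actK V * (B * (A + A')) = actK V * (B * A) + actK V * (B * A')"
    using mult_add_distrib_mat[OF b a] mult_add_distrib_mat[OF v c] by simp
  then show "tr (actK V * (B * (A + A'))) = 0"
    using assms(1,3) B tr_add[OF mult_carrier_mat[OF v c(1)] mult_carrier_mat[OF v c(2)]] by (simp add: negl_def)
qed

lemma negl_comp_left:
  assumes A: "negl V W A" "intertw V W A" and B: "intertw W U B"
    and o: "V \<in> uq_modules p" "W \<in> uq_modules p" "U \<in> uq_modules p"
  shows "negl V U (B * A)"
  unfolding negl_def
proof (intro allI impI)
  fix C assume C: "intertw U V C"
  have "C * (B * A) = (C * B) * A"
    by (rule assoc_mult_mat[OF intertw_carrier[OF C] intertw_carrier[OF B] intertw_carrier[OF A(2)], symmetric])
  then show "tr (actK V * (C * (B * A))) = 0"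
    using A(1) intertw_comp[OF B C o(2,3,1)] by (simp add: negl_def)
qed

lemma tr_actK_commute:
  assumes A: "intertw V W A" and B: "intertw W V B" and o: "V \<in> uq_modules p" "W \<in> uq_modules p"
  shows "tr (actK V * (B * A)) = tr (actK W * (A * B))"
proof -
  note a = intertw_carrier[OF A] and b = intertw_carrier[OF B] and v = uq_modulesD(3)[OF o(1)] and w = uq_modulesD(3)[OF o(2)]
  have "actK V * (B * A) = (actK V * B) * A" by (rule assoc_mult_mat[OF v b a, symmetric])
  then have "tr (actK V * (B * A)) = tr (A * (actK V * B))" using tr_mult_commute[OF mult_carrier_mat[OF v b] a] by simp
  also have "A * (actK V * B) = (A * actK V) * B" by (rule assoc_mult_mat[OF a v b, symmetric])
  also have "A * actK V = actK W * A" using A by (simp add: intertw_def)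
  also have "(actK W * A) * B = actK W * (A * B)" by (rule assoc_mult_mat[OF w a b])
  finally show ?thesis .
qed

lemma negl_comp_right:
  assumes A: "negl V W A" "intertw V W A" and B: "intertw U V B"
    and o: "V \<in> uq_modules p" "W \<in> uq_modules p" "U \<in> uq_modules p"
  shows "negl U W (A * B)"
  unfolding negl_def
proof (intro allI impI)
  fix C assume C: "intertw W U C"
  note a = intertw_carrier[OF A(2)] and b = intertw_carrier[OF B] and c = intertw_carrier[OF C]
  have "tr (actK U * (C * (A * B))) = tr (actK U * ((C * A) * B))" unfolding assoc_mult_mat[OF c a b] ..
  also have "\<dots> = tr (actK V * (B * (C * A)))" by (rule tr_actK_commute[OF B intertw_comp[OF A(2) C o] o(3,1)])
  also have "\<dots> = tr (actK V * ((B * C) * A))" unfolding assoc_mult_mat[OF b c a] ..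
  also have "\<dots> = 0" using A(1) intertw_comp[OF C B o(2,3,1)] by (simp add: negl_def)
  finally show "tr (actK U * (C * (A * B))) = 0" .
qed

sublocale R: strict_tensor_category "Rep_Uq p" by (rule Rep_Uq_strict[OF p_nonzero])

lemma R_mor: "R.mor f X Y \<longleftrightarrow> X \<in> uq_modules p \<and> Y \<in> uq_modules p \<and> (\<exists>A. f = Arr X Y A \<and> intertw X Y A)"
  by (auto simp: R.mor_def uq_hom_iff)

abbreviation "Zpow \<equiv> R.pow_ob Zv"

lemma Zpow_module: "Zpow n \<in> uq_modules p"
  using R.pow_ob_in[of Zv n] Zv_module by simp

lemma Zpow_Suc: "Zpow (Suc n) = uq_tensor Zv (Zpow n)" "Zpow (Suc n) = uq_tensor (Zpow n) Zv"
  using R.pow_ob_Suc_right[of Zv n] Zv_module by simp_all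

lemma negl_Zpow:
  assumes A: "negl V W A" "intertw V W A" and o: "V \<in> uq_modules p" "W \<in> uq_modules p"
  shows "negl (uq_tensor V (Zpow n)) (uq_tensor W (Zpow n)) (kron A (1\<^sub>m (dimen (Zpow n))))"
    "negl (uq_tensor (Zpow n) V) (uq_tensor (Zpow n) W) (kron (1\<^sub>m (dimen (Zpow n))) A)"
proof (induction n)
  case 0
  show "negl (uq_tensor V (Zpow 0)) (uq_tensor W (Zpow 0)) (kron A (1\<^sub>m (dimen (Zpow 0))))"
    "negl (uq_tensor (Zpow 0) V) (uq_tensor (Zpow 0) W) (kron (1\<^sub>m (dimen (Zpow 0))) A)"
    using A o uq_tensor_unit[of V p] uq_tensor_unit[of W p] kron_unit[of A] by simp_all
next
  case (Suc n)
  note m = Zpow_module[of n] and t = uq_tensor_modules[OF p_nonzero]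
  have i: "intertw (uq_tensor V (Zpow n)) (uq_tensor W (Zpow n)) (kron A (1\<^sub>m (dimen (Zpow n))))"
    "intertw (uq_tensor (Zpow n) V) (uq_tensor (Zpow n) W) (kron (1\<^sub>m (dimen (Zpow n))) A)"
    using intertw_tens[OF A(2) intertw_ident[OF m] o m m] intertw_tens[OF intertw_ident[OF m] A(2) m m o] .
  show "negl (uq_tensor V (Zpow (Suc n))) (uq_tensor W (Zpow (Suc n))) (kron A (1\<^sub>m (dimen (Zpow (Suc n)))))"
    using negl_tensor_right[OF Suc(1) i(1) t[OF o(1) m] t[OF o(2) m]]
    unfolding Zpow_Suc(2) uq_tensor_assoc[OF o(1) m Zv_module] uq_tensor_assoc[OF o(2) m Zv_module] kron_assoc
    by (simp add: kron_one Zv_entries)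
  show "negl (uq_tensor (Zpow (Suc n)) V) (uq_tensor (Zpow (Suc n)) W) (kron (1\<^sub>m (dimen (Zpow (Suc n)))) A)"
    using negl_tensor_left[OF Suc(2) i(2) t[OF m o(1)] t[OF m o(2)]]
    unfolding Zpow_Suc(1) uq_tensor_assoc[OF Zv_module m o(1)] uq_tensor_assoc[OF Zv_module m o(2)] kron_assoc[symmetric]
    by (simp add: kron_one Zv_entries)
qed

lemma negl_tens_through:
  assumes A: "negl V W A" "intertw V W A" and o: "V \<in> uq_modules p" "W \<in> uq_modules p"
    and U: "U \<in> uq_modules p" "U' \<in> uq_modules p" and g: "g \<in> R.through (range Zpow) U U'"
  shows "negl (uq_tensor V U) (uq_tensor W U') (kron A (body g))" "negl (uq_tensor U V) (uq_tensor U' W) (kron (body g) A)"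
  using g
proof (induction rule: R.through.induct)
  case through_zero
  have "dim_row A = dimen W" "dim_col A = dimen V" using intertw_carrier[OF A(2)] by simp_all
  then show "negl (uq_tensor V U) (uq_tensor W U') (kron A (body (Zero (Rep_Uq p) U U')))"
    "negl (uq_tensor U V) (uq_tensor U' W) (kron (body (Zero (Rep_Uq p) U U')) A)"
    using negl_zero[OF uq_tensor_modules[OF p_nonzero o(1) U(1)], of "uq_tensor W U'"]
      negl_zero[OF uq_tensor_modules[OF p_nonzero U(1) o(1)], of "uq_tensor U' W"] by (simp_all add: kron_zero)
next
  case (through_add f L r i)
  note t = uq_tensor_modules[OF p_nonzero]
  obtain n where L: "L = Zpow n" using through_add(2) by blast
  have m: "L \<in> uq_modules p" unfolding L by (rule Zpow_module)
  obtain P where P: "r = Arr U L P" "intertw U L P" using through_add(3) by (auto simp: uq_hom_iff)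
  obtain I where I: "i = Arr L U' I" "intertw L U' I" using through_add(4) by (auto simp: uq_hom_iff)
  have "R.mor f U U'" using R.mor_through[OF through_add(1)] U Zpow_module by auto
  then obtain B where B: "f = Arr U U' B" "intertw U U' B" by (auto simp: R_mor)
  let ?one = "\<lambda>V. 1\<^sub>m (dimen V)"
  note a = intertw_carrier[OF A(2)] and pc = intertw_carrier[OF P(2)] and ic = intertw_carrier[OF I(2)] and bc = intertw_carrier[OF B(2)]
  note id = intertw_ident[OF o(1)] intertw_ident[OF o(2)] intertw_ident[OF m]
  have IP: "intertw U U' (I * P)" by (rule intertw_comp[OF P(2) I(2) U(1) m U(2)])
  have kr: "kron A (I * P) = kron (?one W) I * (kron A (?one L) * kron (?one V) P)"
    using kron_mult[OF a one_carrier_mat one_carrier_mat pc] kron_mult[OF one_carrier_mat a ic pc] a pc by simp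
  have kl: "kron (I * P) A = kron I (?one W) * (kron (?one L) A * kron P (?one V))"
    using kron_mult[OF one_carrier_mat pc a one_carrier_mat] kron_mult[OF ic pc one_carrier_mat a] a pc by simp
  have iA: "intertw (uq_tensor V L) (uq_tensor W L) (kron A (?one L))" "intertw (uq_tensor L V) (uq_tensor L W) (kron (?one L) A)"
    by (rule intertw_tens[OF A(2) id(3) o m m], rule intertw_tens[OF id(3) A(2) m m o])
  have iP: "intertw (uq_tensor V U) (uq_tensor V L) (kron (?one V) P)" "intertw (uq_tensor U V) (uq_tensor L V) (kron P (?one V))"
    by (rule intertw_tens[OF id(1) P(2) o(1,1) U(1) m], rule intertw_tens[OF P(2) id(1) U(1) m o(1,1)])
  have iI: "intertw (uq_tensor W L) (uq_tensor W U') (kron (?one W) I)" "intertw (uq_tensor L W) (uq_tensor U' W) (kron I (?one W))"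
    by (rule intertw_tens[OF id(2) I(2) o(2,2) m U(2)], rule intertw_tens[OF I(2) id(2) m U(2) o(2,2)])
  note N = negl_Zpow[OF A o, of n, folded L]
  have 1: "negl (uq_tensor V U) (uq_tensor W U') (kron A (I * P))"
    unfolding kr by (rule negl_comp_left[OF negl_comp_right[OF N(1) iA(1) iP(1) t[OF o(1) m] t[OF o(2) m] t[OF o(1) U(1)]]
        intertw_comp[OF iP(1) iA(1) t[OF o(1) U(1)] t[OF o(1) m] t[OF o(2) m]] iI(1) t[OF o(1) U(1)] t[OF o(2) m] t[OF o(2) U(2)]])
  have 2: "negl (uq_tensor U V) (uq_tensor U' W) (kron (I * P) A)"
    unfolding kl by (rule negl_comp_left[OF negl_comp_right[OF N(2) iA(2) iP(2) t[OF m o(1)] t[OF m o(2)] t[OF U(1) o(1)]]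
        intertw_comp[OF iP(2) iA(2) t[OF U(1) o(1)] t[OF m o(1)] t[OF m o(2)]] iI(2) t[OF U(1) o(1)] t[OF m o(2)] t[OF U(2) o(2)]])
  show "negl (uq_tensor V U) (uq_tensor W U') (kron A (body (Add (Rep_Uq p) (i \<cdot>\<^bsub>Rep_Uq p\<^esub> r) f)))"
    using negl_add[OF 1 intertw_tens[OF A(2) IP o U] through_add(5)[unfolded B arrow.sel] intertw_tens[OF A(2) B(2) o U] t[OF o(1) U(1)]]
    unfolding P(1) I(1) B(1) Rep_simps arrow.sel kron_add(2)[OF intertw_carrier[OF IP] bc a] .
  show "negl (uq_tensor U V) (uq_tensor U' W) (kron (body (Add (Rep_Uq p) (i \<cdot>\<^bsub>Rep_Uq p\<^esub> r) f)) A)"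
    using negl_add[OF 2 intertw_tens[OF IP A(2) U o] through_add(6)[unfolded B arrow.sel] intertw_tens[OF B(2) A(2) U o] t[OF U(1) o(1)]]
    unfolding P(1) I(1) B(1) Rep_simps arrow.sel kron_add(1)[OF intertw_carrier[OF IP] bc a] .
qed

section \<open>Tilting modules\<close>

lemma zigzag_Zv: "R.zigzag Zv Zv (Arr (uq_tensor Zv Zv) uq_trivial cap) (Arr uq_trivial (uq_tensor Zv Zv) cup)"
  unfolding R.zigzag_def R_mor Rep_simps Zv_simps(1)
  using cup_cap(1,2) cup_cap(3,4) uq_trivial_module uq_tensor_modules[OF p_nonzero Zv_module Zv_module]
    uq_tensor_unit[OF Zv_module] uq_tensor_assoc[OF Zv_module Zv_module Zv_module] by simp

definition tilt :: "'k uq_module set" where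
  "tilt = \<Inter>{S. fusion_subcategory (Rep_Uq p) S \<and> Zv \<in> S}"

lemma tilting_eq: "tilting_modules p = full_subcat (Rep_Uq p) tilt"
  by (simp add: tilting_modules_def generated_subcat_def tilt_def)

lemma tilt_fusion: "fusion_subcategory (Rep_Uq p) tilt" and Zv_tilt: "Zv \<in> tilt"
  and tilt_powers: "tilt \<subseteq> R.built_from_powers Zv"
proof -
  have b: "R.built_from_powers Zv \<in> {S. fusion_subcategory (Rep_Uq p) S \<and> Zv \<in> S}"
    using R.fusion_subcategory_built_from_powers[OF zigzag_Zv] Zv_module by simp
  then show "tilt \<subseteq> R.built_from_powers Zv" "Zv \<in> tilt" unfolding tilt_def by blast+
  show "fusion_subcategory (Rep_Uq p) tilt" unfolding tilt_def
    by (rule fusion_subcategory_Inter) (use b in blast)+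
qed

lemma tilt_closed: "V \<in> tilt \<Longrightarrow> V \<in> uq_modules p" "uq_trivial \<in> tilt" "V \<in> tilt \<Longrightarrow> W \<in> tilt \<Longrightarrow> uq_tensor V W \<in> tilt"
proof -
  have "tilt \<subseteq> uq_modules p \<and> uq_trivial \<in> tilt \<and> (\<forall>X\<in>tilt. \<forall>Y\<in>tilt. uq_tensor X Y \<in> tilt)"
    using tilt_fusion unfolding fusion_subcategory_def Rep_simps by (elim conjE) (intro conjI)
  then show "V \<in> tilt \<Longrightarrow> V \<in> uq_modules p" "uq_trivial \<in> tilt" "V \<in> tilt \<Longrightarrow> W \<in> tilt \<Longrightarrow> uq_tensor V W \<in> tilt"
    by blast+
qed

lemma Wv_tilt: "Wv \<in> tilt"
proof -
  note t = uq_tensor_modules[OF p_nonzero Zv_module Zv_module]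
  have "(inverse d \<cdot>\<^sub>m pW) * iW = inverse d \<cdot>\<^sub>m (d \<cdot>\<^sub>m 1\<^sub>m 3)"
    using mult_smult_assoc_mat[OF intertw_carrier[OF iW_pW(2)] intertw_carrier[OF iW_pW(1)]] by (simp add: iW_pW(3))
  then have "(inverse d \<cdot>\<^sub>m pW) * iW = 1\<^sub>m (dimen Wv)" using d_nonzero by (simp add: smult_smult_mat smult_mat_trivial Wv_simps)
  then have "Arr (uq_tensor Zv Zv) Wv (inverse d \<cdot>\<^sub>m pW) \<cdot>\<^bsub>Rep_Uq p\<^esub> Arr Wv (uq_tensor Zv Zv) iW = Ident (Rep_Uq p) Wv"
    by simp
  then have "direct_summand (Rep_Uq p) Wv (uq_tensor Zv Zv)"
    using uq_homI[OF iW_pW(1)] uq_homI[OF intertw_smult[OF iW_pW(2) t Wv_module]] unfolding direct_summand_def Rep_simps(2)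
    by blast
  moreover have "\<forall>X\<in>uq_modules p. \<forall>Y\<in>tilt. direct_summand (Rep_Uq p) X Y \<longrightarrow> X \<in> tilt"
    using tilt_fusion unfolding fusion_subcategory_def Rep_simps by (elim conjE)
  ultimately show ?thesis using Wv_module tilt_closed(3)[OF Zv_tilt Zv_tilt] by blast
qed

sublocale T: strict_tensor_category "tilting_modules p"
  unfolding tilting_eq by (rule R.full_subcat_strict; unfold Rep_simps) (use tilt_closed in blast)+

lemma T_simps [simp]:
  "Ob (tilting_modules p) = tilt" "Hom (tilting_modules p) = uq_hom" "Ident (tilting_modules p) V = Arr V V (1\<^sub>m (dimen V))"
  "Zero (tilting_modules p) V W = Arr V W (0\<^sub>m (dimen W) (dimen V))" "TensO (tilting_modules p) = uq_tensor"
  "Unit (tilting_modules p) = uq_trivial"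
  "Arr Y' Z B \<cdot>\<^bsub>tilting_modules p\<^esub> Arr X Y A = Arr X Z (B * A)"
  "Add (tilting_modules p) (Arr X Y A) (Arr X' Y' B) = Arr X Y (A + B)"
  "Scale (tilting_modules p) a (Arr X Y A) = Arr X Y (a \<cdot>\<^sub>m A)"
  "Arr X Y A \<boxtimes>\<^bsub>tilting_modules p\<^esub> Arr X' Y' B = Arr (uq_tensor X X') (uq_tensor Y Y') (kron A B)"
  by (simp_all add: tilting_eq)

lemma T_mor: "T.mor f X Y \<longleftrightarrow> X \<in> tilt \<and> Y \<in> tilt \<and> (\<exists>A. f = Arr X Y A \<and> intertw X Y A)"
  by (auto simp: T.mor_def uq_hom_iff)

lemma tilt_through:
  assumes "U \<in> tilt" "U' \<in> uq_modules p" "intertw U U' B"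
  shows "Arr U U' B \<in> R.through (range Zpow) U U'"
proof -
  have "Ident (Rep_Uq p) U \<in> R.through (range Zpow) U U" using assms(1) tilt_powers by (auto simp: R.built_from_powers_def)
  moreover have m: "R.mor (Arr U U' B) U U'" using assms tilt_closed(1) by (auto simp: R_mor)
  ultimately have "Arr U U' B \<cdot>\<^bsub>Rep_Uq p\<^esub> Ident (Rep_Uq p) U \<in> R.through (range Zpow) U U'"
    using R.through_comp_left[of "Ident (Rep_Uq p) U" "range Zpow" U U "Arr U U' B" U'] Zpow_module tilt_closed(1)[OF assms(1)] by auto
  then show ?thesis using R.rid[OF m] by simp
qed

lemma negl_tens:
  assumes A: "negl V W A" "intertw V W A" and o: "V \<in> tilt" "W \<in> tilt"
    and B: "intertw U U' B" "U \<in> tilt" "U' \<in> tilt"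
  shows "negl (uq_tensor V U) (uq_tensor W U') (kron A B)" "negl (uq_tensor U V) (uq_tensor U' W) (kron B A)"
  using negl_tens_through[OF A tilt_closed(1)[OF o(1)] tilt_closed(1)[OF o(2)] tilt_closed(1)[OF B(2)] tilt_closed(1)[OF B(3)]
      tilt_through[OF B(2) tilt_closed(1)[OF B(3)] B(1)]] by simp_all

end

lemma smult_add_cancel:
  fixes X Y Z :: "'k::field mat"
  assumes "X \<in> carrier_mat m n" "Y \<in> carrier_mat m n" "Z \<in> carrier_mat m n"
  shows "(X + (-1) \<cdot>\<^sub>m Y) + (Y + (-1) \<cdot>\<^sub>m Z) = X + (-1) \<cdot>\<^sub>m Z" "(-1) \<cdot>\<^sub>m (X + (-1) \<cdot>\<^sub>m Y) = Y + (-1) \<cdot>\<^sub>m X"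
    "X + (-1) \<cdot>\<^sub>m X = 0\<^sub>m m n" "X + (-1) \<cdot>\<^sub>m 0\<^sub>m m n = X"
    "s \<cdot>\<^sub>m (X + (-1) \<cdot>\<^sub>m Y) = s \<cdot>\<^sub>m X + (-1) \<cdot>\<^sub>m (s \<cdot>\<^sub>m Y)"
  by (rule eq_matI; use assms in \<open>auto simp: algebra_simps\<close>)+

lemma smult_add_add:
  fixes X Y Z V :: "'k::field mat"
  assumes "X \<in> carrier_mat m n" "Y \<in> carrier_mat m n" "Z \<in> carrier_mat m n" "V \<in> carrier_mat m n"
  shows "(X + (-1) \<cdot>\<^sub>m Y) + (Z + (-1) \<cdot>\<^sub>m V) = (X + Z) + (-1) \<cdot>\<^sub>m (Y + V)"
  by (rule eq_matI; use assms in \<open>auto simp: algebra_simps\<close>)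

context eighth_root
begin

section \<open>The semisimplification\<close>

abbreviation "NR \<equiv> negligible_rel (tilting_modules p)"

lemma negligible_iff: "negligible (tilting_modules p) (Arr X Y A) \<longleftrightarrow> negl X Y A"
proof -
  have "(\<forall>h\<in>uq_hom Y X. P h) \<longleftrightarrow> (\<forall>B. intertw Y X B \<longrightarrow> P (Arr Y X B))" for P by (auto simp: uq_hom_iff)
  then show ?thesis unfolding negligible_def arrow.sel T_simps quantum_trace_def tr_diag negl_def by simp
qed

lemma NR_iff: "(f, g) \<in> NR \<longleftrightarrow> (\<exists>X Y A B. X \<in> tilt \<and> Y \<in> tilt \<and> intertw X Y A \<and> intertw X Y B \<and>
    f = Arr X Y A \<and> g = Arr X Y B \<and> negl X Y (A + (-1) \<cdot>\<^sub>m B))" (is "_ \<longleftrightarrow> ?R")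
proof
  assume "(f, g) \<in> NR"
  then obtain X Y where XY: "X \<in> tilt" "Y \<in> tilt" "f \<in> uq_hom X Y" "g \<in> uq_hom X Y"
      "negligible (tilting_modules p) (Add (tilting_modules p) f (Scale (tilting_modules p) (-1) g))"
    unfolding negligible_rel_def by auto
  obtain A where A: "intertw X Y A" "f = Arr X Y A" using XY(3) by (rule uq_homE)
  obtain B where B: "intertw X Y B" "g = Arr X Y B" using XY(4) by (rule uq_homE)
  have "negl X Y (A + (-1) \<cdot>\<^sub>m B)" using XY(5) unfolding A(2) B(2) T_simps negligible_iff .
  then show ?R using XY A B by blast
next
  assume ?R
  then obtain X Y A B where "X \<in> tilt" "Y \<in> tilt" "intertw X Y A" "intertw X Y B" "f = Arr X Y A" "g = Arr X Y B"
    "negl X Y (A + (-1) \<cdot>\<^sub>m B)" by blast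
  then show "(f, g) \<in> NR" unfolding negligible_rel_def by (auto simp: negligible_iff uq_hom_iff)
qed

lemma NR_E:
  assumes "(f, g) \<in> NR"
  obtains X Y A B where "X \<in> tilt" "Y \<in> tilt" "intertw X Y A" "intertw X Y B" "f = Arr X Y A" "g = Arr X Y B"
    "negl X Y (A + (-1) \<cdot>\<^sub>m B)"
  using assms unfolding NR_iff by blast

lemma NR_I: "X \<in> tilt \<Longrightarrow> Y \<in> tilt \<Longrightarrow> intertw X Y A \<Longrightarrow> intertw X Y B \<Longrightarrow> negl X Y (A + (-1) \<cdot>\<^sub>m B) \<Longrightarrow>
    (Arr X Y A, Arr X Y B) \<in> NR"
  unfolding NR_iff by blast

lemma intertw_diff: "intertw X Y A \<Longrightarrow> intertw X Y B \<Longrightarrow> X \<in> tilt \<Longrightarrow> Y \<in> tilt \<Longrightarrow> intertw X Y (A + (-1) \<cdot>\<^sub>m B)"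
  by (intro intertw_add[of _ _ _ _ p] intertw_smult[of _ _ _ p] tilt_closed(1))

lemma NR_refl: "T.mor f X Y \<Longrightarrow> (f, f) \<in> NR"
proof -
  assume "T.mor f X Y"
  then obtain A where A: "X \<in> tilt" "Y \<in> tilt" "intertw X Y A" "f = Arr X Y A" unfolding T_mor by blast
  have "negl X Y (A + (-1) \<cdot>\<^sub>m A)"
    unfolding smult_add_cancel(3)[OF intertw_carrier[OF A(3)] intertw_carrier[OF A(3)] intertw_carrier[OF A(3)]]
    by (rule negl_zero[OF tilt_closed(1)[OF A(1)]])
  then show "(f, f) \<in> NR" unfolding A(4) by (intro NR_I A)
qed

lemma NR_sym: "sym NR"
proof (rule symI)
  fix f g assume "(f, g) \<in> NR"
  then obtain X Y A B where a: "X \<in> tilt" "Y \<in> tilt" "intertw X Y A" "intertw X Y B" "f = Arr X Y A" "g = Arr X Y B"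
    "negl X Y (A + (-1) \<cdot>\<^sub>m B)" by (rule NR_E)
  note c = intertw_carrier[OF a(3)] intertw_carrier[OF a(4)]
  have "negl X Y ((-1) \<cdot>\<^sub>m (A + (-1) \<cdot>\<^sub>m B))" by (rule negl_smult[OF a(7) intertw_diff[OF a(3,4,1,2)] tilt_closed(1)[OF a(1)]])
  then have "negl X Y (B + (-1) \<cdot>\<^sub>m A)" unfolding smult_add_cancel(2)[OF c c(1)] .
  then show "(g, f) \<in> NR" unfolding a(5,6) by (intro NR_I a)
qed

lemma NR_trans: "trans NR"
proof (rule transI)
  fix f g h assume "(f, g) \<in> NR" "(g, h) \<in> NR"
  from this(1) obtain X Y A B where a: "X \<in> tilt" "Y \<in> tilt" "intertw X Y A" "intertw X Y B" "f = Arr X Y A" "g = Arr X Y B"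
    "negl X Y (A + (-1) \<cdot>\<^sub>m B)" by (rule NR_E)
  from \<open>(g, h) \<in> NR\<close> obtain C where b: "intertw X Y C" "h = Arr X Y C" "negl X Y (B + (-1) \<cdot>\<^sub>m C)"
    unfolding NR_iff a(6) by auto
  note c = intertw_carrier[OF a(3)] intertw_carrier[OF a(4)] intertw_carrier[OF b(1)]
  have "negl X Y ((A + (-1) \<cdot>\<^sub>m B) + (B + (-1) \<cdot>\<^sub>m C))"
    by (rule negl_add[OF a(7) intertw_diff[OF a(3,4,1,2)] b(3) intertw_diff[OF a(4) b(1) a(1,2)] tilt_closed(1)[OF a(1)]])
  then have "negl X Y (A + (-1) \<cdot>\<^sub>m C)" unfolding smult_add_cancel(1)[OF c] .
  then show "(f, h) \<in> NR" unfolding a(5) b(2) by (intro NR_I a b)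
qed

text \<open>\<open>B A - B' A' = B (A - A') + (B - B') A'\<close>, and likewise for tensor products.\<close>

lemma NR_comp:
  assumes m: "T.mor f X Y" "T.mor g Y Z" and r: "(f, f') \<in> NR" "(g, g') \<in> NR"
  shows "(g \<cdot>\<^bsub>tilting_modules p\<^esub> f, g' \<cdot>\<^bsub>tilting_modules p\<^esub> f') \<in> NR"
proof -
  from m have o: "X \<in> tilt" "Y \<in> tilt" "Z \<in> tilt" by (simp_all add: T_mor)
  note o' = o[THEN tilt_closed(1)]
  obtain A A' where A: "intertw X Y A" "intertw X Y A'" "f = Arr X Y A" "f' = Arr X Y A'" "negl X Y (A + (-1) \<cdot>\<^sub>m A')"
    using m(1) r(1) unfolding NR_iff T_mor by auto
  obtain B B' where B: "intertw Y Z B" "intertw Y Z B'" "g = Arr Y Z B" "g' = Arr Y Z B'" "negl Y Z (B + (-1) \<cdot>\<^sub>m B')"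
    using m(2) r(2) unfolding NR_iff T_mor by auto
  note a = A(1,2)[THEN intertw_carrier] and b = B(1,2)[THEN intertw_carrier]
  note c = mult_carrier_mat[OF b(1) a(1)] mult_carrier_mat[OF b(1) a(2)] mult_carrier_mat[OF b(2) a(2)]
  have "B * (A + (-1) \<cdot>\<^sub>m A') = B * A + (-1) \<cdot>\<^sub>m (B * A')"
    using mult_add_distrib_mat[OF b(1) a(1) smult_carrier_mat[OF a(2)]] mult_smult_distrib[OF b(1) a(2)] by simp
  moreover have "(B + (-1) \<cdot>\<^sub>m B') * A' = B * A' + (-1) \<cdot>\<^sub>m (B' * A')"
    using add_mult_distrib_mat[OF b(1) smult_carrier_mat[OF b(2)] a(2)] mult_smult_assoc_mat[OF b(2) a(2)] by simp
  ultimately have e: "B * A + (-1) \<cdot>\<^sub>m (B' * A') = B * (A + (-1) \<cdot>\<^sub>m A') + (B + (-1) \<cdot>\<^sub>m B') * A'"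
    using smult_add_cancel(1)[OF c] by simp
  note dA = intertw_diff[OF A(1,2) o(1,2)] and dB = intertw_diff[OF B(1,2) o(2,3)]
  have "negl X Z (B * A + (-1) \<cdot>\<^sub>m (B' * A'))" unfolding e
    by (rule negl_add[OF negl_comp_left[OF A(5) dA B(1) o'] intertw_comp[OF dA B(1) o']
          negl_comp_right[OF B(5) dB A(2) o'(2,3,1)] intertw_comp[OF A(2) dB o'] o'(1)])
  then show ?thesis unfolding A B T_simps
    by (rule NR_I[OF o(1,3) intertw_comp[OF A(1) B(1) o'] intertw_comp[OF A(2) B(2) o']])
qed

lemma NR_tens:
  assumes m: "T.mor f X Y" "T.mor g X' Y'" and r: "(f, f') \<in> NR" "(g, g') \<in> NR"
  shows "(f \<boxtimes>\<^bsub>tilting_modules p\<^esub> g, f' \<boxtimes>\<^bsub>tilting_modules p\<^esub> g') \<in> NR"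
proof -
  from m have o: "X \<in> tilt" "Y \<in> tilt" "X' \<in> tilt" "Y' \<in> tilt" by (simp_all add: T_mor)
  note o' = o[THEN tilt_closed(1)]
  obtain A A' where A: "intertw X Y A" "intertw X Y A'" "f = Arr X Y A" "f' = Arr X Y A'" "negl X Y (A + (-1) \<cdot>\<^sub>m A')"
    using m(1) r(1) unfolding NR_iff T_mor by auto
  obtain B B' where B: "intertw X' Y' B" "intertw X' Y' B'" "g = Arr X' Y' B" "g' = Arr X' Y' B'" "negl X' Y' (B + (-1) \<cdot>\<^sub>m B')"
    using m(2) r(2) unfolding NR_iff T_mor by auto
  note a = A(1,2)[THEN intertw_carrier] and b = B(1,2)[THEN intertw_carrier]
  note c = kron_carrier[OF a(1) b(1)] kron_carrier[OF a(1) b(2)] kron_carrier[OF a(2) b(2)]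
  have "kron A (B + (-1) \<cdot>\<^sub>m B') = kron A B + (-1) \<cdot>\<^sub>m kron A B'"
    using kron_add(2)[OF b(1) smult_carrier_mat[OF b(2)] a(1)] by (simp add: kron_smult)
  moreover have "kron (A + (-1) \<cdot>\<^sub>m A') B' = kron A B' + (-1) \<cdot>\<^sub>m kron A' B'"
    using kron_add(1)[OF a(1) smult_carrier_mat[OF a(2)] b(2)] by (simp add: kron_smult)
  ultimately have e: "kron A B + (-1) \<cdot>\<^sub>m kron A' B' = kron A (B + (-1) \<cdot>\<^sub>m B') + kron (A + (-1) \<cdot>\<^sub>m A') B'"
    using smult_add_cancel(1)[OF c] by simp
  note dA = intertw_diff[OF A(1,2) o(1,2)] and dB = intertw_diff[OF B(1,2) o(3,4)]
  have "negl (uq_tensor X X') (uq_tensor Y Y') (kron A B + (-1) \<cdot>\<^sub>m kron A' B')" unfolding e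
    by (rule negl_add[OF negl_tens(2)[OF B(5) dB o(3,4) A(1) o(1,2)] intertw_tens[OF A(1) dB o']
          negl_tens(1)[OF A(5) dA o(1,2) B(2) o(3,4)] intertw_tens[OF dA B(2) o'] tilt_closed(1)[OF tilt_closed(3)[OF o(1,3)]]])
  then show ?thesis unfolding A B T_simps
    by (rule NR_I[OF tilt_closed(3)[OF o(1,3)] tilt_closed(3)[OF o(2,4)] intertw_tens[OF A(1) B(1) o'] intertw_tens[OF A(2) B(2) o']])
qed

sublocale S: tensor_congruence "tilting_modules p" NR
proof
  fix f g X Y assume "(f, g) \<in> NR" "f \<in> Hom (tilting_modules p) X Y"
  then show "g \<in> Hom (tilting_modules p) X Y" unfolding NR_iff by (auto simp: uq_hom_iff)
next
  fix f g f' g' X Y assume m: "T.mor f X Y" "T.mor g X Y" and r: "(f, f') \<in> NR" "(g, g') \<in> NR"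
  from m have o: "X \<in> tilt" "Y \<in> tilt" by (simp_all add: T_mor)
  note o' = o[THEN tilt_closed(1)]
  obtain A A' where A: "intertw X Y A" "intertw X Y A'" "f = Arr X Y A" "f' = Arr X Y A'" "negl X Y (A + (-1) \<cdot>\<^sub>m A')"
    using m(1) r(1) unfolding NR_iff T_mor by auto
  obtain B B' where B: "intertw X Y B" "intertw X Y B'" "g = Arr X Y B" "g' = Arr X Y B'" "negl X Y (B + (-1) \<cdot>\<^sub>m B')"
    using m(2) r(2) unfolding NR_iff T_mor by auto
  note c = A(1)[THEN intertw_carrier] A(2)[THEN intertw_carrier] B(1)[THEN intertw_carrier] B(2)[THEN intertw_carrier]
  have "negl X Y ((A + B) + (-1) \<cdot>\<^sub>m (A' + B'))"
    unfolding smult_add_add[OF c, symmetric]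
    by (rule negl_add[OF A(5) intertw_diff[OF A(1,2) o] B(5) intertw_diff[OF B(1,2) o] o'(1)])
  then show "(Add (tilting_modules p) f g, Add (tilting_modules p) f' g') \<in> NR" unfolding A B T_simps
    by (rule NR_I[OF o intertw_add[OF A(1) B(1) o'] intertw_add[OF A(2) B(2) o']])
next
  fix f f' X Y a assume m: "T.mor f X Y" and r: "(f, f') \<in> NR"
  from m have o: "X \<in> tilt" "Y \<in> tilt" by (simp_all add: T_mor)
  note o' = o[THEN tilt_closed(1)]
  obtain A A' where A: "intertw X Y A" "intertw X Y A'" "f = Arr X Y A" "f' = Arr X Y A'" "negl X Y (A + (-1) \<cdot>\<^sub>m A')"
    using m r unfolding NR_iff T_mor by auto
  note c = A(1)[THEN intertw_carrier] A(2)[THEN intertw_carrier]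
  have "negl X Y (a \<cdot>\<^sub>m A + (-1) \<cdot>\<^sub>m (a \<cdot>\<^sub>m A'))"
    unfolding smult_add_cancel(5)[OF c c(1), symmetric]
    by (rule negl_smult[OF A(5) intertw_diff[OF A(1,2) o] o'(1)])
  then show "(Scale (tilting_modules p) a f, Scale (tilting_modules p) a f') \<in> NR" unfolding A T_simps
    by (rule NR_I[OF o intertw_smult[OF A(1) o'] intertw_smult[OF A(2) o']])
qed (fact NR_refl NR_sym NR_trans NR_comp NR_tens)+

abbreviation "SS \<equiv> semisimplified_Rep_Uq p"

lemma SS_eq: "SS = S.Q" by (simp add: semisimplified_Rep_Uq_def)

sublocale Q: strict_tensor_category "semisimplified_Rep_Uq p"
  unfolding SS_eq by (rule S.quotient_strict)

definition qm :: "'k uq_module \<Rightarrow> 'k uq_module \<Rightarrow> 'k mat \<Rightarrow> 'k uq_arrow set" where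
  "qm X Y A = S.cls (Arr X Y A)"

lemma SS_simps [simp]: "Ob SS = tilt" "Unit SS = uq_trivial" "TensO SS = uq_tensor"
  "Ident SS X = qm X X (1\<^sub>m (dimen X))" "Zero SS X Y = qm X Y (0\<^sub>m (dimen Y) (dimen X))"
  unfolding SS_eq qm_def by simp_all

lemma Arr_mor: "X \<in> tilt \<Longrightarrow> Y \<in> tilt \<Longrightarrow> intertw X Y A \<Longrightarrow> T.mor (Arr X Y A) X Y"
  unfolding T_mor by blast

lemma qm_mor: "X \<in> tilt \<Longrightarrow> Y \<in> tilt \<Longrightarrow> intertw X Y A \<Longrightarrow> Q.mor (qm X Y A) X Y"
proof -
  assume a: "X \<in> tilt" "Y \<in> tilt" "intertw X Y A"
  have "qm X Y A \<in> Hom SS X Y" unfolding qm_def SS_eq by (rule S.cls_hom[OF Arr_mor[OF a]])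
  then show ?thesis unfolding Q.mor_def SS_simps(1) using a by blast
qed

lemma Q_morE:
  assumes "Q.mor F X Y"
  obtains A where "X \<in> tilt" "Y \<in> tilt" "intertw X Y A" "F = qm X Y A"
proof -
  have o: "X \<in> tilt" "Y \<in> tilt" "F \<in> Hom S.Q X Y" using assms[unfolded Q.mor_def SS_simps(1)] unfolding SS_eq by blast+
  obtain f where "T.mor f X Y" "F = S.cls f" using S.Q_hom[of X Y F] o unfolding T_simps(1) by blast
  then show thesis using that o unfolding T_mor qm_def by blast
qed

lemma qm_comp: "X \<in> tilt \<Longrightarrow> Y \<in> tilt \<Longrightarrow> Z \<in> tilt \<Longrightarrow> intertw X Y A \<Longrightarrow> intertw Y Z B \<Longrightarrow>
    qm Y Z B \<cdot>\<^bsub>SS\<^esub> qm X Y A = qm X Z (B * A)"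
  using S.cls_comp[OF Arr_mor Arr_mor, of Y Z B X A] unfolding qm_def SS_eq by simp

lemma qm_add: "X \<in> tilt \<Longrightarrow> Y \<in> tilt \<Longrightarrow> intertw X Y A \<Longrightarrow> intertw X Y B \<Longrightarrow>
    Add SS (qm X Y A) (qm X Y B) = qm X Y (A + B)"
  using S.cls_add[OF Arr_mor Arr_mor, of X Y A B] unfolding qm_def SS_eq by simp

lemma qm_scale: "X \<in> tilt \<Longrightarrow> Y \<in> tilt \<Longrightarrow> intertw X Y A \<Longrightarrow> Scale SS a (qm X Y A) = qm X Y (a \<cdot>\<^sub>m A)"
  using S.cls_scale[OF Arr_mor, of X Y A a] unfolding qm_def SS_eq by simp

lemma qm_tens: "X \<in> tilt \<Longrightarrow> Y \<in> tilt \<Longrightarrow> X' \<in> tilt \<Longrightarrow> Y' \<in> tilt \<Longrightarrow> intertw X Y A \<Longrightarrow> intertw X' Y' B \<Longrightarrow>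
    qm X Y A \<boxtimes>\<^bsub>SS\<^esub> qm X' Y' B = qm (uq_tensor X X') (uq_tensor Y Y') (kron A B)"
  using S.cls_tens[OF Arr_mor Arr_mor, of X Y A X' Y' B] unfolding qm_def SS_eq by simp

lemma qm_eq_iff:
  assumes "X \<in> tilt" "Y \<in> tilt" "intertw X Y A" "intertw X Y B"
  shows "qm X Y A = qm X Y B \<longleftrightarrow> negl X Y (A + (-1) \<cdot>\<^sub>m B)"
  unfolding qm_def S.cls_eq_iff[OF Arr_mor[OF assms(1-3)] Arr_mor[OF assms(1,2,4)]] NR_iff using assms by auto

lemma qm_zero_iff:
  assumes "X \<in> tilt" "Y \<in> tilt" "intertw X Y A"
  shows "qm X Y A = Zero SS X Y \<longleftrightarrow> negl X Y A"
  using qm_eq_iff[OF assms intertw_zero[OF tilt_closed(1)[OF assms(1)] tilt_closed(1)[OF assms(2)]]]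
    smult_add_cancel(4)[OF intertw_carrier[OF assms(3)] intertw_carrier[OF assms(3)] intertw_carrier[OF assms(3)]] by simp

end

context eighth_root
begin

section \<open>Decomposition in the semisimplification\<close>

lemma W_complement: "qm (uq_tensor Wv Zv) (uq_tensor Wv Zv) (1\<^sub>m 6) = qm (uq_tensor Wv Zv) (uq_tensor Wv Zv) (iZ * pZ)"
proof -
  let ?V = "uq_tensor Wv Zv"
  note V = tilt_closed(3)[OF Wv_tilt Zv_tilt]
  have d6: "dimen ?V = 6" by (simp add: Wv_simps Zv_simps)
  have one: "intertw ?V ?V (1\<^sub>m 6)" using intertw_ident[OF tilt_closed(1)[OF V]] unfolding d6 .
  have i: "intertw ?V ?V (iZ * pZ)" by (rule intertw_comp[OF iZ_pZ(2,1) tilt_closed(1)[OF V] Zv_module tilt_closed(1)[OF V]])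
  have c: "iZ * pZ \<in> carrier_mat 6 6" "i3 * p3 \<in> carrier_mat 6 6"
    by (rule intertw_carrier[OF i, unfolded d6]) (auto simp: i3_def p3_def mat_of_rows_list_def)
  have "X = A + B \<Longrightarrow> X + (-1) \<cdot>\<^sub>m A = B" if "A \<in> carrier_mat 6 6" "B \<in> carrier_mat 6 6" for A B X :: "'k mat"
    by (rule eq_matI) (use that in auto)
  from this[OF c iZ_pZ(4)] show ?thesis unfolding qm_eq_iff[OF V V one i] using negl_complement by simp
qed

lemma ZZ_decomposition:
  "qm (uq_tensor Zv Zv) (uq_tensor Zv Zv) (1\<^sub>m 4) =
     qm (uq_tensor Zv Zv) (uq_tensor Zv Zv) (iW * (inverse d \<cdot>\<^sub>m pW) + cup * ((- inverse d) \<cdot>\<^sub>m cap))"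
proof -
  let ?V = "uq_tensor Zv Zv"
  note c = intertw_carrier[OF iW_pW(1)] intertw_carrier[OF iW_pW(2)] intertw_carrier[OF cup_cap(1)] intertw_carrier[OF cup_cap(2)]
  note m = mult_carrier_mat[OF c(1,2)] mult_carrier_mat[OF c(3,4)]
  have "1\<^sub>m 4 = inverse d \<cdot>\<^sub>m (d \<cdot>\<^sub>m 1\<^sub>m 4)" using d_nonzero by (simp add: smult_smult_mat smult_mat_trivial)
  also have "\<dots> = inverse d \<cdot>\<^sub>m (iW * pW) + inverse d \<cdot>\<^sub>m ((-1) \<cdot>\<^sub>m (cup * cap))"
    unfolding iW_pW(4) by (rule add_smult_distrib_left_mat[OF m(1) smult_carrier_mat[OF m(2)]])
  also have "\<dots> = iW * (inverse d \<cdot>\<^sub>m pW) + cup * ((- inverse d) \<cdot>\<^sub>m cap)"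
    using mult_smult_distrib[OF c(1,2)] mult_smult_distrib[OF c(3,4)] by (simp add: smult_smult_mat)
  finally show ?thesis by simp
qed

abbreviation "simples \<equiv> {uq_trivial, Wv, Zv}"

lemma simples_tilt: "simples \<subseteq> tilt"
  using tilt_closed(2) Wv_tilt Zv_tilt by blast

lemma Ident_through: "L \<in> P \<Longrightarrow> L \<in> tilt \<Longrightarrow> Ident SS L \<in> Q.through P L L"
proof -
  assume L: "L \<in> P" "L \<in> tilt"
  then have m: "Q.mor (Ident SS L) L L" by (intro Q.mor_ident) simp
  show ?thesis using Q.through_single[OF m m L(1)] unfolding Q.lid[OF m] .
qed

lemma qm_through:
  assumes "X \<in> tilt" "L \<in> P" "L \<in> tilt" "intertw X L A" "intertw L X B"
  shows "qm X X (B * A) \<in> Q.through P X X"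
  using Q.through_single[OF qm_mor[OF assms(1,3,4)] qm_mor[OF assms(3,1,5)] assms(2)] qm_comp[OF assms(1,3,1,4,5)] by simp

lemma L_tens_Z_through:
  assumes "L \<in> simples"
  shows "Ident SS (uq_tensor L Zv) \<in> Q.through simples (uq_tensor L Zv) (uq_tensor L Zv)"
proof -
  note ZZ = tilt_closed(3)[OF Zv_tilt Zv_tilt] and WZ = tilt_closed(3)[OF Wv_tilt Zv_tilt]
  note ZZ' = tilt_closed(1)[OF ZZ]
  consider "L = uq_trivial" | "L = Wv" | "L = Zv" using assms by blast
  then show ?thesis
  proof cases
    case 1
    then show ?thesis using Ident_through[of Zv simples] Zv_tilt uq_tensor_unit[OF Zv_module] by simp
  next
    case 2
    have "qm (uq_tensor Wv Zv) (uq_tensor Wv Zv) (iZ * pZ) \<in> Q.through simples (uq_tensor Wv Zv) (uq_tensor Wv Zv)"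
      by (rule qm_through[OF WZ _ Zv_tilt iZ_pZ(2,1)]) simp
    then show ?thesis unfolding 2 SS_simps uq_tensor_simps Wv_simps(1) Zv_simps(1) using W_complement by simp
  next
    case 3
    have i: "intertw (uq_tensor Zv Zv) Wv (inverse d \<cdot>\<^sub>m pW)" "intertw (uq_tensor Zv Zv) uq_trivial ((- inverse d) \<cdot>\<^sub>m cap)"
      by (rule intertw_smult[OF iW_pW(2) ZZ' Wv_module], rule intertw_smult[OF cup_cap(2) ZZ' uq_trivial_module])
    have "Add SS (qm (uq_tensor Zv Zv) (uq_tensor Zv Zv) (iW * (inverse d \<cdot>\<^sub>m pW)))
        (qm (uq_tensor Zv Zv) (uq_tensor Zv Zv) (cup * ((- inverse d) \<cdot>\<^sub>m cap))) \<in> Q.through simples (uq_tensor Zv Zv) (uq_tensor Zv Zv)"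
      by (rule Q.through_Add[OF qm_through[OF ZZ _ Wv_tilt i(1) iW_pW(1)] qm_through[OF ZZ _ tilt_closed(2) i(2) cup_cap(1)]])
        (use simples_tilt ZZ in simp_all)
    then have "qm (uq_tensor Zv Zv) (uq_tensor Zv Zv) (1\<^sub>m 4) \<in> Q.through simples (uq_tensor Zv Zv) (uq_tensor Zv Zv)"
      unfolding ZZ_decomposition using qm_add[OF ZZ ZZ intertw_comp[OF i(1) iW_pW(1) ZZ' Wv_module ZZ']
          intertw_comp[OF i(2) cup_cap(1) ZZ' uq_trivial_module ZZ']] by simp
    then show ?thesis unfolding 3 SS_simps uq_tensor_simps Zv_simps(1) by simp
  qed
qed

lemma Zpow_tilt: "Zpow n \<in> tilt"
  by (induction n) (use tilt_closed(2,3) Zv_tilt in simp_all)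

lemma Zpow_through: "Ident SS (Zpow n) \<in> Q.through simples (Zpow n) (Zpow n)"
proof (induction n)
  case 0
  show ?case using Ident_through[of uq_trivial simples] tilt_closed(2) by simp
next
  case (Suc n)
  let ?R = "(\<lambda>L. uq_tensor L Zv) ` simples"
  note s = simples_tilt and m = Zpow_tilt[of n]
  have R: "?R \<subseteq> Ob SS" using s tilt_closed(3)[OF _ Zv_tilt] by auto
  have "Ident SS (Zpow n) \<boxtimes>\<^bsub>SS\<^esub> Ident SS Zv \<in> Q.through ?R (uq_tensor (Zpow n) Zv) (uq_tensor (Zpow n) Zv)"
    using Q.through_tens[OF Suc Ident_through[of Zv "{Zv}"], of ?R] s m Zv_tilt R by auto
  then have "Ident SS (Zpow (Suc n)) \<in> Q.through ?R (Zpow (Suc n)) (Zpow (Suc n))"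
    using Q.tens_ident[of "Zpow n" Zv] m Zv_tilt unfolding Zpow_Suc(2) SS_simps by simp
  then show ?case
  proof (rule Q.through_trans[OF _ R])
    show "simples \<subseteq> Ob SS" "Zpow (Suc n) \<in> Ob SS" "Zpow (Suc n) \<in> Ob SS"
      using s Zpow_tilt by (simp_all only: SS_simps(1))
    fix L assume "L \<in> ?R"
    then obtain L' where "L = uq_tensor L' Zv" "L' \<in> simples" by blast
    then show "Ident SS L \<in> Q.through simples L L" using L_tens_Z_through by blast
  qed
qed

lemma decomposition:
  assumes V: "V \<in> tilt"
  shows "Ident SS V \<in> Q.through simples V V"
proof -
  have "Arr V V (1\<^sub>m (dimen V)) \<in> R.through (range Zpow) V V"
    by (rule tilt_through[OF V tilt_closed(1)[OF V] intertw_ident[OF tilt_closed(1)[OF V]]])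
  then have "Arr V V (1\<^sub>m (dimen V)) \<in> T.through (range Zpow) V V"
    using R.through_full_subcat[of _ "range Zpow" V V tilt] T.strict_tensor_category_axioms unfolding tilting_eq by blast
  then have "S.cls (Arr V V (1\<^sub>m (dimen V))) \<in> strict_tensor_category.through S.Q (range Zpow) V V"
    by (rule S.quotient_through) (use V Zpow_tilt in auto)
  then have "qm V V (1\<^sub>m (dimen V)) \<in> Q.through (range Zpow) V V" unfolding qm_def SS_eq .
  then have "Ident SS V \<in> Q.through (range Zpow) V V" by (simp only: SS_simps(4))
  then show ?thesis
    by (rule Q.through_trans) (use V Zpow_tilt Zpow_through simples_tilt in auto)
qed

section \<open>Simple objects and the parity\<close>

lemma simples_scalar:
  assumes "L \<in> simples"
  shows "tr (actK L) \<noteq> 0" "intertw L L A \<Longrightarrow> \<exists>s. A = s \<cdot>\<^sub>m 1\<^sub>m (dimen L)"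
  using assms traces d_nonzero scalar_1 scalar_W scalar_Z by (auto simp: Wv_simps(1) Zv_simps(1))

lemma simple_nonzero:
  assumes L: "L \<in> simples"
  shows "Ident SS L \<noteq> Zero SS L L"
proof
  have l: "L \<in> tilt" using L simples_tilt by blast
  note i = intertw_ident[OF tilt_closed(1)[OF l]] and k = uq_modulesD(3)[OF tilt_closed(1)[OF l]]
  assume "Ident SS L = Zero SS L L"
  then have "negl L L (1\<^sub>m (dimen L))" using qm_zero_iff[OF l l i] by simp
  then have "tr (actK L * (1\<^sub>m (dimen L) * 1\<^sub>m (dimen L))) = 0" using i unfolding negl_def by blast
  then show False using simples_scalar(1)[OF L] k by simp
qed

lemma simple_split:
  assumes L: "L \<in> simples" and f: "Q.mor f V L" "f \<noteq> Zero SS V L"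
  shows "\<exists>i. Q.mor i L V \<and> f \<cdot>\<^bsub>SS\<^esub> i = Ident SS L"
proof -
  obtain A where A: "V \<in> tilt" "L \<in> tilt" "intertw V L A" "f = qm V L A" using f(1) by (rule Q_morE)
  note o = A(1,2)[THEN tilt_closed(1)]
  obtain B where B: "intertw L V B" "tr (actK V * (B * A)) \<noteq> 0"
    using f(2) qm_zero_iff[OF A(1-3)] unfolding A(4) negl_def by blast
  obtain s where s: "A * B = s \<cdot>\<^sub>m 1\<^sub>m (dimen L)" using simples_scalar(2)[OF L intertw_comp[OF B(1) A(3) o(2,1,2)]] by blast
  have "s \<noteq> 0"
  proof
    assume "s = 0"
    have "tr (actK V * (B * A)) = tr (actK L * (A * B))" by (rule tr_actK_commute[OF A(3) B(1) o])
    also have "actK L * (A * B) = 0 \<cdot>\<^sub>m actK L"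
      unfolding s \<open>s = 0\<close> using mult_smult_distrib[OF uq_modulesD(3)[OF o(2)] one_carrier_mat] uq_modulesD(3)[OF o(2)] by simp
    also have "tr (0 \<cdot>\<^sub>m actK L) = 0" using tr_smult[OF uq_modulesD(3)[OF o(2)]] by simp
    finally show False using B(2) by simp
  qed
  note i = intertw_smult[OF B(1) o(2,1), of "inverse s"]
  have "A * (inverse s \<cdot>\<^sub>m B) = 1\<^sub>m (dimen L)"
    using mult_smult_distrib[OF intertw_carrier[OF A(3)] intertw_carrier[OF B(1)]] \<open>s \<noteq> 0\<close>
    by (simp add: s smult_smult_mat smult_mat_trivial)
  then have "f \<cdot>\<^bsub>SS\<^esub> qm L V (inverse s \<cdot>\<^sub>m B) = Ident SS L"
    unfolding A(4) using qm_comp[OF A(2,1,2) i A(3)] by simp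
  then show ?thesis using qm_mor[OF A(2,1) i] by blast
qed

lemma scaled_summand:
  assumes "L \<in> tilt" "V \<in> tilt" "intertw L V I" "intertw V L P" "P * I = s \<cdot>\<^sub>m 1\<^sub>m (dimen L)" "s \<noteq> 0"
  shows "\<exists>i r. Q.mor i L V \<and> Q.mor r V L \<and> r \<cdot>\<^bsub>SS\<^esub> i = Ident SS L"
proof -
  note o = assms(1,2)[THEN tilt_closed(1)]
  note i = intertw_smult[OF assms(4) o(2,1), of "inverse s"]
  have "(inverse s \<cdot>\<^sub>m P) * I = 1\<^sub>m (dimen L)"
    using mult_smult_assoc_mat[OF intertw_carrier[OF assms(4)] intertw_carrier[OF assms(3)]] assms(6)
    by (simp add: assms(5) smult_smult_mat smult_mat_trivial)
  then have "qm V L (inverse s \<cdot>\<^sub>m P) \<cdot>\<^bsub>SS\<^esub> qm L V I = Ident SS L"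
    using qm_comp[OF assms(1,2,1,3) i] by simp
  then show ?thesis using qm_mor[OF assms(1-3)] qm_mor[OF assms(2,1) i] by blast
qed

lemma end_Z: "Q.mor f Zv Zv \<Longrightarrow> \<exists>s. f = Scale SS s (Ident SS Zv)"
proof (erule Q_morE)
  fix A assume A: "Zv \<in> tilt" "intertw Zv Zv A" "f = qm Zv Zv A"
  obtain s where "A = s \<cdot>\<^sub>m 1\<^sub>m (dimen Zv)" using scalar_Z[OF A(2)] by (auto simp: Zv_simps)
  then have "f = Scale SS s (Ident SS Zv)" using qm_scale[OF A(1,1) intertw_ident[OF Zv_module]] A(3) by simp
  then show ?thesis by blast
qed

lemma end_WZ:
  assumes f: "Q.mor f (uq_tensor Wv Zv) (uq_tensor Wv Zv)"
  shows "\<exists>s. f = Scale SS s (Ident SS (uq_tensor Wv Zv))"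
proof -
  let ?V = "uq_tensor Wv Zv"
  let ?i = "qm Zv ?V iZ" and ?r = "qm ?V Zv pZ"
  note V = tilt_closed(3)[OF Wv_tilt Zv_tilt]
  have d6: "dimen ?V = 6" by (simp add: Wv_simps Zv_simps)
  note i = qm_mor[OF Zv_tilt V iZ_pZ(1)] and r = qm_mor[OF V Zv_tilt iZ_pZ(2)]
  have id: "?i \<cdot>\<^bsub>SS\<^esub> ?r = Ident SS ?V"
    using qm_comp[OF V Zv_tilt V iZ_pZ(2,1)] W_complement unfolding SS_simps(4) d6 by simp
  obtain s where s: "?r \<cdot>\<^bsub>SS\<^esub> (f \<cdot>\<^bsub>SS\<^esub> ?i) = Scale SS s (Ident SS Zv)"
    using end_Z[OF Q.mor_comp[OF r Q.mor_comp[OF f i]]] by blast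
  note fi = Q.mor_comp[OF f i]
  have "f = (?i \<cdot>\<^bsub>SS\<^esub> ?r) \<cdot>\<^bsub>SS\<^esub> (f \<cdot>\<^bsub>SS\<^esub> (?i \<cdot>\<^bsub>SS\<^esub> ?r))"
    unfolding id Q.rid[OF f] Q.lid[OF f] ..
  also have "\<dots> = ?i \<cdot>\<^bsub>SS\<^esub> (?r \<cdot>\<^bsub>SS\<^esub> ((f \<cdot>\<^bsub>SS\<^esub> ?i) \<cdot>\<^bsub>SS\<^esub> ?r))"
    unfolding Q.cassoc[OF f i r] by (rule Q.cassoc[OF i r Q.mor_comp[OF f Q.mor_comp[OF i r]]])
  also have "?r \<cdot>\<^bsub>SS\<^esub> ((f \<cdot>\<^bsub>SS\<^esub> ?i) \<cdot>\<^bsub>SS\<^esub> ?r) = Scale SS s (Ident SS Zv) \<cdot>\<^bsub>SS\<^esub> ?r"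
    unfolding s[symmetric] by (rule Q.cassoc[OF r fi r, symmetric])
  also have "\<dots> = Scale SS s ?r"
    using Q.scalec[OF Q.mor_ident r, of s] Zv_tilt Q.lid[OF r] by simp
  also have "?i \<cdot>\<^bsub>SS\<^esub> Scale SS s ?r = Scale SS s (Ident SS ?V)" unfolding Q.cscale[OF i r] id ..
  finally show ?thesis by blast
qed

definition K4 :: "'k uq_module \<Rightarrow> 'k mat" where "K4 V = actK V * actK V * (actK V * actK V)"

definition theta :: "'k uq_module \<Rightarrow> 'k uq_arrow set" where "theta V = qm V V (K4 V)"

lemma K4_carrier: "V \<in> uq_modules p \<Longrightarrow> K4 V \<in> carrier_mat (dimen V) (dimen V)"
  unfolding K4_def by (intro mult_carrier_mat[of _ "dimen V" "dimen V"] uq_modulesD(3))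

lemma K4_intertw:
  assumes A: "intertw V W A" and o: "V \<in> uq_modules p" "W \<in> uq_modules p"
  shows "A * K4 V = K4 W * A"
proof -
  have step: "A * (M * N) = (M' * N') * A" if "A * M = M' * A" "A * N = N' * A"
    "M \<in> carrier_mat (dimen V) (dimen V)" "N \<in> carrier_mat (dimen V) (dimen V)"
    "M' \<in> carrier_mat (dimen W) (dimen W)" "N' \<in> carrier_mat (dimen W) (dimen W)" for M N M' N'
    using assoc_mult_mat[OF intertw_carrier[OF A] that(3,4)] assoc_mult_mat[OF that(5) intertw_carrier[OF A] that(4)]
      assoc_mult_mat[OF that(5,6) intertw_carrier[OF A]] that(1,2) by simp
  note v = uq_modulesD(3)[OF o(1)] and w = uq_modulesD(3)[OF o(2)]
  have "A * actK V = actK W * A" using A by (simp add: intertw_def)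
  note 2 = step[OF this this v v w w]
  show ?thesis unfolding K4_def
    by (rule step[OF 2 2 mult_carrier_mat[OF v v] mult_carrier_mat[OF v v] mult_carrier_mat[OF w w] mult_carrier_mat[OF w w]])
qed

lemma K4_module_map:
  assumes V: "V \<in> uq_modules p"
  shows "intertw V V (K4 V)"
proof -
  let ?n = "dimen V"
  note v = uq_modulesD[OF V]
  have step: "(M * N) * X = (s * t) \<cdot>\<^sub>m (X * (M * N))" if "M * X = s \<cdot>\<^sub>m (X * M)" "N * X = t \<cdot>\<^sub>m (X * N)"
    "M \<in> carrier_mat ?n ?n" "N \<in> carrier_mat ?n ?n" "X \<in> carrier_mat ?n ?n" for M N X and s t :: 'k
  proof -
    have "(M * N) * X = t \<cdot>\<^sub>m ((M * X) * N)"
      using assoc_mult_mat[OF that(3,4,5)] assoc_mult_mat[OF that(3,5,4)] mult_smult_distrib[OF that(3) mult_carrier_mat[OF that(5,4)]]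
      by (simp add: that(2))
    also have "(M * X) * N = s \<cdot>\<^sub>m (X * (M * N))"
      unfolding that(1) using mult_smult_assoc_mat[OF mult_carrier_mat[OF that(5,3)] that(4)] assoc_mult_mat[OF that(5,3,4)] by simp
    finally show ?thesis by (simp add: smult_smult_mat mult.commute)
  qed
  have K4: "K4 V * X = X * K4 V" if X: "X \<in> carrier_mat ?n ?n" "actK V * X = s \<cdot>\<^sub>m (X * actK V)" and s: "s * s * (s * s) = 1" for X s
  proof -
    note kk = mult_carrier_mat[OF v(3) v(3)]
    note 2 = step[OF X(2,2) v(3,3) X(1)]
    show ?thesis using step[OF 2 2 kk kk X(1)] by (simp add: K4_def s smult_mat_trivial)
  qed
  have 1: "p\<^sup>2 * p\<^sup>2 * (p\<^sup>2 * p\<^sup>2) = 1" by (simp add: p_simps algebra_simps)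
  have "inverse (p\<^sup>2) * inverse (p\<^sup>2) * (inverse (p\<^sup>2) * inverse (p\<^sup>2)) = inverse (p\<^sup>2 * p\<^sup>2 * (p\<^sup>2 * p\<^sup>2))"
    by (simp only: inverse_mult_distrib mult_ac)
  then have 2: "inverse (p\<^sup>2) * inverse (p\<^sup>2) * (inverse (p\<^sup>2) * inverse (p\<^sup>2)) = 1" unfolding 1 by simp
  have 3: "actK V * actK V = 1 \<cdot>\<^sub>m (actK V * actK V)" "actK V * actKinv V = 1 \<cdot>\<^sub>m (actKinv V * actK V)"
    using v(5,6) by (simp_all add: smult_mat_trivial)
  show ?thesis unfolding intertw_def
    using K4_carrier[OF V] K4[OF v(1,7) 1] K4[OF v(2,8) 2] K4[OF v(3) 3(1)] K4[OF v(4) 3(2)] by simp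
qed

lemma K4_tensor:
  assumes "V \<in> uq_modules p" "W \<in> uq_modules p"
  shows "K4 (uq_tensor V W) = kron (K4 V) (K4 W)"
proof -
  note v = uq_modulesD(3)[OF assms(1)] and w = uq_modulesD(3)[OF assms(2)]
  show ?thesis unfolding K4_def uq_tensor_simps kron_mult[OF v v w w]
    by (rule kron_mult[OF mult_carrier_mat[OF v v] mult_carrier_mat[OF v v] mult_carrier_mat[OF w w] mult_carrier_mat[OF w w]])
qed

theorem semisimplification_ising_like:
  assumes N: "N \<ge> 1"
  shows "ising_like SS theta (2 ^ N) Wv Zv"
proof (unfold_locales; (unfold SS_simps(1-3))?)
  show "even (2 ^ N :: nat)" "0 < (2 ^ N :: nat)" "\<exists>N'\<ge>1. (2 ^ N :: nat) = 2 ^ N'" using N by auto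
  show "Wv \<in> tilt" "Zv \<in> tilt" by (fact Wv_tilt Zv_tilt)+
  show "(1::'k) \<noteq> -1" by simp
next
  fix X assume X: "X \<in> tilt"
  show "Q.mor (theta X) X X" unfolding theta_def by (rule qm_mor[OF X X K4_module_map[OF tilt_closed(1)[OF X]]])
next
  fix f X Y assume "Q.mor f X Y"
  then obtain A where A: "X \<in> tilt" "Y \<in> tilt" "intertw X Y A" "f = qm X Y A" by (rule Q_morE)
  note o = A(1,2)[THEN tilt_closed(1)]
  show "theta Y \<cdot>\<^bsub>SS\<^esub> f = f \<cdot>\<^bsub>SS\<^esub> theta X"
    unfolding theta_def A(4) qm_comp[OF A(1,2,2,3) K4_module_map[OF o(2)]] qm_comp[OF A(1,1,2) K4_module_map[OF o(1)] A(3)]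
      K4_intertw[OF A(3) o] ..
next
  fix X Y assume X: "X \<in> tilt" and Y: "Y \<in> tilt"
  note o = X[THEN tilt_closed(1)] Y[THEN tilt_closed(1)]
  show "theta (uq_tensor X Y) = theta X \<boxtimes>\<^bsub>SS\<^esub> theta Y"
    unfolding theta_def qm_tens[OF X X Y Y K4_module_map[OF o(1)] K4_module_map[OF o(2)]] K4_tensor[OF o] ..
next
  show "theta uq_trivial = Ident SS uq_trivial" "theta Wv = Ident SS Wv"
    using sign_K4 by (simp_all add: theta_def K4_def Wv_simps(1))
  show "theta Zv = Scale SS (-1) (Ident SS Zv)"
    using sign_K4(3) qm_scale[OF Zv_tilt Zv_tilt intertw_ident[OF Zv_module], of "-1"] by (simp add: theta_def K4_def Zv_simps(1))
next
  fix L assume "L \<in> simples"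
  then show "Ident SS L \<noteq> Zero SS L L" by (rule simple_nonzero)
next
  fix L f V assume "L \<in> simples" "Q.mor f V L" "f \<noteq> Zero SS V L"
  then show "\<exists>i. Q.mor i L V \<and> f \<cdot>\<^bsub>SS\<^esub> i = Ident SS L" by (rule simple_split)
next
  fix V assume "V \<in> tilt"
  then show "Ident SS V \<in> Q.through simples V V" by (rule decomposition)
next
  fix f assume "Q.mor f uq_trivial Wv"
  then obtain A where A: "intertw uq_trivial Wv A" "f = qm uq_trivial Wv A" by (rule Q_morE)
  show "f = Zero SS uq_trivial Wv" using hom_trivial_W[OF A(1)] A(2) by (simp add: Wv_simps(1))
next
  fix f assume "Q.mor f Zv Zv"
  then show "\<exists>s. f = Scale SS s (Ident SS Zv)" by (rule end_Z)
next
  fix f assume "Q.mor f (uq_tensor Wv Zv) (uq_tensor Wv Zv)"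
  then show "\<exists>s. f = Scale SS s (Ident SS (uq_tensor Wv Zv))" by (rule end_WZ)
next
  note ZZ = tilt_closed(3)[OF Zv_tilt Zv_tilt] and WW = tilt_closed(3)[OF Wv_tilt Wv_tilt]
  fix L assume "L \<in> {uq_trivial, Wv}"
  moreover have "\<exists>i r. Q.mor i uq_trivial (uq_tensor Zv Zv) \<and> Q.mor r (uq_tensor Zv Zv) uq_trivial \<and> r \<cdot>\<^bsub>SS\<^esub> i = Ident SS uq_trivial"
    by (rule scaled_summand[OF tilt_closed(2) ZZ cup_cap(1,2), of "- d"]) (use cup_cap(5) d_nonzero in simp_all)
  moreover have "\<exists>i r. Q.mor i Wv (uq_tensor Zv Zv) \<and> Q.mor r (uq_tensor Zv Zv) Wv \<and> r \<cdot>\<^bsub>SS\<^esub> i = Ident SS Wv"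
    by (rule scaled_summand[OF Wv_tilt ZZ iW_pW(1,2), of d]) (use iW_pW(3) d_nonzero in \<open>simp_all add: Wv_simps(1)\<close>)
  ultimately show "\<exists>i r. Q.mor i L (uq_tensor Zv Zv) \<and> Q.mor r (uq_tensor Zv Zv) L \<and> r \<cdot>\<^bsub>SS\<^esub> i = Ident SS L" by blast
next
  note WW = tilt_closed(3)[OF Wv_tilt Wv_tilt]
  show "\<exists>i r. Q.mor i uq_trivial (uq_tensor Wv Wv) \<and> Q.mor r (uq_tensor Wv Wv) uq_trivial \<and> r \<cdot>\<^bsub>SS\<^esub> i = Ident SS uq_trivial"
    by (rule scaled_summand[OF tilt_closed(2) WW cup_capW(1,2), of d]) (use cup_capW(3) d_nonzero in simp_all)
qed

end

section \<open>\<open>N\<close>-Ising categories are prime\<close>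

context ising_like
begin

theorem generated_by_Z_prime:
  assumes omega: "\<And>a b e. \<omega> a b e \<noteq> 0"
    and OB: "OB = \<Inter>{S. fusion_subcategory (graded_product C n (\<lambda>_ _ _. 1)) S \<and> [(Z, 1)] \<in> S}"
    and braided: "braiding (full_subcat (graded_product C n \<omega>) OB) c"
  shows "prime_braided (full_subcat (graded_product C n \<omega>) OB) c"
proof -
  let ?G = "graded_product C n (\<lambda>_ _ _. 1)"
  have "1 < n" using power_of_2 one_less_power[of "2::nat"] by fastforce
  then have "[(Z, 1)] \<in> parity_objects" using Z_ob parity_Z by (simp add: parity_objects_def gobs_def sign_def)
  then have fam: "parity_objects \<in> {S. fusion_subcategory ?G S \<and> [(Z, 1)] \<in> S}"
    using fusion_subcategory_parity_objects by blast
  have fus: "fusion_subcategory ?G OB" unfolding OB by (rule fusion_subcategory_Inter) (use fam in blast)+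
  have par: "OB \<subseteq> parity_objects" and Z: "[(Z, 1)] \<in> OB" unfolding OB using fam by blast+
  have ob: "OB \<subseteq> gobs n" "[(Unit C, 0)] \<in> OB" "\<forall>X\<in>OB. \<forall>Y\<in>OB. graded_tensor C n X Y \<in> OB"
  proof -
    have "OB \<subseteq> gobs n \<and> [(Unit C, 0)] \<in> OB \<and> (\<forall>X\<in>OB. \<forall>Y\<in>OB. graded_tensor C n X Y \<in> OB)"
      using fus unfolding fusion_subcategory_def gp_simps by (elim conjE) (intro conjI)
    then show "OB \<subseteq> gobs n" "[(Unit C, 0)] \<in> OB" "\<forall>X\<in>OB. \<forall>Y\<in>OB. graded_tensor C n X Y \<in> OB" by blast+
  qed
  have eq: "full_subcat ?G (gobs n) = ?G"
    unfolding full_subcat_def graded_product_def gobs_def by simp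
  interpret ising_braided C \<theta> n W Z \<omega> OB c
  proof
    show "0 < n" by (rule pos_n)
    show "\<omega> a b e \<noteq> 0" for a b e by (rule omega)
    fix xs x assume "xs \<in> OB" "x \<in> set xs"
    then have "[x] \<in> gobs n" using ob(1) by (auto simp: gobs_def)
    then show "[x] \<in> OB"
      using fusion_subcat_singleton[of n "\<lambda>_ _ _. 1" "gobs n" OB xs x] fus \<open>xs \<in> OB\<close> \<open>x \<in> set xs\<close> by (simp add: eq)
  qed (use ob fus par Z braided in blast)+
  show ?thesis by (rule prime)
qed

end

theorem corollary4p8:
  fixes q :: "'k :: {alg_closed_field, field_char_0}"
    and N :: nat
    and I :: "('k ising_ob, 'k ising_arrow, 'k) lincat"
    and c :: "'k ising_ob \<Rightarrow> 'k ising_ob \<Rightarrow> 'k ising_arrow"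
  assumes "q ^ 4 = -1"
    and "N \<ge> 1"
    and "N_Ising_category q N I"
    and "braiding I c"
  shows "prime_braided I c"
proof -
  interpret eighth_root "- q" by unfold_locales (use assms(1) in simp)
  interpret ising_like "semisimplified_Rep_Uq (- q)" theta "2 ^ N" Wv Zv
    by (rule semisimplification_ising_like[OF assms(2)])
  let ?G = "graded_product (semisimplified_Rep_Uq (- q)) (2 ^ N)"
  let ?OB = "\<Inter>{S. fusion_subcategory (?G (\<lambda>_ _ _. 1)) S \<and> [(Zv, 1)] \<in> S}"
  obtain \<zeta> where \<zeta>: "\<zeta> ^ (2 ^ N) = 1" "I = Ising_N_twisted q N \<zeta>"
    using assms(3) unfolding N_Ising_category_def by blast
  have "\<zeta> \<noteq> 0" using \<zeta>(1) by (auto simp: power_0_left)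
  then have omega: "omega N \<zeta> a b e \<noteq> 0" for a b e by (simp add: omega_def)
  have I: "I = full_subcat (?G (omega N \<zeta>)) ?OB"
    unfolding \<zeta>(2) Ising_N_twisted_def Ising_N_def Ising_def Ising_Z_def generated_subcat_def full_subcat_def
    by (simp add: graded_product_def)
  have b: "braiding (full_subcat (?G (omega N \<zeta>)) ?OB) c" using assms(4) unfolding I .
  show ?thesis unfolding I by (rule generated_by_Z_prime[OF _ refl b]) (rule omega)
qed

end
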